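(* Let $G$ be an abelian group, let $k$ be a commutative $G$-ring, let $n$ be a natural number and let $\delta\in k$. Let $G\mathcal{B}_n(\delta)$ be the $G$-Brauer algebra over $k$. If $\delta$ is invertible, there is an isomorphism of graded $k$-modules $$\mathrm{Tor}_{\star}^{G\mathcal{B}_n(\delta)}(\mathbf{1},\mathbf{1})\cong \mathrm{Tor}_{\star}^{k[G^n\rtimes\Sigma_n]}(\mathbf{1},\mathbf{1})=H_{\star}(G^n\rtimes\Sigma_n,k),$$ where the symmetric group $\Sigma_n$ acts on $G^n$ by permuting the factors.
   Context: A commutative $G$-ring is a unital commutative ring $k$ together with a group homomorphism $G\to\mathrm{Aut}(k)$ to the group of ring automorphisms; the action of $g\in G$ on $\lambda\in k$ is written $g\lambda$. A $G$-Brauer $n$-diagram is a graph on two columns (left and right) of $n$ nodes in which each node is connected to exactly one other node by an edge (left-to-left, right-to-right and left-to-right edges are all allowed), and each edge is labelled by an element of $G$. The $G$-Brauer algebra $G\mathcal{B}_n(\delta)$ consists of formal $k$-linear combinations of $G$-Brauer $n$-diagrams. The product $x\cdot y$ of two diagrams is the $k$-bilinear extension of: identify the right-hand nodes of $x$ with the left-hand nodes of $y$, forget the middle nodes, label each edge formed by concatenation with the product of the group elements along it, and replace each closed loop formed in the middle by a factor $g\delta\in k$, where $g\in G$ is the product of all the labels on the loop. The trivial module $\mathbf{1}$ of $G\mathcal{B}_n(\delta)$ is a copy of $k$ (as a left and as a right module) on which diagrams with no left-to-left and no right-to-right connections act as $1$ and all other diagrams act as $0$. For the (untwisted) group algebra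 $k[G^n\rtimes\Sigma_n]$, $\mathbf{1}$ is $k$ with every group element acting as $1$. *)

theory Defs
  imports "HOL-Algebra.Algebra"
begin

section \<open>Modules over a not necessarily commutative ring\<close>

text \<open>
  The library locale \<^locale>\<open>module\<close> asks the base ring to be commutative, so its axioms are
  restated here for an arbitrary ring. Modules are still records of type
  \<^typ>\<open>('a, 'b) module\<close>; the fields \<open>mult\<close> and \<open>one\<close> of the record play no role, unless it is
  used as a \<open>k\<close>-algebra. A right module over \<open>A\<close> is a left module over \<open>opposite A\<close>,
  so that \<open>a \<odot> m\<close> stands for \<open>m a\<close>.
\<close>

locale left_module = R?: ring R + M?: abelian_group M
  for R :: "('a, 'r) ring_scheme" (structure) and M :: "('a, 'm) module" (structure) +
  assumes smult_closed [simp, intro]: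
      "\<lbrakk>a \<in> carrier R; x \<in> carrier M\<rbrakk> \<Longrightarrow> a \<odot>\<^bsub>M\<^esub> x \<in> carrier M"
    and smult_l_distr:
      "\<lbrakk>a \<in> carrier R; b \<in> carrier R; x \<in> carrier M\<rbrakk> \<Longrightarrow>
        (a \<oplus>\<^bsub>R\<^esub> b) \<odot>\<^bsub>M\<^esub> x = a \<odot>\<^bsub>M\<^esub> x \<oplus>\<^bsub>M\<^esub> b \<odot>\<^bsub>M\<^esub> x"
    and smult_r_distr:
      "\<lbrakk>a \<in> carrier R; x \<in> carrier M; y \<in> carrier M\<rbrakk> \<Longrightarrow>
        a \<odot>\<^bsub>M\<^esub> (x \<oplus>\<^bsub>M\<^esub> y) = a \<odot>\<^bsub>M\<^esub> x \<oplus>\<^bsub>M\<^esub> a \<odot>\<^bsub>M\<^esub> y"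
    and smult_assoc:
      "\<lbrakk>a \<in> carrier R; b \<in> carrier R; x \<in> carrier M\<rbrakk> \<Longrightarrow>
        (a \<otimes>\<^bsub>R\<^esub> b) \<odot>\<^bsub>M\<^esub> x = a \<odot>\<^bsub>M\<^esub> (b \<odot>\<^bsub>M\<^esub> x)"
    and smult_one: "x \<in> carrier M \<Longrightarrow> \<one>\<^bsub>R\<^esub> \<odot>\<^bsub>M\<^esub> x = x"

definition opposite :: "('a, 'e) ring_scheme \<Rightarrow> ('a, 'e) ring_scheme" where
  "opposite A = A\<lparr>mult := (\<lambda>a b. b \<otimes>\<^bsub>A\<^esub> a)\<rparr>"

definition lin_maps ::
  "('a, 'e) ring_scheme \<Rightarrow> ('a, 'm) module \<Rightarrow> ('a, 'n) module \<Rightarrow> ('m \<Rightarrow> 'n) set" where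
  "lin_maps R M N = {f. f \<in> carrier M \<rightarrow> carrier N \<and>
     (\<forall>x\<in>carrier M. \<forall>y\<in>carrier M. f (x \<oplus>\<^bsub>M\<^esub> y) = f x \<oplus>\<^bsub>N\<^esub> f y) \<and>
     (\<forall>a\<in>carrier R. \<forall>x\<in>carrier M. f (a \<odot>\<^bsub>M\<^esub> x) = a \<odot>\<^bsub>N\<^esub> f x)}"

definition module_iso ::
  "('a, 'e) ring_scheme \<Rightarrow> ('a, 'm) module \<Rightarrow> ('a, 'n) module \<Rightarrow> bool" where
  "module_iso R M N \<longleftrightarrow> (\<exists>f\<in>lin_maps R M N. bij_betw f (carrier M) (carrier N))"

definition quot_module :: "('a, 'm) module \<Rightarrow> 'm set \<Rightarrow> ('a, 'm set) module" where
  "quot_module M H =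
     \<lparr>carrier = a_rcosets\<^bsub>M\<^esub> H, monoid.mult = undefined, monoid.one = undefined,
      ring.zero = H, ring.add = (\<lambda>S T. S <+>\<^bsub>M\<^esub> T),
      smult = (\<lambda>a S. \<Union>x\<in>S. H +>\<^bsub>M\<^esub> (a \<odot>\<^bsub>M\<^esub> x))\<rparr>"

definition submodule_gen :: "('a, 'e) ring_scheme \<Rightarrow> ('a, 'm) module \<Rightarrow> 'm set \<Rightarrow> 'm set" where
  "submodule_gen R M S = \<Inter>{H. submodule H R M \<and> S \<subseteq> H}"

definition free_module :: "('a, 'e) ring_scheme \<Rightarrow> 'x set \<Rightarrow> ('a, 'x \<Rightarrow> 'a) module" where
  "free_module R B =
     \<lparr>carrier = {f. (\<forall>x\<in>B. f x \<in> carrier R) \<and> (\<forall>x. x \<notin> B \<longrightarrow> f x = \<zero>\<^bsub>R\<^esub>)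
                   \<and> finite {x. f x \<noteq> \<zero>\<^bsub>R\<^esub>}},
      monoid.mult = undefined, monoid.one = undefined,
      ring.zero = (\<lambda>x. \<zero>\<^bsub>R\<^esub>), ring.add = (\<lambda>f g x. f x \<oplus>\<^bsub>R\<^esub> g x),
      smult = (\<lambda>a f x. a \<otimes>\<^bsub>R\<^esub> f x)\<rparr>"

definition basis_vec :: "('a, 'e) ring_scheme \<Rightarrow> 'x \<Rightarrow> 'x \<Rightarrow> 'a" where
  "basis_vec R x = (\<lambda>y. if y = x then \<one>\<^bsub>R\<^esub> else \<zero>\<^bsub>R\<^esub>)"

text \<open>The linear map from a free module to \<open>M\<close> with prescribed values \<open>v\<close> on the basis.\<close>

definition lin_ext ::
  "('a, 'e) ring_scheme \<Rightarrow> ('a, 'm) module \<Rightarrow> ('x \<Rightarrow> 'm) \<Rightarrow> ('x \<Rightarrow> 'a) \<Rightarrow> 'm" where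
  "lin_ext R M v f = (\<Oplus>\<^bsub>M\<^esub>x\<in>{x. f x \<noteq> \<zero>\<^bsub>R\<^esub>}. f x \<odot>\<^bsub>M\<^esub> v x)"


section \<open>Tensor products, homology and Tor\<close>

text \<open>
  Let \<open>A\<close> be an algebra over a commutative ring \<open>k\<close>, \<open>M\<close> a right and \<open>N\<close> a left \<open>A\<close>-module. The
  \<open>k\<close>-module \<open>M \<otimes>\<^sub>A N\<close> is the free \<open>k\<close>-module on the symbols \<open>(m, n)\<close> modulo the
  relations of biadditivity, \<open>(m a, n) = (m, a n)\<close> and \<open>r (m, n) = (m (r 1), n)\<close> for \<open>r\<close> in \<open>k\<close>.
\<close>

definition tensor_rels ::
  "('k, 'e) ring_scheme \<Rightarrow> ('k, 'a) module \<Rightarrow> ('a, 'm) module \<Rightarrow> ('a, 'n) module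
    \<Rightarrow> ('m \<times> 'n \<Rightarrow> 'k) set" where
  "tensor_rels k A M N =
     (let F = free_module k (carrier M \<times> carrier N); s = (\<lambda>m n. basis_vec k (m, n)) in
       {s (m \<oplus>\<^bsub>M\<^esub> m') n \<ominus>\<^bsub>F\<^esub> (s m n \<oplus>\<^bsub>F\<^esub> s m' n) | m m' n.
          m \<in> carrier M \<and> m' \<in> carrier M \<and> n \<in> carrier N}
     \<union> {s m (n \<oplus>\<^bsub>N\<^esub> n') \<ominus>\<^bsub>F\<^esub> (s m n \<oplus>\<^bsub>F\<^esub> s m n') | m n n'.
          m \<in> carrier M \<and> n \<in> carrier N \<and> n' \<in> carrier N}
     \<union> {s (a \<odot>\<^bsub>M\<^esub> m) n \<ominus>\<^bsub>F\<^esub> s m (a \<odot>\<^bsub>N\<^esub> n) | a m n.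
          a \<in> carrier A \<and> m \<in> carrier M \<and> n \<in> carrier N}
     \<union> {r \<odot>\<^bsub>F\<^esub> s m n \<ominus>\<^bsub>F\<^esub> s ((r \<odot>\<^bsub>A\<^esub> \<one>\<^bsub>A\<^esub>) \<odot>\<^bsub>M\<^esub> m) n | r m n.
          r \<in> carrier k \<and> m \<in> carrier M \<and> n \<in> carrier N})"

definition tensor_ker ::
  "('k, 'e) ring_scheme \<Rightarrow> ('k, 'a) module \<Rightarrow> ('a, 'm) module \<Rightarrow> ('a, 'n) module
    \<Rightarrow> ('m \<times> 'n \<Rightarrow> 'k) set" where
  "tensor_ker k A M N =
     submodule_gen k (free_module k (carrier M \<times> carrier N)) (tensor_rels k A M N)"

definition tensor ::
  "('k, 'e) ring_scheme \<Rightarrow> ('k, 'a) module \<Rightarrow> ('a, 'm) module \<Rightarrow> ('a, 'n) module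
    \<Rightarrow> ('k, ('m \<times> 'n \<Rightarrow> 'k) set) module" where
  "tensor k A M N =
     quot_module (free_module k (carrier M \<times> carrier N)) (tensor_ker k A M N)"

text \<open>The map \<open>f \<otimes> N\<close> from \<open>M \<otimes>\<^sub>A N\<close> to \<open>M' \<otimes>\<^sub>A N\<close> induced by \<open>f\<close> from \<open>M\<close> to \<open>M'\<close>,
  computed on cosets; it does not mention \<open>M\<close>.\<close>

definition tensor_map ::
  "('k, 'e) ring_scheme \<Rightarrow> ('k, 'a) module \<Rightarrow> ('a, 'm') module \<Rightarrow> ('a, 'n) module
    \<Rightarrow> ('m \<Rightarrow> 'm') \<Rightarrow> ('m \<times> 'n \<Rightarrow> 'k) set \<Rightarrow> ('m' \<times> 'n \<Rightarrow> 'k) set" where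
  "tensor_map k A M' N f S =
     (let F' = free_module k (carrier M' \<times> carrier N) in
      \<Union>c\<in>S. tensor_ker k A M' N +>\<^bsub>F'\<^esub>
        lin_ext k F' (\<lambda>(m, n). basis_vec k (f m, n)) c)"

text \<open>A chain complex is given by modules \<open>C p\<close> and differentials \<open>d p\<close> from
  \<open>C (Suc p)\<close> to \<open>C p\<close>; the differential leaving \<open>C 0\<close> is zero.\<close>

definition cycles :: "(nat \<Rightarrow> ('k, 'c) module) \<Rightarrow> (nat \<Rightarrow> 'c \<Rightarrow> 'c) \<Rightarrow> nat \<Rightarrow> 'c set" where
  "cycles C d p = (case p of 0 \<Rightarrow> carrier (C 0)
     | Suc q \<Rightarrow> {x \<in> carrier (C (Suc q)). d q x = \<zero>\<^bsub>C q\<^esub>})"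

definition homology ::
  "(nat \<Rightarrow> ('k, 'c) module) \<Rightarrow> (nat \<Rightarrow> 'c \<Rightarrow> 'c) \<Rightarrow> nat \<Rightarrow> ('k, 'c set) module" where
  "homology C d p =
     quot_module ((C p)\<lparr>carrier := cycles C d p\<rparr>) (d p ` carrier (C (Suc p)))"

text \<open>\<open>\<dots> \<rightarrow> R\<^bsup>(B 1)\<^esup> \<rightarrow> R\<^bsup>(B 0)\<^esup> \<rightarrow> M \<rightarrow> 0\<close> is exact.\<close>

definition free_resolution ::
  "('a, 'e) ring_scheme \<Rightarrow> ('a, 'm) module \<Rightarrow> (nat \<Rightarrow> 'x set)
    \<Rightarrow> (nat \<Rightarrow> ('x \<Rightarrow> 'a) \<Rightarrow> 'x \<Rightarrow> 'a) \<Rightarrow> (('x \<Rightarrow> 'a) \<Rightarrow> 'm) \<Rightarrow> bool" where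
  "free_resolution R M B d e \<longleftrightarrow>
     (\<forall>p. d p \<in> lin_maps R (free_module R (B (Suc p))) (free_module R (B p))) \<and>
     e \<in> lin_maps R (free_module R (B 0)) M \<and>
     e ` carrier (free_module R (B 0)) = carrier M \<and>
     d 0 ` carrier (free_module R (B (Suc 0))) =
       {f \<in> carrier (free_module R (B 0)). e f = \<zero>\<^bsub>M\<^esub>} \<and>
     (\<forall>p. d (Suc p) ` carrier (free_module R (B (Suc (Suc p)))) =
       {f \<in> carrier (free_module R (B (Suc p))). d p f = \<zero>\<^bsub>free_module R (B p)\<^esub>})"

text \<open>
  Tor is computed from a chosen free resolution of \<open>M\<close>. The bases of the free modules are taken
  in the following type, which is large enough for every module to have such a resolution
  (lemma \<open>free_resolution_exists\<close>): \<open>Gen\<close> provides names for the elements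
  of \<open>M\<close> and \<open>Comb\<close> names for the elements of the successive kernels.
\<close>

datatype ('m, 'a) gen = Gen 'm | Comb "(('m, 'a) gen \<times> 'a) list"

lemma free_module_simps [simp]:
  "\<zero>\<^bsub>free_module R B\<^esub> = (\<lambda>x. \<zero>\<^bsub>R\<^esub>)"
  "f \<oplus>\<^bsub>free_module R B\<^esub> g = (\<lambda>x. f x \<oplus>\<^bsub>R\<^esub> g x)"
  "a \<odot>\<^bsub>free_module R B\<^esub> f = (\<lambda>x. a \<otimes>\<^bsub>R\<^esub> f x)"
  by (simp_all add: free_module_def)

lemma free_module_carrier:
  "f \<in> carrier (free_module R B) \<longleftrightarrow> (\<forall>x\<in>B. f x \<in> carrier R) \<and> (\<forall>x. x \<notin> B \<longrightarrow> f x = \<zero>\<^bsub>R\<^esub>)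
     \<and> finite {x. f x \<noteq> \<zero>\<^bsub>R\<^esub>}"
  by (simp add: free_module_def)

lemma free_module_finite: "f \<in> carrier (free_module R B) \<Longrightarrow> finite {x. f x \<noteq> \<zero>\<^bsub>R\<^esub>}"
  by (simp add: free_module_carrier)

lemma free_module_closed:
  assumes "ring R" "f \<in> carrier (free_module R B)"
  shows "f x \<in> carrier R"
proof -
  interpret ring R by fact
  show ?thesis using assms(2) by (cases "x \<in> B") (auto simp: free_module_carrier)
qed

lemma free_module_left_module:
  assumes "ring R" shows "left_module R (free_module R B)"
proof -
  interpret ring R by fact
  let ?F = "free_module R B"
  note cl = free_module_closed[OF assms, of _ B]
  have in_F: "h \<in> carrier ?F"
    if "\<And>x. h x \<in> carrier R" "finite S" "\<And>x. x \<notin> S \<Longrightarrow> h x = \<zero>\<^bsub>R\<^esub>"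
      "\<And>x. x \<notin> B \<Longrightarrow> h x = \<zero>\<^bsub>R\<^esub>" for h S
  proof -
    have "{x. h x \<noteq> \<zero>\<^bsub>R\<^esub>} \<subseteq> S" using that(3) by blast
    then have "finite {x. h x \<noteq> \<zero>\<^bsub>R\<^esub>}" using that(2) by (rule finite_subset)
    then show ?thesis using that(1,4) by (simp add: free_module_carrier)
  qed
  have outside: "f x = \<zero>\<^bsub>R\<^esub>" if "f \<in> carrier ?F" "x \<notin> B" for f x
    using that by (simp add: free_module_carrier)
  have add: "(\<lambda>x. f x \<oplus>\<^bsub>R\<^esub> g x) \<in> carrier ?F" if f: "f \<in> carrier ?F" and g: "g \<in> carrier ?F" for f g
    by (rule in_F[OF _ finite_UnI[OF free_module_finite[OF f] free_module_finite[OF g]]])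
      (simp_all add: cl[OF f] cl[OF g] outside[OF f] outside[OF g])
  have sm: "(\<lambda>x. a \<otimes>\<^bsub>R\<^esub> f x) \<in> carrier ?F" if a: "a \<in> carrier R" and f: "f \<in> carrier ?F" for a f
    by (rule in_F[OF _ free_module_finite[OF f]]) (simp_all add: a cl[OF f] outside[OF f])
  have "abelian_group ?F"
  proof (rule abelian_groupI, unfold free_module_simps)
    show "(\<lambda>x. \<zero>\<^bsub>R\<^esub>) \<in> carrier ?F" by (simp add: free_module_carrier)
    show "(\<lambda>x. f x \<oplus>\<^bsub>R\<^esub> g x) \<in> carrier ?F" if "f \<in> carrier ?F" "g \<in> carrier ?F" for f g
      using that by (rule add)
    show "(\<lambda>x. (f x \<oplus>\<^bsub>R\<^esub> g x) \<oplus>\<^bsub>R\<^esub> h x) = (\<lambda>x. f x \<oplus>\<^bsub>R\<^esub> (g x \<oplus>\<^bsub>R\<^esub> h x))"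
      if f: "f \<in> carrier ?F" and g: "g \<in> carrier ?F" and h: "h \<in> carrier ?F" for f g h
      by (rule ext) (rule a_assoc[OF cl[OF f] cl[OF g] cl[OF h]])
    show "(\<lambda>x. f x \<oplus>\<^bsub>R\<^esub> g x) = (\<lambda>x. g x \<oplus>\<^bsub>R\<^esub> f x)"
      if f: "f \<in> carrier ?F" and g: "g \<in> carrier ?F" for f g
      by (rule ext) (rule a_comm[OF cl[OF f] cl[OF g]])
    show "(\<lambda>x. \<zero>\<^bsub>R\<^esub> \<oplus>\<^bsub>R\<^esub> f x) = f" if f: "f \<in> carrier ?F" for f
      by (rule ext) (rule l_zero[OF cl[OF f]])
    show "\<exists>g\<in>carrier ?F. (\<lambda>x. g x \<oplus>\<^bsub>R\<^esub> f x) = (\<lambda>x. \<zero>\<^bsub>R\<^esub>)" if f: "f \<in> carrier ?F" for f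
    proof (rule bexI)
      show "(\<lambda>x. ((\<ominus>\<^bsub>R\<^esub> \<one>\<^bsub>R\<^esub>) \<otimes>\<^bsub>R\<^esub> f x) \<oplus>\<^bsub>R\<^esub> f x) = (\<lambda>x. \<zero>\<^bsub>R\<^esub>)"
        by (rule ext) (simp add: cl[OF f] l_minus l_neg)
      show "(\<lambda>x. (\<ominus>\<^bsub>R\<^esub> \<one>\<^bsub>R\<^esub>) \<otimes>\<^bsub>R\<^esub> f x) \<in> carrier ?F"
        by (rule sm[OF a_inv_closed[OF one_closed] f])
    qed
  qed
  moreover have "left_module_axioms R ?F"
  proof (rule left_module_axioms.intro, unfold free_module_simps)
    show "(\<lambda>x. a \<otimes>\<^bsub>R\<^esub> f x) \<in> carrier ?F" if "a \<in> carrier R" "f \<in> carrier ?F" for a f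
      using that by (rule sm)
    show "(\<lambda>x. (a \<oplus>\<^bsub>R\<^esub> b) \<otimes>\<^bsub>R\<^esub> f x) = (\<lambda>x. a \<otimes>\<^bsub>R\<^esub> f x \<oplus>\<^bsub>R\<^esub> b \<otimes>\<^bsub>R\<^esub> f x)"
      if "a \<in> carrier R" "b \<in> carrier R" and f: "f \<in> carrier ?F" for a b f
      by (rule ext) (rule l_distr[OF that(1,2) cl[OF f]])
    show "(\<lambda>x. a \<otimes>\<^bsub>R\<^esub> (f x \<oplus>\<^bsub>R\<^esub> g x)) = (\<lambda>x. a \<otimes>\<^bsub>R\<^esub> f x \<oplus>\<^bsub>R\<^esub> a \<otimes>\<^bsub>R\<^esub> g x)"
      if a: "a \<in> carrier R" and f: "f \<in> carrier ?F" and g: "g \<in> carrier ?F" for a f g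
      by (rule ext) (rule r_distr[OF cl[OF f] cl[OF g] a])
    show "(\<lambda>x. a \<otimes>\<^bsub>R\<^esub> b \<otimes>\<^bsub>R\<^esub> f x) = (\<lambda>x. a \<otimes>\<^bsub>R\<^esub> (b \<otimes>\<^bsub>R\<^esub> f x))"
      if "a \<in> carrier R" "b \<in> carrier R" and f: "f \<in> carrier ?F" for a b f
      by (rule ext) (rule m_assoc[OF that(1,2) cl[OF f]])
    show "(\<lambda>x. \<one>\<^bsub>R\<^esub> \<otimes>\<^bsub>R\<^esub> f x) = f" if f: "f \<in> carrier ?F" for f
      by (rule ext) (rule l_one[OF cl[OF f]])
  qed
  ultimately show ?thesis using assms by (intro left_module.intro)
qed

context left_module
begin

lemma smult_l_null:
  assumes x: "x \<in> carrier M" shows "\<zero>\<^bsub>R\<^esub> \<odot>\<^bsub>M\<^esub> x = \<zero>\<^bsub>M\<^esub>"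
proof -
  have "\<zero>\<^bsub>R\<^esub> \<odot>\<^bsub>M\<^esub> x \<oplus>\<^bsub>M\<^esub> \<zero>\<^bsub>R\<^esub> \<odot>\<^bsub>M\<^esub> x = \<zero>\<^bsub>R\<^esub> \<odot>\<^bsub>M\<^esub> x"
    using smult_l_distr[of "\<zero>\<^bsub>R\<^esub>" "\<zero>\<^bsub>R\<^esub>" x] x by simp
  then show ?thesis using x by (simp add: M.add.r_cancel_one)
qed

lemma smult_r_null:
  assumes a: "a \<in> carrier R" shows "a \<odot>\<^bsub>M\<^esub> \<zero>\<^bsub>M\<^esub> = \<zero>\<^bsub>M\<^esub>"
proof -
  have "a \<odot>\<^bsub>M\<^esub> \<zero>\<^bsub>M\<^esub> \<oplus>\<^bsub>M\<^esub> a \<odot>\<^bsub>M\<^esub> \<zero>\<^bsub>M\<^esub> = a \<odot>\<^bsub>M\<^esub> \<zero>\<^bsub>M\<^esub>"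
    using smult_r_distr[of a "\<zero>\<^bsub>M\<^esub>" "\<zero>\<^bsub>M\<^esub>"] a by simp
  then show ?thesis using a by (simp add: M.add.r_cancel_one)
qed

lemma smult_finsum:
  assumes "a \<in> carrier R" "v \<in> S \<rightarrow> carrier M"
  shows "a \<odot>\<^bsub>M\<^esub> (\<Oplus>\<^bsub>M\<^esub>x\<in>S. v x) = (\<Oplus>\<^bsub>M\<^esub>x\<in>S. a \<odot>\<^bsub>M\<^esub> v x)"
  using assms(2)
proof (induction S rule: infinite_finite_induct)
  case (insert x S)
  then have "v x \<in> carrier M" "v \<in> S \<rightarrow> carrier M" by auto
  with insert assms(1) show ?case
    by (subst M.finsum_insert, simp_all add: Pi_iff smult_r_distr M.finsum_insert)
qed (use assms(1) in \<open>simp_all add: smult_r_null\<close>)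

lemma lin_ext_superset:
  assumes "v \<in> B \<rightarrow> carrier M" "f \<in> carrier (free_module R B)"
    "finite S" "{x. f x \<noteq> \<zero>\<^bsub>R\<^esub>} \<subseteq> S" "S \<subseteq> B"
  shows "lin_ext R M v f = (\<Oplus>\<^bsub>M\<^esub>x\<in>S. f x \<odot>\<^bsub>M\<^esub> v x)"
  unfolding lin_ext_def using assms smult_l_null
  by (intro M.add.finprod_mono_neutral_cong_left)
    (auto simp: Pi_iff free_module_carrier subset_iff)

lemma free_module_support: "f \<in> carrier (free_module R B) \<Longrightarrow> {x. f x \<noteq> \<zero>\<^bsub>R\<^esub>} \<subseteq> B"
  by (auto simp: free_module_carrier)

lemma lin_ext_lin:
  assumes v: "v \<in> B \<rightarrow> carrier M"
  shows "lin_ext R M v \<in> lin_maps R (free_module R B) M"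
proof -
  let ?F = "free_module R B"
  interpret F: left_module R ?F by (rule free_module_left_module) unfold_locales
  note cl = free_module_closed[OF R.ring_axioms, of _ B]
  note sup = lin_ext_superset[OF v]
  have tm: "f x \<odot>\<^bsub>M\<^esub> v x \<in> carrier M" if "f \<in> carrier ?F" "x \<in> B" for f x
    using that v cl by auto
  have "lin_ext R M v f \<in> carrier M" if "f \<in> carrier ?F" for f
    unfolding lin_ext_def using tm[OF that] free_module_support[OF that]
    by (intro M.finsum_closed) auto
  moreover have "lin_ext R M v (f \<oplus>\<^bsub>?F\<^esub> g) = lin_ext R M v f \<oplus>\<^bsub>M\<^esub> lin_ext R M v g"
    if "f \<in> carrier ?F" "g \<in> carrier ?F" for f g
  proof -
    let ?S = "{x. f x \<noteq> \<zero>\<^bsub>R\<^esub>} \<union> {x. g x \<noteq> \<zero>\<^bsub>R\<^esub>}"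
    have S: "finite ?S" "?S \<subseteq> B" using that by (auto simp: free_module_carrier)
    have sub: "{x. (f \<oplus>\<^bsub>?F\<^esub> g) x \<noteq> \<zero>\<^bsub>R\<^esub>} \<subseteq> ?S"
    proof -
      have "(f \<oplus>\<^bsub>?F\<^esub> g) x = \<zero>\<^bsub>R\<^esub>" if "x \<notin> ?S" for x using that by simp
      then show ?thesis by blast
    qed
    have "lin_ext R M v (f \<oplus>\<^bsub>?F\<^esub> g) = (\<Oplus>\<^bsub>M\<^esub>x\<in>?S. (f x \<oplus>\<^bsub>R\<^esub> g x) \<odot>\<^bsub>M\<^esub> v x)"
      using sup[OF F.a_closed[OF that] S(1) sub S(2)] by simp
    also have "\<dots> = (\<Oplus>\<^bsub>M\<^esub>x\<in>?S. f x \<odot>\<^bsub>M\<^esub> v x \<oplus>\<^bsub>M\<^esub> g x \<odot>\<^bsub>M\<^esub> v x)"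
      using that S(2) v cl tm by (intro M.finsum_cong') (auto simp: smult_l_distr Pi_iff subset_iff)
    also have "\<dots> = (\<Oplus>\<^bsub>M\<^esub>x\<in>?S. f x \<odot>\<^bsub>M\<^esub> v x) \<oplus>\<^bsub>M\<^esub> (\<Oplus>\<^bsub>M\<^esub>x\<in>?S. g x \<odot>\<^bsub>M\<^esub> v x)"
      using that S(2) tm by (intro M.finsum_addf) blast+
    finally show ?thesis using sup[OF that(1) S(1) _ S(2)] sup[OF that(2) S(1) _ S(2)] by simp
  qed
  moreover have "lin_ext R M v (a \<odot>\<^bsub>?F\<^esub> f) = a \<odot>\<^bsub>M\<^esub> lin_ext R M v f"
    if "a \<in> carrier R" "f \<in> carrier ?F" for a f
  proof -
    let ?S = "{x. f x \<noteq> \<zero>\<^bsub>R\<^esub>}"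
    have S: "finite ?S" "?S \<subseteq> B" using that by (auto simp: free_module_carrier)
    have sub: "{x. (a \<odot>\<^bsub>?F\<^esub> f) x \<noteq> \<zero>\<^bsub>R\<^esub>} \<subseteq> ?S" using that(1) by auto
    have "lin_ext R M v (a \<odot>\<^bsub>?F\<^esub> f) = (\<Oplus>\<^bsub>M\<^esub>x\<in>?S. (a \<otimes>\<^bsub>R\<^esub> f x) \<odot>\<^bsub>M\<^esub> v x)"
      using sup[OF F.smult_closed[OF that] S(1) sub S(2)] by simp
    also have "\<dots> = (\<Oplus>\<^bsub>M\<^esub>x\<in>?S. a \<odot>\<^bsub>M\<^esub> (f x \<odot>\<^bsub>M\<^esub> v x))"
      using that S(2) v cl tm by (intro M.finsum_cong') (auto simp: smult_assoc Pi_iff subset_iff)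
    also have "\<dots> = a \<odot>\<^bsub>M\<^esub> lin_ext R M v f"
      unfolding lin_ext_def using that S(2) tm by (intro smult_finsum[symmetric]) blast+
    finally show ?thesis .
  qed
  ultimately show ?thesis unfolding lin_maps_def by blast
qed

lemma basis_vec_closed: "x \<in> B \<Longrightarrow> basis_vec R x \<in> carrier (free_module R B)"
  by (auto simp: free_module_carrier basis_vec_def)

lemma lin_ext_basis_vec:
  assumes "v \<in> B \<rightarrow> carrier M" "x \<in> B"
  shows "lin_ext R M v (basis_vec R x) = v x"
proof -
  have vx: "v x \<in> carrier M" using assms by auto
  have "lin_ext R M v (basis_vec R x) = (\<Oplus>\<^bsub>M\<^esub>y\<in>{x}. basis_vec R x y \<odot>\<^bsub>M\<^esub> v y)"
    by (rule lin_ext_superset[OF assms(1) basis_vec_closed[OF assms(2)]])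
      (use assms in \<open>auto simp: basis_vec_def\<close>)
  also have "\<dots> = v x" using vx by (simp add: basis_vec_def smult_one)
  finally show ?thesis .
qed

lemma free_cover:
  fixes K :: "(('x, 'a) gen \<Rightarrow> 'a) set" and C :: "('x, 'a) gen set"
  assumes "K \<subseteq> carrier (free_module R C)" "\<And>f g. f \<in> K \<Longrightarrow> g \<in> K \<Longrightarrow> f \<oplus>\<^bsub>free_module R C\<^esub> g \<in> K"
    "\<And>a f. a \<in> carrier R \<Longrightarrow> f \<in> K \<Longrightarrow> a \<odot>\<^bsub>free_module R C\<^esub> f \<in> K"
    "\<zero>\<^bsub>free_module R C\<^esub> \<in> K"
  shows "\<exists>(D :: ('x, 'a) gen set) d. d \<in> lin_maps R (free_module R D) (free_module R C) \<and>
           d ` carrier (free_module R D) = K"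
proof -
  let ?F = "free_module R C"
  interpret F: left_module R ?F by (rule free_module_left_module) unfold_locales
  define word :: "(('x, 'a) gen \<Rightarrow> 'a) \<Rightarrow> (('x, 'a) gen \<times> 'a) list" where
    "word f = (SOME l. set l = (\<lambda>x. (x, f x)) ` {x. f x \<noteq> \<zero>\<^bsub>R\<^esub>})" for f
  have word: "set (word f) = (\<lambda>x. (x, f x)) ` {x. f x \<noteq> \<zero>\<^bsub>R\<^esub>}" if "f \<in> K" for f
  proof -
    have "finite {x. f x \<noteq> \<zero>\<^bsub>R\<^esub>}"
      using assms(1) that by (intro free_module_finite[of f R C]) (rule subsetD)
    then have "\<exists>l. set l = (\<lambda>x. (x, f x)) ` {x. f x \<noteq> \<zero>\<^bsub>R\<^esub>}"
      by (intro finite_list finite_imageI)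
    then show ?thesis unfolding word_def by (rule someI_ex)
  qed
  define enc where "enc f = Comb (word f)" for f
  have inj: "inj_on enc K"
  proof (rule inj_onI)
    fix f g assume fg: "f \<in> K" "g \<in> K" "enc f = enc g"
    then have "set (word f) = set (word g)" by (simp add: enc_def)
    then have eq: "(\<lambda>x. (x, f x)) ` {x. f x \<noteq> \<zero>\<^bsub>R\<^esub>} = (\<lambda>x. (x, g x)) ` {x. g x \<noteq> \<zero>\<^bsub>R\<^esub>}"
      using word fg by blast
    have "f x = g x" for x
    proof (cases "f x = \<zero>\<^bsub>R\<^esub> \<and> g x = \<zero>\<^bsub>R\<^esub>")
      case False
      then have "(x, f x) \<in> (\<lambda>x. (x, f x)) ` {x. f x \<noteq> \<zero>\<^bsub>R\<^esub>} \<or>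
          (x, g x) \<in> (\<lambda>x. (x, g x)) ` {x. g x \<noteq> \<zero>\<^bsub>R\<^esub>}" by blast
      then have "(x, f x) \<in> (\<lambda>x. (x, g x)) ` {x. g x \<noteq> \<zero>\<^bsub>R\<^esub>} \<or>
          (x, g x) \<in> (\<lambda>x. (x, f x)) ` {x. f x \<noteq> \<zero>\<^bsub>R\<^esub>}" by (simp only: eq)
      then show ?thesis by auto
    qed simp
    then show "f = g" by blast
  qed
  let ?v = "inv_into K enc"
  have v: "?v x \<in> K" if "x \<in> enc ` K" for x
    using that by (rule inv_into_into)
  have v': "?v \<in> enc ` K \<rightarrow> carrier ?F"
    by (rule Pi_I) (rule subsetD[OF assms(1) v])
  let ?d = "lin_ext R ?F ?v"
  have image: "?d f \<in> K" if f: "f \<in> carrier (free_module R (enc ` K))" for f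
  proof -
    have term_in: "f x \<odot>\<^bsub>?F\<^esub> ?v x \<in> K" if "x \<in> enc ` K" for x
      by (rule assms(3)[OF free_module_closed[OF R.ring_axioms f] v[OF that]])
    have "(\<Oplus>\<^bsub>?F\<^esub>x\<in>S. f x \<odot>\<^bsub>?F\<^esub> ?v x) \<in> K" if "finite S" "S \<subseteq> enc ` K" for S
      using that
    proof (induction S rule: finite_induct)
      case empty
      show ?case unfolding F.finsum_empty by (rule assms(4))
    next
      case (insert x S)
      have x: "x \<in> enc ` K" and S: "S \<subseteq> enc ` K" using insert.prems by simp_all
      have "(\<Oplus>\<^bsub>?F\<^esub>x\<in>insert x S. f x \<odot>\<^bsub>?F\<^esub> ?v x)
          = f x \<odot>\<^bsub>?F\<^esub> ?v x \<oplus>\<^bsub>?F\<^esub> (\<Oplus>\<^bsub>?F\<^esub>x\<in>S. f x \<odot>\<^bsub>?F\<^esub> ?v x)"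
      proof (rule F.finsum_insert[OF insert.hyps])
        show "(\<lambda>x. f x \<odot>\<^bsub>?F\<^esub> ?v x) \<in> S \<rightarrow> carrier ?F"
          by (rule Pi_I) (rule subsetD[OF assms(1) term_in[OF subsetD[OF S]]])
        show "f x \<odot>\<^bsub>?F\<^esub> ?v x \<in> carrier ?F"
          by (rule subsetD[OF assms(1) term_in[OF x]])
      qed
      also have "\<dots> \<in> K" by (rule assms(2)[OF term_in[OF x] insert.IH[OF S]])
      finally show ?case .
    qed
    then show ?thesis
      unfolding lin_ext_def using free_module_finite[OF f] free_module_support[OF f] .
  qed
  have preimage: "f \<in> ?d ` carrier (free_module R (enc ` K))" if f: "f \<in> K" for f
  proof (rule image_eqI)
    have "?d (basis_vec R (enc f)) = ?v (enc f)"
      by (rule F.lin_ext_basis_vec[OF v' imageI[OF f]])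
    also have "\<dots> = f" by (rule inv_into_f_f[OF inj f])
    finally show "f = ?d (basis_vec R (enc f))" by (rule sym)
    show "basis_vec R (enc f) \<in> carrier (free_module R (enc ` K))"
      by (rule basis_vec_closed[OF imageI[OF f]])
  qed
  have "?d ` carrier (free_module R (enc ` K)) = K"
    by (intro subset_antisym image_subsetI subsetI image preimage)
  then show ?thesis using F.lin_ext_lin[OF v'] by (intro exI conjI)
qed

end

lemma free_module_kernel_cover:
  fixes R :: "('a, 'e) ring_scheme" and N :: "('a, 'n) module" and C :: "('m, 'a) gen set"
  assumes N: "left_module R N" and h: "h \<in> lin_maps R (free_module R C) N"
  shows "\<exists>(D :: ('m, 'a) gen set) d. d \<in> lin_maps R (free_module R D) (free_module R C) \<and>
    d ` carrier (free_module R D) = {f \<in> carrier (free_module R C). h f = \<zero>\<^bsub>N\<^esub>}"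
proof -
  let ?F = "free_module R C"
  interpret N: left_module R N by fact
  show ?thesis
  proof (rule N.free_cover)
    interpret F: left_module R "?F" by (rule free_module_left_module) unfold_locales
    have h_closed: "h f \<in> carrier N" if "f \<in> carrier ?F" for f
      using h that by (auto simp: lin_maps_def)
    have h_add: "h (f \<oplus>\<^bsub>?F\<^esub> g) = h f \<oplus>\<^bsub>N\<^esub> h g"
      if "f \<in> carrier ?F" "g \<in> carrier ?F" for f g
      using h that by (simp only: lin_maps_def mem_Collect_eq)
    have h_smult: "h (a \<odot>\<^bsub>?F\<^esub> f) = a \<odot>\<^bsub>N\<^esub> h f"
      if "a \<in> carrier R" "f \<in> carrier ?F" for a f
      using h that by (simp only: lin_maps_def mem_Collect_eq)
    let ?K = "{f \<in> carrier ?F. h f = \<zero>\<^bsub>N\<^esub>}"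
    show "?K \<subseteq> carrier ?F" by (rule Collect_restrict)
    show "f \<oplus>\<^bsub>?F\<^esub> g \<in> ?K" if "f \<in> ?K" "g \<in> ?K" for f g
    proof -
      have "f \<in> carrier ?F" "g \<in> carrier ?F" "h f = \<zero>\<^bsub>N\<^esub>" "h g = \<zero>\<^bsub>N\<^esub>"
        using that by simp_all
      then have "f \<oplus>\<^bsub>?F\<^esub> g \<in> carrier ?F" "h (f \<oplus>\<^bsub>?F\<^esub> g) = \<zero>\<^bsub>N\<^esub> \<oplus>\<^bsub>N\<^esub> \<zero>\<^bsub>N\<^esub>"
        by (simp_all only: F.a_closed h_add)
      then show ?thesis by (simp only: mem_Collect_eq N.l_zero N.zero_closed)
    qed
    show smult: "a \<odot>\<^bsub>?F\<^esub> f \<in> ?K" if "a \<in> carrier R" "f \<in> ?K" for a f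
    proof -
      have "f \<in> carrier ?F" "h f = \<zero>\<^bsub>N\<^esub>" using that by simp_all
      with that(1) have "a \<odot>\<^bsub>?F\<^esub> f \<in> carrier ?F" "h (a \<odot>\<^bsub>?F\<^esub> f) = a \<odot>\<^bsub>N\<^esub> \<zero>\<^bsub>N\<^esub>"
        by (simp_all only: F.smult_closed h_smult)
      then show ?thesis using N.smult_r_null[OF that(1)] by (simp only: mem_Collect_eq)
    qed
    have z: "\<zero>\<^bsub>?F\<^esub> \<in> carrier ?F" by (rule F.zero_closed)
    have "h \<zero>\<^bsub>?F\<^esub> = \<zero>\<^bsub>N\<^esub>"
      using h_smult[OF N.R.zero_closed z] F.smult_l_null[OF z] N.smult_l_null[OF h_closed[OF z]]
      by (simp only:)
    then show "\<zero>\<^bsub>?F\<^esub> \<in> ?K" using z by (simp only: mem_Collect_eq)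
  qed
qed

lemma free_resolution_exists:
  fixes R :: "('a, 'e) ring_scheme" and M :: "('a, 'm) module"
  assumes "left_module R M"
  shows "\<exists>(B :: nat \<Rightarrow> ('m, 'a) gen set) d e. free_resolution R M B d e"
proof -
  interpret left_module R M by fact
  let ?F = "\<lambda>B :: ('m, 'a) gen set. free_module R B"
  have lm: "left_module R (?F B)" for B
    by (rule free_module_left_module) unfold_locales
  let ?B0 = "Gen ` carrier M :: ('m, 'a) gen set"
  define v :: "('m, 'a) gen \<Rightarrow> 'm" where "v = (\<lambda>g. case g of Gen m \<Rightarrow> m | Comb l \<Rightarrow> \<zero>\<^bsub>M\<^esub>)"
  have v: "v \<in> ?B0 \<rightarrow> carrier M" by (auto simp: v_def)
  define e where "e = lin_ext R M v"
  have e: "e \<in> lin_maps R (?F ?B0) M" unfolding e_def by (rule lin_ext_lin[OF v])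
  have "m \<in> e ` carrier (?F ?B0)" if "m \<in> carrier M" for m
  proof -
    have "e (basis_vec R (Gen m)) = m"
      unfolding e_def using lin_ext_basis_vec[OF v, of "Gen m"] that by (simp add: v_def)
    then show ?thesis using basis_vec_closed[of "Gen m" ?B0] that by (metis imageI)
  qed
  moreover have "e ` carrier (?F ?B0) \<subseteq> carrier M" using e by (auto simp: lin_maps_def)
  ultimately have e_onto: "e ` carrier (?F ?B0) = carrier M" by blast
  obtain B1 d0 where d0: "d0 \<in> lin_maps R (?F B1) (?F ?B0)"
      "d0 ` carrier (?F B1) = {f \<in> carrier (?F ?B0). e f = \<zero>\<^bsub>M\<^esub>}"
    using free_module_kernel_cover[OF assms e] by blast
  \<comment> \<open>a stage consists of source basis, target basis and differential\<close>
  define P where "P = (\<lambda>(n::nat) (D, C, d). d \<in> lin_maps R (?F D) (?F C) \<and>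
    (n = 0 \<longrightarrow> (D, C, d) = (B1, ?B0, d0)))"
  define Q where "Q = (\<lambda>(n::nat) (D, C, d) (D', C', d'). C' = D \<and>
    d' ` carrier (?F D') = {f \<in> carrier (?F D). d f = \<zero>\<^bsub>?F C\<^esub>})"
  have "\<exists>s. \<forall>n. P n (s n) \<and> Q n (s n) (s (Suc n))"
  proof (rule dependent_nat_choice)
    show "\<exists>s. P 0 s" using d0(1) by (auto simp: P_def)
  next
    fix s n assume "P n s"
    obtain D C d where s: "s = (D, C, d)" by (cases s)
    with \<open>P n s\<close> have "d \<in> lin_maps R (?F D) (?F C)" by (simp add: P_def)
    from free_module_kernel_cover[OF lm this] obtain D' d' where "d' \<in> lin_maps R (?F D') (?F D)"
      "d' ` carrier (?F D') = {f \<in> carrier (?F D). d f = \<zero>\<^bsub>?F C\<^esub>}" by blast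
    then show "\<exists>s'. P (Suc n) s' \<and> Q n s s'"
      by (intro exI[of _ "(D', D, d')"]) (simp add: P_def Q_def s)
  qed
  then obtain s where s: "\<And>n. P n (s n)" "\<And>n. Q n (s n) (s (Suc n))" by blast
  define B where "B n = fst (snd (s n))" for n
  define d where "d n = snd (snd (s n))" for n
  have sn: "s n = (B (Suc n), B n, d n)" for n
    using s(2)[of n] by (auto simp: Q_def B_def d_def split: prod.splits)
  have "d n \<in> lin_maps R (?F (B (Suc n))) (?F (B n))" for n
    using s(1)[of n] unfolding sn by (simp add: P_def)
  moreover have "B 0 = ?B0" "B (Suc 0) = B1" "d 0 = d0"
    using s(1)[of 0] unfolding sn by (simp_all add: P_def)
  moreover have "d (Suc n) ` carrier (?F (B (Suc (Suc n))))
      = {f \<in> carrier (?F (B (Suc n))). d n f = \<zero>\<^bsub>?F (B n)\<^esub>}" for n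
    using s(2)[of n] unfolding sn by (simp add: Q_def)
  ultimately have "free_resolution R M B d e"
    unfolding free_resolution_def using e e_onto d0(2) by simp
  then show ?thesis by blast
qed

definition chosen_resolution ::
  "('a, 'e) ring_scheme \<Rightarrow> ('a, 'm) module \<Rightarrow> (nat \<Rightarrow> ('m, 'a) gen set) \<times>
    (nat \<Rightarrow> (('m, 'a) gen \<Rightarrow> 'a) \<Rightarrow> ('m, 'a) gen \<Rightarrow> 'a)" where
  "chosen_resolution R M = (SOME (B, d). \<exists>e. free_resolution R M B d e)"

definition Tor ::
  "('k, 'e) ring_scheme \<Rightarrow> ('k, 'a) module \<Rightarrow> ('a, 'm) module \<Rightarrow> ('a, 'n) module \<Rightarrow> nat
    \<Rightarrow> ('k, (((('m, 'a) gen \<Rightarrow> 'a) \<times> 'n) \<Rightarrow> 'k) set set) module" where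
  "Tor k A M N =
     (case chosen_resolution (opposite A) M of (B, d) \<Rightarrow>
       let P = (\<lambda>p. free_module (opposite A) (B p)) in
       homology (\<lambda>p. tensor k A (P p) N) (\<lambda>p. tensor_map k A (P p) N (d p)))"


section \<open>Algebras with a basis, and their trivial modules\<close>

text \<open>The free \<open>k\<close>-module on \<open>S\<close> with the bilinear extension of a product \<open>b\<close> of basis elements.\<close>

definition based_algebra ::
  "('k, 'e) ring_scheme \<Rightarrow> 'x set \<Rightarrow> ('x \<Rightarrow> 'x \<Rightarrow> 'x \<Rightarrow> 'k) \<Rightarrow> 'x \<Rightarrow> ('k, 'x \<Rightarrow> 'k) module" where
  "based_algebra k S b u =
     (free_module k S)\<lparr>
       mult := (\<lambda>f g. lin_ext k (free_module k S) (\<lambda>x. lin_ext k (free_module k S) (b x) g) f),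
       one := basis_vec k u\<rparr>"

definition group_algebra ::
  "('k, 'e) ring_scheme \<Rightarrow> ('h, 'f) monoid_scheme \<Rightarrow> ('k, 'h \<Rightarrow> 'k) module" where
  "group_algebra k H =
     based_algebra k (carrier H) (\<lambda>x y. basis_vec k (x \<otimes>\<^bsub>H\<^esub> y)) \<one>\<^bsub>H\<^esub>"

text \<open>The module \<open>k\<close> on which a basis element \<open>x\<close> acts as 1 if \<open>P x\<close> and as 0 otherwise.
  As \<open>k\<close> is commutative, the same record serves as a left and as a right module.\<close>

definition scalar_module ::
  "('k, 'e) ring_scheme \<Rightarrow> ('x \<Rightarrow> bool) \<Rightarrow> ('x \<Rightarrow> 'k, 'k) module" where
  "scalar_module k P =
     \<lparr>carrier = carrier k, monoid.mult = monoid.mult k, monoid.one = \<one>\<^bsub>k\<^esub>,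
      ring.zero = \<zero>\<^bsub>k\<^esub>, ring.add = add k,
      smult = (\<lambda>f r. (\<Oplus>\<^bsub>k\<^esub>x\<in>{x. f x \<noteq> \<zero>\<^bsub>k\<^esub>}. f x \<otimes>\<^bsub>k\<^esub> (if P x then \<one>\<^bsub>k\<^esub> else \<zero>\<^bsub>k\<^esub>)) \<otimes>\<^bsub>k\<^esub> r)\<rparr>"

definition group_trivial_module :: "('k, 'e) ring_scheme \<Rightarrow> ('h \<Rightarrow> 'k, 'k) module" where
  "group_trivial_module k = scalar_module k (\<lambda>_. True)"


section \<open>Group homology\<close>

text \<open>
  \<open>H\<^sub>p(H, k)\<close> with trivial coefficients, as the homology of the inhomogeneous bar complex: in
  degree \<open>p\<close> the free \<open>k\<close>-module on \<open>p\<close>-tuples of group elements, with differential the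
  alternating sum of the faces.
\<close>

definition bar_face :: "('h, 'f) monoid_scheme \<Rightarrow> nat \<Rightarrow> 'h list \<Rightarrow> 'h list" where
  "bar_face H i xs =
     (if i = 0 then tl xs
      else if i = length xs then butlast xs
      else take (i - 1) xs @ (xs ! (i - 1) \<otimes>\<^bsub>H\<^esub> xs ! i) # drop (i + 1) xs)"

definition bar_module ::
  "('k, 'e) ring_scheme \<Rightarrow> ('h, 'f) monoid_scheme \<Rightarrow> nat \<Rightarrow> ('k, 'h list \<Rightarrow> 'k) module" where
  "bar_module k H p = free_module k {xs. length xs = p \<and> set xs \<subseteq> carrier H}"

definition bar_diff ::
  "('k, 'e) ring_scheme \<Rightarrow> ('h, 'f) monoid_scheme \<Rightarrow> nat \<Rightarrow> ('h list \<Rightarrow> 'k) \<Rightarrow> 'h list \<Rightarrow> 'k" where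
  "bar_diff k H p =
     lin_ext k (bar_module k H p)
       (\<lambda>xs. \<Oplus>\<^bsub>bar_module k H p\<^esub>i\<in>{0..Suc p}.
          ((\<ominus>\<^bsub>k\<^esub> \<one>\<^bsub>k\<^esub>) [^]\<^bsub>k\<^esub> i) \<odot>\<^bsub>bar_module k H p\<^esub> basis_vec k (bar_face H i xs))"

definition group_homology ::
  "('k, 'e) ring_scheme \<Rightarrow> ('h, 'f) monoid_scheme \<Rightarrow> nat \<Rightarrow> ('k, ('h list \<Rightarrow> 'k) set) module" where
  "group_homology k H = homology (bar_module k H) (bar_diff k H)"


section \<open>The group \<open>G\<^sup>n \<rtimes> \<Sigma>\<^sub>n\<close>\<close>

definition semidirect ::
  "('a, 'e) monoid_scheme \<Rightarrow> ('b, 'f) monoid_scheme \<Rightarrow> ('b \<Rightarrow> 'a \<Rightarrow> 'a) \<Rightarrow> ('a \<times> 'b) monoid" where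
  "semidirect N H act =
     \<lparr>carrier = carrier N \<times> carrier H,
      monoid.mult = (\<lambda>(a, s) (b, t). (a \<otimes>\<^bsub>N\<^esub> act s b, s \<otimes>\<^bsub>H\<^esub> t)),
      monoid.one = (\<one>\<^bsub>N\<^esub>, \<one>\<^bsub>H\<^esub>)\<rparr>"

definition permute_factors :: "nat \<Rightarrow> (nat \<Rightarrow> nat) \<Rightarrow> (nat \<Rightarrow> 'g) \<Rightarrow> nat \<Rightarrow> 'g" where
  "permute_factors n s a = (\<lambda>i\<in>{1..n}. a (inv_into UNIV s i))"

definition power_sym_group ::
  "('g, 'e) monoid_scheme \<Rightarrow> nat \<Rightarrow> ((nat \<Rightarrow> 'g) \<times> (nat \<Rightarrow> nat)) monoid" where
  "power_sym_group G n =
     semidirect (product_group {1..n} (\<lambda>_. G)) (sym_group n) (permute_factors n)"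


section \<open>\<open>G\<close>-Brauer algebras\<close>

definition commutative_G_ring ::
  "('g, 'e) monoid_scheme \<Rightarrow> ('k, 'f) ring_scheme \<Rightarrow> ('g \<Rightarrow> 'k \<Rightarrow> 'k) \<Rightarrow> bool" where
  "commutative_G_ring G k act \<longleftrightarrow> cring k \<and>
     (\<forall>g\<in>carrier G. act g \<in> ring_iso k k) \<and>
     (\<forall>g\<in>carrier G. \<forall>h\<in>carrier G. \<forall>r\<in>carrier k. act (g \<otimes>\<^bsub>G\<^esub> h) r = act g (act h r))"

text \<open>The middle column only occurs when two diagrams are placed side by side.\<close>

datatype column = Lft | Mid | Rgt

type_synonym node = "column \<times> nat"

text \<open>A diagram is the set of its edges, each given by its two end points and its label.\<close>

type_synonym 'g diagram = "(node set \<times> 'g) set"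

definition outer_nodes :: "nat \<Rightarrow> node set" where
  "outer_nodes n = {Lft, Rgt} \<times> {1..n}"

definition brauer_diagrams :: "('g, 'e) monoid_scheme \<Rightarrow> nat \<Rightarrow> 'g diagram set" where
  "brauer_diagrams G n =
     {D. (\<forall>(e, g)\<in>D. e \<subseteq> outer_nodes n \<and> card e = 2 \<and> g \<in> carrier G) \<and>
         (\<forall>v\<in>outer_nodes n. \<exists>!eg. eg \<in> D \<and> v \<in> fst eg)}"

definition id_diagram :: "('g, 'e) monoid_scheme \<Rightarrow> nat \<Rightarrow> 'g diagram" where
  "id_diagram G n = (\<lambda>i. ({(Lft, i), (Rgt, i)}, \<one>\<^bsub>G\<^esub>)) ` {1..n}"

text \<open>
  For the product of \<open>D\<close> and \<open>E\<close>, the right column of \<open>D\<close> and the left column of \<open>E\<close> are both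
  moved to the middle. A connected component of the resulting graph is either a path, whose
  end points are its two outer nodes, or a closed loop of middle nodes. Its label is the
  product of the labels of all its edges, for which no order or direction is needed as \<open>G\<close> is
  abelian. The edges from \<open>D\<close> and from \<open>E\<close> are multiplied
  separately, since they may coincide as labelled edges.
\<close>

definition move :: "(column \<Rightarrow> column) \<Rightarrow> 'g diagram \<Rightarrow> 'g diagram" where
  "move c D = (\<lambda>(e, g). (map_prod c id ` e, g)) ` D"

definition first_half :: "'g diagram \<Rightarrow> 'g diagram" where
  "first_half D = move (id(Rgt := Mid)) D"

definition second_half :: "'g diagram \<Rightarrow> 'g diagram" where
  "second_half E = move (id(Lft := Mid)) E"

definition joined :: "'g diagram \<Rightarrow> 'g diagram \<Rightarrow> (node \<times> node) set" where
  "joined D E = {(u, v). \<exists>(e, g)\<in>first_half D \<union> second_half E. u \<in> e \<and> v \<in> e}"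

definition components :: "nat \<Rightarrow> 'g diagram \<Rightarrow> 'g diagram \<Rightarrow> node set set" where
  "components n D E = (\<lambda>v. (joined D E)\<^sup>* `` {v}) ` ({Lft, Mid, Rgt} \<times> {1..n})"

definition component_label ::
  "('g, 'e) monoid_scheme \<Rightarrow> 'g diagram \<Rightarrow> 'g diagram \<Rightarrow> node set \<Rightarrow> 'g" where
  "component_label G D E C =
     (\<Otimes>\<^bsub>G\<^esub>eg\<in>{eg \<in> first_half D. fst eg \<subseteq> C}. snd eg) \<otimes>\<^bsub>G\<^esub>
     (\<Otimes>\<^bsub>G\<^esub>eg\<in>{eg \<in> second_half E. fst eg \<subseteq> C}. snd eg)"

definition diagram_comp ::
  "('g, 'e) monoid_scheme \<Rightarrow> nat \<Rightarrow> 'g diagram \<Rightarrow> 'g diagram \<Rightarrow> 'g diagram" where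
  "diagram_comp G n D E =
     (\<lambda>C. (C \<inter> outer_nodes n, component_label G D E C)) `
       {C \<in> components n D E. C \<inter> outer_nodes n \<noteq> {}}"

definition loop_factor ::
  "('g, 'e) monoid_scheme \<Rightarrow> ('k, 'f) ring_scheme \<Rightarrow> ('g \<Rightarrow> 'k \<Rightarrow> 'k) \<Rightarrow> nat \<Rightarrow> 'k
    \<Rightarrow> 'g diagram \<Rightarrow> 'g diagram \<Rightarrow> 'k" where
  "loop_factor G k act n \<delta> D E =
     (\<Otimes>\<^bsub>k\<^esub>C\<in>{C \<in> components n D E. C \<inter> outer_nodes n = {}}. act (component_label G D E C) \<delta>)"

definition brauer_algebra ::
  "('g, 'e) monoid_scheme \<Rightarrow> ('k, 'f) ring_scheme \<Rightarrow> ('g \<Rightarrow> 'k \<Rightarrow> 'k) \<Rightarrow> nat \<Rightarrow> 'k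
    \<Rightarrow> ('k, 'g diagram \<Rightarrow> 'k) module" where
  "brauer_algebra G k act n \<delta> =
     based_algebra k (brauer_diagrams G n)
       (\<lambda>D E. loop_factor G k act n \<delta> D E \<odot>\<^bsub>free_module k (brauer_diagrams G n)\<^esub>
               basis_vec k (diagram_comp G n D E))
       (id_diagram G n)"

definition no_turns :: "'g diagram \<Rightarrow> bool" where
  "no_turns D \<longleftrightarrow> (\<forall>(e, g)\<in>D. \<not> fst ` e \<subseteq> {Lft} \<and> \<not> fst ` e \<subseteq> {Rgt})"

definition brauer_trivial_module :: "('k, 'f) ring_scheme \<Rightarrow> ('g diagram \<Rightarrow> 'k, 'k) module" where
  "brauer_trivial_module k = scalar_module k no_turns"

end

theory Submission
  imports Defs
begin

text \<open>
  Composing with a diagram from the left never removes a right-hand turn (an edge joining two nodes of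
  the right column), and the diagrams without such turns are exactly the elements of
  \<open>G\<^sup>n \<rtimes> \<Sigma>\<^sub>n\<close>. If \<open>S\<close> is the set of right-hand turns of a diagram, let \<open>w\<close> consist of \<open>S\<close>, of the
  mirror image of \<open>S\<close> in the left column with inverse labels, and of horizontal edges. Then
  \<open>y w = \<delta>\<^bsup>|S|\<^esup> y\<close> for every diagram \<open>y\<close> that contains \<open>S\<close>, since every turn of \<open>S\<close> closes up to a loop
  with trivial label. As \<open>\<delta>\<close> is invertible, the left ideal spanned by the diagrams containing \<open>S\<close> is
  therefore generated by an idempotent. Let \<open>I\<close> be the ideal spanned by all diagrams with turns and \<open>P\<close> a
  free resolution of the right module \<open>\<one>\<close>. By descending induction on the number of turns, the
  idempotents show that the subcomplex \<open>P I\<close> is exact. Hence \<open>P / P I\<close> is a free resolution of \<open>\<one>\<close> over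
  the quotient by \<open>I\<close>, which is the group algebra, and it yields the same complex as \<open>P\<close> after tensoring
  with \<open>\<one>\<close>. Group homology appears by taking the bar resolution over the group algebra.
\<close>

section \<open>Modules and quotients\<close>

text \<open>For a left ideal \<open>L\<close> the complex \<open>P L\<close> computes Tor of
  \<open>\<one>\<close> with \<open>L\<close>. If \<open>L\<close> is generated by an idempotent it
  is projective, so this Tor sits in degree 0, where it is zero if all diagrams in \<open>L\<close>
  have turns. The obstacle is that \<open>I\<close> is only a sum of such left ideals, one for each
  nonempty turn set, and the sum is not direct: the ideals of \<open>S\<close> and \<open>T\<close>
  meet in that of their union. Hence all left ideals spanned by families closed under enlarging the
  turn set are treated at once. In a cycle, the part with one fixed turn set \<open>S\<close> of
  minimal size has its boundary in the ideal of strictly larger turn sets, which is exact by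
  induction; so it can be completed to a cycle over the single ideal of \<open>S\<close>, where the
  idempotent applies. This uses only a monoid with a scalar cocycle and a set-valued function that
  grows under left multiplication; diagrams enter to verify these axioms. There the difficulty is
  associativity including the loop factors, settled by comparing both bracketings with one graph on
  four columns. Tensoring a free module with \<open>\<one>\<close> is reduced to applying the
  augmentation to coefficients.\<close>

lemma lin_maps_closed: "f \<in> lin_maps R M N \<Longrightarrow> x \<in> carrier M \<Longrightarrow> f x \<in> carrier N"
  by (auto simp: lin_maps_def)

lemma lin_maps_add:
  "f \<in> lin_maps R M N \<Longrightarrow> x \<in> carrier M \<Longrightarrow> y \<in> carrier M \<Longrightarrow> f (x \<oplus>\<^bsub>M\<^esub> y) = f x \<oplus>\<^bsub>N\<^esub> f y"
  by (auto simp: lin_maps_def)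

lemma lin_maps_smult:
  "f \<in> lin_maps R M N \<Longrightarrow> a \<in> carrier R \<Longrightarrow> x \<in> carrier M \<Longrightarrow> f (a \<odot>\<^bsub>M\<^esub> x) = a \<odot>\<^bsub>N\<^esub> f x"
  by (auto simp: lin_maps_def)

lemma lin_mapsI:
  assumes "\<And>x. x \<in> carrier M \<Longrightarrow> f x \<in> carrier N"
    "\<And>x y. x \<in> carrier M \<Longrightarrow> y \<in> carrier M \<Longrightarrow> f (x \<oplus>\<^bsub>M\<^esub> y) = f x \<oplus>\<^bsub>N\<^esub> f y"
    "\<And>a x. a \<in> carrier R \<Longrightarrow> x \<in> carrier M \<Longrightarrow> f (a \<odot>\<^bsub>M\<^esub> x) = a \<odot>\<^bsub>N\<^esub> f x"
  shows "f \<in> lin_maps R M N"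
  unfolding lin_maps_def using assms by blast

lemma lin_maps_comp:
  assumes "f \<in> lin_maps R M N" "g \<in> lin_maps R N L"
  shows "(\<lambda>x. g (f x)) \<in> lin_maps R M L"
  using assms by (intro lin_mapsI) (auto simp: lin_maps_add lin_maps_smult lin_maps_closed)

lemma lin_maps_id: "(\<lambda>x. x) \<in> lin_maps R M M"
  by (intro lin_mapsI) auto

lemma lin_maps_zero:
  assumes "left_module R M" "left_module R N" "f \<in> lin_maps R M N"
  shows "f \<zero>\<^bsub>M\<^esub> = \<zero>\<^bsub>N\<^esub>"
proof -
  interpret M: left_module R M by fact
  interpret N: left_module R N by fact
  have "f (\<zero>\<^bsub>R\<^esub> \<odot>\<^bsub>M\<^esub> \<zero>\<^bsub>M\<^esub>) = \<zero>\<^bsub>R\<^esub> \<odot>\<^bsub>N\<^esub> f \<zero>\<^bsub>M\<^esub>"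
    using assms(3) by (rule lin_maps_smult) auto
  then show ?thesis
    using M.smult_l_null[of "\<zero>\<^bsub>M\<^esub>"] N.smult_l_null[of "f \<zero>\<^bsub>M\<^esub>"] lin_maps_closed[OF assms(3)] by simp
qed

lemma lin_maps_a_inv:
  assumes "left_module R M" "left_module R N" "f \<in> lin_maps R M N" "x \<in> carrier M"
  shows "f (\<ominus>\<^bsub>M\<^esub> x) = \<ominus>\<^bsub>N\<^esub> f x"
proof -
  interpret M: left_module R M by fact
  interpret N: left_module R N by fact
  have "f (\<ominus>\<^bsub>M\<^esub> x) \<oplus>\<^bsub>N\<^esub> f x = \<zero>\<^bsub>N\<^esub>"
    using lin_maps_add[OF assms(3), of "\<ominus>\<^bsub>M\<^esub> x" x] lin_maps_zero[OF assms(1-3)] assms(4)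
    by (simp add: M.M.l_neg)
  then show ?thesis
    using assms lin_maps_closed[OF assms(3)] by (metis M.M.a_inv_closed N.M.minus_equality)
qed

lemma lin_maps_diff:
  assumes "left_module R M" "left_module R N" "f \<in> lin_maps R M N" "x \<in> carrier M" "y \<in> carrier M"
  shows "f (x \<ominus>\<^bsub>M\<^esub> y) = f x \<ominus>\<^bsub>N\<^esub> f y"
proof -
  interpret M: left_module R M by fact
  show ?thesis using assms by (simp add: a_minus_def lin_maps_add lin_maps_a_inv)
qed

context left_module
begin

lemma smult_minus_one: "x \<in> carrier M \<Longrightarrow> (\<ominus>\<^bsub>R\<^esub> \<one>\<^bsub>R\<^esub>) \<odot>\<^bsub>M\<^esub> x = \<ominus>\<^bsub>M\<^esub> x"
  using smult_l_distr[of "\<ominus>\<^bsub>R\<^esub> \<one>\<^bsub>R\<^esub>" "\<one>\<^bsub>R\<^esub>" x]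
  by (simp add: R.l_neg smult_l_null smult_one) (metis M.minus_equality R.a_inv_closed R.one_closed smult_closed)

lemma smult_r_minus:
  "a \<in> carrier R \<Longrightarrow> x \<in> carrier M \<Longrightarrow> a \<odot>\<^bsub>M\<^esub> (\<ominus>\<^bsub>M\<^esub> x) = \<ominus>\<^bsub>M\<^esub> (a \<odot>\<^bsub>M\<^esub> x)"
  using smult_r_distr[of a "\<ominus>\<^bsub>M\<^esub> x" x]
  by (simp add: M.l_neg smult_r_null) (metis M.a_inv_closed M.minus_equality smult_closed)

lemma smult_diff:
  "a \<in> carrier R \<Longrightarrow> x \<in> carrier M \<Longrightarrow> y \<in> carrier M \<Longrightarrow>
    a \<odot>\<^bsub>M\<^esub> (x \<ominus>\<^bsub>M\<^esub> y) = a \<odot>\<^bsub>M\<^esub> x \<ominus>\<^bsub>M\<^esub> a \<odot>\<^bsub>M\<^esub> y"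
  by (simp add: a_minus_def smult_r_distr smult_r_minus)

lemma add_diff_cancel:
  "x \<in> carrier M \<Longrightarrow> y \<in> carrier M \<Longrightarrow> (x \<oplus>\<^bsub>M\<^esub> y) \<ominus>\<^bsub>M\<^esub> y = x"
  by (simp add: a_minus_def M.a_assoc M.r_neg)

lemma diff_add_cancel:
  "x \<in> carrier M \<Longrightarrow> y \<in> carrier M \<Longrightarrow> (x \<ominus>\<^bsub>M\<^esub> y) \<oplus>\<^bsub>M\<^esub> y = x"
  by (simp add: a_minus_def M.a_assoc M.l_neg)

lemma lin_maps_plus:
  assumes "left_module R N" "f \<in> lin_maps R N M" "g \<in> lin_maps R N M"
  shows "(\<lambda>x. f x \<oplus>\<^bsub>M\<^esub> g x) \<in> lin_maps R N M"
proof -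
  interpret N: left_module R N by fact
  show ?thesis using assms
    by (intro lin_mapsI)
      (auto simp: lin_maps_add lin_maps_smult lin_maps_closed smult_r_distr M.a_ac)
qed

lemma lin_maps_minus:
  assumes "left_module R N" "f \<in> lin_maps R N M" "g \<in> lin_maps R N M"
  shows "(\<lambda>x. f x \<ominus>\<^bsub>M\<^esub> g x) \<in> lin_maps R N M"
proof -
  interpret N: left_module R N by fact
  show ?thesis using assms
    by (intro lin_mapsI)
      (auto simp: lin_maps_add lin_maps_smult lin_maps_closed smult_diff M.a_ac a_minus_def
         M.minus_add smult_r_distr smult_r_minus)
qed

text \<open>Closure under negatives comes for free, since a negative is the multiple by minus
  one.\<close>

lemma restrict_carrier:
  assumes "Z \<subseteq> carrier M" "\<zero>\<^bsub>M\<^esub> \<in> Z" "\<And>x y. x \<in> Z \<Longrightarrow> y \<in> Z \<Longrightarrow> x \<oplus>\<^bsub>M\<^esub> y \<in> Z"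
    "\<And>a x. a \<in> carrier R \<Longrightarrow> x \<in> Z \<Longrightarrow> a \<odot>\<^bsub>M\<^esub> x \<in> Z"
  shows "left_module R (M\<lparr>carrier := Z\<rparr>)"
proof -
  have Z: "x \<in> carrier M" if "x \<in> Z" for x using assms(1) that by auto
  have "\<exists>y\<in>Z. y \<oplus>\<^bsub>M\<^esub> x = \<zero>\<^bsub>M\<^esub>" if "x \<in> Z" for x
    using assms(4)[of "\<ominus>\<^bsub>R\<^esub> \<one>\<^bsub>R\<^esub>" x] that Z[OF that]
    by (intro bexI[of _ "\<ominus>\<^bsub>M\<^esub> x"]) (simp_all add: smult_minus_one M.l_neg)
  then have "abelian_group (M\<lparr>carrier := Z\<rparr>)"
    by (intro abelian_groupI) (auto simp: assms Z M.a_ac)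
  moreover have "left_module_axioms R (M\<lparr>carrier := Z\<rparr>)"
    by (intro left_module_axioms.intro) (auto simp: assms Z smult_l_distr smult_r_distr smult_assoc smult_one)
  ultimately show ?thesis by (intro left_module.intro R.ring_axioms)
qed

end

section \<open>Quotients of a module by a submodule\<close>

locale quotient_module = left_module +
  fixes H
  assumes H_sub: "H \<subseteq> carrier M" and H_zero: "\<zero>\<^bsub>M\<^esub> \<in> H"
    and H_add: "\<And>x y. x \<in> H \<Longrightarrow> y \<in> H \<Longrightarrow> x \<oplus>\<^bsub>M\<^esub> y \<in> H"
    and H_smult: "\<And>a x. a \<in> carrier R \<Longrightarrow> x \<in> H \<Longrightarrow> a \<odot>\<^bsub>M\<^esub> x \<in> H"
begin

lemma H_minus: "x \<in> H \<Longrightarrow> \<ominus>\<^bsub>M\<^esub> x \<in> H"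
  using H_smult[of "\<ominus>\<^bsub>R\<^esub> \<one>\<^bsub>R\<^esub>" x] H_sub by (auto simp: smult_minus_one)

lemma H_abelian_subgroup: "abelian_subgroup H M"
proof (rule abelian_subgroupI3)
  show "additive_subgroup H M"
    unfolding additive_subgroup_def using H_sub H_zero H_add H_minus
    by (intro M.a_group [THEN group.subgroupI]) (auto simp: a_inv_def[symmetric])
qed (rule M.abelian_group_axioms)

lemma mem_coset:
  assumes "x \<in> carrier M"
  shows "y \<in> H +>\<^bsub>M\<^esub> x \<longleftrightarrow> y \<in> carrier M \<and> y \<ominus>\<^bsub>M\<^esub> x \<in> H"
proof
  assume "y \<in> H +>\<^bsub>M\<^esub> x"
  then obtain h where "h \<in> H" "y = h \<oplus>\<^bsub>M\<^esub> x" by (auto simp: a_r_coset_def')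
  then show "y \<in> carrier M \<and> y \<ominus>\<^bsub>M\<^esub> x \<in> H"
    using assms H_sub by (auto simp: add_diff_cancel)
next
  assume "y \<in> carrier M \<and> y \<ominus>\<^bsub>M\<^esub> x \<in> H"
  then show "y \<in> H +>\<^bsub>M\<^esub> x"
    using assms by (auto simp: a_r_coset_def' intro!: bexI[of _ "y \<ominus>\<^bsub>M\<^esub> x"] simp: diff_add_cancel)
qed

lemma self_mem_coset: "x \<in> carrier M \<Longrightarrow> x \<in> H +>\<^bsub>M\<^esub> x"
  using H_zero by (simp add: mem_coset a_minus_def M.r_neg)

lemma coset_eq_iff:
  assumes "x \<in> carrier M" "y \<in> carrier M"
  shows "H +>\<^bsub>M\<^esub> x = H +>\<^bsub>M\<^esub> y \<longleftrightarrow> x \<ominus>\<^bsub>M\<^esub> y \<in> H"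
proof
  assume "H +>\<^bsub>M\<^esub> x = H +>\<^bsub>M\<^esub> y"
  then show "x \<ominus>\<^bsub>M\<^esub> y \<in> H" using self_mem_coset[OF assms(1)] mem_coset[OF assms(2)] by auto
next
  assume *: "x \<ominus>\<^bsub>M\<^esub> y \<in> H"
  have "z \<ominus>\<^bsub>M\<^esub> y = (z \<ominus>\<^bsub>M\<^esub> x) \<oplus>\<^bsub>M\<^esub> (x \<ominus>\<^bsub>M\<^esub> y)" if "z \<in> carrier M" for z
  proof -
    have "(z \<ominus>\<^bsub>M\<^esub> x) \<oplus>\<^bsub>M\<^esub> (x \<ominus>\<^bsub>M\<^esub> y) = ((z \<ominus>\<^bsub>M\<^esub> x) \<oplus>\<^bsub>M\<^esub> x) \<ominus>\<^bsub>M\<^esub> y"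
      using assms that by (simp add: a_minus_def M.a_assoc)
    then show ?thesis using assms that by (simp add: diff_add_cancel)
  qed
  moreover have "z \<ominus>\<^bsub>M\<^esub> x = (z \<ominus>\<^bsub>M\<^esub> y) \<ominus>\<^bsub>M\<^esub> (x \<ominus>\<^bsub>M\<^esub> y)" if "z \<in> carrier M" for z
    using calculation[OF that] assms that by (simp add: add_diff_cancel)
  ultimately have "z \<ominus>\<^bsub>M\<^esub> x \<in> H \<longleftrightarrow> z \<ominus>\<^bsub>M\<^esub> y \<in> H" if "z \<in> carrier M" for z
    using that * H_add H_minus by (metis a_minus_def)
  then show "H +>\<^bsub>M\<^esub> x = H +>\<^bsub>M\<^esub> y" using mem_coset assms by blast
qed

lemma quot_carrier: "carrier (quot_module M H) = (\<lambda>x. H +>\<^bsub>M\<^esub> x) ` carrier M"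
  by (auto simp: quot_module_def A_RCOSETS_def')

lemma quot_zero: "\<zero>\<^bsub>quot_module M H\<^esub> = H +>\<^bsub>M\<^esub> \<zero>\<^bsub>M\<^esub>"
  using H_sub by (auto simp: quot_module_def mem_coset a_minus_def)

lemma quot_add:
  assumes "x \<in> carrier M" "y \<in> carrier M"
  shows "(H +>\<^bsub>M\<^esub> x) \<oplus>\<^bsub>quot_module M H\<^esub> (H +>\<^bsub>M\<^esub> y) = H +>\<^bsub>M\<^esub> (x \<oplus>\<^bsub>M\<^esub> y)"
proof -
  have "S \<oplus>\<^bsub>quot_module M H\<^esub> T = S <+>\<^bsub>M\<^esub> T" for S T by (simp add: quot_module_def)
  then show ?thesis using abelian_subgroup.a_rcos_sum[OF H_abelian_subgroup assms] by (rule trans)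
qed

text \<open>Both \<open>quot_module\<close> and \<open>tensor_map\<close> define a map on cosets as
  the union of its values at all representatives. When these values agree, the union collapses to
  any one of them.\<close>

lemma coset_Union:
  assumes "x \<in> carrier M" "\<And>y. y \<in> carrier M \<Longrightarrow> y \<ominus>\<^bsub>M\<^esub> x \<in> H \<Longrightarrow> F y = F x"
  shows "(\<Union>y\<in>H +>\<^bsub>M\<^esub> x. F y) = F x"
proof -
  have "F y = F x" if "y \<in> H +>\<^bsub>M\<^esub> x" for y using that mem_coset[OF assms(1)] assms(2) by blast
  then show ?thesis using self_mem_coset[OF assms(1)] by blast
qed

lemma quot_smult:
  assumes "a \<in> carrier R" "x \<in> carrier M"
  shows "a \<odot>\<^bsub>quot_module M H\<^esub> (H +>\<^bsub>M\<^esub> x) = H +>\<^bsub>M\<^esub> (a \<odot>\<^bsub>M\<^esub> x)"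
proof -
  have "(\<Union>y\<in>H +>\<^bsub>M\<^esub> x. H +>\<^bsub>M\<^esub> (a \<odot>\<^bsub>M\<^esub> y)) = H +>\<^bsub>M\<^esub> (a \<odot>\<^bsub>M\<^esub> x)"
  proof (rule coset_Union[OF assms(2)])
    fix y assume y: "y \<in> carrier M" "y \<ominus>\<^bsub>M\<^esub> x \<in> H"
    have "a \<odot>\<^bsub>M\<^esub> y \<ominus>\<^bsub>M\<^esub> a \<odot>\<^bsub>M\<^esub> x \<in> H"
      using H_smult[OF assms(1) y(2)] smult_diff[OF assms(1) y(1) assms(2)] by simp
    then show "H +>\<^bsub>M\<^esub> (a \<odot>\<^bsub>M\<^esub> y) = H +>\<^bsub>M\<^esub> (a \<odot>\<^bsub>M\<^esub> x)"
      using coset_eq_iff[OF smult_closed[OF assms(1) y(1)] smult_closed[OF assms]] by blast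
  qed
  then show ?thesis by (simp add: quot_module_def)
qed

lemma quot_left_module: "left_module R (quot_module M H)"
proof -
  let ?Q = "quot_module M H"
  have "abelian_group ?Q"
  proof (rule abelian_groupI, unfold quot_carrier)
    show "\<exists>y\<in>(+>\<^bsub>M\<^esub>) H ` carrier M. y \<oplus>\<^bsub>?Q\<^esub> x = \<zero>\<^bsub>?Q\<^esub>" if "x \<in> (+>\<^bsub>M\<^esub>) H ` carrier M" for x
    proof -
      from that obtain x' where x': "x = H +>\<^bsub>M\<^esub> x'" "x' \<in> carrier M" by auto
      show ?thesis
        by (rule bexI[of _ "H +>\<^bsub>M\<^esub> (\<ominus>\<^bsub>M\<^esub> x')"]) (use x' in \<open>simp_all add: quot_add M.l_neg quot_zero\<close>)
    qed
  qed (auto simp: quot_add quot_zero M.a_ac)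
  moreover have "left_module_axioms R ?Q"
    by (rule left_module_axioms.intro, unfold quot_carrier)
      (auto simp: quot_add quot_smult smult_l_distr smult_r_distr smult_assoc smult_one)
  ultimately show ?thesis by (intro left_module.intro R.ring_axioms)
qed

text \<open>The first isomorphism theorem on representatives: on cosets \<open>sub\<close> makes the
  map well defined, \<open>inj\<close> makes it injective and \<open>surj\<close> makes it onto,
  although \<open>f\<close> itself may be neither.\<close>

lemma quot_iso:
  assumes "quotient_module R N K" and f: "f \<in> lin_maps R M N"
    and sub: "\<And>x. x \<in> H \<Longrightarrow> f x \<in> K"
    and inj: "\<And>x. x \<in> carrier M \<Longrightarrow> f x \<in> K \<Longrightarrow> x \<in> H"
    and surj: "\<And>y. y \<in> carrier N \<Longrightarrow> \<exists>x\<in>carrier M. y \<ominus>\<^bsub>N\<^esub> f x \<in> K"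
  shows "module_iso R (quot_module M H) (quot_module N K)"
proof -
  interpret N: quotient_module R N K by fact
  have N: "left_module R N" and M: "left_module R M" by unfold_locales
  note cl = lin_maps_closed[OF f]
  define F where "F = (\<lambda>S. \<Union>x\<in>S. K +>\<^bsub>N\<^esub> f x)"
  have F: "F (H +>\<^bsub>M\<^esub> x) = K +>\<^bsub>N\<^esub> f x" if "x \<in> carrier M" for x
    unfolding F_def using that
    by (intro coset_Union) (simp_all add: N.coset_eq_iff cl lin_maps_diff[OF M N f, symmetric] sub)
  have "F \<in> lin_maps R (quot_module M H) (quot_module N K)"
    by (rule lin_mapsI, unfold quot_carrier N.quot_carrier)
      (auto simp: quot_add quot_smult N.quot_add N.quot_smult F cl lin_maps_add[OF f] lin_maps_smult[OF f])
  moreover have "inj_on F (carrier (quot_module M H))"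
  proof (rule inj_onI, unfold quot_carrier, elim imageE)
    fix S T x y assume *: "F S = F T" "S = H +>\<^bsub>M\<^esub> x" "T = H +>\<^bsub>M\<^esub> y" "x \<in> carrier M" "y \<in> carrier M"
    then have "f (x \<ominus>\<^bsub>M\<^esub> y) \<in> K"
      by (simp add: F N.coset_eq_iff cl lin_maps_diff[OF M N f])
    then show "S = T" using * inj[of "x \<ominus>\<^bsub>M\<^esub> y"] by (simp add: coset_eq_iff)
  qed
  moreover have "F ` carrier (quot_module M H) = carrier (quot_module N K)"
  proof -
    have "K +>\<^bsub>N\<^esub> y \<in> F ` (+>\<^bsub>M\<^esub>) H ` carrier M" if y: "y \<in> carrier N" for y
    proof -
      obtain x where "x \<in> carrier M" "y \<ominus>\<^bsub>N\<^esub> f x \<in> K" using surj[OF y] by auto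
      then have "K +>\<^bsub>N\<^esub> y = F (H +>\<^bsub>M\<^esub> x)" using y by (simp add: F N.coset_eq_iff cl)
      then show ?thesis using \<open>x \<in> carrier M\<close> by blast
    qed
    then show ?thesis unfolding quot_carrier N.quot_carrier using F cl by auto
  qed
  ultimately show ?thesis unfolding module_iso_def bij_betw_def by blast
qed

end

lemma module_iso_trans:
  assumes "module_iso R M N" "module_iso R N L" shows "module_iso R M L"
proof -
  obtain f g where "f \<in> lin_maps R M N" "bij_betw f (carrier M) (carrier N)"
    "g \<in> lin_maps R N L" "bij_betw g (carrier N) (carrier L)"
    using assms unfolding module_iso_def by blast
  then have "(\<lambda>x. g (f x)) \<in> lin_maps R M L" "bij_betw (\<lambda>x. g (f x)) (carrier M) (carrier L)"
    by (auto intro: lin_maps_comp bij_betw_trans[unfolded comp_def])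
  then show ?thesis unfolding module_iso_def by blast
qed

lemma module_iso_sym:
  assumes "left_module R M" "module_iso R M N" shows "module_iso R N M"
proof -
  interpret M: left_module R M by fact
  obtain f where f: "f \<in> lin_maps R M N" "bij_betw f (carrier M) (carrier N)"
    using assms(2) unfolding module_iso_def by blast
  let ?g = "inv_into (carrier M) f"
  have g: "bij_betw ?g (carrier N) (carrier M)" by (rule bij_betw_inv_into[OF f(2)])
  have gf: "?g (f x) = x" if "x \<in> carrier M" for x
    using f(2) that by (simp add: bij_betw_def inv_into_f_f)
  have im: "carrier N = f ` carrier M" using f(2) by (simp add: bij_betw_def)
  have "?g \<in> lin_maps R N M"
    by (rule lin_mapsI, unfold im)
      (auto simp: gf lin_maps_add[OF f(1), symmetric] lin_maps_smult[OF f(1), symmetric])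
  then show ?thesis using g unfolding module_iso_def by blast
qed

section \<open>Chain complexes\<close>

definition chain_complex ::
  "('k, 'e) ring_scheme \<Rightarrow> (nat \<Rightarrow> ('k, 'c) module) \<Rightarrow> (nat \<Rightarrow> 'c \<Rightarrow> 'c) \<Rightarrow> bool" where
  "chain_complex k C d \<longleftrightarrow> (\<forall>p. left_module k (C p)) \<and> (\<forall>p. d p \<in> lin_maps k (C (Suc p)) (C p)) \<and>
     (\<forall>p. \<forall>x\<in>carrier (C (Suc (Suc p))). d p (d (Suc p) x) = \<zero>\<^bsub>C p\<^esub>)"

lemma cycles_sub: "cycles C d p \<subseteq> carrier (C p)"
  by (auto simp: cycles_def split: nat.splits)

lemma homology_quotient_module:
  assumes "chain_complex k C d"
  shows "quotient_module k ((C p)\<lparr>carrier := cycles C d p\<rparr>) (d p ` carrier (C (Suc p)))"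
proof -
  have lm: "left_module k (C q)" and d: "d q \<in> lin_maps k (C (Suc q)) (C q)" for q
    using assms by (auto simp: chain_complex_def)
  have dd: "d q (d (Suc q) x) = \<zero>\<^bsub>C q\<^esub>" if "x \<in> carrier (C (Suc (Suc q)))" for q x
    using assms that by (auto simp: chain_complex_def)
  note dz = lin_maps_zero[OF lm lm d]
  interpret C: left_module k "C q" for q by (rule lm)
  have "left_module k ((C p)\<lparr>carrier := cycles C d p\<rparr>)"
    by (rule C.restrict_carrier)
      (auto simp: cycles_def dz lin_maps_add[OF d] lin_maps_smult[OF d] C.smult_r_null
        intro: C.smult_closed split: nat.splits)
  moreover have "d p ` carrier (C (Suc p)) \<subseteq> cycles C d p"
    using lin_maps_closed[OF d] dd by (cases p) (auto simp: cycles_def)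
  moreover have "\<zero>\<^bsub>C p\<^esub> \<in> d p ` carrier (C (Suc p))"
    using dz[of p] C.zero_closed by (metis imageI)
  moreover have "x \<oplus>\<^bsub>C p\<^esub> y \<in> d p ` carrier (C (Suc p))"
    if "x \<in> d p ` carrier (C (Suc p))" "y \<in> d p ` carrier (C (Suc p))" for x y
  proof -
    from that obtain x' y' where "x' \<in> carrier (C (Suc p))" "y' \<in> carrier (C (Suc p))" "x = d p x'" "y = d p y'"
      by blast
    then show ?thesis by (intro image_eqI[of _ _ "x' \<oplus>\<^bsub>C (Suc p)\<^esub> y'"]) (simp_all add: lin_maps_add[OF d])
  qed
  moreover have "a \<odot>\<^bsub>C p\<^esub> x \<in> d p ` carrier (C (Suc p))"
    if "a \<in> carrier k" "x \<in> d p ` carrier (C (Suc p))" for a x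
  proof -
    from that(2) obtain x' where "x' \<in> carrier (C (Suc p))" "x = d p x'" by blast
    then show ?thesis using that(1)
      by (intro image_eqI[of _ _ "a \<odot>\<^bsub>C (Suc p)\<^esub> x'"]) (simp_all add: lin_maps_smult[OF d])
  qed
  ultimately show ?thesis
    by (intro quotient_module.intro quotient_module_axioms.intro) simp_all
qed

lemma homology_left_module: "chain_complex k C d \<Longrightarrow> left_module k (homology C d p)"
  unfolding homology_def by (rule quotient_module.quot_left_module[OF homology_quotient_module])

text \<open>The two conditions in degree \<open>p\<close> have the form in which a chain homotopy
  delivers them: a cycle of the target is reached up to the boundary \<open>d' p w\<close>.\<close>

lemma homology_iso:
  assumes C: "chain_complex k C d" and D: "chain_complex k D d'"
    and u: "\<And>p. u p \<in> lin_maps k (C p) (D p)"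
    and comm: "\<And>p x. x \<in> carrier (C (Suc p)) \<Longrightarrow> d' p (u (Suc p) x) = u p (d p x)"
    and inj: "\<And>x. x \<in> cycles C d p \<Longrightarrow> u p x \<in> d' p ` carrier (D (Suc p)) \<Longrightarrow>
       x \<in> d p ` carrier (C (Suc p))"
    and surj: "\<And>y. y \<in> cycles D d' p \<Longrightarrow>
       \<exists>x\<in>cycles C d p. \<exists>w\<in>carrier (D (Suc p)). y = u p x \<oplus>\<^bsub>D p\<^esub> d' p w"
  shows "module_iso k (homology C d p) (homology D d' p)"
proof -
  interpret C: quotient_module k "(C p)\<lparr>carrier := cycles C d p\<rparr>" "d p ` carrier (C (Suc p))"
    by (rule homology_quotient_module[OF C])
  interpret D: quotient_module k "(D p)\<lparr>carrier := cycles D d' p\<rparr>" "d' p ` carrier (D (Suc p))"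
    by (rule homology_quotient_module[OF D])
  have lm: "left_module k (C q)" "left_module k (D q)" "d' q \<in> lin_maps k (D (Suc q)) (D q)"
    "d q \<in> lin_maps k (C (Suc q)) (C q)" for q
    using C D by (auto simp: chain_complex_def)
  interpret Dp: left_module k "D p" by (rule lm)
  note uz = lin_maps_zero[OF lm(1,2) u]
  have uc: "u p x \<in> cycles D d' p" if "x \<in> cycles C d p" for x
    using that comm uz by (cases p) (auto simp: cycles_def lin_maps_closed[OF u])
  have ul: "u p \<in> lin_maps k ((C p)\<lparr>carrier := cycles C d p\<rparr>) ((D p)\<lparr>carrier := cycles D d' p\<rparr>)"
    by (rule lin_mapsI) (use uc subsetD[OF cycles_sub, of _ C d p] in
        \<open>auto simp: lin_maps_add[OF u] lin_maps_smult[OF u]\<close>)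
  show ?thesis unfolding homology_def
  proof (rule C.quot_iso[OF D.quotient_module_axioms ul])
    show "u p x \<in> d' p ` carrier (D (Suc p))" if "x \<in> d p ` carrier (C (Suc p))" for x
    proof -
      from that obtain w where w: "w \<in> carrier (C (Suc p))" "x = d p w" by blast
      show ?thesis by (rule image_eqI[of _ _ "u (Suc p) w"]) (use w comm lin_maps_closed[OF u] in simp_all)
    qed
    show "x \<in> d p ` carrier (C (Suc p))"
      if "x \<in> carrier ((C p)\<lparr>carrier := cycles C d p\<rparr>)" "u p x \<in> d' p ` carrier (D (Suc p))" for x
      using inj that by simp
    fix y assume "y \<in> carrier ((D p)\<lparr>carrier := cycles D d' p\<rparr>)"
    then have "y \<in> cycles D d' p" by simp
    then obtain x w where x: "x \<in> cycles C d p" and w: "w \<in> carrier (D (Suc p))"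
      and y: "y = u p x \<oplus>\<^bsub>D p\<^esub> d' p w" using surj by blast
    have dw: "d' p w \<in> cycles D d' p" using D.H_sub w by auto
    let ?Z = "(D p)\<lparr>carrier := cycles D d' p\<rparr>"
    have "y = d' p w \<oplus>\<^bsub>?Z\<^esub> u p x"
      using y uc[OF x] dw subsetD[OF cycles_sub, of _ D d' p] Dp.M.a_comm by simp
    then have "y \<ominus>\<^bsub>?Z\<^esub> u p x = d' p w"
      using D.add_diff_cancel[of "d' p w" "u p x"] dw uc[OF x] by simp
    then show "\<exists>x\<in>carrier ((C p)\<lparr>carrier := cycles C d p\<rparr>). y \<ominus>\<^bsub>?Z\<^esub> u p x \<in> d' p ` carrier (D (Suc p))"
      using x w by (intro bexI[of _ x]) auto
  qed
qed

section \<open>Free modules, comparison of resolutions and base change\<close>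

lemma free_moduleI:
  assumes "\<And>x. x \<in> B \<Longrightarrow> f x \<in> carrier R" "\<And>x. x \<notin> B \<Longrightarrow> f x = \<zero>\<^bsub>R\<^esub>"
    "finite S" "\<And>x. x \<notin> S \<Longrightarrow> f x = \<zero>\<^bsub>R\<^esub>"
  shows "f \<in> carrier (free_module R B)"
proof -
  have "{x. f x \<noteq> \<zero>\<^bsub>R\<^esub>} \<subseteq> S" using assms(4) by blast
  then show ?thesis using assms finite_subset by (auto simp: free_module_carrier)
qed

text \<open>Peels off one basis vector at a time. The premise that \<open>g\<close> vanishes at
  \<open>b\<close> keeps the summands readable from the sum, which has coefficient \<open>a\<close>
  at \<open>b\<close> and agrees with \<open>g\<close> elsewhere.\<close>

lemma free_module_induct [consumes 2, case_names zero step]: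
  assumes "ring R" "f \<in> carrier (free_module R B)"
    and P_zero: "P (\<lambda>_. \<zero>\<^bsub>R\<^esub>)"
    and P_step: "\<And>b a g. b \<in> B \<Longrightarrow> a \<in> carrier R \<Longrightarrow> g \<in> carrier (free_module R B) \<Longrightarrow> P g \<Longrightarrow>
       g b = \<zero>\<^bsub>R\<^esub> \<Longrightarrow> P (a \<odot>\<^bsub>free_module R B\<^esub> basis_vec R b \<oplus>\<^bsub>free_module R B\<^esub> g)"
  shows "P f"
proof -
  interpret ring R by fact
  note cl = free_module_closed[OF assms(1), of _ B]
  have main: "P f" if "finite T" "f \<in> carrier (free_module R B)" "{x. f x \<noteq> \<zero>\<^bsub>R\<^esub>} \<subseteq> T" for T f
    using that
  proof (induction T arbitrary: f rule: finite_induct)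
    case empty
    then have "f = (\<lambda>_. \<zero>\<^bsub>R\<^esub>)" by auto
    then show ?case using P_zero by simp
  next
    case (insert b T)
    show ?case
    proof (cases "f b = \<zero>\<^bsub>R\<^esub>")
      case True
      then show ?thesis using insert.prems by (intro insert.IH) auto
    next
      case False
      then have b: "b \<in> B" using insert.prems(1) by (auto simp: free_module_carrier)
      define g where "g = f(b := \<zero>\<^bsub>R\<^esub>)"
      have g: "g \<in> carrier (free_module R B)"
        by (rule free_moduleI[OF _ _ free_module_finite[OF insert.prems(1)]])
          (use insert.prems(1) in \<open>auto simp: free_module_carrier g_def\<close>)
      have "P g" using insert.prems(2) by (intro insert.IH g) (auto simp: g_def)
      moreover have "f = f b \<odot>\<^bsub>free_module R B\<^esub> basis_vec R b \<oplus>\<^bsub>free_module R B\<^esub> g"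
        using cl[OF insert.prems(1)] by (intro ext) (simp add: g_def basis_vec_def)
      moreover have "g b = \<zero>\<^bsub>R\<^esub>" by (simp add: g_def)
      ultimately show ?thesis using P_step[OF b cl[OF insert.prems(1)] g] by metis
    qed
  qed
  show ?thesis by (rule main[OF free_module_finite[OF assms(2)] assms(2) subset_refl])
qed

lemma basis_vec_in_free: "ring R \<Longrightarrow> b \<in> B \<Longrightarrow> basis_vec R b \<in> carrier (free_module R B)"
  by (rule left_module.basis_vec_closed[OF free_module_left_module])

lemma lin_maps_basis_ext:
  assumes "left_module R N" "f \<in> lin_maps R (free_module R B) N" "g \<in> lin_maps R (free_module R B) N"
    "\<And>b. b \<in> B \<Longrightarrow> f (basis_vec R b) = g (basis_vec R b)" "x \<in> carrier (free_module R B)"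
  shows "f x = g x"
proof -
  interpret N: left_module R N by fact
  have R: "ring R" by unfold_locales
  have F: "left_module R (free_module R B)" by (rule free_module_left_module[OF R])
  interpret F: left_module R "free_module R B" by (rule F)
  have z: "h (\<lambda>_. \<zero>\<^bsub>R\<^esub>) = \<zero>\<^bsub>N\<^esub>" if "h \<in> lin_maps R (free_module R B) N" for h
    using lin_maps_zero[OF F assms(1) that] by simp
  have s: "h (a \<odot>\<^bsub>free_module R B\<^esub> basis_vec R b \<oplus>\<^bsub>free_module R B\<^esub> y)
      = a \<odot>\<^bsub>N\<^esub> h (basis_vec R b) \<oplus>\<^bsub>N\<^esub> h y"
    if "h \<in> lin_maps R (free_module R B) N" "b \<in> B" "a \<in> carrier R" "y \<in> carrier (free_module R B)"
    for h a b y
    unfolding lin_maps_add[OF that(1) F.smult_closed[OF that(3) basis_vec_in_free[OF R that(2)]] that(4)]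
      lin_maps_smult[OF that(1,3) basis_vec_in_free[OF R that(2)]] ..
  show ?thesis using R assms(5)
  proof (induction rule: free_module_induct)
    case zero
    show ?case unfolding z[OF assms(2)] z[OF assms(3)] ..
  next
    case (step b a y)
    show ?case unfolding s[OF assms(2) step(1-3)] s[OF assms(3) step(1-3)] assms(4)[OF step(1)] step.IH ..
  qed
qed

text \<open>Projectivity of free modules: preimages are chosen for the basis vectors only. Asking
  \<open>h\<close> to land in the image of \<open>q\<close>, instead of \<open>q\<close> to be onto,
  makes the lemma applicable to differentials.\<close>

lemma free_module_lift:
  assumes M: "left_module R M" and N: "left_module R N" and q: "q \<in> lin_maps R M N"
    and h: "h \<in> lin_maps R (free_module R B) N"
    and im: "\<And>x. x \<in> carrier (free_module R B) \<Longrightarrow> h x \<in> q ` carrier M"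
  shows "\<exists>\<phi>\<in>lin_maps R (free_module R B) M. \<forall>x\<in>carrier (free_module R B). q (\<phi> x) = h x"
proof -
  interpret M: left_module R M by fact
  have R: "ring R" by unfold_locales
  have "\<forall>b\<in>B. \<exists>y\<in>carrier M. q y = h (basis_vec R b)"
    using im[OF basis_vec_in_free[OF R]] by (metis imageE)
  then obtain v where v: "\<And>b. b \<in> B \<Longrightarrow> v b \<in> carrier M" "\<And>b. b \<in> B \<Longrightarrow> q (v b) = h (basis_vec R b)"
    by metis
  have vB: "v \<in> B \<rightarrow> carrier M" using v by auto
  let ?\<phi> = "lin_ext R M v"
  have \<phi>: "?\<phi> \<in> lin_maps R (free_module R B) M" by (rule M.lin_ext_lin[OF vB])
  have "q (?\<phi> x) = h x" if "x \<in> carrier (free_module R B)" for x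
    by (rule lin_maps_basis_ext[OF N lin_maps_comp[OF \<phi> q] h _ that])
      (simp add: M.lin_ext_basis_vec[OF vB] v)
  then show ?thesis by (intro bexI[OF _ \<phi>] ballI)
qed

lemma free_resolutionD:
  assumes "free_resolution R M B d e"
  shows "d p \<in> lin_maps R (free_module R (B (Suc p))) (free_module R (B p))"
    "e \<in> lin_maps R (free_module R (B 0)) M"
    "e ` carrier (free_module R (B 0)) = carrier M"
    "x \<in> carrier (free_module R (B (Suc 0))) \<Longrightarrow> e (d 0 x) = \<zero>\<^bsub>M\<^esub>"
    "x \<in> carrier (free_module R (B (Suc (Suc p)))) \<Longrightarrow> d p (d (Suc p) x) = \<zero>\<^bsub>free_module R (B p)\<^esub>"
    "x \<in> carrier (free_module R (B 0)) \<Longrightarrow> e x = \<zero>\<^bsub>M\<^esub> \<Longrightarrow> x \<in> d 0 ` carrier (free_module R (B (Suc 0)))"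
    "x \<in> carrier (free_module R (B (Suc p))) \<Longrightarrow> d p x = \<zero>\<^bsub>free_module R (B p)\<^esub> \<Longrightarrow>
      x \<in> d (Suc p) ` carrier (free_module R (B (Suc (Suc p))))"
proof -
  note r = assms[unfolded free_resolution_def]
  show "d p \<in> lin_maps R (free_module R (B (Suc p))) (free_module R (B p))"
    and "e \<in> lin_maps R (free_module R (B 0)) M"
    and "e ` carrier (free_module R (B 0)) = carrier M"
    using r by (simp_all only:)
  have d0: "d 0 ` carrier (free_module R (B (Suc 0))) = {f \<in> carrier (free_module R (B 0)). e f = \<zero>\<^bsub>M\<^esub>}"
    and dp: "d (Suc p) ` carrier (free_module R (B (Suc (Suc p)))) =
       {f \<in> carrier (free_module R (B (Suc p))). d p f = \<zero>\<^bsub>free_module R (B p)\<^esub>}"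
    using r by (simp_all only:)
  show "e (d 0 x) = \<zero>\<^bsub>M\<^esub>" if "x \<in> carrier (free_module R (B (Suc 0)))"
    using imageI[OF that, of "d 0"] unfolding d0 by simp
  show "d p (d (Suc p) x) = \<zero>\<^bsub>free_module R (B p)\<^esub>" if "x \<in> carrier (free_module R (B (Suc (Suc p))))"
    using imageI[OF that, of "d (Suc p)"] unfolding dp by simp
  show "x \<in> d 0 ` carrier (free_module R (B (Suc 0)))"
    if "x \<in> carrier (free_module R (B 0))" "e x = \<zero>\<^bsub>M\<^esub>"
    unfolding d0 using that by simp
  show "x \<in> d (Suc p) ` carrier (free_module R (B (Suc (Suc p))))"
    if "x \<in> carrier (free_module R (B (Suc p)))" "d p x = \<zero>\<^bsub>free_module R (B p)\<^esub>"
    unfolding dp using that by simp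
qed

text \<open>The comparison theorem: the identity of \<open>M\<close> is lifted degree by degree,
  each step being an instance of \<open>free_module_lift\<close>.\<close>

lemma chain_map_exists:
  assumes M: "left_module R M"
    and r: "free_resolution R M B d e" and r': "free_resolution R M B' d' e'"
  shows "\<exists>u. (\<forall>p. u p \<in> lin_maps R (free_module R (B p)) (free_module R (B' p))) \<and>
    (\<forall>x\<in>carrier (free_module R (B 0)). e' (u 0 x) = e x) \<and>
    (\<forall>p. \<forall>x\<in>carrier (free_module R (B (Suc p))). d' p (u (Suc p) x) = u p (d p x))"
proof -
  define C where "C p = free_module R (B p)" for p
  define D where "D p = free_module R (B' p)" for p
  have R: "ring R" using M by (simp add: left_module_def)
  have lC: "left_module R (C p)" and lD: "left_module R (D p)" for p
    unfolding C_def D_def by (rule free_module_left_module[OF R])+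
  note rC = free_resolutionD[OF r, folded C_def] and rD = free_resolutionD[OF r', folded D_def]
  \<comment> \<open>\<open>P\<close> is what the next degree consumes: compatibility with the
    augmentations in degree 0, and later that cycles go to cycles. Exactness of the target then
    makes \<open>u (d p x)\<close> a boundary.\<close>
  define P where "P p u \<longleftrightarrow> u \<in> lin_maps R (C p) (D p) \<and> (case p of 0 \<Rightarrow> \<forall>x\<in>carrier (C 0). e' (u x) = e x
    | Suc q \<Rightarrow> \<forall>x\<in>carrier (C (Suc q)). d q x = \<zero>\<^bsub>C q\<^esub> \<longrightarrow> d' q (u x) = \<zero>\<^bsub>D q\<^esub>)" for p u
  define Q where "Q p u u' \<longleftrightarrow> (\<forall>x\<in>carrier (C (Suc p)). d' p (u' x) = u (d p x))" for p u u'
  have "\<exists>u. \<forall>p. P p (u p) \<and> Q p (u p) (u (Suc p))"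
  proof (rule dependent_nat_choice)
    have "\<exists>u\<in>lin_maps R (C 0) (D 0). \<forall>x\<in>carrier (C 0). e' (u x) = e x"
      unfolding C_def using rC(2) lin_maps_closed[OF rC(2)] rD(3)
      by (intro free_module_lift[OF lD M rD(2)]) (auto simp: C_def)
    then show "\<exists>u. P 0 u" by (auto simp: P_def)
  next
    fix u p assume u: "P p u"
    then have ul: "u \<in> lin_maps R (C p) (D p)" by (simp add: P_def)
    have "u (d p x) \<in> d' p ` carrier (D (Suc p))" if "x \<in> carrier (C (Suc p))" for x
    proof (cases p)
      case 0
      then show ?thesis using u that rC(4) lin_maps_closed[OF rC(1)] lin_maps_closed[OF ul]
        by (auto simp: P_def intro!: rD(6))
    next
      case (Suc q)
      then show ?thesis using u that rC(5) lin_maps_closed[OF rC(1)] lin_maps_closed[OF ul]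
        by (auto simp: P_def intro!: rD(7))
    qed
    then have "\<exists>u'\<in>lin_maps R (C (Suc p)) (D (Suc p)). \<forall>x\<in>carrier (C (Suc p)). d' p (u' x) = u (d p x)"
      using lin_maps_comp[OF rC(1) ul] unfolding C_def
      by (intro free_module_lift[OF lD lD rD(1)]) (auto simp: C_def)
    then obtain u' where "u' \<in> lin_maps R (C (Suc p)) (D (Suc p))" "Q p u u'" unfolding Q_def by blast
    moreover from this have "P (Suc p) u'"
      using lin_maps_zero[OF lC lD ul] by (simp add: P_def Q_def)
    ultimately show "\<exists>u'. P (Suc p) u' \<and> Q p u u'" by blast
  qed
  then obtain u where u: "\<And>p. P p (u p)" "\<And>p. Q p (u p) (u (Suc p))" by blast
  then have "\<forall>p. u p \<in> lin_maps R (C p) (D p)" "\<forall>x\<in>carrier (C 0). e' (u 0 x) = e x"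
    "\<forall>p. \<forall>x\<in>carrier (C (Suc p)). d' p (u (Suc p) x) = u p (d p x)"
    using u(1)[of 0] by (auto simp: P_def Q_def)
  then show ?thesis unfolding C_def D_def by blast
qed

text \<open>A chain map that covers zero on \<open>M\<close> is null homotopic. The homotopy
  equation is solved for \<open>d' (Suc p) (s (Suc p) x)\<close>; its right-hand side is a cycle by
  the equation one degree lower, hence a boundary.\<close>

lemma homotopy_exists:
  assumes M: "left_module R M"
    and r: "free_resolution R M B d e" and r': "free_resolution R M B' d' e'"
    and w: "\<And>p. w p \<in> lin_maps R (free_module R (B p)) (free_module R (B' p))"
    and w0: "\<And>x. x \<in> carrier (free_module R (B 0)) \<Longrightarrow> e' (w 0 x) = \<zero>\<^bsub>M\<^esub>"
    and wd: "\<And>p x. x \<in> carrier (free_module R (B (Suc p))) \<Longrightarrow> d' p (w (Suc p) x) = w p (d p x)"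
  shows "\<exists>s. (\<forall>p. s p \<in> lin_maps R (free_module R (B p)) (free_module R (B' (Suc p)))) \<and>
    (\<forall>x\<in>carrier (free_module R (B 0)). d' 0 (s 0 x) = w 0 x) \<and>
    (\<forall>p. \<forall>x\<in>carrier (free_module R (B (Suc p))).
       d' (Suc p) (s (Suc p) x) = w (Suc p) x \<ominus>\<^bsub>free_module R (B' (Suc p))\<^esub> s p (d p x))"
proof -
  define C where "C p = free_module R (B p)" for p
  define D where "D p = free_module R (B' p)" for p
  have R: "ring R" using M by (simp add: left_module_def)
  have lC: "left_module R (C p)" and lD: "left_module R (D p)" for p
    unfolding C_def D_def by (rule free_module_left_module[OF R])+
  note rC = free_resolutionD[OF r, folded C_def] and rD = free_resolutionD[OF r', folded D_def]
  note w = w[folded C_def D_def] and w0 = w0[folded C_def] and wd = wd[folded C_def]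
  interpret D: left_module R "D p" for p by (rule lD)
  \<comment> \<open>Only the values on cycles are remembered: for a cycle the term with
    \<open>s\<close> of the boundary is absent, so \<open>d'\<close> of \<open>s x\<close> is
    \<open>w x\<close>. This is what turns the next right-hand side into a cycle, because
    \<open>d p x\<close> is one.\<close>
  define P where "P p s \<longleftrightarrow> s \<in> lin_maps R (C p) (D (Suc p)) \<and> (case p of 0 \<Rightarrow> \<forall>x\<in>carrier (C 0). d' 0 (s x) = w 0 x
    | Suc q \<Rightarrow> \<forall>x\<in>carrier (C (Suc q)). d q x = \<zero>\<^bsub>C q\<^esub> \<longrightarrow> d' (Suc q) (s x) = w (Suc q) x)" for p s
  define Q where "Q p s s' \<longleftrightarrow> (\<forall>x\<in>carrier (C (Suc p)).
     d' (Suc p) (s' x) = w (Suc p) x \<ominus>\<^bsub>D (Suc p)\<^esub> s (d p x))" for p s s'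
  have "\<exists>s. \<forall>p. P p (s p) \<and> Q p (s p) (s (Suc p))"
  proof (rule dependent_nat_choice)
    have "\<exists>s\<in>lin_maps R (C 0) (D (Suc 0)). \<forall>x\<in>carrier (C 0). d' 0 (s x) = w 0 x"
      unfolding C_def using w[of 0] lin_maps_closed[OF w] w0
      by (intro free_module_lift[OF lD lD rD(1)] rD(6)) (auto simp: C_def)
    then show "\<exists>s. P 0 s" by (auto simp: P_def)
  next
    fix s p assume s: "P p s"
    then have sl: "s \<in> lin_maps R (C p) (D (Suc p))" by (simp add: P_def)
    let ?h = "\<lambda>x. w (Suc p) x \<ominus>\<^bsub>D (Suc p)\<^esub> s (d p x)"
    have h: "?h \<in> lin_maps R (C (Suc p)) (D (Suc p))"
      by (rule D.lin_maps_minus[OF lC w lin_maps_comp[OF rC(1) sl]])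
    have "?h x \<in> d' (Suc p) ` carrier (D (Suc (Suc p)))" if x: "x \<in> carrier (C (Suc p))" for x
    proof (rule rD(7)[OF lin_maps_closed[OF h x]])
      have dx: "d p x \<in> carrier (C p)" by (rule lin_maps_closed[OF rC(1) x])
      have "d' p (s (d p x)) = w p (d p x)"
        using s dx x rC(5) by (auto simp: P_def split: nat.splits)
      then show "d' p (?h x) = \<zero>\<^bsub>D p\<^esub>"
        using lin_maps_diff[OF lD lD rD(1) lin_maps_closed[OF w x] lin_maps_closed[OF sl dx]]
          wd[OF x] lin_maps_closed[OF w dx]
        by (simp add: a_minus_def D.M.r_neg)
    qed
    then have "\<exists>s'\<in>lin_maps R (C (Suc p)) (D (Suc (Suc p))). \<forall>x\<in>carrier (C (Suc p)). d' (Suc p) (s' x) = ?h x"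
      using h unfolding C_def by (intro free_module_lift[OF lD lD rD(1)]) (auto simp: C_def)
    then obtain s' where s': "s' \<in> lin_maps R (C (Suc p)) (D (Suc (Suc p)))" "Q p s s'"
      unfolding Q_def by blast
    moreover from this have "P (Suc p) s'"
      using lin_maps_zero[OF lC lD sl] lin_maps_closed[OF w]
      by (simp add: P_def Q_def a_minus_def)
    ultimately show "\<exists>s'. P (Suc p) s' \<and> Q p s s'" by blast
  qed
  then obtain s where s: "\<And>p. P p (s p)" "\<And>p. Q p (s p) (s (Suc p))" by blast
  then have "\<forall>p. s p \<in> lin_maps R (C p) (D (Suc p))" "\<forall>x\<in>carrier (C 0). d' 0 (s 0 x) = w 0 x"
    "\<forall>p. \<forall>x\<in>carrier (C (Suc p)). d' (Suc p) (s (Suc p) x) = w (Suc p) x \<ominus>\<^bsub>D (Suc p)\<^esub> s p (d p x)"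
    using s(1)[of 0] by (auto simp: P_def Q_def)
  then show ?thesis unfolding C_def D_def by blast
qed

section \<open>Base change of free modules along a surjective ring homomorphism\<close>

text \<open>Extension of scalars of a free module along \<open>h\<close> is coefficientwise
  composition \<open>h \<circ> f\<close>, so no tensor product has to be formed. By surjectivity
  every vector of the target has this shape, and identities between linear maps can be checked on
  lifts. The instances are the augmentations to \<open>k\<close> and the projection of one algebra
  onto another.\<close>

locale ring_surjection =
  fixes R :: "('a, 'r) ring_scheme" and R' :: "('b, 's) ring_scheme" and h :: "'a \<Rightarrow> 'b"
  assumes ring_source: "ring R" and ring_target: "ring R'"
    and hom: "h \<in> ring_hom R R'" and surj: "h ` carrier R = carrier R'"
begin

lemma h_closed: "a \<in> carrier R \<Longrightarrow> h a \<in> carrier R'"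
  and h_add: "a \<in> carrier R \<Longrightarrow> b \<in> carrier R \<Longrightarrow> h (a \<oplus>\<^bsub>R\<^esub> b) = h a \<oplus>\<^bsub>R'\<^esub> h b"
  and h_mult: "a \<in> carrier R \<Longrightarrow> b \<in> carrier R \<Longrightarrow> h (a \<otimes>\<^bsub>R\<^esub> b) = h a \<otimes>\<^bsub>R'\<^esub> h b"
  and h_one: "h \<one>\<^bsub>R\<^esub> = \<one>\<^bsub>R'\<^esub>"
  and h_zero: "h \<zero>\<^bsub>R\<^esub> = \<zero>\<^bsub>R'\<^esub>"
  using hom ring_hom_zero[OF hom ring_source ring_target]
  by (auto simp: ring_hom_closed ring_hom_add ring_hom_mult ring_hom_one)

lemma comp_closed:
  assumes f: "f \<in> carrier (free_module R B)"
  shows "h \<circ> f \<in> carrier (free_module R' B)"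
  by (rule free_moduleI[OF _ _ free_module_finite[OF f]])
    (use f in \<open>auto simp: free_module_carrier h_zero h_closed\<close>)

lemma comp_add:
  assumes "f \<in> carrier (free_module R B)" "g \<in> carrier (free_module R B)"
  shows "h \<circ> (f \<oplus>\<^bsub>free_module R B\<^esub> g) = (h \<circ> f) \<oplus>\<^bsub>free_module R' B\<^esub> (h \<circ> g)"
  by (rule ext) (simp add: h_add free_module_closed[OF ring_source assms(1)] free_module_closed[OF ring_source assms(2)])

lemma comp_smult:
  assumes "a \<in> carrier R" "f \<in> carrier (free_module R B)"
  shows "h \<circ> (a \<odot>\<^bsub>free_module R B\<^esub> f) = h a \<odot>\<^bsub>free_module R' B\<^esub> (h \<circ> f)"
  by (rule ext) (simp add: h_mult assms(1) free_module_closed[OF ring_source assms(2)])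

lemma comp_zero: "h \<circ> \<zero>\<^bsub>free_module R B\<^esub> = \<zero>\<^bsub>free_module R' B\<^esub>"
  by (auto simp: h_zero)

lemma comp_basis: "h \<circ> basis_vec R b = basis_vec R' b"
  by (auto simp: basis_vec_def h_zero h_one)

lemma comp_surj:
  assumes "f \<in> carrier (free_module R' B)"
  obtains g where "g \<in> carrier (free_module R B)" "f = h \<circ> g"
proof
  \<comment> \<open>Zero coefficients are lifted to zero explicitly; an arbitrary preimage of zero
    could destroy finite support.\<close>
  let ?g = "\<lambda>x. if f x = \<zero>\<^bsub>R'\<^esub> then \<zero>\<^bsub>R\<^esub> else inv_into (carrier R) h (f x)"
  have cl: "f x \<in> h ` carrier R" for x using free_module_closed[OF ring_target assms] surj by simp
  have "finite {x. ?g x \<noteq> \<zero>\<^bsub>R\<^esub>}"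
    by (rule finite_subset[OF _ free_module_finite[OF assms]]) auto
  then show "?g \<in> carrier (free_module R B)"
    using assms inv_into_into[OF cl] ring.ring_simprules(2)[OF ring_source] by (auto simp: free_module_carrier)
  show "f = h \<circ> ?g" using f_inv_into_f[OF cl] by (auto simp: h_zero)
qed

text \<open>The map \<open>u \<circ> \<phi>\<close> is linear over \<open>R\<close> once
  \<open>R\<close> acts on \<open>M'\<close> through \<open>h\<close>. It therefore factors through
  \<open>h \<circ> f\<close>, and the factor is the linear extension with the same values on the
  basis.\<close>

lemma base_change:
  assumes M: "left_module R M" and M': "left_module R' M'" and \<phi>: "\<phi> \<in> lin_maps R (free_module R B) M"
    and uc: "\<And>x. x \<in> carrier M \<Longrightarrow> u x \<in> carrier M'"
    and ua: "\<And>x y. x \<in> carrier M \<Longrightarrow> y \<in> carrier M \<Longrightarrow> u (x \<oplus>\<^bsub>M\<^esub> y) = u x \<oplus>\<^bsub>M'\<^esub> u y"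
    and us: "\<And>a x. a \<in> carrier R \<Longrightarrow> x \<in> carrier M \<Longrightarrow> u (a \<odot>\<^bsub>M\<^esub> x) = h a \<odot>\<^bsub>M'\<^esub> u x"
  shows "lin_ext R' M' (\<lambda>b. u (\<phi> (basis_vec R b))) \<in> lin_maps R' (free_module R' B) M'" (is "?L \<in> _")
    and "f \<in> carrier (free_module R B) \<Longrightarrow> lin_ext R' M' (\<lambda>b. u (\<phi> (basis_vec R b))) (h \<circ> f) = u (\<phi> f)"
proof -
  interpret M: left_module R M by fact
  interpret M': left_module R' M' by fact
  have F: "left_module R (free_module R B)" by (rule free_module_left_module[OF ring_source])
  have F': "left_module R' (free_module R' B)" by (rule free_module_left_module[OF ring_target])
  interpret F: left_module R "free_module R B" by (rule F)
  interpret F': left_module R' "free_module R' B" by (rule F')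
  note bc = basis_vec_in_free[OF ring_source, of _ B] and bc' = basis_vec_in_free[OF ring_target, of _ B]
  note \<phi>c = lin_maps_closed[OF \<phi>]
  have v: "(\<lambda>b. u (\<phi> (basis_vec R b))) \<in> B \<rightarrow> carrier M'"
    using uc \<phi>c bc by auto
  show L: "?L \<in> lin_maps R' (free_module R' B) M'" by (rule M'.lin_ext_lin[OF v])
  show "?L (h \<circ> f) = u (\<phi> f)" if "f \<in> carrier (free_module R B)"
    using ring_source that
  proof (induction rule: free_module_induct)
    case zero
    have "u \<zero>\<^bsub>M\<^esub> = \<zero>\<^bsub>M'\<^esub>"
      using us[of "\<zero>\<^bsub>R\<^esub>" "\<zero>\<^bsub>M\<^esub>"] M.smult_l_null[of "\<zero>\<^bsub>M\<^esub>"] M'.smult_l_null uc by (simp add: h_zero)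
    then show ?case
      using comp_zero[of B] lin_maps_zero[OF F' M' L] lin_maps_zero[OF F M \<phi>] by simp
  next
    case (step b a g)
    note cs = comp_closed[OF step(3)] \<phi>c[OF step(3)] \<phi>c[OF bc[OF step(1)]] bc[OF step(1)] bc'[OF step(1)]
    have 1: "h \<circ> (a \<odot>\<^bsub>free_module R B\<^esub> basis_vec R b \<oplus>\<^bsub>free_module R B\<^esub> g)
        = h a \<odot>\<^bsub>free_module R' B\<^esub> basis_vec R' b \<oplus>\<^bsub>free_module R' B\<^esub> (h \<circ> g)"
      by (simp only: comp_add F.smult_closed step comp_smult bc comp_basis)
    have 2: "?L (h \<circ> (a \<odot>\<^bsub>free_module R B\<^esub> basis_vec R b \<oplus>\<^bsub>free_module R B\<^esub> g))
        = h a \<odot>\<^bsub>M'\<^esub> u (\<phi> (basis_vec R b)) \<oplus>\<^bsub>M'\<^esub> u (\<phi> g)"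
      unfolding 1 lin_maps_add[OF L F'.smult_closed[OF h_closed[OF step(2)] cs(5)] cs(1)]
        lin_maps_smult[OF L h_closed[OF step(2)] cs(5)]
      by (simp only: step.IH M'.lin_ext_basis_vec[OF v step(1)])
    show ?case unfolding 2 lin_maps_add[OF \<phi> F.smult_closed[OF step(2) cs(4)] step(3)]
        lin_maps_smult[OF \<phi> step(2) cs(4)]
      by (simp add: ua us cs step)
  qed
qed

text \<open>The matrix of \<open>\<phi>\<close> with \<open>h\<close> applied to its entries, that
  is, \<open>\<phi>\<close> tensored with \<open>R'\<close>.\<close>

definition change :: "'y set \<Rightarrow> (('x \<Rightarrow> 'a) \<Rightarrow> 'y \<Rightarrow> 'a) \<Rightarrow> ('x \<Rightarrow> 'b) \<Rightarrow> 'y \<Rightarrow> 'b" where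
  "change B' \<phi> = lin_ext R' (free_module R' B') (\<lambda>b. h \<circ> \<phi> (basis_vec R b))"

lemma change:
  assumes \<phi>: "\<phi> \<in> lin_maps R (free_module R B) (free_module R B')"
  shows "change B' \<phi> \<in> lin_maps R' (free_module R' B) (free_module R' B')"
    and "f \<in> carrier (free_module R B) \<Longrightarrow> change B' \<phi> (h \<circ> f) = h \<circ> \<phi> f"
proof -
  have c: "\<And>x. x \<in> carrier (free_module R B') \<Longrightarrow> h \<circ> x \<in> carrier (free_module R' B')"
    "\<And>x y. x \<in> carrier (free_module R B') \<Longrightarrow> y \<in> carrier (free_module R B') \<Longrightarrow>
       h \<circ> (x \<oplus>\<^bsub>free_module R B'\<^esub> y) = (h \<circ> x) \<oplus>\<^bsub>free_module R' B'\<^esub> (h \<circ> y)"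
    "\<And>a x. a \<in> carrier R \<Longrightarrow> x \<in> carrier (free_module R B') \<Longrightarrow>
       h \<circ> (a \<odot>\<^bsub>free_module R B'\<^esub> x) = h a \<odot>\<^bsub>free_module R' B'\<^esub> (h \<circ> x)"
    by (rule comp_closed comp_add comp_smult; assumption)+
  note b = base_change[OF free_module_left_module[OF ring_source] free_module_left_module[OF ring_target] \<phi>,
      of "(\<circ>) h", OF c, folded change_def]
  show "change B' \<phi> \<in> lin_maps R' (free_module R' B) (free_module R' B')" by (rule b(1))
  show "change B' \<phi> (h \<circ> f) = h \<circ> \<phi> f" if "f \<in> carrier (free_module R B)"
    by (rule b(2)) (simp_all only: that)
qed

lemma change_complex:
  assumes r: "free_resolution R M B d e"
  shows "chain_complex R' (\<lambda>p. free_module R' (B p)) (\<lambda>p. change (B p) (d p))"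
proof -
  note rD = free_resolutionD[OF r]
  have "change (B p) (d p) (change (B (Suc p)) (d (Suc p)) x) = \<zero>\<^bsub>free_module R' (B p)\<^esub>"
    if x: "x \<in> carrier (free_module R' (B (Suc (Suc p))))" for p x
  proof -
    obtain y where y: "y \<in> carrier (free_module R (B (Suc (Suc p))))" "x = h \<circ> y"
      using comp_surj[OF x] by blast
    then show ?thesis
      by (simp only: change(2)[OF rD(1)] lin_maps_closed[OF rD(1)] rD(5) comp_zero)
  qed
  then show ?thesis
    unfolding chain_complex_def using free_module_left_module[OF ring_target] change(1)[OF rD(1)] by blast
qed

text \<open>An endomorphism \<open>w\<close> of the resolution that covers the identity of
  \<open>M\<close> is homotopic to the identity. The homotopy survives base change, even where
  exactness does not, so \<open>w\<close> still acts as the identity on homology.\<close>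

lemma change_retract:
  assumes M: "left_module R M" and r: "free_resolution R M B d e"
    and w: "\<And>p. w p \<in> lin_maps R (free_module R (B p)) (free_module R (B p))"
    and w0: "\<And>x. x \<in> carrier (free_module R (B 0)) \<Longrightarrow> e (w 0 x) = e x"
    and wd: "\<And>p x. x \<in> carrier (free_module R (B (Suc p))) \<Longrightarrow> d p (w (Suc p) x) = w p (d p x)"
    and x: "x \<in> cycles (\<lambda>p. free_module R' (B p)) (\<lambda>p. change (B p) (d p)) p"
  shows "\<exists>y\<in>carrier (free_module R' (B (Suc p))).
    x = change (B p) (w p) x \<oplus>\<^bsub>free_module R' (B p)\<^esub> change (B p) (d p) y"
proof -
  define C where "C p = free_module R (B p)" for p
  define C' where "C' p = free_module R' (B p)" for p
  have lC: "left_module R (C p)" and lC': "left_module R' (C' p)" for p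
    unfolding C_def C'_def by (rule free_module_left_module[OF ring_source], rule free_module_left_module[OF ring_target])
  interpret C: left_module R "C i" for i by (rule lC)
  interpret C': left_module R' "C' i" for i by (rule lC')
  note rD = free_resolutionD[OF r, folded C_def] and w = w[folded C_def] and w0 = w0[folded C_def]
    and wd = wd[folded C_def]
  note cl = lin_maps_closed[OF w] lin_maps_closed[OF rD(1)]
  have w': "(\<lambda>x. x \<ominus>\<^bsub>C p\<^esub> w p x) \<in> lin_maps R (C p) (C p)" for p
    by (rule C.lin_maps_minus[OF lC lin_maps_id w])
  have ex: "\<exists>s. (\<forall>p. s p \<in> lin_maps R (C p) (C (Suc p))) \<and>
    (\<forall>x\<in>carrier (C 0). d 0 (s 0 x) = x \<ominus>\<^bsub>C 0\<^esub> w 0 x) \<and>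
    (\<forall>p. \<forall>x\<in>carrier (C (Suc p)).
       d (Suc p) (s (Suc p) x) = (x \<ominus>\<^bsub>C (Suc p)\<^esub> w (Suc p) x) \<ominus>\<^bsub>C (Suc p)\<^esub> s p (d p x))"
  proof (unfold C_def, rule homotopy_exists[OF M r r], fold C_def)
    show "(\<lambda>x. x \<ominus>\<^bsub>C p\<^esub> w p x) \<in> lin_maps R (C p) (C p)" for p by (rule w')
    show "e (x \<ominus>\<^bsub>C 0\<^esub> w 0 x) = \<zero>\<^bsub>M\<^esub>" if x: "x \<in> carrier (C 0)" for x
    proof -
      interpret M: left_module R M by (rule M)
      show ?thesis using lin_maps_diff[OF lC M rD(2) x cl(1)[OF x]] w0[OF x] lin_maps_closed[OF rD(2) x]
        by (simp add: a_minus_def M.M.r_neg)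
    qed
    show "d p (x \<ominus>\<^bsub>C (Suc p)\<^esub> w (Suc p) x) = d p x \<ominus>\<^bsub>C p\<^esub> w p (d p x)"
      if x: "x \<in> carrier (C (Suc p))" for p x
      using lin_maps_diff[OF lC lC rD(1) x cl(1)[OF x]] wd[OF x] by simp
  qed
  then obtain s where s: "\<And>p. s p \<in> lin_maps R (C p) (C (Suc p))"
    "\<And>x. x \<in> carrier (C 0) \<Longrightarrow> d 0 (s 0 x) = x \<ominus>\<^bsub>C 0\<^esub> w 0 x"
    "\<And>p x. x \<in> carrier (C (Suc p)) \<Longrightarrow>
       d (Suc p) (s (Suc p) x) = (x \<ominus>\<^bsub>C (Suc p)\<^esub> w (Suc p) x) \<ominus>\<^bsub>C (Suc p)\<^esub> s p (d p x)"
    by blast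
  note scl = lin_maps_closed[OF s(1)]
  note ch = change(2)[OF w[unfolded C_def], folded C_def] change(2)[OF rD(1)[unfolded C_def], folded C_def]
    change(2)[OF s(1)[unfolded C_def], folded C_def]
  note ca = comp_add[of _ "B p", folded C_def C'_def]
  have "x \<in> carrier (C' p)" unfolding C'_def by (rule subsetD[OF cycles_sub x])
  then obtain f where f: "f \<in> carrier (C p)" "x = h \<circ> f" using comp_surj unfolding C_def C'_def by blast
  have dif: "a = b \<oplus>\<^bsub>C p\<^esub> c" if "c = a \<ominus>\<^bsub>C p\<^esub> b" "a \<in> carrier (C p)" "b \<in> carrier (C p)" for a b c
    using that C.diff_add_cancel[of a p b] C.M.a_comm by (metis C.M.minus_closed)
  have "x = change (B p) (w p) x \<oplus>\<^bsub>C' p\<^esub> change (B p) (d p) (h \<circ> s p f)"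
  proof (cases p)
    case 0
    have "f = w p f \<oplus>\<^bsub>C p\<^esub> d p (s p f)"
      using s(2) f 0 by (intro dif cl) auto
    then have "h \<circ> f = (h \<circ> w p f) \<oplus>\<^bsub>C' p\<^esub> (h \<circ> d p (s p f))"
      using ca[OF cl(1)[OF f(1)] cl(2)[OF scl[OF f(1)]]] by metis
    then show ?thesis unfolding f(2) ch(1)[OF f(1)] ch(2)[OF scl[OF f(1)]] .
  next
    case (Suc q)
    have f': "f \<in> carrier (C (Suc q))" using f(1) Suc by simp
    have df: "d q f \<in> carrier (C q)" by (rule cl(2)[OF f'])
    have 1: "d p (s p f) = (f \<ominus>\<^bsub>C p\<^esub> w p f) \<ominus>\<^bsub>C p\<^esub> s q (d q f)" using s(3)[OF f'] Suc by simp
    have sc: "s q (d q f) \<in> carrier (C p)" using scl[OF df] Suc by simp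
    have "f \<ominus>\<^bsub>C p\<^esub> w p f = s q (d q f) \<oplus>\<^bsub>C p\<^esub> d p (s p f)"
      by (rule dif[OF 1]) (use sc cl f in auto)
    then have "f = w p f \<oplus>\<^bsub>C p\<^esub> (s q (d q f) \<oplus>\<^bsub>C p\<^esub> d p (s p f))"
      by (intro dif) (use cl f in auto)
    then have "h \<circ> f = (h \<circ> w p f) \<oplus>\<^bsub>C' p\<^esub> ((h \<circ> s q (d q f)) \<oplus>\<^bsub>C' p\<^esub> (h \<circ> d p (s p f)))"
      using ca[OF cl(1)[OF f(1)] C.M.a_closed[OF sc cl(2)[OF scl[OF f(1)]]]]
        ca[OF sc cl(2)[OF scl[OF f(1)]]] by metis
    \<comment> \<open>The lift \<open>f\<close> of the cycle \<open>x\<close> need not be a cycle;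
      only the image of \<open>d q f\<close> under \<open>h\<close> vanishes, and that kills this
      term.\<close>
    moreover have "h \<circ> s q (d q f) = \<zero>\<^bsub>C' p\<^esub>"
    proof -
      have "change (B q) (d q) x = \<zero>\<^bsub>C' q\<^esub>" using x Suc by (simp add: cycles_def C'_def)
      then have "h \<circ> d q f = \<zero>\<^bsub>C' q\<^esub>" using ch(2)[OF f'] f(2) by simp
      then have "h \<circ> s q (d q f) = change (B (Suc q)) (s q) \<zero>\<^bsub>C' q\<^esub>" using ch(3)[OF df] by simp
      also have "\<dots> = \<zero>\<^bsub>C' (Suc q)\<^esub>"
        by (rule lin_maps_zero[OF lC' lC'], unfold C'_def, rule change(1)) (rule s(1)[unfolded C_def])
      finally show ?thesis using Suc by simp
    qed
    moreover have "h \<circ> d p (s p f) \<in> carrier (C' p)"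
      unfolding C'_def by (rule comp_closed) (use cl(2)[OF scl[OF f(1)]] in \<open>simp add: C_def\<close>)
    ultimately have "h \<circ> f = (h \<circ> w p f) \<oplus>\<^bsub>C' p\<^esub> (h \<circ> d p (s p f))"
      by (simp only: C'.M.l_zero)
    then show ?thesis unfolding f(2) ch(1)[OF f(1)] ch(2)[OF scl[OF f(1)]] .
  qed
  moreover have "h \<circ> s p f \<in> carrier (C' (Suc p))"
    unfolding C'_def by (rule comp_closed) (use scl[OF f(1)] in \<open>simp add: C_def\<close>)
  ultimately show ?thesis unfolding C'_def by blast
qed

text \<open>Independence of the resolution: comparison maps \<open>u\<close> and \<open>v\<close>
  exist in both directions, both composites cover the identity of \<open>M\<close>, and
  \<open>change_retract\<close> converts them into injectivity and surjectivity on homology.\<close>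

theorem change_homology_iso:
  assumes M: "left_module R M"
    and r: "free_resolution R M B d e" and r': "free_resolution R M B' d' e'"
  shows "module_iso R' (homology (\<lambda>p. free_module R' (B p)) (\<lambda>p. change (B p) (d p)) p)
     (homology (\<lambda>p. free_module R' (B' p)) (\<lambda>p. change (B' p) (d' p)) p)"
proof -
  obtain u where u: "\<And>p. u p \<in> lin_maps R (free_module R (B p)) (free_module R (B' p))"
    "\<And>x. x \<in> carrier (free_module R (B 0)) \<Longrightarrow> e' (u 0 x) = e x"
    "\<And>p x. x \<in> carrier (free_module R (B (Suc p))) \<Longrightarrow> d' p (u (Suc p) x) = u p (d p x)"
    using chain_map_exists[OF M r r'] by blast
  obtain v where v: "\<And>p. v p \<in> lin_maps R (free_module R (B' p)) (free_module R (B p))"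
    "\<And>x. x \<in> carrier (free_module R (B' 0)) \<Longrightarrow> e (v 0 x) = e' x"
    "\<And>p x. x \<in> carrier (free_module R (B' (Suc p))) \<Longrightarrow> d p (v (Suc p) x) = v p (d' p x)"
    using chain_map_exists[OF M r' r] by blast
  note rD = free_resolutionD[OF r] and rD' = free_resolutionD[OF r']
  let ?C = "\<lambda>p. free_module R' (B p)" and ?D = "\<lambda>p. free_module R' (B' p)"
  let ?d = "\<lambda>p. change (B p) (d p)" and ?d' = "\<lambda>p. change (B' p) (d' p)"
  let ?u = "\<lambda>p. change (B' p) (u p)" and ?v = "\<lambda>p. change (B p) (v p)"
  have cu: "?d' p (?u (Suc p) x) = ?u p (?d p x)" if x: "x \<in> carrier (?C (Suc p))" for p x
  proof -
    obtain f where "f \<in> carrier (free_module R (B (Suc p)))" "x = h \<circ> f" using comp_surj[OF x] by blast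
    then show ?thesis
      by (simp only: change(2)[OF u(1)] change(2)[OF rD(1)] change(2)[OF rD'(1)]
          lin_maps_closed[OF u(1)] lin_maps_closed[OF rD(1)] u(3))
  qed
  have cv: "?d p (?v (Suc p) x) = ?v p (?d' p x)" if x: "x \<in> carrier (?D (Suc p))" for p x
  proof -
    obtain f where "f \<in> carrier (free_module R (B' (Suc p)))" "x = h \<circ> f" using comp_surj[OF x] by blast
    then show ?thesis
      by (simp only: change(2)[OF v(1)] change(2)[OF rD(1)] change(2)[OF rD'(1)]
          lin_maps_closed[OF v(1)] lin_maps_closed[OF rD'(1)] v(3))
  qed
  have vu: "change (B p) (\<lambda>x. v p (u p x)) x = ?v p (?u p x)" if x: "x \<in> carrier (?C p)" for p x
  proof -
    obtain f where "f \<in> carrier (free_module R (B p))" "x = h \<circ> f" using comp_surj[OF x] by blast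
    then show ?thesis
      by (simp only: change(2)[OF v(1)] change(2)[OF u(1)] lin_maps_closed[OF u(1)]
          change(2)[OF lin_maps_comp[OF u(1) v(1)]])
  qed
  have uv: "change (B' p) (\<lambda>x. u p (v p x)) x = ?u p (?v p x)" if x: "x \<in> carrier (?D p)" for p x
  proof -
    obtain f where "f \<in> carrier (free_module R (B' p))" "x = h \<circ> f" using comp_surj[OF x] by blast
    then show ?thesis
      by (simp only: change(2)[OF v(1)] change(2)[OF u(1)] lin_maps_closed[OF v(1)]
          change(2)[OF lin_maps_comp[OF v(1) u(1)]])
  qed
  have lC: "left_module R' (?C p)" and lD: "left_module R' (?D p)" for p
    by (rule free_module_left_module[OF ring_target])+
  have dlin: "?d p \<in> lin_maps R' (?C (Suc p)) (?C p)" for p by (rule change(1)[OF rD(1)])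
  have vlin: "?v p \<in> lin_maps R' (?D p) (?C p)" for p by (rule change(1)[OF v(1)])
  show ?thesis
  proof (rule homology_iso[where u = ?u, OF change_complex[OF r] change_complex[OF r']])
    show "?u p \<in> lin_maps R' (?C p) (?D p)" for p by (rule change(1)[OF u(1)])
    show "?d' p (?u (Suc p) x) = ?u p (?d p x)" if "x \<in> carrier (?C (Suc p))" for p x by (rule cu[OF that])
    fix x assume x: "x \<in> cycles ?C ?d p" and "?u p x \<in> ?d' p ` carrier (?D (Suc p))"
    then obtain y where y: "y \<in> carrier (?D (Suc p))" "?u p x = ?d' p y" by blast
    have "\<exists>z\<in>carrier (?C (Suc p)). x = change (B p) (\<lambda>x. v p (u p x)) x \<oplus>\<^bsub>?C p\<^esub> ?d p z"
      by (rule change_retract[OF M r lin_maps_comp[OF u(1) v(1)] _ _ x])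
        (simp_all only: u v lin_maps_closed[OF u(1)])
    then obtain z where z: "z \<in> carrier (?C (Suc p))" "x = ?v p (?u p x) \<oplus>\<^bsub>?C p\<^esub> ?d p z"
      using vu[OF subsetD[OF cycles_sub x]] by metis
    have "x = ?d p (?v (Suc p) y) \<oplus>\<^bsub>?C p\<^esub> ?d p z" using z(2) y cv by metis
    also have "\<dots> = ?d p (?v (Suc p) y \<oplus>\<^bsub>?C (Suc p)\<^esub> z)"
      by (rule lin_maps_add[OF dlin lin_maps_closed[OF vlin y(1)] z(1), symmetric])
    finally show "x \<in> ?d p ` carrier (?C (Suc p))"
      using abelian_monoid.a_closed[OF abelian_group.axioms(1)[OF left_module.axioms(2)[OF lC]]
        lin_maps_closed[OF vlin y(1)] z(1)] by blast
  next
    fix y assume y: "y \<in> cycles ?D ?d' p"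
    have yc: "y \<in> carrier (?D p)" by (rule subsetD[OF cycles_sub y])
    have "\<exists>z\<in>carrier (?D (Suc p)). y = change (B' p) (\<lambda>x. u p (v p x)) y \<oplus>\<^bsub>?D p\<^esub> ?d' p z"
      by (rule change_retract[OF M r' lin_maps_comp[OF v(1) u(1)] _ _ y])
        (simp_all only: u v lin_maps_closed[OF v(1)])
    then obtain z where z: "z \<in> carrier (?D (Suc p))" "y = ?u p (?v p y) \<oplus>\<^bsub>?D p\<^esub> ?d' p z"
      using uv[OF yc] by metis
    have "?v p y \<in> cycles ?C ?d p"
    proof (cases p)
      case 0
      then show ?thesis using lin_maps_closed[OF vlin yc] by (simp add: cycles_def)
    next
      case (Suc q)
      have "?d q (?v (Suc q) y) = ?v q (?d' q y)" using cv yc Suc by blast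
      also have "\<dots> = ?v q \<zero>\<^bsub>?D q\<^esub>" using y Suc by (simp add: cycles_def)
      also have "\<dots> = \<zero>\<^bsub>?C q\<^esub>" by (rule lin_maps_zero[OF lD lC vlin])
      finally show ?thesis using lin_maps_closed[OF vlin yc] Suc by (simp add: cycles_def)
    qed
    then show "\<exists>x\<in>cycles ?C ?d p. \<exists>w\<in>carrier (?D (Suc p)). y = ?u p x \<oplus>\<^bsub>?D p\<^esub> ?d' p w"
      using z by blast
  qed
qed

end

section \<open>Tor over an augmented algebra\<close>

text \<open>Transport of structure: linearity of \<open>d'\<close> and the vanishing of its square
  are inherited through the bijections. This spares a direct proof that \<open>tensor_map\<close> is
  linear.\<close>

lemma homology_iso_bij:
  assumes C: "chain_complex k C d" and lD: "\<And>p. left_module k (D p)"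
    and u: "\<And>p. u p \<in> lin_maps k (C p) (D p)" and bij: "\<And>p. bij_betw (u p) (carrier (C p)) (carrier (D p))"
    and comm: "\<And>p x. x \<in> carrier (C (Suc p)) \<Longrightarrow> d' p (u (Suc p) x) = u p (d p x)"
  shows "chain_complex k D d'" and "module_iso k (homology C d p) (homology D d' p)"
proof -
  have lC: "left_module k (C q)" and dl: "d q \<in> lin_maps k (C (Suc q)) (C q)" for q
    using C by (auto simp: chain_complex_def)
  have dd: "d q (d (Suc q) x) = \<zero>\<^bsub>C q\<^esub>" if "x \<in> carrier (C (Suc (Suc q)))" for q x
    using C that by (auto simp: chain_complex_def)
  note dc = lin_maps_closed[OF dl] and uc = lin_maps_closed[OF u]
  interpret C: left_module k "C q" for q by (rule lC)
  interpret D: left_module k "D q" for q by (rule lD)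
  have uz: "u q \<zero>\<^bsub>C q\<^esub> = \<zero>\<^bsub>D q\<^esub>" for q by (rule lin_maps_zero[OF lC lD u])
  have im: "carrier (D q) = u q ` carrier (C q)" for q using bij[of q] by (simp add: bij_betw_def)
  have inj: "x = y" if "u q x = u q y" "x \<in> carrier (C q)" "y \<in> carrier (C q)" for q x y
    using bij[of q] that by (simp add: bij_betw_def inj_on_def)
  have d'l: "d' q \<in> lin_maps k (D (Suc q)) (D q)" for q
    by (rule lin_mapsI, unfold im)
      (auto simp: lin_maps_add[OF u, symmetric] lin_maps_smult[OF u, symmetric] comm dc
        lin_maps_add[OF dl] lin_maps_smult[OF dl])
  show D: "chain_complex k D d'"
    unfolding chain_complex_def using lD d'l
    by (auto simp: im comm dc dd uz)
  show "module_iso k (homology C d p) (homology D d' p)"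
  proof (rule homology_iso[OF C D u comm])
    fix x assume x: "x \<in> cycles C d p" and "u p x \<in> d' p ` carrier (D (Suc p))"
    then obtain y where y: "y \<in> carrier (C (Suc p))" "u p x = u p (d p y)" by (auto simp: im comm)
    then have "x = d p y" using subsetD[OF cycles_sub x] dc by (intro inj)
    then show "x \<in> d p ` carrier (C (Suc p))" using y(1) by (rule image_eqI)
  next
    fix y assume y: "y \<in> cycles D d' p"
    then obtain x where x: "x \<in> carrier (C p)" "y = u p x" using subsetD[OF cycles_sub y] by (auto simp: im)
    have "x \<in> cycles C d p"
    proof (cases p)
      case 0 then show ?thesis using x by (simp add: cycles_def)
    next
      case (Suc q)
      have "u q (d q x) = u q \<zero>\<^bsub>C q\<^esub>" using y x Suc uz by (simp add: cycles_def comm)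
      then have "d q x = \<zero>\<^bsub>C q\<^esub>" using x Suc dc by (intro inj) auto
      then show ?thesis using x Suc by (simp add: cycles_def)
    qed
    moreover have "y = u p x \<oplus>\<^bsub>D p\<^esub> d' p \<zero>\<^bsub>D (Suc p)\<^esub>"
      using x lin_maps_zero[OF lD lD d'l] uc by simp
    ultimately show "\<exists>x\<in>cycles C d p. \<exists>w\<in>carrier (D (Suc p)). y = u p x \<oplus>\<^bsub>D p\<^esub> d' p w"
      by (intro bexI[of _ x] bexI[of _ "\<zero>\<^bsub>D (Suc p)\<^esub>"]) auto
  qed
qed

lemma submoduleD:
  assumes "left_module R M" "submodule H R M"
  shows "quotient_module R M H"
proof -
  interpret M: left_module R M by fact
  interpret H: submodule H R M by fact
  show ?thesis
    by unfold_locales (use H.subset H.one_closed H.m_closed H.smult_closed in auto)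
qed

lemma (in quotient_module) submodule: "submodule H R M"
proof (intro submodule.intro submodule_axioms.intro)
  show "subgroup H (add_monoid M)"
    using H_abelian_subgroup unfolding abelian_subgroup_def additive_subgroup_def by blast
qed (rule H_smult)

lemma submodule_gen_quotient_module:
  assumes M: "left_module R M" and S: "S \<subseteq> carrier M"
  shows "quotient_module R M (submodule_gen R M S)"
proof -
  interpret M: left_module R M by fact
  \<comment> \<open>The intersection runs over a nonempty family, because the whole module is a
    submodule containing \<open>S\<close>.\<close>
  have c: "submodule (carrier M) R M"
    by (rule quotient_module.submodule) (unfold_locales, auto)
  note D = submoduleD[OF M, THEN quotient_module.H_zero] submoduleD[OF M, THEN quotient_module.H_add]
    submoduleD[OF M, THEN quotient_module.H_smult]
  show ?thesis
    unfolding submodule_gen_def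
    by unfold_locales (use c S D in blast)+
qed

lemma opposite_simps [simp]:
  "carrier (opposite A) = carrier A" "\<one>\<^bsub>opposite A\<^esub> = \<one>\<^bsub>A\<^esub>" "\<zero>\<^bsub>opposite A\<^esub> = \<zero>\<^bsub>A\<^esub>"
  "x \<oplus>\<^bsub>opposite A\<^esub> y = x \<oplus>\<^bsub>A\<^esub> y" "x \<otimes>\<^bsub>opposite A\<^esub> y = y \<otimes>\<^bsub>A\<^esub> x"
  by (simp_all add: opposite_def)

lemma opposite_ring:
  assumes "ring A" shows "ring (opposite A)"
proof -
  interpret ring A by fact
  have "abelian_group (opposite A)"
    by (rule abelian_groupI) (auto simp: a_ac intro: bexI[of _ "\<ominus>\<^bsub>A\<^esub> x" for x] l_neg)
  moreover have "monoid (opposite A)" by (rule monoidI) (auto simp: m_assoc)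
  ultimately show ?thesis by (rule ringI) (auto simp: l_distr r_distr)
qed

text \<open>\<open>N\<close> is \<open>k\<close> with \<open>A\<close> acting through
  \<open>\<epsilon>\<close>; as \<open>k\<close> is commutative, one record is both a left and a
  right module. The unit axioms make \<open>\<epsilon>\<close> onto, so that tensoring a free right
  module with \<open>N\<close> is base change along \<open>\<epsilon>\<close>.\<close>

locale augmented_algebra =
  fixes k :: "('k, 'e) ring_scheme" and A :: "('k, 'a) module" and N :: "('a, 'k) module" and \<epsilon> :: "'a \<Rightarrow> 'k"
  assumes k: "cring k" and A: "ring A" and \<epsilon>: "\<epsilon> \<in> ring_hom A k"
    and unit_closed: "\<And>r. r \<in> carrier k \<Longrightarrow> r \<odot>\<^bsub>A\<^esub> \<one>\<^bsub>A\<^esub> \<in> carrier A"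
    and \<epsilon>_unit: "\<And>r. r \<in> carrier k \<Longrightarrow> \<epsilon> (r \<odot>\<^bsub>A\<^esub> \<one>\<^bsub>A\<^esub>) = r"
    and N_carrier: "carrier N = carrier k" and N_zero: "\<zero>\<^bsub>N\<^esub> = \<zero>\<^bsub>k\<^esub>"
    and N_add: "\<And>x y. x \<oplus>\<^bsub>N\<^esub> y = x \<oplus>\<^bsub>k\<^esub> y"
    and N_smult: "\<And>a r. a \<in> carrier A \<Longrightarrow> r \<in> carrier k \<Longrightarrow> a \<odot>\<^bsub>N\<^esub> r = \<epsilon> a \<otimes>\<^bsub>k\<^esub> r"
begin

sublocale k: cring k by (rule k)
sublocale A: ring A by (rule A)

lemma op: "ring (opposite A)" by (rule opposite_ring[OF A])

lemma \<epsilon>_closed [simp]: "a \<in> carrier A \<Longrightarrow> \<epsilon> a \<in> carrier k" using \<epsilon> by (rule ring_hom_closed)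
lemma \<epsilon>_add: "a \<in> carrier A \<Longrightarrow> b \<in> carrier A \<Longrightarrow> \<epsilon> (a \<oplus>\<^bsub>A\<^esub> b) = \<epsilon> a \<oplus>\<^bsub>k\<^esub> \<epsilon> b" using \<epsilon> by (rule ring_hom_add)
lemma \<epsilon>_mult: "a \<in> carrier A \<Longrightarrow> b \<in> carrier A \<Longrightarrow> \<epsilon> (a \<otimes>\<^bsub>A\<^esub> b) = \<epsilon> a \<otimes>\<^bsub>k\<^esub> \<epsilon> b" using \<epsilon> by (rule ring_hom_mult)
lemma \<epsilon>_one: "\<epsilon> \<one>\<^bsub>A\<^esub> = \<one>\<^bsub>k\<^esub>" using \<epsilon> by (rule ring_hom_one)
lemma \<epsilon>_zero: "\<epsilon> \<zero>\<^bsub>A\<^esub> = \<zero>\<^bsub>k\<^esub>" using \<epsilon> A k.ring_axioms by (rule ring_hom_zero)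

lemma surjection: "ring_surjection (opposite A) k \<epsilon>"
proof (rule ring_surjection.intro)
  show "\<epsilon> \<in> ring_hom (opposite A) k"
    by (rule ring_hom_memI) (simp_all add: \<epsilon>_mult \<epsilon>_add \<epsilon>_one k.m_comm)
  show "\<epsilon> ` carrier (opposite A) = carrier k"
  proof
    show "carrier k \<subseteq> \<epsilon> ` carrier (opposite A)"
    proof
      fix r assume "r \<in> carrier k"
      then show "r \<in> \<epsilon> ` carrier (opposite A)"
        by (intro image_eqI[of _ _ "r \<odot>\<^bsub>A\<^esub> \<one>\<^bsub>A\<^esub>"]) (simp_all add: unit_closed \<epsilon>_unit)
    qed
  qed auto
qed (rule op, rule k.ring_axioms)

sublocale ring_surjection "opposite A" k \<epsilon> by (rule surjection)

lemma N_left: "left_module A N" and N_right: "left_module (opposite A) N"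
proof -
  have "abelian_group N"
    by (rule abelian_groupI)
      (auto simp: N_carrier N_zero N_add k.a_ac intro: bexI[of _ "\<ominus>\<^bsub>k\<^esub> x" for x] k.l_neg)
  then show "left_module A N" "left_module (opposite A) N"
    by (intro left_module.intro left_module_axioms.intro A op;
        simp add: N_carrier N_add N_smult \<epsilon>_add \<epsilon>_mult \<epsilon>_one k.l_distr k.r_distr k.m_ac)+
qed

context
  fixes B :: "'x set"
begin

abbreviation (input) "P \<equiv> free_module (opposite A) B"
abbreviation (input) "F \<equiv> free_module k (carrier (free_module (opposite A) B) \<times> carrier N)"
abbreviation (input) "K \<equiv> tensor_ker k A (free_module (opposite A) B) N"

text \<open>\<open>flat\<close>, \<open>sharp\<close> and \<open>tclass\<close> realise the
  isomorphism between the free right module on \<open>B\<close>, tensored with \<open>N\<close>, and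
  the free \<open>k\<close>-module on \<open>B\<close>. The first two live on formal sums of
  symbols, before the tensor relations are imposed, where they are plain linear extensions;
  \<open>flat\<close> after \<open>sharp\<close> is the identity there, the other composite only
  modulo \<open>K\<close>.\<close>

definition flat :: "(('x \<Rightarrow> 'a) \<times> 'k \<Rightarrow> 'k) \<Rightarrow> 'x \<Rightarrow> 'k" where
  "flat = lin_ext k (free_module k B) (\<lambda>(f, r) b. \<epsilon> (f b) \<otimes>\<^bsub>k\<^esub> r)"

definition sharp :: "('x \<Rightarrow> 'k) \<Rightarrow> ('x \<Rightarrow> 'a) \<times> 'k \<Rightarrow> 'k" where
  "sharp = lin_ext k F (\<lambda>b. basis_vec k (basis_vec (opposite A) b, \<one>\<^bsub>k\<^esub>))"

definition tclass :: "('x \<Rightarrow> 'k) \<Rightarrow> (('x \<Rightarrow> 'a) \<times> 'k \<Rightarrow> 'k) set" where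
  "tclass g = K +>\<^bsub>F\<^esub> sharp g"

lemma P_closed: "f \<in> carrier P \<Longrightarrow> f b \<in> carrier A"
  using free_module_closed[OF op] by fastforce

lemma lP: "left_module (opposite A) P" by (rule free_module_left_module[OF op])
lemma lF: "left_module k F" by (rule free_module_left_module[OF k.ring_axioms])
lemma lB: "left_module k (free_module k B)" by (rule free_module_left_module[OF k.ring_axioms])

lemma flat_val:
  assumes "f \<in> carrier P" "r \<in> carrier k"
  shows "(\<lambda>b. \<epsilon> (f b) \<otimes>\<^bsub>k\<^esub> r) \<in> carrier (free_module k B)"
  by (rule free_moduleI[OF _ _ free_module_finite[OF assms(1)]])
    (use assms P_closed[OF assms(1)] in \<open>auto simp: free_module_carrier \<epsilon>_zero\<close>)

lemma flat_val': "(\<lambda>(f, r) b. \<epsilon> (f b) \<otimes>\<^bsub>k\<^esub> r) \<in> carrier P \<times> carrier N \<rightarrow> carrier (free_module k B)"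
  using flat_val by (auto simp: N_carrier)

lemma flat_lin: "flat \<in> lin_maps k F (free_module k B)"
  unfolding flat_def by (rule left_module.lin_ext_lin[OF lB flat_val'])

lemma flat_basis:
  "f \<in> carrier P \<Longrightarrow> r \<in> carrier k \<Longrightarrow> flat (basis_vec k (f, r)) = (\<lambda>b. \<epsilon> (f b) \<otimes>\<^bsub>k\<^esub> r)"
  unfolding flat_def by (subst left_module.lin_ext_basis_vec[OF lB flat_val']) (auto simp: N_carrier)

lemma basis_F: "f \<in> carrier P \<Longrightarrow> r \<in> carrier k \<Longrightarrow> basis_vec k (f, r) \<in> carrier F"
  by (rule basis_vec_in_free[OF k.ring_axioms]) (simp add: N_carrier)

lemma sharp_val: "(\<lambda>b. basis_vec k (basis_vec (opposite A) b, \<one>\<^bsub>k\<^esub>)) \<in> B \<rightarrow> carrier F"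
  by (rule Pi_I) (rule basis_F[OF basis_vec_in_free[OF op] k.one_closed])

lemma sharp_lin: "sharp \<in> lin_maps k (free_module k B) F"
  unfolding sharp_def by (rule left_module.lin_ext_lin[OF lF sharp_val])

lemma sharp_basis: "b \<in> B \<Longrightarrow> sharp (basis_vec k b) = basis_vec k (basis_vec (opposite A) b, \<one>\<^bsub>k\<^esub>)"
  unfolding sharp_def by (rule left_module.lin_ext_basis_vec[OF lF sharp_val])

lemma flat_sharp: "g \<in> carrier (free_module k B) \<Longrightarrow> flat (sharp g) = g"
proof (rule lin_maps_basis_ext[OF lB lin_maps_comp[OF sharp_lin flat_lin] lin_maps_id])
  fix b assume b: "b \<in> B"
  show "flat (sharp (basis_vec k b)) = basis_vec k b"
    unfolding sharp_basis[OF b] flat_basis[OF basis_vec_in_free[OF op b] k.one_closed]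
    by (auto simp: basis_vec_def \<epsilon>_one \<epsilon>_zero)
qed

lemma rels_sub: "tensor_rels k A P N \<subseteq> carrier F"
proof -
  interpret F: left_module k F by (rule lF)
  interpret P: left_module "opposite A" P by (rule lP)
  interpret N: left_module A N by (rule N_left)
  have s: "basis_vec k (f, r) \<in> carrier F" if "f \<in> carrier P" "r \<in> carrier N" for f r
    using basis_F that by (simp add: N_carrier)
  have PA: "a \<odot>\<^bsub>P\<^esub> f \<in> carrier P" if "a \<in> carrier A" "f \<in> carrier P" for a f
    by (rule P.smult_closed) (use that in simp_all)
  show ?thesis unfolding tensor_rels_def Let_def
    by (intro Un_least subsetI; elim CollectE exE conjE; simp only:;
        intro F.M.minus_closed F.M.a_closed F.smult_closed s P.M.a_closed N.M.a_closed PA N.smult_closed unit_closed;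
        assumption?)
qed

lemma K_quot: "quotient_module k F K"
  unfolding tensor_ker_def by (rule submodule_gen_quotient_module[OF lF rels_sub])

lemma flat_eq_diff:
  assumes "x \<in> carrier F" "y \<in> carrier F" "flat x = flat y"
  shows "x \<ominus>\<^bsub>F\<^esub> y \<in> {c \<in> carrier F. flat c = \<zero>\<^bsub>free_module k B\<^esub>}"
proof -
  interpret F: left_module k F by (rule lF)
  interpret Bk: left_module k "free_module k B" by (rule lB)
  have "flat (x \<ominus>\<^bsub>F\<^esub> y) = flat y \<ominus>\<^bsub>free_module k B\<^esub> flat y"
    using lin_maps_diff[OF lF lB flat_lin assms(1,2)] assms(3) by (simp only:)
  also have "\<dots> = \<zero>\<^bsub>free_module k B\<^esub>"
    unfolding a_minus_def by (rule Bk.M.r_neg[OF lin_maps_closed[OF flat_lin assms(2)]])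
  finally show ?thesis using F.M.minus_closed[OF assms(1,2)] by (simp only: mem_Collect_eq)
qed

text \<open>The kernel of \<open>flat\<close> is a submodule, so it is enough that it contains the
  generating relations.\<close>

lemma K_flat: "c \<in> K \<Longrightarrow> flat c = \<zero>\<^bsub>free_module k B\<^esub>"
proof -
  let ?Z = "{c \<in> carrier F. flat c = \<zero>\<^bsub>free_module k B\<^esub>}"
  interpret F: left_module k F by (rule lF)
  interpret Bk: left_module k "free_module k B" by (rule lB)
  interpret P: left_module "opposite A" P by (rule lP)
  interpret N: left_module A N by (rule N_left)
  have "quotient_module k F ?Z"
  proof (intro quotient_module.intro quotient_module_axioms.intro lF)
    show "\<zero>\<^bsub>F\<^esub> \<in> ?Z" using lin_maps_zero[OF lF lB flat_lin] F.M.zero_closed by (simp only: mem_Collect_eq)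
    show "x \<oplus>\<^bsub>F\<^esub> y \<in> ?Z" if "x \<in> ?Z" "y \<in> ?Z" for x y
    proof -
      have *: "x \<in> carrier F" "y \<in> carrier F" "flat x = \<zero>\<^bsub>free_module k B\<^esub>" "flat y = \<zero>\<^bsub>free_module k B\<^esub>"
        using that by (simp_all only: mem_Collect_eq)
      show ?thesis
        unfolding mem_Collect_eq lin_maps_add[OF flat_lin *(1,2)] *(3,4) Bk.M.l_zero[OF Bk.M.zero_closed]
        using F.M.a_closed[OF *(1,2)] by (rule conjI) (rule refl)
    qed
    show "a \<odot>\<^bsub>F\<^esub> x \<in> ?Z" if "a \<in> carrier k" "x \<in> ?Z" for a x
    proof -
      have *: "x \<in> carrier F" "flat x = \<zero>\<^bsub>free_module k B\<^esub>" using that by (simp_all only: mem_Collect_eq)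
      show ?thesis
        unfolding mem_Collect_eq lin_maps_smult[OF flat_lin that(1) *(1)] *(2) Bk.smult_r_null[OF that(1)]
        using F.smult_closed[OF that(1) *(1)] by (rule conjI) (rule refl)
    qed
  qed (rule Collect_restrict)
  then have Z: "submodule ?Z k F" by (rule quotient_module.submodule)
  have s: "basis_vec k (f, r) \<in> carrier F" if "f \<in> carrier P" "r \<in> carrier N" for f r
    using basis_F that by (simp add: N_carrier)
  have PA: "a \<odot>\<^bsub>P\<^esub> f \<in> carrier P" if "a \<in> carrier A" "f \<in> carrier P" for a f
    by (rule P.smult_closed) (use that in simp_all)
  have fb: "flat (basis_vec k (f, r)) b = \<epsilon> (f b) \<otimes>\<^bsub>k\<^esub> r" if "f \<in> carrier P" "r \<in> carrier N" for f r b
    using flat_basis that by (simp add: N_carrier)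
  have fa: "flat (x \<oplus>\<^bsub>F\<^esub> y) b = flat x b \<oplus>\<^bsub>k\<^esub> flat y b" if "x \<in> carrier F" "y \<in> carrier F" for x y b
    using lin_maps_add[OF flat_lin that] by (simp only: free_module_simps)
  have fs: "flat (r \<odot>\<^bsub>F\<^esub> x) b = r \<otimes>\<^bsub>k\<^esub> flat x b" if "r \<in> carrier k" "x \<in> carrier F" for r x b
    using lin_maps_smult[OF flat_lin that] by (simp only: free_module_simps)
  \<comment> \<open>\<open>r1\<close> to \<open>r4\<close> follow the four families in
    \<open>tensor_rels\<close>. The last two hold because \<open>\<epsilon>\<close> is
    multiplicative and sends a scalar multiple of the unit to that scalar.\<close>
  have r1: "flat (basis_vec k (m \<oplus>\<^bsub>P\<^esub> m', n)) = flat (basis_vec k (m, n) \<oplus>\<^bsub>F\<^esub> basis_vec k (m', n))"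
    if "m \<in> carrier P" "m' \<in> carrier P" "n \<in> carrier N" for m m' n
    by (rule ext, subst fa[OF s s], (rule that)+, subst (1 2 3) fb, (rule that P.M.a_closed)+)
      (use that P_closed[OF that(1)] P_closed[OF that(2)] in \<open>simp add: N_carrier \<epsilon>_add k.l_distr\<close>)
  have r2: "flat (basis_vec k (m, n \<oplus>\<^bsub>N\<^esub> n')) = flat (basis_vec k (m, n) \<oplus>\<^bsub>F\<^esub> basis_vec k (m, n'))"
    if "m \<in> carrier P" "n \<in> carrier N" "n' \<in> carrier N" for m n n'
    by (rule ext, subst fa[OF s s], (rule that)+, subst (1 2 3) fb, (rule that N.M.a_closed)+)
      (use that P_closed[OF that(1)] in \<open>simp add: N_carrier N_add k.r_distr\<close>)
  have r3: "flat (basis_vec k (a \<odot>\<^bsub>P\<^esub> m, n)) = flat (basis_vec k (m, a \<odot>\<^bsub>N\<^esub> n))"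
    if "a \<in> carrier A" "m \<in> carrier P" "n \<in> carrier N" for a m n
    by (rule ext, subst (1 2) fb, (rule that PA N.smult_closed)+)
      (use that P_closed[OF that(2)] in \<open>simp add: N_carrier N_smult \<epsilon>_mult k.m_assoc\<close>)
  have r4: "flat (r \<odot>\<^bsub>F\<^esub> basis_vec k (m, n)) = flat (basis_vec k ((r \<odot>\<^bsub>A\<^esub> \<one>\<^bsub>A\<^esub>) \<odot>\<^bsub>P\<^esub> m, n))"
    if "r \<in> carrier k" "m \<in> carrier P" "n \<in> carrier N" for r m n
    by (rule ext, subst fs[OF _ s], (rule that)+, subst (1 2) fb, (rule that PA unit_closed)+)
      (use that P_closed[OF that(2)] in \<open>simp add: N_carrier unit_closed \<epsilon>_unit \<epsilon>_mult k.m_ac\<close>)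
  have "tensor_rels k A P N \<subseteq> ?Z"
    unfolding tensor_rels_def Let_def
    by (intro Un_least subsetI; elim CollectE exE conjE; simp only:;
        rule flat_eq_diff;
        (intro F.M.a_closed F.smult_closed s P.M.a_closed N.M.a_closed PA N.smult_closed unit_closed r1 r2 r3 r4;
          assumption)?)
  then have "K \<subseteq> ?Z" unfolding tensor_ker_def submodule_gen_def using Z by (intro Inter_lower) simp
  then show "c \<in> K \<Longrightarrow> flat c = \<zero>\<^bsub>free_module k B\<^esub>" by (blast dest: subsetD)
qed

lemma coset_lin: "(\<lambda>c. K +>\<^bsub>F\<^esub> c) \<in> lin_maps k F (tensor k A P N)"
proof -
  interpret K: quotient_module k F K by (rule K_quot)
  show ?thesis unfolding tensor_def
  proof (rule lin_mapsI)
    show "K +>\<^bsub>F\<^esub> x \<in> carrier (quot_module F K)" if "x \<in> carrier F" for x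
      unfolding K.quot_carrier using that by (rule imageI)
  qed (rule K.quot_add[symmetric] K.quot_smult[symmetric]; assumption)+
qed

lemma tensor_left_module: "left_module k (tensor k A P N)"
  unfolding tensor_def by (rule quotient_module.quot_left_module[OF K_quot])

text \<open>Modulo the relations, every symbol is a combination of symbols pairing a basis vector
  with 1: coefficients in \<open>A\<close> cross the tensor sign through \<open>\<epsilon>\<close>
  and become scalars of \<open>k\<close>.\<close>

lemma coset_sharp_flat:
  assumes "c \<in> carrier F"
  shows "K +>\<^bsub>F\<^esub> c = K +>\<^bsub>F\<^esub> sharp (flat c)"
proof (rule lin_maps_basis_ext[OF tensor_left_module coset_lin
      lin_maps_comp[OF lin_maps_comp[OF flat_lin sharp_lin] coset_lin] _ assms])
  interpret F: left_module k F by (rule lF)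
  interpret K: quotient_module k F K by (rule K_quot)
  interpret Bk: left_module k "free_module k B" by (rule lB)
  interpret P: left_module "opposite A" P by (rule lP)
  interpret N: left_module A N by (rule N_left)
  interpret T: left_module k "tensor k A P N" by (rule tensor_left_module)
  let ?cl = "\<lambda>c. K +>\<^bsub>F\<^esub> c" and ?T = "tensor k A P N" and ?s = "\<lambda>f r. basis_vec k (f, r)"
  note s = basis_F
  have PA: "a \<odot>\<^bsub>P\<^esub> f \<in> carrier P" if "a \<in> carrier A" "f \<in> carrier P" for a f
    by (rule P.smult_closed) (use that in simp_all)
  have rel: "x \<ominus>\<^bsub>F\<^esub> y \<in> tensor_rels k A P N \<Longrightarrow> x \<in> carrier F \<Longrightarrow> y \<in> carrier F \<Longrightarrow> ?cl x = ?cl y" for x y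
    by (subst K.coset_eq_iff) (auto simp only: tensor_ker_def submodule_gen_def)
  have cl: "?cl x \<in> carrier ?T" if "x \<in> carrier F" for x by (rule lin_maps_closed[OF coset_lin that])
  have A1: "?cl (?s (f \<oplus>\<^bsub>P\<^esub> g) r) = ?cl (?s f r) \<oplus>\<^bsub>?T\<^esub> ?cl (?s g r)"
    if "f \<in> carrier P" "g \<in> carrier P" "r \<in> carrier k" for f g r
  proof -
    have "?cl (?s (f \<oplus>\<^bsub>P\<^esub> g) r) = ?cl (?s f r \<oplus>\<^bsub>F\<^esub> ?s g r)"
      by (rule rel) (unfold tensor_rels_def Let_def, (use that N_carrier in blast),
          (rule s F.M.a_closed P.M.a_closed that)+)
    also have "\<dots> = ?cl (?s f r) \<oplus>\<^bsub>?T\<^esub> ?cl (?s g r)" by (rule lin_maps_add[OF coset_lin]) (rule s that)+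
    finally show ?thesis .
  qed
  have A3: "?cl (?s (a \<odot>\<^bsub>P\<^esub> f) r) = ?cl (?s f (\<epsilon> a \<otimes>\<^bsub>k\<^esub> r))"
    if "a \<in> carrier A" "f \<in> carrier P" "r \<in> carrier k" for f a r
  proof -
    have "?cl (?s (a \<odot>\<^bsub>P\<^esub> f) r) = ?cl (?s f (a \<odot>\<^bsub>N\<^esub> r))"
      by (rule rel) (unfold tensor_rels_def Let_def, (use that N_carrier in blast),
          (rule s PA N.smult_closed[unfolded N_carrier] that)+)
    then show ?thesis using that by (simp only: N_smult)
  qed
  have A4: "t \<odot>\<^bsub>?T\<^esub> ?cl (?s f r) = ?cl (?s ((t \<odot>\<^bsub>A\<^esub> \<one>\<^bsub>A\<^esub>) \<odot>\<^bsub>P\<^esub> f) r)"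
    if "t \<in> carrier k" "f \<in> carrier P" "r \<in> carrier k" for f t r
  proof -
    have "?cl (t \<odot>\<^bsub>F\<^esub> ?s f r) = ?cl (?s ((t \<odot>\<^bsub>A\<^esub> \<one>\<^bsub>A\<^esub>) \<odot>\<^bsub>P\<^esub> f) r)"
      by (rule rel) (unfold tensor_rels_def Let_def, (use that N_carrier in blast),
          (rule s PA F.smult_closed unit_closed that)+)
    then show ?thesis using lin_maps_smult[OF coset_lin that(1) s[OF that(2,3)]] by (simp only:)
  qed
  \<comment> \<open>The scalar \<open>t\<close> acts as a multiple of the unit of \<open>A\<close>,
    which crosses to the right-hand factor, where \<open>\<epsilon>_unit\<close> turns it back into
    \<open>t\<close>.\<close>
  have A5: "?cl (?s f t) = t \<odot>\<^bsub>?T\<^esub> ?cl (?s f \<one>\<^bsub>k\<^esub>)" if "f \<in> carrier P" "t \<in> carrier k" for f t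
    unfolding A4[OF that(2,1) k.one_closed] A3[OF unit_closed[OF that(2)] that(1) k.one_closed]
    using that by (simp add: \<epsilon>_unit)
  have gen: "?cl (?s f r) = ?cl (sharp (\<lambda>b. \<epsilon> (f b) \<otimes>\<^bsub>k\<^esub> r))" if "f \<in> carrier P" and r: "r \<in> carrier k" for f r
    using op that(1)
  proof (induction f rule: free_module_induct)
    case zero
    have z: "(\<lambda>_. \<zero>\<^bsub>opposite A\<^esub>) \<in> carrier P" using P.M.zero_closed by simp
    have "(\<lambda>_. \<zero>\<^bsub>opposite A\<^esub>) \<oplus>\<^bsub>P\<^esub> (\<lambda>_. \<zero>\<^bsub>opposite A\<^esub>) = (\<lambda>_. \<zero>\<^bsub>opposite A\<^esub>)" by simp
    \<comment> \<open>By additivity the class of a symbol with zero vector equals its own double,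
      hence is zero.\<close>
    then have "?cl (?s (\<lambda>_. \<zero>\<^bsub>opposite A\<^esub>) r) = \<zero>\<^bsub>?T\<^esub>"
      using A1[OF z z r] cl[OF s[OF z r]] T.M.add.r_cancel_one' by metis
    moreover have "(\<lambda>b. \<epsilon> \<zero>\<^bsub>opposite A\<^esub> \<otimes>\<^bsub>k\<^esub> r) = \<zero>\<^bsub>free_module k B\<^esub>" using r by (simp add: \<epsilon>_zero)
    then have "?cl (sharp (\<lambda>b. \<epsilon> \<zero>\<^bsub>opposite A\<^esub> \<otimes>\<^bsub>k\<^esub> r)) = \<zero>\<^bsub>?T\<^esub>"
      using lin_maps_zero[OF lB lF sharp_lin] lin_maps_zero[OF lF tensor_left_module coset_lin]
      by (simp only:)
    ultimately show ?case by (simp only:)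
  next
    case (step b a g)
    have a: "a \<in> carrier A" using step(2) by simp
    have e: "basis_vec (opposite A) b \<in> carrier P" by (rule basis_vec_in_free[OF op step(1)])
    have e': "basis_vec k b \<in> carrier (free_module k B)" by (rule basis_vec_in_free[OF k.ring_axioms step(1)])
    have ar: "\<epsilon> a \<otimes>\<^bsub>k\<^esub> r \<in> carrier k" using a r by simp
    have gv: "(\<lambda>b. \<epsilon> (g b) \<otimes>\<^bsub>k\<^esub> r) \<in> carrier (free_module k B)" by (rule flat_val[OF step(3) r])
    have "(\<lambda>b'. \<epsilon> ((a \<odot>\<^bsub>P\<^esub> basis_vec (opposite A) b \<oplus>\<^bsub>P\<^esub> g) b') \<otimes>\<^bsub>k\<^esub> r)
        = (\<epsilon> a \<otimes>\<^bsub>k\<^esub> r) \<odot>\<^bsub>free_module k B\<^esub> basis_vec k b \<oplus>\<^bsub>free_module k B\<^esub> (\<lambda>b. \<epsilon> (g b) \<otimes>\<^bsub>k\<^esub> r)"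
      using a r P_closed[OF step(3)] by (intro ext) (auto simp: basis_vec_def \<epsilon>_add \<epsilon>_zero k.l_distr)
    then have R: "?cl (sharp (\<lambda>b'. \<epsilon> ((a \<odot>\<^bsub>P\<^esub> basis_vec (opposite A) b \<oplus>\<^bsub>P\<^esub> g) b') \<otimes>\<^bsub>k\<^esub> r))
        = (\<epsilon> a \<otimes>\<^bsub>k\<^esub> r) \<odot>\<^bsub>?T\<^esub> ?cl (?s (basis_vec (opposite A) b) \<one>\<^bsub>k\<^esub>)
          \<oplus>\<^bsub>?T\<^esub> ?cl (sharp (\<lambda>b. \<epsilon> (g b) \<otimes>\<^bsub>k\<^esub> r))"
      using lin_maps_add[OF lin_maps_comp[OF sharp_lin coset_lin] Bk.smult_closed[OF ar e'] gv]
        lin_maps_smult[OF lin_maps_comp[OF sharp_lin coset_lin] ar e'] sharp_basis[OF step(1)]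
      by (simp only:)
    show ?case unfolding R A1[OF PA[OF a e] step(3) r] A3[OF a e r] A5[OF e ar] step.IH ..
  qed
  fix x assume "x \<in> carrier P \<times> carrier N"
  then obtain f r where "x = (f, r)" "f \<in> carrier P" "r \<in> carrier k" by (auto simp: N_carrier)
  then show "?cl (basis_vec k x) = ?cl (sharp (flat (basis_vec k x)))"
    using gen flat_basis by (simp only:)
qed

lemma tclass_lin: "tclass \<in> lin_maps k (free_module k B) (tensor k A P N)"
  unfolding tclass_def[abs_def] by (rule lin_maps_comp[OF sharp_lin coset_lin])

lemma tclass_bij: "bij_betw tclass (carrier (free_module k B)) (carrier (tensor k A P N))"
proof -
  interpret K: quotient_module k F K by (rule K_quot)
  interpret Bk: left_module k "free_module k B" by (rule lB)
  note sc = lin_maps_closed[OF sharp_lin] and fc = lin_maps_closed[OF flat_lin]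
  have inj: "g = g'" if g: "g \<in> carrier (free_module k B)" "g' \<in> carrier (free_module k B)" "tclass g = tclass g'" for g g'
  proof -
    have "sharp g \<ominus>\<^bsub>F\<^esub> sharp g' \<in> K"
      using that(3) K.coset_eq_iff[OF sc[OF g(1)] sc[OF g(2)]] unfolding tclass_def by (simp only:)
    then have "flat (sharp g \<ominus>\<^bsub>F\<^esub> sharp g') = \<zero>\<^bsub>free_module k B\<^esub>" by (rule K_flat)
    then have "g \<ominus>\<^bsub>free_module k B\<^esub> g' = \<zero>\<^bsub>free_module k B\<^esub>"
      using lin_maps_diff[OF lF lB flat_lin sc[OF g(1)] sc[OF g(2)]] flat_sharp[OF g(1)] flat_sharp[OF g(2)]
      by (simp only:)
    then show ?thesis using Bk.diff_add_cancel[OF g(1,2)] Bk.M.l_zero[OF g(2)] by (simp only:)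
  qed
  have "carrier (tensor k A P N) \<subseteq> tclass ` carrier (free_module k B)"
    unfolding tensor_def K.quot_carrier tclass_def[abs_def]
  proof (rule image_subsetI)
    fix c assume c: "c \<in> carrier F"
    show "K +>\<^bsub>F\<^esub> c \<in> (\<lambda>g. K +>\<^bsub>F\<^esub> sharp g) ` carrier (free_module k B)"
      by (rule image_eqI[of _ _ "flat c"]) (rule coset_sharp_flat[OF c], rule fc[OF c])
  qed
  moreover have "tclass ` carrier (free_module k B) \<subseteq> carrier (tensor k A P N)"
    by (rule image_subsetI) (rule lin_maps_closed[OF tclass_lin])
  moreover have "inj_on tclass (carrier (free_module k B))" by (rule inj_onI) (rule inj)
  ultimately show ?thesis unfolding bij_betw_def by simp
qed

end

text \<open>In the coordinates given by \<open>tclass\<close>, tensoring \<open>\<phi>\<close> with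
  \<open>N\<close> is \<open>change\<close>. The complex that defines Tor thereby becomes the
  base-changed resolution.\<close>

lemma tensor_map_tclass:
  assumes \<phi>: "\<phi> \<in> lin_maps (opposite A) (free_module (opposite A) B) (free_module (opposite A) B')"
    and g: "g \<in> carrier (free_module k B)"
  shows "tensor_map k A (free_module (opposite A) B') N \<phi> (tclass B g) = tclass B' (change B' \<phi> g)"
proof -
  let ?F = "\<lambda>B. free_module k (carrier (free_module (opposite A) B) \<times> carrier N)"
  let ?K = "\<lambda>B. tensor_ker k A (free_module (opposite A) B) N"
  let ?L = "lin_ext k (?F B') (\<lambda>(m, n). basis_vec k (\<phi> m, n))"
  interpret K: quotient_module k "?F B" "?K B" by (rule K_quot)
  interpret K': quotient_module k "?F B'" "?K B'" by (rule K_quot)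
  have v: "(\<lambda>(m, n). basis_vec k (\<phi> m, n)) \<in> carrier (free_module (opposite A) B) \<times> carrier N \<rightarrow> carrier (?F B')"
    using basis_F lin_maps_closed[OF \<phi>] by (auto simp: N_carrier)
  have L: "?L \<in> lin_maps k (?F B) (?F B')" by (rule left_module.lin_ext_lin[OF lF v])
  note Lc = lin_maps_closed[OF L]
  have flatL: "flat B' (?L c) = change B' \<phi> (flat B c)" if "c \<in> carrier (?F B)" for c
  proof (rule lin_maps_basis_ext[OF lB lin_maps_comp[OF L flat_lin] lin_maps_comp[OF flat_lin change(1)[OF \<phi>]] _ that])
    fix x assume x: "x \<in> carrier (free_module (opposite A) B) \<times> carrier N"
    then obtain f r where fr: "x = (f, r)" "f \<in> carrier (free_module (opposite A) B)" "r \<in> carrier k"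
      by (auto simp: N_carrier)
    have "flat B (basis_vec k x) = r \<odot>\<^bsub>free_module k B\<^esub> (\<epsilon> \<circ> f)"
      unfolding fr(1) flat_basis[OF fr(2,3)] using P_closed[OF fr(2)] fr(3) by (auto simp: k.m_comm)
    then have "change B' \<phi> (flat B (basis_vec k x)) = r \<odot>\<^bsub>free_module k B'\<^esub> (\<epsilon> \<circ> \<phi> f)"
      using lin_maps_smult[OF change(1)[OF \<phi>] fr(3) comp_closed[OF fr(2)]] change(2)[OF \<phi> fr(2)]
      by (simp only:)
    also have "\<dots> = flat B' (basis_vec k (\<phi> f, r))"
      unfolding flat_basis[OF lin_maps_closed[OF \<phi> fr(2)] fr(3)]
      using P_closed[OF lin_maps_closed[OF \<phi> fr(2)]] fr(3) by (auto simp: k.m_comm)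
    also have "basis_vec k (\<phi> f, r) = ?L (basis_vec k x)"
      using left_module.lin_ext_basis_vec[OF lF v x] fr(1) by simp
    finally show "flat B' (?L (basis_vec k x)) = change B' \<phi> (flat B (basis_vec k x))" by (rule sym)
  qed
  have cosL: "?K B' +>\<^bsub>?F B'\<^esub> ?L c = tclass B' (change B' \<phi> (flat B c))" if "c \<in> carrier (?F B)" for c
    unfolding tclass_def coset_sharp_flat[OF Lc[OF that]] flatL[OF that] ..
  have sg: "sharp B g \<in> carrier (?F B)" by (rule lin_maps_closed[OF sharp_lin g])
  have "tensor_map k A (free_module (opposite A) B') N \<phi> (tclass B g)
      = (\<Union>c\<in>?K B +>\<^bsub>?F B\<^esub> sharp B g. ?K B' +>\<^bsub>?F B'\<^esub> ?L c)"
    unfolding tensor_map_def Let_def tclass_def ..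
  also have "\<dots> = ?K B' +>\<^bsub>?F B'\<^esub> ?L (sharp B g)"
  \<comment> \<open>Two representatives of one class have the same \<open>flat\<close>, since
    \<open>tclass\<close> is injective, and by \<open>cosL\<close> the value depends on
    \<open>flat\<close> alone.\<close>
  proof (rule K.coset_Union[OF sg])
    fix c assume c: "c \<in> carrier (?F B)" "c \<ominus>\<^bsub>?F B\<^esub> sharp B g \<in> ?K B"
    have eq: "?K B +>\<^bsub>?F B\<^esub> c = ?K B +>\<^bsub>?F B\<^esub> sharp B g" using K.coset_eq_iff[OF c(1) sg] c(2) by blast
    have "tclass B (flat B c) = tclass B (flat B (sharp B g))"
      unfolding tclass_def coset_sharp_flat[OF c(1), symmetric] coset_sharp_flat[OF sg, symmetric] by (rule eq)
    then have "flat B c = flat B (sharp B g)"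
      using tclass_bij lin_maps_closed[OF flat_lin c(1)] lin_maps_closed[OF flat_lin sg]
      unfolding bij_betw_def by (blast dest: inj_onD)
    then show "?K B' +>\<^bsub>?F B'\<^esub> ?L c = ?K B' +>\<^bsub>?F B'\<^esub> ?L (sharp B g)"
      unfolding cosL[OF c(1)] cosL[OF sg] by (simp only:)
  qed
  also have "\<dots> = tclass B' (change B' \<phi> g)" unfolding cosL[OF sg] flat_sharp[OF g] ..
  finally show ?thesis .
qed

text \<open>\<open>Tor\<close> is tied to one chosen resolution with bases in a fixed type. Here it
  may be computed from any free resolution, with bases in any type, which admits the bar resolution
  as well as a resolution transported from another algebra.\<close>

theorem Tor_iso:
  assumes r: "free_resolution (opposite A) N B d e"
  shows "module_iso k (Tor k A N N p) (homology (\<lambda>p. free_module k (B p)) (\<lambda>p. change (B p) (d p)) p)"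
    and Tor_left_module: "left_module k (Tor k A N N p)"
proof -
  obtain B' d' where ch: "chosen_resolution (opposite A) N = (B', d')" by (cases "chosen_resolution (opposite A) N")
  have "\<exists>x. (case x of (B, d) \<Rightarrow> \<exists>e. free_resolution (opposite A) N (B :: nat \<Rightarrow> ('k, 'a) gen set) d e)"
    using free_resolution_exists[OF N_right] by auto
  then have "case chosen_resolution (opposite A) N of (B, d) \<Rightarrow> \<exists>e. free_resolution (opposite A) N B d e"
    unfolding chosen_resolution_def by (rule someI_ex)
  then obtain e' where r': "free_resolution (opposite A) N B' d' e'" unfolding ch by auto
  let ?P = "\<lambda>p. free_module (opposite A) (B' p)"
  let ?C = "\<lambda>p. free_module k (B' p)" and ?d = "\<lambda>p. change (B' p) (d' p)"
  let ?D = "\<lambda>p. tensor k A (?P p) N" and ?d' = "\<lambda>p. tensor_map k A (?P p) N (d' p)"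
  have T: "Tor k A N N p = homology ?D ?d' p" unfolding Tor_def ch by simp
  have D: "chain_complex k ?D ?d'" and iso: "module_iso k (homology ?C ?d p) (homology ?D ?d' p)"
    by (rule homology_iso_bij[where u = "\<lambda>p. tclass (B' p)", OF change_complex[OF r'] tensor_left_module
          tclass_lin tclass_bij tensor_map_tclass[OF free_resolutionD(1)[OF r']]], assumption)+
  have "module_iso k (Tor k A N N p) (homology ?C ?d p)"
    unfolding T by (rule module_iso_sym[OF homology_left_module[OF change_complex[OF r']] iso])
  then show "module_iso k (Tor k A N N p) (homology (\<lambda>p. free_module k (B p)) (\<lambda>p. change (B p) (d p)) p)"
    by (rule module_iso_trans[OF _ change_homology_iso[OF N_right r' r]])
  show "left_module k (Tor k A N N p)" unfolding T by (rule homology_left_module[OF D])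
qed

end

section \<open>Twisted monoid algebras\<close>

lemma lin_maps_cong:
  assumes "left_module R M" "f \<in> lin_maps R M N" "\<And>x. x \<in> carrier M \<Longrightarrow> g x = f x"
  shows "g \<in> lin_maps R M N"
proof -
  interpret M: left_module R M by fact
  show ?thesis using assms(2,3)
    by (intro lin_mapsI) (auto simp: lin_maps_closed lin_maps_add lin_maps_smult)
qed

lemma lin_maps_scale:
  assumes "cring k" "left_module k N" "f \<in> lin_maps k M N" "a \<in> carrier k"
  shows "(\<lambda>x. a \<odot>\<^bsub>N\<^esub> f x) \<in> lin_maps k M N"
proof -
  interpret k: cring k by fact
  interpret N: left_module k N by fact
  show ?thesis using assms(3,4)
    by (intro lin_mapsI)
      (auto simp: lin_maps_closed lin_maps_add lin_maps_smult N.smult_r_distr N.smult_assoc[symmetric] k.m_comm)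
qed

lemma lin_maps_const_zero:
  assumes "left_module R N" shows "(\<lambda>x. \<zero>\<^bsub>N\<^esub>) \<in> lin_maps R M N"
proof -
  interpret N: left_module R N by fact
  show ?thesis by (intro lin_mapsI) (auto simp: N.smult_r_null)
qed

text \<open>The common shape of Brauer algebras and group algebras: a monoid \<open>S\<close> whose
  product carries a scalar \<open>lam\<close>, where \<open>cocycle\<close> is the scalar half of
  associativity. \<open>Q\<close> marks the basis elements acting as 1 on the trivial module;
  \<open>Q_cmp\<close> and \<open>Q_lam\<close> make this action multiplicative. The product
  \<open>b\<close> is a separate parameter, constrained on \<open>S\<close> only, so that the locale
  matches the expressions in \<open>brauer_algebra\<close> and \<open>group_algebra\<close> as they
  are written.\<close>

locale twisted_monoid_algebra =
  fixes k :: "('k, 'e) ring_scheme" and S :: "'x set" and cmp :: "'x \<Rightarrow> 'x \<Rightarrow> 'x"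
    and lam :: "'x \<Rightarrow> 'x \<Rightarrow> 'k" and u :: 'x and Q :: "'x \<Rightarrow> bool" and b
  assumes k: "cring k"
    and cmp_closed: "x \<in> S \<Longrightarrow> y \<in> S \<Longrightarrow> cmp x y \<in> S"
    and lam_closed: "x \<in> S \<Longrightarrow> y \<in> S \<Longrightarrow> lam x y \<in> carrier k"
    and u: "u \<in> S" "Q u"
    and cmp_u: "x \<in> S \<Longrightarrow> cmp u x = x" "x \<in> S \<Longrightarrow> cmp x u = x"
    and lam_u: "x \<in> S \<Longrightarrow> lam u x = \<one>\<^bsub>k\<^esub>" "x \<in> S \<Longrightarrow> lam x u = \<one>\<^bsub>k\<^esub>"
    and cmp_assoc: "x \<in> S \<Longrightarrow> y \<in> S \<Longrightarrow> z \<in> S \<Longrightarrow> cmp (cmp x y) z = cmp x (cmp y z)"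
    and cocycle: "x \<in> S \<Longrightarrow> y \<in> S \<Longrightarrow> z \<in> S \<Longrightarrow>
      lam x y \<otimes>\<^bsub>k\<^esub> lam (cmp x y) z = lam y z \<otimes>\<^bsub>k\<^esub> lam x (cmp y z)"
    and Q_cmp: "x \<in> S \<Longrightarrow> y \<in> S \<Longrightarrow> Q (cmp x y) \<longleftrightarrow> Q x \<and> Q y"
    and Q_lam: "x \<in> S \<Longrightarrow> y \<in> S \<Longrightarrow> Q x \<Longrightarrow> Q y \<Longrightarrow> lam x y = \<one>\<^bsub>k\<^esub>"
    and b: "x \<in> S \<Longrightarrow> y \<in> S \<Longrightarrow> b x y = lam x y \<odot>\<^bsub>free_module k S\<^esub> basis_vec k (cmp x y)"
begin

sublocale k: cring k by (rule k)

abbreviation "F \<equiv> free_module k S"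
abbreviation "A \<equiv> based_algebra k S b u"
abbreviation "N \<equiv> scalar_module k Q"

lemma lF: "left_module k F" by (rule free_module_left_module[OF k.ring_axioms])
sublocale F: left_module k F by (rule lF)

lemma e: "x \<in> S \<Longrightarrow> basis_vec k x \<in> carrier F" by (rule basis_vec_in_free[OF k.ring_axioms])

lemma A_simps:
  "carrier A = carrier F" "\<zero>\<^bsub>A\<^esub> = \<zero>\<^bsub>F\<^esub>" "x \<oplus>\<^bsub>A\<^esub> y = x \<oplus>\<^bsub>F\<^esub> y" "\<one>\<^bsub>A\<^esub> = basis_vec k u" "a \<odot>\<^bsub>A\<^esub> x = a \<odot>\<^bsub>F\<^esub> x"
  "f \<otimes>\<^bsub>A\<^esub> g = lin_ext k F (\<lambda>x. lin_ext k F (b x) g) f"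
  by (simp_all add: based_algebra_def free_module_def)

lemma b_closed: "x \<in> S \<Longrightarrow> y \<in> S \<Longrightarrow> b x y \<in> carrier F"
  unfolding b by (rule F.smult_closed[OF lam_closed e[OF cmp_closed]])

lemma bx_lin: "x \<in> S \<Longrightarrow> lin_ext k F (b x) \<in> lin_maps k F F"
  by (rule F.lin_ext_lin) (rule Pi_I, rule b_closed)

lemma bg_closed: "g \<in> carrier F \<Longrightarrow> (\<lambda>x. lin_ext k F (b x) g) \<in> S \<rightarrow> carrier F"
  by (rule Pi_I) (rule lin_maps_closed[OF bx_lin])

lemma mult_left_lin: "g \<in> carrier F \<Longrightarrow> (\<lambda>f. f \<otimes>\<^bsub>A\<^esub> g) \<in> lin_maps k F F"
  unfolding A_simps by (rule F.lin_ext_lin[OF bg_closed])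

lemma mult_basis_left: "x \<in> S \<Longrightarrow> g \<in> carrier F \<Longrightarrow> basis_vec k x \<otimes>\<^bsub>A\<^esub> g = lin_ext k F (b x) g"
  unfolding A_simps by (rule F.lin_ext_basis_vec[OF bg_closed])

lemma mult_basis: "x \<in> S \<Longrightarrow> y \<in> S \<Longrightarrow> basis_vec k x \<otimes>\<^bsub>A\<^esub> basis_vec k y = lam x y \<odot>\<^bsub>F\<^esub> basis_vec k (cmp x y)"
  unfolding mult_basis_left[OF _ e] b[symmetric]
  by (rule F.lin_ext_basis_vec[where B = S]) (rule Pi_I, rule b_closed)

text \<open>The product is by definition a linear extension in the first factor; linearity in the
  second is obtained by induction on the first.\<close>

lemma mult_right_lin: "f \<in> carrier F \<Longrightarrow> (\<lambda>g. f \<otimes>\<^bsub>A\<^esub> g) \<in> lin_maps k F F"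
  using k.ring_axioms
proof (induction f rule: free_module_induct)
  case zero
  show ?case
  proof (rule lin_maps_cong[OF lF lin_maps_const_zero[OF lF]])
    show "(\<lambda>_. \<zero>\<^bsub>k\<^esub>) \<otimes>\<^bsub>A\<^esub> g = \<zero>\<^bsub>F\<^esub>" if "g \<in> carrier F" for g
      using lin_maps_zero[OF lF lF mult_left_lin[OF that]] by (simp only: free_module_simps)
  qed
next
  case (step x a f)
  note ex = e[OF step(1)]
  have l: "(\<lambda>g. a \<odot>\<^bsub>F\<^esub> (lin_ext k F (b x) g) \<oplus>\<^bsub>F\<^esub> f \<otimes>\<^bsub>A\<^esub> g) \<in> lin_maps k F F"
    by (rule F.lin_maps_plus[OF lF lin_maps_scale[OF k lF bx_lin[OF step(1)] step(2)] step.IH])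
  show ?case
  proof (rule lin_maps_cong[OF lF l])
    fix g assume g: "g \<in> carrier F"
    show "(a \<odot>\<^bsub>F\<^esub> basis_vec k x \<oplus>\<^bsub>F\<^esub> f) \<otimes>\<^bsub>A\<^esub> g = a \<odot>\<^bsub>F\<^esub> (lin_ext k F (b x) g) \<oplus>\<^bsub>F\<^esub> f \<otimes>\<^bsub>A\<^esub> g"
      unfolding lin_maps_add[OF mult_left_lin[OF g] F.smult_closed[OF step(2) ex] step(3)]
        lin_maps_smult[OF mult_left_lin[OF g] step(2) ex] mult_basis_left[OF step(1) g] ..
  qed
qed

lemma mult_closed: "f \<in> carrier F \<Longrightarrow> g \<in> carrier F \<Longrightarrow> f \<otimes>\<^bsub>A\<^esub> g \<in> carrier F"
  by (rule lin_maps_closed[OF mult_left_lin])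

lemma mult_assoc:
  assumes f: "f \<in> carrier F" and g: "g \<in> carrier F" and h: "h \<in> carrier F"
  shows "(f \<otimes>\<^bsub>A\<^esub> g) \<otimes>\<^bsub>A\<^esub> h = f \<otimes>\<^bsub>A\<^esub> (g \<otimes>\<^bsub>A\<^esub> h)"
proof (rule lin_maps_basis_ext[OF lF lin_maps_comp[OF mult_left_lin[OF g] mult_left_lin[OF h]]
      mult_left_lin[OF mult_closed[OF g h]] _ f])
  fix x assume x: "x \<in> S"
  note ex = e[OF x]
  show "(basis_vec k x \<otimes>\<^bsub>A\<^esub> g) \<otimes>\<^bsub>A\<^esub> h = basis_vec k x \<otimes>\<^bsub>A\<^esub> (g \<otimes>\<^bsub>A\<^esub> h)"
  proof (rule lin_maps_basis_ext[OF lF lin_maps_comp[OF mult_right_lin[OF ex] mult_left_lin[OF h]]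
        lin_maps_comp[OF mult_left_lin[OF h] mult_right_lin[OF ex]] _ g])
    fix y assume y: "y \<in> S"
    note ey = e[OF y]
    show "(basis_vec k x \<otimes>\<^bsub>A\<^esub> basis_vec k y) \<otimes>\<^bsub>A\<^esub> h = basis_vec k x \<otimes>\<^bsub>A\<^esub> (basis_vec k y \<otimes>\<^bsub>A\<^esub> h)"
    proof (rule lin_maps_basis_ext[OF lF mult_right_lin[OF mult_closed[OF ex ey]]
          lin_maps_comp[OF mult_right_lin[OF ey] mult_right_lin[OF ex]] _ h])
      fix z assume z: "z \<in> S"
      note ez = e[OF z]
      note c = cmp_closed[OF x y] cmp_closed[OF y z] lam_closed[OF x y] lam_closed[OF y z]
      show "(basis_vec k x \<otimes>\<^bsub>A\<^esub> basis_vec k y) \<otimes>\<^bsub>A\<^esub> basis_vec k z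
          = basis_vec k x \<otimes>\<^bsub>A\<^esub> (basis_vec k y \<otimes>\<^bsub>A\<^esub> basis_vec k z)"
      proof -
        have "(basis_vec k x \<otimes>\<^bsub>A\<^esub> basis_vec k y) \<otimes>\<^bsub>A\<^esub> basis_vec k z
            = (lam x y \<otimes>\<^bsub>k\<^esub> lam (cmp x y) z) \<odot>\<^bsub>F\<^esub> basis_vec k (cmp (cmp x y) z)"
          unfolding mult_basis[OF x y] lin_maps_smult[OF mult_left_lin[OF ez] c(3) e[OF c(1)]]
            mult_basis[OF c(1) z]
          by (rule F.smult_assoc[OF c(3) lam_closed[OF c(1) z] e[OF cmp_closed[OF c(1) z]], symmetric])
        moreover have "basis_vec k x \<otimes>\<^bsub>A\<^esub> (basis_vec k y \<otimes>\<^bsub>A\<^esub> basis_vec k z)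
            = (lam y z \<otimes>\<^bsub>k\<^esub> lam x (cmp y z)) \<odot>\<^bsub>F\<^esub> basis_vec k (cmp x (cmp y z))"
          unfolding mult_basis[OF y z] lin_maps_smult[OF mult_right_lin[OF ex] c(4) e[OF c(2)]]
            mult_basis[OF x c(2)]
          by (rule F.smult_assoc[OF c(4) lam_closed[OF x c(2)] e[OF cmp_closed[OF x c(2)]], symmetric])
        ultimately show ?thesis using cocycle[OF x y z] cmp_assoc[OF x y z] by (simp only:)
      qed
    qed
  qed
qed

lemma mult_one: "f \<in> carrier F \<Longrightarrow> basis_vec k u \<otimes>\<^bsub>A\<^esub> f = f" "f \<in> carrier F \<Longrightarrow> f \<otimes>\<^bsub>A\<^esub> basis_vec k u = f"
proof -
  note eu = e[OF u(1)]
  show "basis_vec k u \<otimes>\<^bsub>A\<^esub> f = f" if "f \<in> carrier F"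
    by (rule lin_maps_basis_ext[OF lF mult_right_lin[OF eu] lin_maps_id _ that])
      (simp only: mult_basis u lam_u cmp_u F.smult_one e)
  show "f \<otimes>\<^bsub>A\<^esub> basis_vec k u = f" if "f \<in> carrier F"
    by (rule lin_maps_basis_ext[OF lF mult_left_lin[OF eu] lin_maps_id _ that])
      (simp only: mult_basis u lam_u cmp_u F.smult_one e)
qed

lemma A_ring: "ring A"
proof (rule ringI)
  show "abelian_group A"
  proof (rule abelian_groupI, unfold A_simps(1-3))
    show "\<exists>y\<in>carrier F. y \<oplus>\<^bsub>F\<^esub> x = \<zero>\<^bsub>F\<^esub>" if "x \<in> carrier F" for x
      by (rule bexI[of _ "\<ominus>\<^bsub>F\<^esub> x"]) (rule F.M.l_neg[OF that], rule F.M.a_inv_closed[OF that])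
  qed (rule F.M.a_closed F.M.a_assoc F.M.a_comm F.M.l_zero F.M.zero_closed; assumption)+
  show "monoid A"
    by (rule monoidI, unfold A_simps(1) A_simps(4))
      (rule mult_closed mult_assoc mult_one e[OF u(1)]; assumption)+
  show "(x \<oplus>\<^bsub>A\<^esub> y) \<otimes>\<^bsub>A\<^esub> z = x \<otimes>\<^bsub>A\<^esub> z \<oplus>\<^bsub>A\<^esub> y \<otimes>\<^bsub>A\<^esub> z"
    if "x \<in> carrier A" "y \<in> carrier A" "z \<in> carrier A" for x y z
    using that unfolding A_simps(1,3) by (rule_tac lin_maps_add[OF mult_left_lin])
  show "z \<otimes>\<^bsub>A\<^esub> (x \<oplus>\<^bsub>A\<^esub> y) = z \<otimes>\<^bsub>A\<^esub> x \<oplus>\<^bsub>A\<^esub> z \<otimes>\<^bsub>A\<^esub> y"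
    if "x \<in> carrier A" "y \<in> carrier A" "z \<in> carrier A" for x y z
    using that unfolding A_simps(1,3) by (rule_tac lin_maps_add[OF mult_right_lin])
qed

definition \<epsilon> :: "('x \<Rightarrow> 'k) \<Rightarrow> 'k" where
  "\<epsilon> f = (\<Oplus>\<^bsub>k\<^esub>x\<in>{x. f x \<noteq> \<zero>\<^bsub>k\<^esub>}. f x \<otimes>\<^bsub>k\<^esub> (if Q x then \<one>\<^bsub>k\<^esub> else \<zero>\<^bsub>k\<^esub>))"

text \<open>\<open>k\<close> as a module over itself: the target that makes
  \<open>\<epsilon>\<close> a linear extension.\<close>

definition kk :: "('k, 'k) module" where
  "kk = \<lparr>carrier = carrier k, monoid.mult = monoid.mult k, monoid.one = \<one>\<^bsub>k\<^esub>,
      ring.zero = \<zero>\<^bsub>k\<^esub>, ring.add = add k, smult = monoid.mult k\<rparr>"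

lemma kk_simps: "carrier kk = carrier k" "\<zero>\<^bsub>kk\<^esub> = \<zero>\<^bsub>k\<^esub>" "x \<oplus>\<^bsub>kk\<^esub> y = x \<oplus>\<^bsub>k\<^esub> y" "x \<odot>\<^bsub>kk\<^esub> y = x \<otimes>\<^bsub>k\<^esub> y"
  by (simp_all add: kk_def)

lemma lkk: "left_module k kk"
proof -
  have "abelian_group kk"
  proof (rule abelian_groupI, unfold kk_simps)
    show "\<exists>y\<in>carrier k. y \<oplus>\<^bsub>k\<^esub> x = \<zero>\<^bsub>k\<^esub>" if "x \<in> carrier k" for x
      by (rule bexI[of _ "\<ominus>\<^bsub>k\<^esub> x"]) (use that in \<open>simp_all add: k.l_neg\<close>)
  qed (auto simp: k.a_ac)
  then show ?thesis
    by (intro left_module.intro left_module_axioms.intro k.ring_axioms)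
      (simp_all add: kk_simps k.l_distr k.r_distr k.m_assoc)
qed

lemma \<epsilon>_lin_ext: "\<epsilon> = lin_ext k kk (\<lambda>x. if Q x then \<one>\<^bsub>k\<^esub> else \<zero>\<^bsub>k\<^esub>)"
  by (rule ext) (simp add: \<epsilon>_def lin_ext_def finsum_def finprod_def kk_def)

lemma \<epsilon>_val: "(\<lambda>x. if Q x then \<one>\<^bsub>k\<^esub> else \<zero>\<^bsub>k\<^esub>) \<in> S \<rightarrow> carrier kk"
  by (auto simp: kk_simps)

lemma \<epsilon>_lin: "\<epsilon> \<in> lin_maps k F kk"
  unfolding \<epsilon>_lin_ext by (rule left_module.lin_ext_lin[OF lkk \<epsilon>_val])

lemma \<epsilon>_basis: "x \<in> S \<Longrightarrow> \<epsilon> (basis_vec k x) = (if Q x then \<one>\<^bsub>k\<^esub> else \<zero>\<^bsub>k\<^esub>)"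
  unfolding \<epsilon>_lin_ext by (rule left_module.lin_ext_basis_vec[OF lkk \<epsilon>_val])

lemma \<epsilon>_closed: "f \<in> carrier F \<Longrightarrow> \<epsilon> f \<in> carrier k"
  using lin_maps_closed[OF \<epsilon>_lin] by (simp only: kk_simps)

lemma \<epsilon>_mult:
  assumes f: "f \<in> carrier F" and g: "g \<in> carrier F"
  shows "\<epsilon> (f \<otimes>\<^bsub>A\<^esub> g) = \<epsilon> f \<otimes>\<^bsub>k\<^esub> \<epsilon> g"
proof -
  have l1: "(\<lambda>f. \<epsilon> f \<otimes>\<^bsub>k\<^esub> r) \<in> lin_maps k F kk" if r: "r \<in> carrier k" for r
    by (rule lin_maps_cong[OF lF lin_maps_scale[OF k lkk \<epsilon>_lin r]])
      (simp only: kk_simps k.m_comm[OF \<epsilon>_closed r])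
  have l2: "(\<lambda>f. r \<otimes>\<^bsub>k\<^esub> \<epsilon> f) \<in> lin_maps k F kk" if r: "r \<in> carrier k" for r
    using lin_maps_scale[OF k lkk \<epsilon>_lin r] by (simp only: kk_simps)
  show ?thesis
  proof (rule lin_maps_basis_ext[OF lkk lin_maps_comp[OF mult_left_lin[OF g] \<epsilon>_lin] l1[OF \<epsilon>_closed[OF g]] _ f])
    fix x assume x: "x \<in> S"
    show "\<epsilon> (basis_vec k x \<otimes>\<^bsub>A\<^esub> g) = \<epsilon> (basis_vec k x) \<otimes>\<^bsub>k\<^esub> \<epsilon> g"
    proof (rule lin_maps_basis_ext[OF lkk lin_maps_comp[OF mult_right_lin[OF e[OF x]] \<epsilon>_lin]
          l2[OF \<epsilon>_closed[OF e[OF x]]] _ g])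
      fix y assume y: "y \<in> S"
      show "\<epsilon> (basis_vec k x \<otimes>\<^bsub>A\<^esub> basis_vec k y) = \<epsilon> (basis_vec k x) \<otimes>\<^bsub>k\<^esub> \<epsilon> (basis_vec k y)"
        unfolding mult_basis[OF x y] lin_maps_smult[OF \<epsilon>_lin lam_closed[OF x y] e[OF cmp_closed[OF x y]]]
          \<epsilon>_basis[OF x] \<epsilon>_basis[OF y] \<epsilon>_basis[OF cmp_closed[OF x y]] kk_simps
        using lam_closed[OF x y] Q_lam[OF x y] Q_cmp[OF x y] by auto
    qed
  qed
qed

lemma augmented: "augmented_algebra k A N \<epsilon>"
proof (intro augmented_algebra.intro k A_ring)
  show "\<epsilon> \<in> ring_hom A k"
  proof (rule ring_hom_memI, unfold A_simps(1,3,4))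
    show "\<epsilon> (x \<otimes>\<^bsub>A\<^esub> y) = \<epsilon> x \<otimes>\<^bsub>k\<^esub> \<epsilon> y" if "x \<in> carrier F" "y \<in> carrier F" for x y
      using that by (rule \<epsilon>_mult)
    show "\<epsilon> (x \<oplus>\<^bsub>F\<^esub> y) = \<epsilon> x \<oplus>\<^bsub>k\<^esub> \<epsilon> y" if "x \<in> carrier F" "y \<in> carrier F" for x y
      using lin_maps_add[OF \<epsilon>_lin that] by (simp only: kk_simps)
    show "\<epsilon> (basis_vec k u) = \<one>\<^bsub>k\<^esub>" using \<epsilon>_basis u by simp
  qed (rule \<epsilon>_closed)
  show "r \<odot>\<^bsub>A\<^esub> \<one>\<^bsub>A\<^esub> \<in> carrier A" if "r \<in> carrier k" for r
    unfolding A_simps(1,4,5) by (rule F.smult_closed[OF that e[OF u(1)]])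
  show "\<epsilon> (r \<odot>\<^bsub>A\<^esub> \<one>\<^bsub>A\<^esub>) = r" if "r \<in> carrier k" for r
    unfolding A_simps(4,5) lin_maps_smult[OF \<epsilon>_lin that e[OF u(1)]] using that \<epsilon>_basis u by (simp add: kk_simps)
  show "a \<odot>\<^bsub>N\<^esub> r = \<epsilon> a \<otimes>\<^bsub>k\<^esub> r" for a r by (simp add: scalar_module_def \<epsilon>_def)
qed (simp_all add: scalar_module_def)

end

section \<open>The quotient by the span of the elements that act as zero\<close>

text \<open>By \<open>Q_cmp\<close> the elements failing \<open>Q\<close> span a two-sided ideal,
  while those with \<open>Q\<close> form a submonoid on which the twist is trivial. The primed
  algebra is the algebra of this submonoid up to the renaming \<open>\<Psi>\<close>, hence the
  quotient by that ideal.\<close>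

locale twisted_quotient = T: twisted_monoid_algebra k S cmp lam u Q b + T': twisted_monoid_algebra k S' cmp' lam' u' "\<lambda>_. True" b'
  for k :: "('k, 'e) ring_scheme" and S :: "'x set" and cmp lam u Q b
    and S' :: "'y set" and cmp' lam' u' b' +
  fixes \<Psi> :: "'y \<Rightarrow> 'x"
  assumes \<Psi>_bij: "bij_betw \<Psi> S' {x \<in> S. Q x}"
    and \<Psi>_cmp: "x \<in> S' \<Longrightarrow> y \<in> S' \<Longrightarrow> \<Psi> (cmp' x y) = cmp (\<Psi> x) (\<Psi> y)"
    and \<Psi>_u: "\<Psi> u' = u"
begin

text \<open>Keeps only the coefficients at elements with \<open>Q\<close>, so its kernel is the
  ideal spanned by the other basis elements.\<close>

definition \<pi> :: "('x \<Rightarrow> 'k) \<Rightarrow> 'y \<Rightarrow> 'k" where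
  "\<pi> f = (\<lambda>h. if h \<in> S' then f (\<Psi> h) else \<zero>\<^bsub>k\<^esub>)"

lemma \<Psi>_mem: "h \<in> S' \<Longrightarrow> \<Psi> h \<in> S" "h \<in> S' \<Longrightarrow> Q (\<Psi> h)"
  and \<Psi>_inj: "h \<in> S' \<Longrightarrow> h' \<in> S' \<Longrightarrow> \<Psi> h = \<Psi> h' \<longleftrightarrow> h = h'"
  using \<Psi>_bij unfolding bij_betw_def inj_on_def by auto

lemma \<Psi>_surj: "x \<in> S \<Longrightarrow> Q x \<Longrightarrow> \<exists>h\<in>S'. x = \<Psi> h"
  using \<Psi>_bij unfolding bij_betw_def by blast

lemma \<pi>_closed: assumes f: "f \<in> carrier T.F" shows "\<pi> f \<in> carrier T'.F"
proof (rule free_moduleI)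
  have "inj_on \<Psi> (S' \<inter> \<Psi> -` {x. f x \<noteq> \<zero>\<^bsub>k\<^esub>})" using \<Psi>_bij unfolding bij_betw_def by (blast intro: inj_on_subset)
  then show "finite (S' \<inter> \<Psi> -` {x. f x \<noteq> \<zero>\<^bsub>k\<^esub>})"
    by (rule inj_on_finite[OF _ _ free_module_finite[OF f]]) auto
qed (use free_module_closed[OF T.k.ring_axioms f] in \<open>auto simp: \<pi>_def\<close>)

lemma \<pi>_lin: "\<pi> \<in> lin_maps k T.F T'.F"
  by (rule lin_mapsI[OF \<pi>_closed]) (auto simp: \<pi>_def)

lemma \<pi>_basis: "h \<in> S' \<Longrightarrow> \<pi> (basis_vec k (\<Psi> h)) = basis_vec k h"
  by (rule ext) (auto simp: \<pi>_def basis_vec_def \<Psi>_inj)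

lemma \<pi>_basis_zero: "\<not> Q x \<Longrightarrow> \<pi> (basis_vec k x) = \<zero>\<^bsub>T'.F\<^esub>"
  by (rule ext) (auto simp: \<pi>_def basis_vec_def \<Psi>_mem)

lemma \<pi>_mult:
  assumes f: "f \<in> carrier T.F" and g: "g \<in> carrier T.F"
  shows "\<pi> (f \<otimes>\<^bsub>T.A\<^esub> g) = \<pi> f \<otimes>\<^bsub>T'.A\<^esub> \<pi> g"
proof (rule lin_maps_basis_ext[OF T'.lF lin_maps_comp[OF T.mult_left_lin[OF g] \<pi>_lin]
      lin_maps_comp[OF \<pi>_lin T'.mult_left_lin[OF \<pi>_closed[OF g]]] _ f])
  fix x assume x: "x \<in> S"
  show "\<pi> (basis_vec k x \<otimes>\<^bsub>T.A\<^esub> g) = \<pi> (basis_vec k x) \<otimes>\<^bsub>T'.A\<^esub> \<pi> g"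
  proof (rule lin_maps_basis_ext[OF T'.lF lin_maps_comp[OF T.mult_right_lin[OF T.e[OF x]] \<pi>_lin]
      lin_maps_comp[OF \<pi>_lin T'.mult_right_lin[OF \<pi>_closed[OF T.e[OF x]]]] _ g])
    fix y assume y: "y \<in> S"
    note c = T.lam_closed[OF x y] T.e[OF T.cmp_closed[OF x y]]
    have z: "\<pi> (basis_vec k z) \<in> carrier T'.F" if "z \<in> S" for z by (rule \<pi>_closed[OF T.e[OF that]])
    show "\<pi> (basis_vec k x \<otimes>\<^bsub>T.A\<^esub> basis_vec k y) = \<pi> (basis_vec k x) \<otimes>\<^bsub>T'.A\<^esub> \<pi> (basis_vec k y)"
    proof (cases "Q x \<and> Q y")
      case True
      then obtain g h where gh: "g \<in> S'" "h \<in> S'" "x = \<Psi> g" "y = \<Psi> h" using x y \<Psi>_surj by blast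
      have "\<pi> (basis_vec k x \<otimes>\<^bsub>T.A\<^esub> basis_vec k y) = \<pi> (basis_vec k (\<Psi> (cmp' g h)))"
        unfolding T.mult_basis[OF x y] using True T.Q_lam[OF x y] c gh \<Psi>_cmp T.F.smult_one by (simp del: free_module_simps)
      also have "\<dots> = basis_vec k (cmp' g h)" by (rule \<pi>_basis[OF T'.cmp_closed[OF gh(1,2)]])
      also have "\<dots> = basis_vec k g \<otimes>\<^bsub>T'.A\<^esub> basis_vec k h"
        unfolding T'.mult_basis[OF gh(1,2)] T'.Q_lam[OF gh(1,2) TrueI TrueI]
        by (rule T'.F.smult_one[OF T'.e[OF T'.cmp_closed[OF gh(1,2)]], symmetric])
      finally show ?thesis unfolding gh(3,4) \<pi>_basis[OF gh(1)] \<pi>_basis[OF gh(2)] .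
    next
      case False
      \<comment> \<open>One factor failing \<open>Q\<close> makes the product fail it too, so both
        sides vanish.\<close>
      then have "\<not> Q (cmp x y)" using T.Q_cmp[OF x y] by simp
      then have l: "\<pi> (basis_vec k x \<otimes>\<^bsub>T.A\<^esub> basis_vec k y) = \<zero>\<^bsub>T'.F\<^esub>"
        unfolding T.mult_basis[OF x y] lin_maps_smult[OF \<pi>_lin c] \<pi>_basis_zero[OF \<open>\<not> Q (cmp x y)\<close>]
        by (intro T'.F.smult_r_null c)
      have "\<pi> (basis_vec k x) \<otimes>\<^bsub>T'.A\<^esub> \<pi> (basis_vec k y) = \<zero>\<^bsub>T'.F\<^esub>"
        using False \<pi>_basis_zero lin_maps_zero[OF T'.lF T'.lF T'.mult_left_lin[OF z[OF y]]]
          lin_maps_zero[OF T'.lF T'.lF T'.mult_right_lin[OF z[OF x]]] by metis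
      then show ?thesis unfolding l by (rule sym)
    qed
  qed
qed

lemma \<epsilon>_\<pi>: assumes "f \<in> carrier T.F" shows "T'.\<epsilon> (\<pi> f) = T.\<epsilon> f"
proof (rule lin_maps_basis_ext[OF T.lkk lin_maps_comp[OF \<pi>_lin T'.\<epsilon>_lin] T.\<epsilon>_lin _ assms])
  fix x assume x: "x \<in> S"
  show "T'.\<epsilon> (\<pi> (basis_vec k x)) = T.\<epsilon> (basis_vec k x)"
  proof (cases "Q x")
    case True
    then obtain h where "h \<in> S'" "x = \<Psi> h" using x \<Psi>_surj by blast
    then show ?thesis using True T.\<epsilon>_basis[OF x] T'.\<epsilon>_basis \<pi>_basis by simp
  next
    case False
    then show ?thesis using \<pi>_basis_zero[OF False] lin_maps_zero[OF T'.lF T'.lkk T'.\<epsilon>_lin] T.\<epsilon>_basis[OF x]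
      by (simp add: T'.kk_simps)
  qed
qed

lemma \<pi>_surjection: "ring_surjection (opposite T.A) (opposite T'.A) \<pi>"
proof (rule ring_surjection.intro)
  show "\<pi> \<in> ring_hom (opposite T.A) (opposite T'.A)"
  proof (rule ring_hom_memI, unfold opposite_simps T.A_simps(1,3,4) T'.A_simps(1,3,4))
    show "\<pi> (y \<otimes>\<^bsub>T.A\<^esub> x) = \<pi> y \<otimes>\<^bsub>T'.A\<^esub> \<pi> x" if "x \<in> carrier T.F" "y \<in> carrier T.F" for x y
      using that(2,1) by (rule \<pi>_mult)
    show "\<pi> (x \<oplus>\<^bsub>T.F\<^esub> y) = \<pi> x \<oplus>\<^bsub>T'.F\<^esub> \<pi> y" if "x \<in> carrier T.F" "y \<in> carrier T.F" for x y
      by (rule lin_maps_add[OF \<pi>_lin that])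
    show "\<pi> (basis_vec k u) = basis_vec k u'" using \<pi>_basis[OF T'.u(1)] \<Psi>_u by simp
  qed (rule \<pi>_closed)
  show "\<pi> ` carrier (opposite T.A) = carrier (opposite T'.A)"
    unfolding opposite_simps T.A_simps(1) T'.A_simps(1)
  proof (intro equalityI image_subsetI \<pi>_closed subsetI)
    fix g assume g: "g \<in> carrier T'.F"
    let ?f = "\<lambda>x. if x \<in> \<Psi> ` S' then g (inv_into S' \<Psi> x) else \<zero>\<^bsub>k\<^esub>"
    have inj: "inj_on \<Psi> S'" using \<Psi>_bij by (simp add: bij_betw_def)
    have "?f \<in> carrier T.F"
    proof (rule free_moduleI[OF _ _ finite_imageI[OF free_module_finite[OF g], of \<Psi>]])
      show "?f x = \<zero>\<^bsub>k\<^esub>" if "x \<notin> \<Psi> ` {y. g y \<noteq> \<zero>\<^bsub>k\<^esub>}" for x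
        using that inj by (auto simp: inv_into_f_f)
    qed (use \<Psi>_mem free_module_closed[OF T.k.ring_axioms g] in auto)
    moreover have "g = \<pi> ?f"
      by (rule ext) (use g inj in \<open>auto simp: \<pi>_def inv_into_f_f free_module_carrier\<close>)
    ultimately show "g \<in> \<pi> ` carrier T.F" by blast
  qed
qed (rule opposite_ring[OF T.A_ring], rule opposite_ring[OF T'.A_ring])

end

section \<open>Passage to the quotient algebra\<close>

lemma homology_cong:
  assumes "\<And>p x. x \<in> carrier (C (Suc p)) \<Longrightarrow> d p x = d' p x"
  shows "homology C d p = homology C d' p"
proof -
  have "cycles C d p = cycles C d' p" using assms by (auto simp: cycles_def split: nat.splits)
  moreover have "d p ` carrier (C (Suc p)) = d' p ` carrier (C (Suc p))" using assms by (intro image_cong) auto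
  ultimately show ?thesis unfolding homology_def by simp
qed

text \<open>The vectors killed by \<open>h\<close> form a subcomplex; if it is exact, passing to the
  quotient preserves exactness. In degree 0 the premise \<open>exact\<close> asks every killed
  vector to be a boundary.\<close>

lemma (in ring_surjection) change_resolution:
  assumes M: "left_module R M" and M': "left_module R' M'"
    and carr: "carrier M' = carrier M" and zero: "\<zero>\<^bsub>M'\<^esub> = \<zero>\<^bsub>M\<^esub>"
    and add: "\<And>x y. x \<in> carrier M \<Longrightarrow> y \<in> carrier M \<Longrightarrow> x \<oplus>\<^bsub>M\<^esub> y = x \<oplus>\<^bsub>M'\<^esub> y"
    and smult: "\<And>a x. a \<in> carrier R \<Longrightarrow> x \<in> carrier M \<Longrightarrow> a \<odot>\<^bsub>M\<^esub> x = h a \<odot>\<^bsub>M'\<^esub> x"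
    and r: "free_resolution R M B d e"
    and exact: "\<And>p z. z \<in> carrier (free_module R (B p)) \<Longrightarrow> h \<circ> z = \<zero>\<^bsub>free_module R' (B p)\<^esub> \<Longrightarrow>
      (case p of 0 \<Rightarrow> True | Suc q \<Rightarrow> d q z = \<zero>\<^bsub>free_module R (B q)\<^esub>) \<Longrightarrow>
      \<exists>y\<in>carrier (free_module R (B (Suc p))). h \<circ> y = \<zero>\<^bsub>free_module R' (B (Suc p))\<^esub> \<and> d p y = z"
  shows "free_resolution R' M' B (\<lambda>p. change (B p) (d p)) (lin_ext R' M' (\<lambda>b. e (basis_vec R b)))"
proof -
  define C where "C p = free_module R (B p)" for p
  define C' where "C' p = free_module R' (B p)" for p
  have lC: "left_module R (C i)" and lC': "left_module R' (C' i)" for i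
    unfolding C_def C'_def by (rule free_module_left_module[OF ring_source], rule free_module_left_module[OF ring_target])
  interpret C: left_module R "C i" for i by (rule lC)
  let ?d = "\<lambda>p. change (B p) (d p)" and ?e = "lin_ext R' M' (\<lambda>b. e (basis_vec R b))"
  note rD = free_resolutionD[OF r, folded C_def]
  note exact = exact[folded C_def C'_def]
  note ch = change(1)[OF rD(1)[unfolded C_def], folded C'_def] change(2)[OF rD(1)[unfolded C_def], folded C_def]
  note be = base_change[OF M M' rD(2)[unfolded C_def], of "\<lambda>x. x", folded C_def C'_def]
  have e: "?e \<in> lin_maps R' (C' 0) M'" by (rule be(1)) (simp_all add: carr add smult)
  have eh: "?e (h \<circ> f) = e f" if "f \<in> carrier (C 0)" for f
    by (rule be(2)) (simp_all add: carr add smult that)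
  have hc: "h \<circ> f \<in> carrier (C' p)" if "f \<in> carrier (C p)" for f p
    using comp_closed[of f "B p"] that unfolding C_def C'_def by blast
  have hs: "\<exists>f\<in>carrier (C p). x = h \<circ> f" if "x \<in> carrier (C' p)" for x p
    using comp_surj[of x "B p"] that unfolding C_def C'_def by metis
  have hz: "h \<circ> \<zero>\<^bsub>C p\<^esub> = \<zero>\<^bsub>C' p\<^esub>" for p unfolding C_def C'_def by (rule comp_zero)
  have dh: "?d p (h \<circ> f) = h \<circ> d p f" if "f \<in> carrier (C (Suc p))" for f p by (rule ch(2)[OF that])
  note dc = lin_maps_closed[OF rD(1)]
  have hd: "h \<circ> (f \<ominus>\<^bsub>C p\<^esub> g) = h \<circ> f" if "f \<in> carrier (C p)" "g \<in> carrier (C p)" "h \<circ> g = \<zero>\<^bsub>C' p\<^esub>" for f g p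
  proof -
    interpret C': left_module R' "C' p" by (rule lC')
    have "h \<circ> f = h \<circ> ((f \<ominus>\<^bsub>C p\<^esub> g) \<oplus>\<^bsub>C p\<^esub> g)" using C.diff_add_cancel[OF that(1,2)] by (simp only:)
    also have "\<dots> = (h \<circ> (f \<ominus>\<^bsub>C p\<^esub> g)) \<oplus>\<^bsub>C' p\<^esub> (h \<circ> g)"
      using comp_add[of "f \<ominus>\<^bsub>C p\<^esub> g" "B p" g] C.M.minus_closed[OF that(1,2)] that(2) unfolding C_def C'_def by blast
    also have "\<dots> = h \<circ> (f \<ominus>\<^bsub>C p\<^esub> g)"
      unfolding that(3) by (rule C'.M.r_zero[OF hc[OF C.M.minus_closed[OF that(1,2)]]])
    finally show ?thesis by (rule sym)
  qed
  have onto: "?e ` carrier (C' 0) = carrier M'"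
  proof (intro equalityI subsetI)
    fix x assume "x \<in> ?e ` carrier (C' 0)"
    then show "x \<in> carrier M'" using lin_maps_closed[OF e] by blast
  next
    fix x assume "x \<in> carrier M'"
    then obtain f where "f \<in> carrier (C 0)" "x = e f" using rD(3) carr by blast
    then show "x \<in> ?e ` carrier (C' 0)" by (intro image_eqI[of _ _ "h \<circ> f"]) (simp_all add: eh hc)
  qed
  have ex0: "?d 0 ` carrier (C' (Suc 0)) = {f \<in> carrier (C' 0). ?e f = \<zero>\<^bsub>M'\<^esub>}"
  proof (intro equalityI subsetI)
    fix x assume "x \<in> ?d 0 ` carrier (C' (Suc 0))"
    then obtain f where f: "f \<in> carrier (C (Suc 0))" "x = h \<circ> d 0 f" using hs dh by blast
    have "?e x = \<zero>\<^bsub>M'\<^esub>" unfolding f(2) eh[OF dc[OF f(1)]] rD(4)[OF f(1)] zero ..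
    moreover have "x \<in> carrier (C' 0)" unfolding f(2) by (rule hc[OF dc[OF f(1)]])
    ultimately show "x \<in> {f \<in> carrier (C' 0). ?e f = \<zero>\<^bsub>M'\<^esub>}" by (simp only: mem_Collect_eq)
  next
    fix x assume "x \<in> {f \<in> carrier (C' 0). ?e f = \<zero>\<^bsub>M'\<^esub>}"
    then have x: "x \<in> carrier (C' 0)" "?e x = \<zero>\<^bsub>M'\<^esub>" by (simp_all only: mem_Collect_eq)
    obtain f where f: "f \<in> carrier (C 0)" "x = h \<circ> f" using hs[OF x(1)] by blast
    have "e f = \<zero>\<^bsub>M\<^esub>" using x(2) unfolding f(2) eh[OF f(1)] zero .
    then obtain g where g: "g \<in> carrier (C (Suc 0))" "f = d 0 g" using rD(6)[OF f(1)] by blast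
    show "x \<in> ?d 0 ` carrier (C' (Suc 0))"
      by (rule image_eqI[OF _ hc[OF g(1)]]) (simp only: f(2) g(2) dh[OF g(1)])
  qed
  have exp: "?d (Suc p) ` carrier (C' (Suc (Suc p))) = {f \<in> carrier (C' (Suc p)). ?d p f = \<zero>\<^bsub>C' p\<^esub>}" for p
  proof (intro equalityI subsetI)
    fix x assume "x \<in> ?d (Suc p) ` carrier (C' (Suc (Suc p)))"
    then obtain f where f: "f \<in> carrier (C (Suc (Suc p)))" "x = h \<circ> d (Suc p) f" using hs dh by blast
    have "?d p x = \<zero>\<^bsub>C' p\<^esub>" unfolding f(2) dh[OF dc[OF f(1)]] rD(5)[OF f(1)] hz ..
    moreover have "x \<in> carrier (C' (Suc p))" unfolding f(2) by (rule hc[OF dc[OF f(1)]])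
    ultimately show "x \<in> {f \<in> carrier (C' (Suc p)). ?d p f = \<zero>\<^bsub>C' p\<^esub>}" by (simp only: mem_Collect_eq)
  next
    fix x assume "x \<in> {f \<in> carrier (C' (Suc p)). ?d p f = \<zero>\<^bsub>C' p\<^esub>}"
    then have x: "x \<in> carrier (C' (Suc p))" "?d p x = \<zero>\<^bsub>C' p\<^esub>" by (simp_all only: mem_Collect_eq)
    obtain f where f': "f \<in> carrier (C (Suc p))" "x = h \<circ> f" using hs[OF x(1)] by blast
    have f: "f \<in> carrier (C (Suc p))" "x = h \<circ> f" "h \<circ> d p f = \<zero>\<^bsub>C' p\<^esub>"
      using f' x(2) unfolding f'(2) dh[OF f'(1)] by simp_all
    have "case p of 0 \<Rightarrow> True | Suc q \<Rightarrow> d q (d p f) = \<zero>\<^bsub>C q\<^esub>" using rD(5) f(1) by (auto split: nat.splits)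
    \<comment> \<open>\<open>f\<close> lifts a cycle only modulo the subcomplex. Its defect
      \<open>d p f\<close> is a cycle of the subcomplex and so the boundary of some \<open>y\<close>
      in it; \<open>f\<close> minus \<open>y\<close> is then a genuine cycle with the same
      image.\<close>
    then obtain y where y: "y \<in> carrier (C (Suc p))" "h \<circ> y = \<zero>\<^bsub>C' (Suc p)\<^esub>" "d p y = d p f"
      using exact[OF dc[OF f(1)] f(3)] by blast
    have "d p (f \<ominus>\<^bsub>C (Suc p)\<^esub> y) = d p f \<ominus>\<^bsub>C p\<^esub> d p f"
      using lin_maps_diff[OF lC lC rD(1) f(1) y(1)] y(3) by (simp only:)
    also have "\<dots> = \<zero>\<^bsub>C p\<^esub>" unfolding a_minus_def by (rule C.M.r_neg[OF dc[OF f(1)]])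
    finally obtain g where g: "g \<in> carrier (C (Suc (Suc p)))" "f \<ominus>\<^bsub>C (Suc p)\<^esub> y = d (Suc p) g"
      using rD(7)[OF C.M.minus_closed[OF f(1) y(1)]] by blast
    have "x = h \<circ> d (Suc p) g" using hd[OF f(1) y(1,2)] f(2) g(2) by (simp only:)
    then show "x \<in> ?d (Suc p) ` carrier (C' (Suc (Suc p)))"
      by (rule_tac image_eqI[OF _ hc[OF g(1)]]) (simp only: dh[OF g(1)])
  qed
  show ?thesis
    unfolding free_resolution_def C'_def[symmetric] by (intro conjI allI ch(1) e onto ex0 exp)
qed

section \<open>Exactness of the subcomplex belonging to the ideal of elements with turns\<close>

text \<open>\<open>rt\<close> abstracts the set of right-hand turns. By \<open>rt_cmp\<close> left
  multiplication can only enlarge it, so upward closed families span left ideals. In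
  \<open>rt_unit\<close> one pair \<open>w\<close>, \<open>c\<close> serves all \<open>y\<close>
  above \<open>x\<close> at once, which makes \<open>c\<close> times \<open>w\<close> a right
  identity of the left ideal belonging to \<open>rt x\<close>. The bound \<open>n\<close> is where
  the descending induction starts.\<close>

locale graded_twisted_quotient = twisted_quotient k S cmp lam u Q b S' cmp' lam' u' b' \<Psi>
  for k :: "('k, 'e) ring_scheme" and S :: "'x set" and cmp lam u Q b
    and S' :: "'y set" and cmp' lam' u' b' \<Psi> +
  fixes rt :: "'x \<Rightarrow> 't set" and n :: nat
  assumes rt_finite: "x \<in> S \<Longrightarrow> finite (rt x)" and rt_card: "x \<in> S \<Longrightarrow> card (rt x) \<le> n"
    and rt_Q: "x \<in> S \<Longrightarrow> Q x \<longleftrightarrow> rt x = {}"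
    and rt_cmp: "x \<in> S \<Longrightarrow> y \<in> S \<Longrightarrow> rt y \<subseteq> rt (cmp x y)"
    and rt_unit: "x \<in> S \<Longrightarrow> \<exists>w\<in>S. \<exists>c\<in>carrier k. rt x \<subseteq> rt w \<and>
      (\<forall>y\<in>S. rt x \<subseteq> rt y \<longrightarrow> cmp y w = y \<and> c \<otimes>\<^bsub>k\<^esub> lam y w = \<one>\<^bsub>k\<^esub>)"
begin

definition up :: "'x set \<Rightarrow> bool" where
  "up T \<longleftrightarrow> T \<subseteq> S \<and> (\<forall>x\<in>T. \<forall>y\<in>S. rt x \<subseteq> rt y \<longrightarrow> y \<in> T)"

abbreviation "FT T \<equiv> free_module k T"

lemma FT_iff: "T \<subseteq> S \<Longrightarrow> f \<in> carrier (FT T) \<longleftrightarrow> f \<in> carrier T.F \<and> (\<forall>x. f x \<noteq> \<zero>\<^bsub>k\<^esub> \<longrightarrow> x \<in> T)"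
  by (auto simp: free_module_carrier)

lemma lFT: "left_module k (FT T)" by (rule free_module_left_module[OF T.k.ring_axioms])

lemma mult_span:
  assumes T: "up T" and a: "a \<in> carrier T.F" and g: "g \<in> carrier (FT T)"
  shows "a \<otimes>\<^bsub>T.A\<^esub> g \<in> carrier (FT T)"
proof -
  interpret FT: left_module k "FT T" by (rule lFT)
  have TS: "T \<subseteq> S" using T by (simp add: up_def)
  have sub: "f \<in> carrier T.F" if "f \<in> carrier (FT T)" for f using that FT_iff[OF TS] by blast
  note eF = T.e[OF subsetD[OF TS]]
  note ml = lin_maps_add[OF T.mult_left_lin] lin_maps_smult[OF T.mult_left_lin] lin_maps_zero[OF T.lF T.lF T.mult_left_lin]
  note mr = lin_maps_add[OF T.mult_right_lin] lin_maps_smult[OF T.mult_right_lin] lin_maps_zero[OF T.lF T.lF T.mult_right_lin]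
  have op: "f \<oplus>\<^bsub>T.F\<^esub> g = f \<oplus>\<^bsub>FT T\<^esub> g" "a \<odot>\<^bsub>T.F\<^esub> f = a \<odot>\<^bsub>FT T\<^esub> f" "\<zero>\<^bsub>T.F\<^esub> = \<zero>\<^bsub>FT T\<^esub>" for f g a by simp_all
  have 1: "basis_vec k x \<otimes>\<^bsub>T.A\<^esub> g \<in> carrier (FT T)" if x: "x \<in> S" for x
    using T.k.ring_axioms g
  proof (induction g rule: free_module_induct)
    case zero
    have "basis_vec k x \<otimes>\<^bsub>T.A\<^esub> \<zero>\<^bsub>T.F\<^esub> = \<zero>\<^bsub>FT T\<^esub>" using mr(3)[OF T.e[OF x]] unfolding op .
    then show ?case using FT.zero_closed by (simp only: free_module_simps)
  next
    case (step y a g)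
    have y: "y \<in> S" using step(1) TS by blast
    have "cmp x y \<in> T" using T step(1) rt_cmp[OF x y] T.cmp_closed[OF x y] unfolding up_def by blast
    then have "basis_vec k (cmp x y) \<in> carrier (FT T)" by (rule basis_vec_in_free[OF T.k.ring_axioms])
    then have "a \<odot>\<^bsub>FT T\<^esub> (lam x y \<odot>\<^bsub>FT T\<^esub> basis_vec k (cmp x y)) \<oplus>\<^bsub>FT T\<^esub> basis_vec k x \<otimes>\<^bsub>T.A\<^esub> g \<in> carrier (FT T)"
      by (intro FT.M.a_closed FT.smult_closed step T.lam_closed x y)
    moreover have "basis_vec k x \<otimes>\<^bsub>T.A\<^esub> (a \<odot>\<^bsub>T.F\<^esub> basis_vec k y \<oplus>\<^bsub>T.F\<^esub> g)
        = a \<odot>\<^bsub>T.F\<^esub> (lam x y \<odot>\<^bsub>T.F\<^esub> basis_vec k (cmp x y)) \<oplus>\<^bsub>T.F\<^esub> basis_vec k x \<otimes>\<^bsub>T.A\<^esub> g"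
      unfolding mr(1)[OF T.e[OF x] T.F.smult_closed[OF step(2) T.e[OF y]] sub[OF step(3)]]
        mr(2)[OF T.e[OF x] step(2) T.e[OF y]] T.mult_basis[OF x y] ..
    ultimately show ?case unfolding op by (simp only:)
  qed
  show ?thesis using T.k.ring_axioms a
  proof (induction a rule: free_module_induct)
    case zero
    have "\<zero>\<^bsub>T.F\<^esub> \<otimes>\<^bsub>T.A\<^esub> g = \<zero>\<^bsub>FT T\<^esub>" using ml(3)[OF sub[OF g]] unfolding op .
    then show ?case using FT.zero_closed by (simp only: free_module_simps)
  next
    case (step x a f)
    have "a \<odot>\<^bsub>FT T\<^esub> (basis_vec k x \<otimes>\<^bsub>T.A\<^esub> g) \<oplus>\<^bsub>FT T\<^esub> f \<otimes>\<^bsub>T.A\<^esub> g \<in> carrier (FT T)"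
      by (intro FT.M.a_closed FT.smult_closed step 1)
    moreover have "(a \<odot>\<^bsub>T.F\<^esub> basis_vec k x \<oplus>\<^bsub>T.F\<^esub> f) \<otimes>\<^bsub>T.A\<^esub> g
        = a \<odot>\<^bsub>T.F\<^esub> (basis_vec k x \<otimes>\<^bsub>T.A\<^esub> g) \<oplus>\<^bsub>T.F\<^esub> f \<otimes>\<^bsub>T.A\<^esub> g"
      unfolding ml(1)[OF sub[OF g] T.F.smult_closed[OF step(2) T.e[OF step(1)]] step(3)]
        ml(2)[OF sub[OF g] step(2) T.e[OF step(1)]] ..
    ultimately show ?case unfolding op by (simp only:)
  qed
qed

abbreviation "PB B \<equiv> free_module (opposite T.A) B"

lemma op: "ring (opposite T.A)" by (rule opposite_ring[OF T.A_ring])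
lemma lPB: "left_module (opposite T.A) (PB B)" by (rule free_module_left_module[OF op])

text \<open>For upward closed \<open>T\<close> this is \<open>P L\<close>, where \<open>L\<close> is
  the left ideal spanned by \<open>T\<close>. It is only a \<open>k\<close>-submodule of the right
  module \<open>P\<close>, which is enough to speak of exactness.\<close>

definition PT :: "'x set \<Rightarrow> 'z set \<Rightarrow> ('z \<Rightarrow> 'x \<Rightarrow> 'k) set" where
  "PT T B = {f \<in> carrier (PB B). \<forall>b. f b \<in> carrier (FT T)}"

lemma PB_closed: "f \<in> carrier (PB B) \<Longrightarrow> f i \<in> carrier T.F"
  using free_module_closed[OF op, of f B i] by (simp add: T.A_simps)

lemma PT_iff: "T \<subseteq> S \<Longrightarrow> f \<in> PT T B \<longleftrightarrow> f \<in> carrier (PB B) \<and> (\<forall>b x. f b x \<noteq> \<zero>\<^bsub>k\<^esub> \<longrightarrow> x \<in> T)"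
proof -
  assume T: "T \<subseteq> S"
  show ?thesis by (auto simp: PT_def FT_iff[OF T] intro: PB_closed)
qed

lemma PT_carrier: "f \<in> PT T B \<Longrightarrow> f \<in> carrier (PB B)"
  and PT_coord: "f \<in> PT T B \<Longrightarrow> f i \<in> carrier (FT T)"
  by (simp_all add: PT_def)

lemma PT_supp: "T \<subseteq> S \<Longrightarrow> f \<in> PT T B \<Longrightarrow> f i x \<noteq> \<zero>\<^bsub>k\<^esub> \<Longrightarrow> x \<in> T"
  by (simp add: PT_iff)

lemma PTI:
  assumes "T \<subseteq> S" "f \<in> carrier (PB B)" "\<And>b x. f b x \<noteq> \<zero>\<^bsub>k\<^esub> \<Longrightarrow> x \<in> T"
  shows "f \<in> PT T B"
  using assms by (simp add: PT_iff)

lemma PB_smult: "(a \<odot>\<^bsub>PB B\<^esub> f) i = f i \<otimes>\<^bsub>T.A\<^esub> a"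
  by simp

lemma PT_add:
  assumes "f \<in> PT T B" "g \<in> PT T B" shows "f \<oplus>\<^bsub>PB B\<^esub> g \<in> PT T B"
proof -
  interpret P: left_module "opposite T.A" "PB B" by (rule lPB)
  interpret FT: left_module k "FT T" by (rule lFT)
  have "(f \<oplus>\<^bsub>PB B\<^esub> g) b \<in> carrier (FT T)" for b
    unfolding free_module_simps(2)[of "opposite T.A"] opposite_simps T.A_simps(3)
    using FT.M.a_closed[OF PT_coord[OF assms(1)] PT_coord[OF assms(2)]] by simp
  then show ?thesis using P.M.a_closed[OF PT_carrier[OF assms(1)] PT_carrier[OF assms(2)]]
    unfolding PT_def mem_Collect_eq by (intro conjI allI)
qed

text \<open>Scalars multiply the coefficients from the right, and a left ideal absorbs the
  coefficients of an arbitrary \<open>y\<close>.\<close>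

lemma PT_smult:
  assumes T: "up T" and y: "y \<in> carrier (PB B)" and a: "a \<in> carrier (FT T)"
  shows "a \<odot>\<^bsub>PB B\<^esub> y \<in> PT T B"
proof -
  interpret P: left_module "opposite T.A" "PB B" by (rule lPB)
  have "a \<in> carrier (opposite T.A)" using a FT_iff[of T] T by (simp add: T.A_simps up_def)
  moreover have "(a \<odot>\<^bsub>PB B\<^esub> y) i \<in> carrier (FT T)" for i
    unfolding PB_smult by (rule mult_span[OF T PB_closed[OF y] a])
  ultimately show ?thesis unfolding PT_def mem_Collect_eq by (intro conjI allI P.smult_closed y)
qed

lemma PB_diff:
  assumes "f \<in> carrier (PB B)" "g \<in> carrier (PB B)"
  shows "(f \<ominus>\<^bsub>PB B\<^esub> g) i x = f i x \<ominus>\<^bsub>k\<^esub> g i x"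
proof -
  interpret P: left_module "opposite T.A" "PB B" by (rule lPB)
  have cl: "y i x \<in> carrier k" if "y \<in> carrier (PB B)" for y
    by (rule free_module_closed[OF T.k.ring_axioms PB_closed[OF that]])
  let ?h = "f \<ominus>\<^bsub>PB B\<^esub> g"
  have h: "?h \<in> carrier (PB B)" by (rule P.M.minus_closed[OF assms])
  have "(?h \<oplus>\<^bsub>PB B\<^esub> g) i x = f i x" using P.diff_add_cancel[OF assms] by (simp only:)
  then have "?h i x \<oplus>\<^bsub>k\<^esub> g i x = f i x"
    unfolding free_module_simps(2)[of "opposite T.A"] opposite_simps T.A_simps(3)
    by (simp only: free_module_simps)
  then have "f i x \<ominus>\<^bsub>k\<^esub> g i x = (?h i x \<oplus>\<^bsub>k\<^esub> g i x) \<ominus>\<^bsub>k\<^esub> g i x" by (simp only:)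
  also have "\<dots> = ?h i x"
    unfolding a_minus_def[of k] T.k.a_assoc[OF cl[OF h] cl[OF assms(2)] T.k.a_inv_closed[OF cl[OF assms(2)]]]
      T.k.r_neg[OF cl[OF assms(2)]] by (rule T.k.r_zero[OF cl[OF h]])
  finally show ?thesis by (rule sym)
qed

lemma PT_diff:
  assumes T: "T \<subseteq> S" and "f \<in> PT T B" "g \<in> PT T B" shows "f \<ominus>\<^bsub>PB B\<^esub> g \<in> PT T B"
proof -
  interpret P: left_module "opposite T.A" "PB B" by (rule lPB)
  note fg = PT_carrier[OF assms(2)] PT_carrier[OF assms(3)]
  show ?thesis
  proof (rule PTI[OF T P.M.minus_closed[OF fg]], rule ccontr)
    fix b x assume nz: "(f \<ominus>\<^bsub>PB B\<^esub> g) b x \<noteq> \<zero>\<^bsub>k\<^esub>" and "x \<notin> T"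
    then have "f b x = \<zero>\<^bsub>k\<^esub>" "g b x = \<zero>\<^bsub>k\<^esub>" using PT_supp[OF T assms(2)] PT_supp[OF T assms(3)] by metis+
    then show False using nz unfolding PB_diff[OF fg] by (simp add: a_minus_def)
  qed
qed

lemma PT_mono: "T \<subseteq> T' \<Longrightarrow> T' \<subseteq> S \<Longrightarrow> f \<in> PT T B \<Longrightarrow> f \<in> PT T' B"
  by (rule PTI[OF _ PT_carrier]) (auto dest: PT_supp[OF subset_trans])

text \<open>A map of free right modules replaces each basis vector by its image and leaves the
  coefficient standing on the right; a coefficient in a left ideal keeps the result in
  \<open>P L\<close>.\<close>

lemma PT_map:
  assumes d: "d \<in> lin_maps (opposite T.A) (PB B) (PB B')" and T: "up T" and f: "f \<in> PT T B"
  shows "d f \<in> PT T B'"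
proof -
  interpret P': left_module "opposite T.A" "PB B'" by (rule lPB)
  interpret P: left_module "opposite T.A" "PB B" by (rule lPB)
  interpret FT: left_module k "FT T" by (rule lFT)
  have z0: "(\<lambda>_. \<zero>\<^bsub>T.A\<^esub>) \<in> PT T B'"
  proof -
    have "\<zero>\<^bsub>PB B'\<^esub> \<in> PT T B'" unfolding PT_def mem_Collect_eq
      using P'.zero_closed FT.zero_closed by (simp add: T.A_simps)
    then show ?thesis by simp
  qed
  \<comment> \<open>Membership of the coefficients is carried as an implication because the
    induction runs over all of \<open>P\<close>; the vanishing of \<open>g\<close> at
    \<open>b\<close> recovers the coefficients of both pieces from those of the sum.\<close>
  have "(\<forall>b. f b \<in> carrier (FT T)) \<longrightarrow> d f \<in> PT T B'"
    using op PT_carrier[OF f]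
  proof (induction f rule: free_module_induct)
    case zero
    then show ?case using lin_maps_zero[OF lPB lPB d] z0 by simp
  next
    case (step b a g)
    have a: "a \<in> carrier T.F" using step(2) by (simp add: T.A_simps)
    have e: "basis_vec (opposite T.A) b \<in> carrier (PB B)" by (rule basis_vec_in_free[OF op step(1)])
    let ?f = "a \<odot>\<^bsub>PB B\<^esub> basis_vec (opposite T.A) b \<oplus>\<^bsub>PB B\<^esub> g"
    interpret A: ring T.A by (rule T.A_ring)
    have a': "a \<in> carrier T.A" using step(2) by simp
    have gb: "g c \<in> carrier T.A" for c using PB_closed[OF step(3)] by (simp add: T.A_simps)
    have fb: "?f b = a" using step(5) step.hyps(4) a' gb[of b] by (simp add: basis_vec_def)
    have fc: "?f c = g c" if "c \<noteq> b" for c using that a' gb[of c] by (simp add: basis_vec_def)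
    show ?case
    proof
      assume *: "\<forall>c. ?f c \<in> carrier (FT T)"
      have aT: "a \<in> carrier (FT T)" using *[rule_format, of b] unfolding fb .
      have "g c \<in> carrier (FT T)" for c
      proof (cases "c = b")
        case True
        then show ?thesis using step.hyps(4) FT.zero_closed by (simp add: T.A_simps)
      next
        case False
        then show ?thesis using *[rule_format, of c] fc[OF False] by simp
      qed
      then have dg: "d g \<in> PT T B'" using step.IH by blast
      have de: "d (basis_vec (opposite T.A) b) \<in> carrier (PB B')" by (rule lin_maps_closed[OF d e])
      have "a \<odot>\<^bsub>PB B'\<^esub> d (basis_vec (opposite T.A) b) \<in> PT T B'" by (rule PT_smult[OF T de aT])
      then show "d ?f \<in> PT T B'"
        unfolding lin_maps_add[OF d P.smult_closed[OF step(2) e] step(3)] lin_maps_smult[OF d step(2) e]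
        using dg by (rule PT_add)
    qed
  qed
  then show ?thesis using f by (simp add: PT_def)
qed

lemma up_S: "up T \<Longrightarrow> T \<subseteq> S" by (simp add: up_def)

text \<open>Through \<open>rt_Q\<close> the ideal killed by \<open>\<pi>\<close> is spanned by the
  elements with nonempty \<open>rt\<close>, which is an upward closed family. The kernel of the
  projection is thus one of the subcomplexes \<open>PT\<close>.\<close>

lemma comp_\<pi>_zero_iff:
  assumes f: "f \<in> carrier (PB B)"
  shows "\<pi> \<circ> f = \<zero>\<^bsub>free_module (opposite T'.A) B\<^esub> \<longleftrightarrow> f \<in> PT {x \<in> S. rt x \<noteq> {}} B"
proof -
  have sub: "{x \<in> S. rt x \<noteq> {}} \<subseteq> S" by blast
  have "\<pi> (f b) = \<zero>\<^bsub>T'.F\<^esub> \<longleftrightarrow> (\<forall>x. f b x \<noteq> \<zero>\<^bsub>k\<^esub> \<longrightarrow> x \<in> S \<and> rt x \<noteq> {})" for b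
  proof
    assume *: "\<pi> (f b) = \<zero>\<^bsub>T'.F\<^esub>"
    show "\<forall>x. f b x \<noteq> \<zero>\<^bsub>k\<^esub> \<longrightarrow> x \<in> S \<and> rt x \<noteq> {}"
    proof (intro allI impI conjI)
      fix x assume x: "f b x \<noteq> \<zero>\<^bsub>k\<^esub>"
      then show xS: "x \<in> S" using PB_closed[OF f, of b] by (auto simp: free_module_carrier)
      show "rt x \<noteq> {}"
      proof
        assume "rt x = {}"
        then obtain h where "h \<in> S'" "x = \<Psi> h" using \<Psi>_surj[OF xS] rt_Q[OF xS] by blast
        then show False using fun_cong[OF *, of h] x by (simp add: \<pi>_def)
      qed
    qed
  next
    assume *: "\<forall>x. f b x \<noteq> \<zero>\<^bsub>k\<^esub> \<longrightarrow> x \<in> S \<and> rt x \<noteq> {}"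
    show "\<pi> (f b) = \<zero>\<^bsub>T'.F\<^esub>"
      by (rule ext) (use * \<Psi>_mem rt_Q in \<open>auto simp: \<pi>_def\<close>)
  qed
  then show ?thesis unfolding PT_iff[OF sub] using f
    by (simp add: fun_eq_iff[of "\<pi> \<circ> f"] T'.A_simps)
qed

text \<open>\<open>c\<close> times \<open>w\<close> lies in the ideal and fixes each of its basis
  elements from the right. In particular it is idempotent, and the ideal is a direct summand of the
  algebra as a left module.\<close>

lemma unit_element:
  assumes x: "x \<in> S" "rt x \<noteq> {}"
  shows "\<exists>E\<in>carrier (FT {y \<in> S. rt x \<subseteq> rt y}). \<forall>a\<in>carrier (FT {y \<in> S. rt x \<subseteq> rt y}). a \<otimes>\<^bsub>T.A\<^esub> E = a"
proof -
  let ?T = "{y \<in> S. rt x \<subseteq> rt y}"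
  obtain w c where w: "w \<in> S" "c \<in> carrier k" "rt x \<subseteq> rt w"
    and unit: "\<And>y. y \<in> ?T \<Longrightarrow> cmp y w = y \<and> c \<otimes>\<^bsub>k\<^esub> lam y w = \<one>\<^bsub>k\<^esub>"
    using rt_unit[OF x(1)] by blast
  interpret FT: left_module k "FT ?T" by (rule lFT)
  have TS: "?T \<subseteq> S" by blast
  let ?E = "c \<odot>\<^bsub>FT ?T\<^esub> basis_vec k w"
  have E: "?E \<in> carrier (FT ?T)"
    by (rule FT.smult_closed[OF w(2) basis_vec_in_free[OF T.k.ring_axioms]]) (use w in blast)
  then have EF: "?E \<in> carrier T.F" using FT_iff[OF TS] by blast
  note ml = T.mult_left_lin[OF EF]
  have sub: "(\<lambda>f. f \<otimes>\<^bsub>T.A\<^esub> ?E) \<in> lin_maps k (FT ?T) T.F"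
    by (rule lin_mapsI)
      (use lin_maps_closed[OF ml] lin_maps_add[OF ml] lin_maps_smult[OF ml] FT_iff[OF TS] in auto)
  have inc: "(\<lambda>f. f) \<in> lin_maps k (FT ?T) T.F"
    by (rule lin_mapsI) (use FT_iff[OF TS] in auto)
  have "a \<otimes>\<^bsub>T.A\<^esub> ?E = a" if a: "a \<in> carrier (FT ?T)" for a
  proof (rule lin_maps_basis_ext[OF T.lF sub inc _ a])
    fix y assume y: "y \<in> ?T"
    then have yS: "y \<in> S" by blast
    have "basis_vec k y \<otimes>\<^bsub>T.A\<^esub> ?E = basis_vec k y \<otimes>\<^bsub>T.A\<^esub> (c \<odot>\<^bsub>T.F\<^esub> basis_vec k w)" by simp
    also have "\<dots> = c \<odot>\<^bsub>T.F\<^esub> (lam y w \<odot>\<^bsub>T.F\<^esub> basis_vec k (cmp y w))"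
      unfolding lin_maps_smult[OF T.mult_right_lin[OF T.e[OF yS]] w(2) T.e[OF w(1)]] T.mult_basis[OF yS w(1)] ..
    also have "\<dots> = (c \<otimes>\<^bsub>k\<^esub> lam y w) \<odot>\<^bsub>T.F\<^esub> basis_vec k (cmp y w)"
      by (rule T.F.smult_assoc[OF w(2) T.lam_closed[OF yS w(1)] T.e[OF T.cmp_closed[OF yS w(1)]], symmetric])
    also have "\<dots> = basis_vec k y" using unit[OF y] T.F.smult_one[OF T.e[OF yS]] by (simp only:)
    finally show "basis_vec k y \<otimes>\<^bsub>T.A\<^esub> ?E = basis_vec k y" .
  qed
  then show ?thesis using E by blast
qed

text \<open>In degree 0 every vector counts as a cycle, so \<open>exact_on\<close> also asserts that
  homology vanishes in degree 0.\<close>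

definition cycle :: "(nat \<Rightarrow> 'z set) \<Rightarrow> (nat \<Rightarrow> ('z \<Rightarrow> 'x \<Rightarrow> 'k) \<Rightarrow> 'z \<Rightarrow> 'x \<Rightarrow> 'k) \<Rightarrow> nat \<Rightarrow>
    ('z \<Rightarrow> 'x \<Rightarrow> 'k) \<Rightarrow> bool" where
  "cycle B d p z \<longleftrightarrow> (case p of 0 \<Rightarrow> True | Suc q \<Rightarrow> d q z = \<zero>\<^bsub>PB (B q)\<^esub>)"

definition exact_on :: "(nat \<Rightarrow> 'z set) \<Rightarrow> (nat \<Rightarrow> ('z \<Rightarrow> 'x \<Rightarrow> 'k) \<Rightarrow> 'z \<Rightarrow> 'x \<Rightarrow> 'k) \<Rightarrow> 'x set \<Rightarrow> bool" where
  "exact_on B d T \<longleftrightarrow> (\<forall>p. \<forall>z\<in>PT T (B p). cycle B d p z \<longrightarrow> (\<exists>y\<in>PT T (B (Suc p)). d p y = z))"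

text \<open>The number of these sets is the measure that decreases in the inner induction of
  \<open>exact_level\<close>.\<close>

definition level :: "nat \<Rightarrow> ('z \<Rightarrow> 'x \<Rightarrow> 'k) \<Rightarrow> 't set set" where
  "level m z = {s. card s = m \<and> (\<exists>b x. z b x \<noteq> \<zero>\<^bsub>k\<^esub> \<and> rt x = s)}"

context
  fixes B :: "nat \<Rightarrow> 'z set" and d e
  assumes r: "free_resolution (opposite T.A) T.N B d e"
begin

lemmas rD = free_resolutionD[OF r]

lemma cycle_d: "y \<in> carrier (PB (B (Suc p))) \<Longrightarrow> cycle B d p (d p y)"
  unfolding cycle_def using rD(5) by (cases p) auto

lemma cycle_diff:
  assumes "cycle B d p y" "cycle B d p z" "y \<in> carrier (PB (B p))" "z \<in> carrier (PB (B p))"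
  shows "cycle B d p (y \<ominus>\<^bsub>PB (B p)\<^esub> z)"
proof (cases p)
  case (Suc q)
  interpret P: left_module "opposite T.A" "PB (B q)" by (rule lPB)
  have "d q (y \<ominus>\<^bsub>PB (B (Suc q))\<^esub> z) = \<zero>\<^bsub>PB (B q)\<^esub> \<ominus>\<^bsub>PB (B q)\<^esub> \<zero>\<^bsub>PB (B q)\<^esub>"
    using lin_maps_diff[OF lPB lPB rD(1)] assms Suc unfolding cycle_def by (simp only: nat.case)
  then show ?thesis using Suc unfolding cycle_def a_minus_def P.M.r_neg[OF P.zero_closed] by (simp only: nat.case)
qed (simp add: cycle_def)

text \<open>The trivial module is inflated from the quotient algebra, so \<open>e\<close> factors
  through \<open>\<pi>\<close>, and \<open>\<pi>\<close> kills the coefficients of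
  \<open>f\<close>.\<close>

lemma e_zero:
  assumes f: "f \<in> PT {x \<in> S. rt x \<noteq> {}} (B 0)"
  shows "e f = \<zero>\<^bsub>T.N\<^esub>"
proof -
  interpret aug: augmented_algebra k T.A T.N T.\<epsilon> by (rule T.augmented)
  interpret aug': augmented_algebra k T'.A T'.N T'.\<epsilon> by (rule T'.augmented)
  interpret \<pi>: ring_surjection "opposite T.A" "opposite T'.A" \<pi> by (rule \<pi>_surjection)
  have fP: "f \<in> carrier (PB (B 0))" using f by (simp add: PT_def)
  have cN: "carrier T.N = carrier k" "carrier T'.N = carrier k" by (simp_all add: scalar_module_def)
  have us: "a \<odot>\<^bsub>T.N\<^esub> x = \<pi> a \<odot>\<^bsub>T'.N\<^esub> x" if "a \<in> carrier (opposite T.A)" "x \<in> carrier T.N" for a x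
    using that aug.N_smult[of a x] aug'.N_smult[of "\<pi> a" x] \<pi>_closed[of a] \<epsilon>_\<pi>[of a] cN
    by (simp add: T.A_simps T'.A_simps)
  note bc = \<pi>.base_change[OF aug.N_right aug'.N_right rD(2), of "\<lambda>x. x"]
  have l: "lin_ext (opposite T'.A) T'.N (\<lambda>b. e (basis_vec (opposite T.A) b))
      \<in> lin_maps (opposite T'.A) (free_module (opposite T'.A) (B 0)) T'.N"
    by (rule bc(1)[OF _ _ us]) (simp_all add: scalar_module_def)
  have "e f = lin_ext (opposite T'.A) T'.N (\<lambda>b. e (basis_vec (opposite T.A) b)) (\<pi> \<circ> f)"
    by (rule bc(2)[OF _ _ us fP, symmetric]) (simp_all add: scalar_module_def)
  also have "\<pi> \<circ> f = \<zero>\<^bsub>free_module (opposite T'.A) (B 0)\<^esub>" using comp_\<pi>_zero_iff[OF fP] f by blast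
  also have "lin_ext (opposite T'.A) T'.N (\<lambda>b. e (basis_vec (opposite T.A) b)) \<dots> = \<zero>\<^bsub>T'.N\<^esub>"
    by (rule lin_maps_zero[OF free_module_left_module[OF \<pi>.ring_target] aug'.N_right l])
  finally show ?thesis by (simp add: scalar_module_def)
qed

lemma boundary:
  assumes z: "z \<in> PT {x \<in> S. rt x \<noteq> {}} (B p)" and c: "cycle B d p z"
  shows "\<exists>y\<in>carrier (PB (B (Suc p))). d p y = z"
proof -
  have zP: "z \<in> carrier (PB (B p))" using z by (simp add: PT_def)
  show ?thesis
  proof (cases p)
    case 0
    then have "z \<in> d 0 ` carrier (PB (B (Suc 0)))" using e_zero z zP by (intro rD(6)) auto
    then show ?thesis using 0 by blast
  next
    case (Suc q)
    then have "z \<in> d (Suc q) ` carrier (PB (B (Suc (Suc q))))"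
      using c zP unfolding cycle_def by (intro rD(7)) simp_all
    then show ?thesis using Suc by blast
  qed
qed

text \<open>Any preimage \<open>y\<close> of \<open>z\<close> under the differential may be
  multiplied by the right identity \<open>E\<close>: this moves it into the ideal, and as the
  differential is linear and \<open>E\<close> fixes the coefficients of \<open>z\<close>, the image
  is still \<open>z\<close>.\<close>

lemma exact_principal:
  assumes x: "x \<in> S" "rt x \<noteq> {}"
  shows "exact_on B d {y \<in> S. rt x \<subseteq> rt y}"
  unfolding exact_on_def
proof (intro allI ballI impI)
  let ?T = "{y \<in> S. rt x \<subseteq> rt y}"
  fix p z assume z: "z \<in> PT ?T (B p)" and c: "cycle B d p z"
  have up: "up ?T" unfolding up_def by blast
  have zP: "z \<in> carrier (PB (B p))" using z by (simp add: PT_def)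
  have "z \<in> PT {x \<in> S. rt x \<noteq> {}} (B p)" by (rule PT_mono[OF _ _ z]) (use x in auto)
  then obtain y where y: "y \<in> carrier (PB (B (Suc p)))" "d p y = z" using boundary c by blast
  obtain E where E: "E \<in> carrier (FT ?T)" "\<And>a. a \<in> carrier (FT ?T) \<Longrightarrow> a \<otimes>\<^bsub>T.A\<^esub> E = a"
    using unit_element[OF x] by blast
  have EA: "E \<in> carrier (opposite T.A)" using E(1) FT_iff[of ?T] by (simp add: T.A_simps)
  interpret P: left_module "opposite T.A" "PB (B (Suc p))" by (rule lPB)
  have "E \<odot>\<^bsub>PB (B (Suc p))\<^esub> y \<in> PT ?T (B (Suc p))" by (rule PT_smult[OF up y(1) E(1)])
  moreover have "d p (E \<odot>\<^bsub>PB (B (Suc p))\<^esub> y) = z"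
  proof -
    have "d p (E \<odot>\<^bsub>PB (B (Suc p))\<^esub> y) = E \<odot>\<^bsub>PB (B p)\<^esub> z"
      using lin_maps_smult[OF rD(1) EA y(1)] y(2) by (simp only:)
    also have "\<dots> = z" by (rule ext) (use z E(2) in \<open>simp only: PB_smult PT_def mem_Collect_eq\<close>)
    finally show ?thesis .
  qed
  ultimately show "\<exists>y\<in>PT ?T (B (Suc p)). d p y = z" by blast
qed

lemma finite_level:
  assumes z: "z \<in> carrier (PB (B p))" shows "finite (level m z)"
proof (rule finite_subset)
  show "level m z \<subseteq> rt ` (\<Union>b\<in>{b. z b \<noteq> \<zero>\<^bsub>T.F\<^esub>}. {x. z b x \<noteq> \<zero>\<^bsub>k\<^esub>})"
  proof
    fix s assume "s \<in> level m z"
    then obtain b x where bx: "z b x \<noteq> \<zero>\<^bsub>k\<^esub>" "s = rt x" unfolding level_def by blast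
    then have "z b \<noteq> \<zero>\<^bsub>T.F\<^esub>" by auto
    then show "s \<in> rt ` (\<Union>b\<in>{b. z b \<noteq> \<zero>\<^bsub>T.F\<^esub>}. {x. z b x \<noteq> \<zero>\<^bsub>k\<^esub>})" using bx by blast
  qed
  have "finite {b. z b \<noteq> \<zero>\<^bsub>T.F\<^esub>}" using free_module_finite[OF z] by (simp add: T.A_simps)
  then show "finite (rt ` (\<Union>b\<in>{b. z b \<noteq> \<zero>\<^bsub>T.F\<^esub>}. {x. z b x \<noteq> \<zero>\<^bsub>k\<^esub>}))"
    using free_module_finite[OF PB_closed[OF z]] by blast
qed

text \<open>The cycle \<open>z\<close> is corrected by a boundary until no element \<open>x\<close> with \<open>rt x\<close> of the minimal
  size \<open>c\<close> occurs in it. The part of \<open>z\<close> with \<open>rt x = s\<close> is a cycle modulo the larger sets.\<close>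

lemma remove_level:
  assumes T: "up T" "\<And>x. x \<in> T \<Longrightarrow> c \<le> card (rt x) \<and> rt x \<noteq> {}"
    and IH: "\<And>T'. up T' \<Longrightarrow> (\<And>x. x \<in> T' \<Longrightarrow> c < card (rt x) \<and> rt x \<noteq> {}) \<Longrightarrow> exact_on B d T'"
    and z: "z \<in> PT T (B p)" "cycle B d p z" and s: "s \<in> level c z"
  shows "\<exists>y\<in>PT T (B (Suc p)). level c (z \<ominus>\<^bsub>PB (B p)\<^esub> d p y) \<subset> level c z"
proof -
  note TS = up_S[OF T(1)]
  have zP: "z \<in> carrier (PB (B p))" using z(1) by (simp add: PT_def)
  obtain b0 x0 where x0: "z b0 x0 \<noteq> \<zero>\<^bsub>k\<^esub>" "rt x0 = s" "card s = c" using s by (auto simp: level_def)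
  then have x0T: "x0 \<in> T" using PT_supp[OF TS z(1)] by metis
  then have x0S: "x0 \<in> S" and s0: "s \<noteq> {}" and fs: "finite s" using TS T(2) x0 rt_finite by auto
  \<comment> \<open>The families of elements above \<open>s\<close>, strictly above
    \<open>s\<close>, and of all elements of \<open>T\<close> other than those with turn set
    \<open>s\<close>. Minimality of the size \<open>c\<close> makes \<open>?Tm\<close> upward
    closed, and \<open>?Ts\<close> meets \<open>?Tm\<close> in \<open>?Tp\<close>.\<close>
  let ?Ts = "{y \<in> S. rt x0 \<subseteq> rt y}" and ?Tp = "{y \<in> S. s \<subset> rt y}" and ?Tm = "{y \<in> T. rt y \<noteq> s}"
  have upTs: "up ?Ts" and upTp: "up ?Tp" unfolding up_def by blast+
  have TsT: "?Ts \<subseteq> T" using T(1) x0T unfolding up_def by blast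
  have TpT: "?Tp \<subseteq> ?Ts" using x0 by blast
  have min: "rt y = s" if "y \<in> T" "rt y \<subseteq> s" for y
    using card_seteq[OF fs that(2)] T(2)[OF that(1)] x0(3) by simp
  have upTm: "up ?Tm"
    unfolding up_def
  proof (intro conjI ballI impI)
    show "?Tm \<subseteq> S" using TS by blast
    fix y w assume "y \<in> ?Tm" "w \<in> S" "rt y \<subseteq> rt w"
    then show "w \<in> ?Tm" using T(1) min[of y] unfolding up_def by blast
  qed
  have exTp: "exact_on B d ?Tp"
  proof (rule IH[OF upTp])
    fix y assume "y \<in> ?Tp"
    then show "c < card (rt y) \<and> rt y \<noteq> {}" using psubset_card_mono[of "rt y" s] rt_finite x0(3) by blast
  qed
  define zs where "zs = (\<lambda>b x. if rt x = s then z b x else \<zero>\<^bsub>k\<^esub>)"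
  have zsb: "zs b \<in> carrier T.F" for b
    by (rule free_moduleI[OF _ _ free_module_finite[OF PB_closed[OF zP, of b]]])
      (use PB_closed[OF zP, of b] in \<open>auto simp: zs_def free_module_carrier\<close>)
  have "zs \<in> carrier (PB (B p))"
  proof (rule free_moduleI[OF _ _ free_module_finite[OF zP]])
    have 0: "z b = \<zero>\<^bsub>T.F\<^esub> \<Longrightarrow> zs b = \<zero>\<^bsub>T.F\<^esub>" for b by (rule ext) (simp add: zs_def)
    show "zs b \<in> carrier (opposite T.A)" for b using zsb by (simp add: T.A_simps)
    show "zs b = \<zero>\<^bsub>opposite T.A\<^esub>" if "b \<notin> B p" for b
      using 0[of b] zP that by (simp add: T.A_simps free_module_carrier)
    show "zs b = \<zero>\<^bsub>opposite T.A\<^esub>" if "b \<notin> {b. z b \<noteq> \<zero>\<^bsub>opposite T.A\<^esub>}" for b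
      using 0[of b] that by (simp add: T.A_simps)
  qed
  moreover have "x \<in> ?Ts" if "zs b x \<noteq> \<zero>\<^bsub>k\<^esub>" for b x
  proof -
    have "rt x = s" "z b x \<noteq> \<zero>\<^bsub>k\<^esub>" using that unfolding zs_def by (auto split: if_splits)
    then show ?thesis using subsetD[OF TS PT_supp[OF TS z(1)]] x0(2) by auto
  qed
  ultimately have zs: "zs \<in> PT ?Ts (B p)" using up_S[OF upTs] by (rule_tac PTI)
  then have zsP: "zs \<in> carrier (PB (B p))" by (simp add: PT_def)
  interpret P: left_module "opposite T.A" "PB (B i)" for i by (rule lPB)
  let ?zm = "z \<ominus>\<^bsub>PB (B p)\<^esub> zs"
  have zval: "z b x \<in> carrier k" for b x by (rule free_module_closed[OF T.k.ring_axioms PB_closed[OF zP]])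
  have zmv: "?zm b x = (if rt x = s then \<zero>\<^bsub>k\<^esub> else z b x)" for b x
    unfolding PB_diff[OF zP zsP] using zval by (simp add: zs_def a_minus_def T.k.r_neg)
  have zm: "?zm \<in> PT ?Tm (B p)"
  proof (rule PTI[OF up_S[OF upTm] P.M.minus_closed[OF zP zsP]])
    fix b x assume "?zm b x \<noteq> \<zero>\<^bsub>k\<^esub>"
    then have "rt x \<noteq> s" "z b x \<noteq> \<zero>\<^bsub>k\<^esub>" unfolding zmv by (auto split: if_splits)
    then show "x \<in> ?Tm" using PT_supp[OF TS z(1)] by simp
  qed
  \<comment> \<open>The part \<open>zs\<close> of \<open>z\<close> at \<open>s\<close> need not be a
    cycle, so it is first corrected by some \<open>w\<close> from the strictly larger sets.\<close>
  have "\<exists>w\<in>PT ?Tp (B p). cycle B d p (zs \<ominus>\<^bsub>PB (B p)\<^esub> w)"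
  proof (cases p)
    case 0
    have "\<zero>\<^bsub>PB (B p)\<^esub> \<in> PT ?Tp (B p)"
      by (rule PTI[OF up_S[OF upTp] P.zero_closed]) (simp add: T.A_simps)
    then show ?thesis using 0 by (intro bexI[of _ "\<zero>\<^bsub>PB (B p)\<^esub>"]) (simp_all add: cycle_def)
  next
    case (Suc q)
    have zP': "z \<in> carrier (PB (B (Suc q)))" "zs \<in> carrier (PB (B (Suc q)))" using zP zsP Suc by auto
    have ds: "d q zs \<in> PT ?Ts (B q)" by (rule PT_map[OF rD(1) upTs]) (use zs Suc in simp)
    have dm: "d q ?zm \<in> PT ?Tm (B q)" by (rule PT_map[OF rD(1) upTm]) (use zm Suc in simp)
    have "d q ?zm = \<zero>\<^bsub>PB (B q)\<^esub> \<ominus>\<^bsub>PB (B q)\<^esub> d q zs"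
      using lin_maps_diff[OF lPB lPB rD(1) zP'] z(2) Suc unfolding cycle_def by (simp only: nat.case)
    moreover have dsP: "d q zs \<in> carrier (PB (B q))" by (rule lin_maps_closed[OF rD(1) zP'(2)])
    ultimately have dmv: "d q ?zm b x = \<zero>\<^bsub>k\<^esub> \<ominus>\<^bsub>k\<^esub> d q zs b x" for b x
      using PB_diff[OF P.zero_closed dsP] by (simp add: T.A_simps)
    \<comment> \<open>The boundary of \<open>zs\<close> lies in the subcomplex of \<open>?Ts\<close>
      and, being minus the boundary of the rest \<open>?zm\<close>, also in that of
      \<open>?Tm\<close>. Hence it lies in that of \<open>?Tp\<close>, where the induction
      hypothesis makes it the boundary of some \<open>w\<close>.\<close>
    have "d q zs \<in> PT ?Tp (B q)"
    proof (rule PTI[OF up_S[OF upTp] dsP])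
      fix b x assume nz: "d q zs b x \<noteq> \<zero>\<^bsub>k\<^esub>"
      have c: "d q zs b x \<in> carrier k" by (rule free_module_closed[OF T.k.ring_axioms PB_closed[OF dsP]])
      have "d q ?zm b x \<noteq> \<zero>\<^bsub>k\<^esub>"
      proof
        assume "d q ?zm b x = \<zero>\<^bsub>k\<^esub>"
        then have "\<zero>\<^bsub>k\<^esub> \<ominus>\<^bsub>k\<^esub> d q zs b x = \<zero>\<^bsub>k\<^esub>" unfolding dmv .
        then have "\<ominus>\<^bsub>k\<^esub> d q zs b x = \<zero>\<^bsub>k\<^esub>" using c by (simp add: a_minus_def)
        then show False using nz c by (metis T.k.minus_minus T.k.minus_zero)
      qed
      then have "x \<in> ?Tm" by (rule PT_supp[OF up_S[OF upTm] dm])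
      moreover have "x \<in> ?Ts" using nz by (rule PT_supp[OF up_S[OF upTs] ds])
      ultimately show "x \<in> ?Tp" using x0(2) by blast
    qed
    moreover have "cycle B d q (d q zs)" by (rule cycle_d[OF zP'(2)])
    ultimately obtain w where w: "w \<in> PT ?Tp (B (Suc q))" "d q w = d q zs"
      using exTp unfolding exact_on_def by blast
    have wP: "w \<in> carrier (PB (B (Suc q)))" using w(1) by (simp add: PT_def)
    have "d q (zs \<ominus>\<^bsub>PB (B (Suc q))\<^esub> w) = d q zs \<ominus>\<^bsub>PB (B q)\<^esub> d q zs"
      using lin_maps_diff[OF lPB lPB rD(1) zP'(2) wP] w(2) by (simp only:)
    also have "\<dots> = \<zero>\<^bsub>PB (B q)\<^esub>" unfolding a_minus_def by (rule P.M.r_neg[OF dsP])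
    finally have "d q (zs \<ominus>\<^bsub>PB (B (Suc q))\<^esub> w) = \<zero>\<^bsub>PB (B q)\<^esub>" .
    then show ?thesis using w(1) Suc unfolding cycle_def by (intro bexI[of _ w]) simp_all
  qed
  then obtain w where w: "w \<in> PT ?Tp (B p)" and cy: "cycle B d p (zs \<ominus>\<^bsub>PB (B p)\<^esub> w)" by blast
  have wP: "w \<in> carrier (PB (B p))" using w by (simp add: PT_def)
  have wTs: "w \<in> PT ?Ts (B p)" by (rule PT_mono[OF TpT _ w]) blast
  have "zs \<ominus>\<^bsub>PB (B p)\<^esub> w \<in> PT ?Ts (B p)" by (rule PT_diff[OF _ zs wTs]) blast
  moreover have "exact_on B d ?Ts" by (rule exact_principal[OF x0S]) (use x0(2) s0 in simp)
  ultimately obtain y where y: "y \<in> PT ?Ts (B (Suc p))" "d p y = zs \<ominus>\<^bsub>PB (B p)\<^esub> w"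
    using cy unfolding exact_on_def by blast
  have val: "(z \<ominus>\<^bsub>PB (B p)\<^esub> d p y) b x = (if rt x = s then \<zero>\<^bsub>k\<^esub> else z b x) \<oplus>\<^bsub>k\<^esub> w b x" for b x
  proof -
    have wc: "w b x \<in> carrier k" by (rule free_module_closed[OF T.k.ring_axioms PB_closed[OF wP]])
    show ?thesis
      unfolding y(2) PB_diff[OF zP P.M.minus_closed[OF zsP wP]] PB_diff[OF zsP wP]
      using zval[of b x] wc
      by (simp add: zs_def a_minus_def T.k.minus_add T.k.r_neg T.k.r_neg1 T.k.a_assoc[symmetric])
  qed
  \<comment> \<open>Subtracting \<open>d p y\<close> deletes the part at \<open>s\<close> and adds
    only terms of \<open>w\<close>, whose sets are too large to count for
    \<open>level c\<close>.\<close>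
  have "level c (z \<ominus>\<^bsub>PB (B p)\<^esub> d p y) \<subseteq> level c z - {s}"
  proof
    fix t assume "t \<in> level c (z \<ominus>\<^bsub>PB (B p)\<^esub> d p y)"
    then obtain b x where t: "card t = c" "rt x = t" "(z \<ominus>\<^bsub>PB (B p)\<^esub> d p y) b x \<noteq> \<zero>\<^bsub>k\<^esub>"
      unfolding level_def by blast
    have "w b x = \<zero>\<^bsub>k\<^esub>"
    proof (rule ccontr)
      assume "w b x \<noteq> \<zero>\<^bsub>k\<^esub>"
      then have "x \<in> ?Tp" by (rule PT_supp[OF up_S[OF upTp] w])
      then have "card s < card (rt x)" using psubset_card_mono[of "rt x" s] rt_finite by blast
      then show False using t x0(3) by simp
    qed
    then have "(if rt x = s then \<zero>\<^bsub>k\<^esub> else z b x) \<noteq> \<zero>\<^bsub>k\<^esub>"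
      using t(3) val[of b x] by (metis T.k.r_zero T.k.zero_closed)
    then have "rt x \<noteq> s" "z b x \<noteq> \<zero>\<^bsub>k\<^esub>" by (cases "rt x = s"; simp)+
    then show "t \<in> level c z - {s}" using t by (auto simp: level_def)
  qed
  then have "level c (z \<ominus>\<^bsub>PB (B p)\<^esub> d p y) \<subset> level c z" using s by blast
  moreover have "y \<in> PT T (B (Suc p))" by (rule PT_mono[OF TsT TS y(1)])
  ultimately show ?thesis by blast
qed

text \<open>Descending induction on a lower bound for the size of \<open>rt\<close>;
  \<open>m\<close> measures how far this bound lies below \<open>n + 1\<close>, and for
  \<open>m = 0\<close> the family is empty. Within one step \<open>remove_level\<close> is repeated
  until no set of size \<open>c\<close> is left.\<close>

lemma exact_level:
  assumes "up T" "\<And>x. x \<in> T \<Longrightarrow> n < card (rt x) + m \<and> rt x \<noteq> {}"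
  shows "exact_on B d T"
  using assms
proof (induction m arbitrary: T)
  case 0
  have TS: "T \<subseteq> S" by (rule up_S[OF 0(1)])
  then have T: "T = {}" using 0(2) rt_card by fastforce
  show ?case unfolding exact_on_def
  proof (intro allI ballI impI)
    fix p z assume z: "z \<in> PT T (B p)"
    interpret P: left_module "opposite T.A" "PB (B i)" for i by (rule lPB)
    have "z b x = \<zero>\<^bsub>k\<^esub>" for b x using PT_supp[OF TS z, of b x] T by auto
    then have "z = \<zero>\<^bsub>PB (B p)\<^esub>" by (intro ext) (simp add: T.A_simps)
    then have "d p \<zero>\<^bsub>PB (B (Suc p))\<^esub> = z" using lin_maps_zero[OF lPB lPB rD(1)] by (simp only:)
    moreover have "\<zero>\<^bsub>PB (B (Suc p))\<^esub> \<in> PT T (B (Suc p))"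
      by (rule PTI[OF TS P.zero_closed]) (simp add: T.A_simps)
    ultimately show "\<exists>y\<in>PT T (B (Suc p)). d p y = z" by blast
  qed
next
  case (Suc m)
  \<comment> \<open>Truncated subtraction does no harm: if \<open>m\<close> is at least
    \<open>n\<close>, the bound is 0 and says nothing.\<close>
  define c where "c = n - m"
  have TS: "T \<subseteq> S" by (rule up_S[OF Suc.prems(1)])
  have Tc: "c \<le> card (rt x) \<and> rt x \<noteq> {}" if "x \<in> T" for x
    using Suc.prems(2)[OF that] unfolding c_def by auto
  have IH: "exact_on B d T'" if "up T'" "\<And>x. x \<in> T' \<Longrightarrow> c < card (rt x) \<and> rt x \<noteq> {}" for T'
  proof (rule Suc.IH[OF that(1)])
    fix x assume "x \<in> T'"
    from that(2)[OF this] show "n < card (rt x) + m \<and> rt x \<noteq> {}" unfolding c_def by linarith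
  qed
  interpret P: left_module "opposite T.A" "PB (B i)" for i by (rule lPB)
  have "\<exists>y\<in>PT T (B (Suc p)). d p y = z" if "z \<in> PT T (B p)" "cycle B d p z" for p z
    using that
  proof (induction "card (level c z)" arbitrary: z rule: less_induct)
    case less
    have zP: "z \<in> carrier (PB (B p))" using less.prems(1) by (simp add: PT_def)
    show ?case
    proof (cases "level c z = {}")
      case True
      let ?T = "{x \<in> T. c < card (rt x)}"
      have sub: "?T \<subseteq> S" using TS by blast
      have "up ?T" unfolding up_def
      proof (intro conjI ballI impI sub)
        fix x y assume "x \<in> ?T" "y \<in> S" "rt x \<subseteq> rt y"
        then show "y \<in> ?T" using Suc.prems(1) card_mono[OF rt_finite[of y], of "rt x"] unfolding up_def by auto
      qed
      then have "exact_on B d ?T" by (rule IH) (use Tc in auto)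
      moreover have "z \<in> PT ?T (B p)"
      proof (rule PTI[OF sub zP])
        fix b x assume nz: "z b x \<noteq> \<zero>\<^bsub>k\<^esub>"
        then have "x \<in> T" by (rule PT_supp[OF TS less.prems(1)])
        moreover have "card (rt x) \<noteq> c" using nz True unfolding level_def by blast
        ultimately show "x \<in> ?T" using Tc[of x] by auto
      qed
      ultimately obtain y where y: "y \<in> PT ?T (B (Suc p))" "d p y = z"
        using less.prems(2) unfolding exact_on_def by blast
      have "y \<in> PT T (B (Suc p))" by (rule PT_mono[OF _ TS y(1)]) blast
      then show ?thesis using y(2) by blast
    next
      case False
      then obtain s where "s \<in> level c z" by blast
      then obtain y where y: "y \<in> PT T (B (Suc p))" "level c (z \<ominus>\<^bsub>PB (B p)\<^esub> d p y) \<subset> level c z"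
        using remove_level[OF Suc.prems(1) Tc IH less.prems] by blast
      have yP: "y \<in> carrier (PB (B (Suc p)))" using y(1) by (simp add: PT_def)
      have dyP: "d p y \<in> carrier (PB (B p))" by (rule lin_maps_closed[OF rD(1) yP])
      have "\<exists>y'\<in>PT T (B (Suc p)). d p y' = z \<ominus>\<^bsub>PB (B p)\<^esub> d p y"
        by (rule less.hyps[OF psubset_card_mono[OF finite_level[OF zP] y(2)]
              PT_diff[OF TS less.prems(1) PT_map[OF rD(1) Suc.prems(1) y(1)]]
              cycle_diff[OF less.prems(2) cycle_d[OF yP] zP dyP]])
      then obtain y' where y': "y' \<in> PT T (B (Suc p))" "d p y' = z \<ominus>\<^bsub>PB (B p)\<^esub> d p y" by blast
      have y'P: "y' \<in> carrier (PB (B (Suc p)))" using y'(1) by (simp add: PT_def)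
      have "d p (y' \<oplus>\<^bsub>PB (B (Suc p))\<^esub> y) = z"
        unfolding lin_maps_add[OF rD(1) y'P yP] y'(2) by (rule P.diff_add_cancel[OF zP dyP])
      then show ?thesis by (intro bexI[OF _ PT_add[OF y'(1) y(1)]])
    qed
  qed
  then show ?case unfolding exact_on_def by blast
qed

end

text \<open>The projected resolution resolves the trivial module over the quotient algebra. As the
  two augmentations agree along \<open>\<pi>\<close>, base change to \<open>k\<close> yields the
  same complex from both resolutions.\<close>

theorem Tor_quotient_iso: "module_iso k (Tor k T.A T.N T.N p) (Tor k T'.A T'.N T'.N p)"
proof -
  interpret aug: augmented_algebra k T.A T.N T.\<epsilon> by (rule T.augmented)
  interpret aug': augmented_algebra k T'.A T'.N T'.\<epsilon> by (rule T'.augmented)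
  interpret \<pi>: ring_surjection "opposite T.A" "opposite T'.A" \<pi> by (rule \<pi>_surjection)
  obtain B :: "nat \<Rightarrow> ('k, 'x \<Rightarrow> 'k) gen set" and d e where r: "free_resolution (opposite T.A) T.N B d e"
    using free_resolution_exists[OF aug.N_right] by blast
  let ?d = "\<lambda>p. \<pi>.change (B p) (d p)"
  have cN: "carrier T.N = carrier k" "carrier T'.N = carrier k" by (simp_all add: scalar_module_def)
  have us: "a \<odot>\<^bsub>T.N\<^esub> x = \<pi> a \<odot>\<^bsub>T'.N\<^esub> x" if "a \<in> carrier (opposite T.A)" "x \<in> carrier T.N" for a x
    using that aug.N_smult[of a x] aug'.N_smult[of "\<pi> a" x] \<pi>_closed[of a] \<epsilon>_\<pi>[of a] cN
    by (simp add: T.A_simps T'.A_simps)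
  let ?T = "{x \<in> S. rt x \<noteq> {}}"
  have up: "up ?T" unfolding up_def by blast
  \<comment> \<open>With \<open>m = Suc n\<close> the condition on sizes is vacuous, and all
    elements with turns are covered.\<close>
  have "exact_on B d ?T" by (rule exact_level[OF r up, of "Suc n"]) auto
  then have ex: "\<exists>y\<in>carrier (PB (B (Suc p))). \<pi> \<circ> y = \<zero>\<^bsub>free_module (opposite T'.A) (B (Suc p))\<^esub> \<and> d p y = z"
    if z: "z \<in> carrier (PB (B p))" "\<pi> \<circ> z = \<zero>\<^bsub>free_module (opposite T'.A) (B p)\<^esub>"
      "case p of 0 \<Rightarrow> True | Suc q \<Rightarrow> d q z = \<zero>\<^bsub>PB (B q)\<^esub>" for p z
  proof -
    have "z \<in> PT ?T (B p)" using comp_\<pi>_zero_iff[OF z(1)] z(2) by blast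
    then obtain y where y: "y \<in> PT ?T (B (Suc p))" "d p y = z"
      using \<open>exact_on B d ?T\<close> z(3) unfolding exact_on_def cycle_def by blast
    then have "y \<in> carrier (PB (B (Suc p)))" by (simp add: PT_def)
    then show ?thesis using comp_\<pi>_zero_iff[of y "B (Suc p)"] y by blast
  qed
  have r': "free_resolution (opposite T'.A) T'.N B ?d
      (lin_ext (opposite T'.A) T'.N (\<lambda>b. e (basis_vec (opposite T.A) b)))"
    by (rule \<pi>.change_resolution[OF aug.N_right aug'.N_right _ _ _ us r ex]) (simp_all add: scalar_module_def)
  have "homology (\<lambda>p. free_module k (B p)) (\<lambda>p. aug.change (B p) (d p)) p
      = homology (\<lambda>p. free_module k (B p)) (\<lambda>p. aug'.change (B p) (?d p)) p"
  proof (rule homology_cong)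
    fix p x assume "x \<in> carrier (free_module k (B (Suc p)))"
    then obtain f where f: "f \<in> carrier (PB (B (Suc p)))" "x = T.\<epsilon> \<circ> f" using aug.comp_surj by blast
    have \<epsilon>\<pi>: "T'.\<epsilon> \<circ> (\<pi> \<circ> g) = T.\<epsilon> \<circ> g" if "g \<in> carrier (PB C)" for g and C :: "('k, 'x \<Rightarrow> 'k) gen set"
      by (rule ext) (use PB_closed[OF that] \<epsilon>_\<pi> in simp)
    note dl = free_resolutionD(1)[OF r]
    have "aug'.change (B p) (?d p) x = T'.\<epsilon> \<circ> (\<pi> \<circ> d p f)"
      using aug'.change(2)[OF \<pi>.change(1)[OF dl] \<pi>.comp_closed[OF f(1)]] \<pi>.change(2)[OF dl f(1)]
        \<epsilon>\<pi>[OF f(1)] f(2) by (simp only:)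
    also have "\<dots> = aug.change (B p) (d p) x"
      using aug.change(2)[OF dl f(1)] \<epsilon>\<pi>[OF lin_maps_closed[OF dl f(1)]] f(2) by (simp only:)
    finally show "aug.change (B p) (d p) x = aug'.change (B p) (?d p) x" by (rule sym)
  qed
  then have "module_iso k (Tor k T.A T.N T.N p)
      (homology (\<lambda>p. free_module k (B p)) (\<lambda>p. aug'.change (B p) (?d p)) p)"
    using aug.Tor_iso(1)[OF r, of p] by (simp only:)
  then show ?thesis
    by (rule module_iso_trans[OF _ module_iso_sym[OF aug'.Tor_left_module[OF r'] aug'.Tor_iso(1)[OF r']]])
qed

end

section \<open>The bar resolution\<close>

lemma (in left_module) diff_zero: "x \<in> carrier M \<Longrightarrow> x \<ominus>\<^bsub>M\<^esub> \<zero>\<^bsub>M\<^esub> = x"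
  by (simp add: a_minus_def)

lemma lin_maps_finsum:
  assumes "left_module R M" "left_module R N" "f \<in> lin_maps R M N" "v \<in> I \<rightarrow> carrier M"
  shows "f (\<Oplus>\<^bsub>M\<^esub>i\<in>I. v i) = (\<Oplus>\<^bsub>N\<^esub>i\<in>I. f (v i))"
proof -
  interpret M: left_module R M by fact
  interpret N: left_module R N by fact
  note z = lin_maps_zero[OF assms(1-3)]
  show ?thesis using assms(4)
  proof (induction I rule: infinite_finite_induct)
    case (insert i I)
    then have "v i \<in> carrier M" "v \<in> I \<rightarrow> carrier M" by auto
    with insert show ?case
      by (simp add: M.finsum_insert N.finsum_insert Pi_iff lin_maps_closed[OF assms(3)] lin_maps_add[OF assms(3)])
  qed (simp_all add: z)
qed

locale group_bar =
  fixes k :: "('k, 'e) ring_scheme" and H :: "('h, 'f) monoid_scheme"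
  assumes k_cring: "cring k" and H_group: "group H"
begin

sublocale H: group H by (rule H_group)

lemma twisted: "twisted_monoid_algebra k (carrier H) (monoid.mult H) (\<lambda>_ _. \<one>\<^bsub>k\<^esub>) \<one>\<^bsub>H\<^esub> (\<lambda>_. True)
    (\<lambda>x y. basis_vec k (x \<otimes>\<^bsub>H\<^esub> y))"
proof -
  interpret k: cring k by (rule k_cring)
  show ?thesis
  proof (unfold_locales)
    show "basis_vec k (x \<otimes>\<^bsub>H\<^esub> y) = \<one>\<^bsub>k\<^esub> \<odot>\<^bsub>free_module k (carrier H)\<^esub> basis_vec k (x \<otimes>\<^bsub>H\<^esub> y)" for x y
      by (rule ext) (simp add: basis_vec_def)
  qed (auto simp: H.m_assoc)
qed

sublocale twisted_monoid_algebra k "carrier H" "monoid.mult H" "\<lambda>_ _. \<one>\<^bsub>k\<^esub>" "\<one>\<^bsub>H\<^esub>" "\<lambda>_. True"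
    "\<lambda>x y. basis_vec k (x \<otimes>\<^bsub>H\<^esub> y)"
  by (rule twisted)

definition L :: "nat \<Rightarrow> 'h list set" where
  "L p = {xs. length xs = p \<and> set xs \<subseteq> carrier H}"

abbreviation "K p \<equiv> free_module k (L p)"
abbreviation "PL p \<equiv> free_module (opposite A) (L p)"

lemma lK: "left_module k (K p)" by (rule free_module_left_module[OF k.ring_axioms])
lemma op: "ring (opposite A)" by (rule opposite_ring[OF A_ring])
lemma lP: "left_module (opposite A) (PL p)" by (rule free_module_left_module[OF op])
lemma eK: "xs \<in> L p \<Longrightarrow> basis_vec k xs \<in> carrier (K p)" by (rule basis_vec_in_free[OF k.ring_axioms])
lemma eP: "xs \<in> L p \<Longrightarrow> basis_vec (opposite A) xs \<in> carrier (PL p)" by (rule basis_vec_in_free[OF op])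

definition sg :: "nat \<Rightarrow> 'k" where "sg i = (\<ominus>\<^bsub>k\<^esub> \<one>\<^bsub>k\<^esub>) [^]\<^bsub>k\<^esub> i"

lemma sg_closed [simp]: "sg i \<in> carrier k" by (simp add: sg_def)
lemma sg_0: "sg 0 = \<one>\<^bsub>k\<^esub>" by (simp add: sg_def)
lemma sg_Suc: "sg (Suc i) = \<ominus>\<^bsub>k\<^esub> sg i" by (simp add: sg_def k.r_minus)
lemma sg_sg: "sg i \<otimes>\<^bsub>k\<^esub> sg i = \<one>\<^bsub>k\<^esub>"
  by (induction i) (simp_all add: sg_0 sg_Suc k.l_minus k.r_minus)

text \<open>The group element split off to the right by the \<open>i\<close>-th face of \<open>[x\<^sub>1|\<dots>|x\<^sub>p]\<close>; it is
  \<open>x\<^sub>p\<close> for the last face.\<close>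

definition split_off :: "nat \<Rightarrow> 'h list \<Rightarrow> 'h" where
  "split_off i xs = (if i = length xs then last xs else \<one>\<^bsub>H\<^esub>)"

lemma face_L:
  assumes "xs \<in> L (Suc p)" "i \<le> Suc p" shows "bar_face H i xs \<in> L p"
proof -
  have xs: "length xs = Suc p" "set xs \<subseteq> carrier H" using assms(1) by (auto simp: L_def)
  have "set (tl xs) \<subseteq> carrier H" "set (butlast xs) \<subseteq> carrier H"
    using xs by (cases xs; auto dest: in_set_butlastD)+
  moreover have "xs ! j \<in> carrier H" if "j < Suc p" for j using xs nth_mem[of j xs] that by auto
  moreover have "set (take j xs) \<subseteq> carrier H" "set (drop j xs) \<subseteq> carrier H" for j
    using xs(2) set_take_subset[of j xs] set_drop_subset[of j xs] by blast+
  ultimately show ?thesis using xs(1) assms(2) unfolding L_def bar_face_def by auto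
qed

lemma split_off_closed: "xs \<in> L (Suc p) \<Longrightarrow> split_off i xs \<in> carrier H"
  by (cases xs rule: rev_cases) (auto simp: split_off_def L_def)

text \<open>Appending a letter commutes with these faces, except that the last of them hands the
  final letter of \<open>xs\<close> over to \<open>h\<close>. The one further face of the longer
  tuple, which would drop \<open>h\<close>, is excluded by the bound on \<open>i\<close>.\<close>

lemma face_snoc:
  assumes "xs \<in> L (Suc p)" "h \<in> carrier H" "i \<le> Suc p"
  shows "bar_face H i (xs @ [h]) = bar_face H i xs @ [split_off i xs \<otimes>\<^bsub>H\<^esub> h]"
proof -
  have xs: "length xs = Suc p" using assms(1) by (simp add: L_def)
  consider "i = 0" | "i = Suc p" | "i \<noteq> 0" "i < Suc p" using assms(3) by linarith
  then show ?thesis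
  proof cases
    case 1
    then show ?thesis using xs assms(2) by (cases xs) (auto simp: bar_face_def split_off_def)
  next
    case 2
    obtain ys y where "xs = ys @ [y]" "length ys = p" using xs by (cases xs rule: rev_cases) auto
    then show ?thesis using 2 by (simp add: bar_face_def split_off_def nth_append)
  next
    case 3
    then show ?thesis using xs assms(2) by (auto simp: bar_face_def split_off_def nth_append)
  qed
qed

lemma snoc_L: "xs \<in> L p \<Longrightarrow> h \<in> carrier H \<Longrightarrow> xs @ [h] \<in> L (Suc p)"
  by (auto simp: L_def)

text \<open>The term \<open>c [xs] h\<close> of the free right module: the generator
  \<open>xs\<close> times the group element \<open>h\<close> and the scalar
  \<open>c\<close>.\<close>

definition gen :: "'k \<Rightarrow> 'h \<Rightarrow> 'h list \<Rightarrow> 'h list \<Rightarrow> 'h \<Rightarrow> 'k" where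
  "gen c h xs = (\<lambda>ys g. if ys = xs \<and> g = h then c else \<zero>\<^bsub>k\<^esub>)"

lemma opA: "carrier (opposite A) = carrier F" by (simp add: A_simps)

lemma gen_eq:
  assumes "c \<in> carrier k" "h \<in> carrier H"
  shows "gen c h xs = (c \<odot>\<^bsub>F\<^esub> basis_vec k h) \<odot>\<^bsub>PL p\<^esub> basis_vec (opposite A) xs"
proof -
  interpret A: ring A by (rule A_ring)
  have c: "c \<odot>\<^bsub>F\<^esub> basis_vec k h \<in> carrier A" unfolding A_simps by (rule F.smult_closed[OF assms(1) e[OF assms(2)]])
  have "((c \<odot>\<^bsub>F\<^esub> basis_vec k h) \<odot>\<^bsub>PL p\<^esub> basis_vec (opposite A) xs) ys g = gen c h xs ys g" for ys g
  proof (cases "ys = xs")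
    case True
    then have "((c \<odot>\<^bsub>F\<^esub> basis_vec k h) \<odot>\<^bsub>PL p\<^esub> basis_vec (opposite A) xs) ys = c \<odot>\<^bsub>F\<^esub> basis_vec k h"
      using A.l_one[OF c] by (simp add: basis_vec_def)
    then show ?thesis using True assms by (simp add: gen_def basis_vec_def)
  next
    case False
    then have "((c \<odot>\<^bsub>F\<^esub> basis_vec k h) \<odot>\<^bsub>PL p\<^esub> basis_vec (opposite A) xs) ys = \<zero>\<^bsub>A\<^esub>"
      using A.l_null[OF c] by (simp add: basis_vec_def)
    then show ?thesis using False by (simp add: gen_def A_simps)
  qed
  then show ?thesis by (intro ext) (rule sym)
qed

lemma gen_closed: "c \<in> carrier k \<Longrightarrow> h \<in> carrier H \<Longrightarrow> xs \<in> L p \<Longrightarrow> gen c h xs \<in> carrier (PL p)"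
proof -
  assume *: "c \<in> carrier k" "h \<in> carrier H" "xs \<in> L p"
  interpret P: left_module "opposite A" "PL p" by (rule lP)
  show ?thesis unfolding gen_eq[OF *(1,2), of xs p]
    by (rule P.smult_closed[OF _ eP[OF *(3)]]) (unfold opA, rule F.smult_closed[OF *(1) e[OF *(2)]])
qed

lemma smult_gen:
  assumes "c \<in> carrier k" "h \<in> carrier H" "c' \<in> carrier k" "h' \<in> carrier H" "xs \<in> L p"
  shows "(c \<odot>\<^bsub>F\<^esub> basis_vec k h) \<odot>\<^bsub>PL p\<^esub> gen c' h' xs = gen (c' \<otimes>\<^bsub>k\<^esub> c) (h' \<otimes>\<^bsub>H\<^esub> h) xs"
proof -
  interpret P: left_module "opposite A" "PL p" by (rule lP)
  note eh = e[OF assms(2)] and eh' = e[OF assms(4)]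
  have m: "c \<odot>\<^bsub>F\<^esub> basis_vec k h \<in> carrier F" "c' \<odot>\<^bsub>F\<^esub> basis_vec k h' \<in> carrier F"
    by (rule F.smult_closed assms(1) assms(3) eh eh')+
  have hh: "h' \<otimes>\<^bsub>H\<^esub> h \<in> carrier H" and cc: "c' \<otimes>\<^bsub>k\<^esub> c \<in> carrier k" using assms by auto
  have "(c \<odot>\<^bsub>F\<^esub> basis_vec k h) \<odot>\<^bsub>PL p\<^esub> gen c' h' xs
      = ((c \<odot>\<^bsub>F\<^esub> basis_vec k h) \<otimes>\<^bsub>opposite A\<^esub> (c' \<odot>\<^bsub>F\<^esub> basis_vec k h')) \<odot>\<^bsub>PL p\<^esub> basis_vec (opposite A) xs"
    unfolding gen_eq[OF assms(3,4), of xs p]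
    by (rule P.smult_assoc[symmetric]) (unfold opA, (rule m eP assms(5))+)
  also have "(c \<odot>\<^bsub>F\<^esub> basis_vec k h) \<otimes>\<^bsub>opposite A\<^esub> (c' \<odot>\<^bsub>F\<^esub> basis_vec k h')
      = (c' \<odot>\<^bsub>F\<^esub> basis_vec k h') \<otimes>\<^bsub>A\<^esub> (c \<odot>\<^bsub>F\<^esub> basis_vec k h)"
    by (rule opposite_simps(5))
  also have "\<dots> = c' \<odot>\<^bsub>F\<^esub> (c \<odot>\<^bsub>F\<^esub> (\<one>\<^bsub>k\<^esub> \<odot>\<^bsub>F\<^esub> basis_vec k (h' \<otimes>\<^bsub>H\<^esub> h)))"
    unfolding lin_maps_smult[OF mult_left_lin[OF m(1)] assms(3) eh'] lin_maps_smult[OF mult_right_lin[OF eh'] assms(1) eh]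
      mult_basis[OF assms(4,2)] ..
  also have "\<dots> = (c' \<otimes>\<^bsub>k\<^esub> c) \<odot>\<^bsub>F\<^esub> basis_vec k (h' \<otimes>\<^bsub>H\<^esub> h)"
    unfolding F.smult_one[OF e[OF hh]] F.smult_assoc[OF assms(3,1) e[OF hh]] ..
  finally show ?thesis unfolding gen_eq[OF cc hh, of xs p] .
qed

lemma gen_induct [consumes 1, case_names zero gen]:
  assumes f: "f \<in> carrier (PL p)"
    and z: "Q (\<lambda>_ _. \<zero>\<^bsub>k\<^esub>)"
    and s: "\<And>c h xs g. c \<in> carrier k \<Longrightarrow> h \<in> carrier H \<Longrightarrow> xs \<in> L p \<Longrightarrow> g \<in> carrier (PL p) \<Longrightarrow> Q g \<Longrightarrow>
      Q (gen c h xs \<oplus>\<^bsub>PL p\<^esub> g)"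
  shows "Q f"
proof -
  interpret P: left_module "opposite A" "PL p" by (rule lP)
  have zP: "\<zero>\<^bsub>PL p\<^esub> = (\<lambda>_ _. \<zero>\<^bsub>k\<^esub>)" by (simp add: A_simps)
  show ?thesis using op f
  proof (induction f rule: free_module_induct)
    case zero
    then show ?case using z zP by (simp only: free_module_simps)
  next
    case (step xs a g)
    have a: "a \<in> carrier F" using step(2) opA by simp
    note ex = eP[OF step(1)]
    show ?case using k.ring_axioms a
    proof (induction a rule: free_module_induct)
      case zero
      have "(\<lambda>_. \<zero>\<^bsub>k\<^esub>) = \<zero>\<^bsub>opposite A\<^esub>" by (simp add: A_simps)
      then have "(\<lambda>_. \<zero>\<^bsub>k\<^esub>) \<odot>\<^bsub>PL p\<^esub> basis_vec (opposite A) xs \<oplus>\<^bsub>PL p\<^esub> g = g"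
        using P.smult_l_null[OF ex] P.M.l_zero[OF step.hyps(3)] by (simp only:)
      then show ?case using step.IH by (simp only:)
    next
      case (step h c a)
      have cA: "c \<odot>\<^bsub>F\<^esub> basis_vec k h \<in> carrier (opposite A)" unfolding opA by (rule F.smult_closed[OF step(2) e[OF step(1)]])
      have aA: "a \<in> carrier (opposite A)" unfolding opA by (rule step(3))
      have add: "x \<oplus>\<^bsub>F\<^esub> y = x \<oplus>\<^bsub>opposite A\<^esub> y" for x y by (simp add: A_simps)
      have "(c \<odot>\<^bsub>F\<^esub> basis_vec k h \<oplus>\<^bsub>F\<^esub> a) \<odot>\<^bsub>PL p\<^esub> basis_vec (opposite A) xs \<oplus>\<^bsub>PL p\<^esub> g
          = gen c h xs \<oplus>\<^bsub>PL p\<^esub> (a \<odot>\<^bsub>PL p\<^esub> basis_vec (opposite A) xs \<oplus>\<^bsub>PL p\<^esub> g)"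
        unfolding add P.smult_l_distr[OF cA aA ex] gen_eq[OF step(2,1), of xs p]
        by (rule P.M.a_assoc[OF P.smult_closed[OF cA ex] P.smult_closed[OF aA ex] \<open>g \<in> carrier (PL p)\<close>])
      then show ?case
        using s[OF step(2,1) \<open>xs \<in> L p\<close> P.M.a_closed[OF P.smult_closed[OF aA ex] \<open>g \<in> carrier (PL p)\<close>] step.IH]
        by (simp only:)
    qed
  qed
qed

section \<open>The bar resolution in coordinates over \<open>k\<close>\<close>

text \<open>Writes the term \<open>[xs] h\<close> as the tuple \<open>xs @ [h]\<close>, identifying
  the free right module on tuples of length \<open>p\<close> with the free \<open>k\<close>-module
  on tuples of length \<open>Suc p\<close>. The contraction is linear over \<open>k\<close> only, so
  it is built on that side.\<close>

definition \<Theta> :: "nat \<Rightarrow> ('h list \<Rightarrow> 'h \<Rightarrow> 'k) \<Rightarrow> 'h list \<Rightarrow> 'k" where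
  "\<Theta> p f = (\<lambda>ys. if ys \<in> L (Suc p) then f (butlast ys) (last ys) else \<zero>\<^bsub>k\<^esub>)"

definition \<Theta>' :: "nat \<Rightarrow> ('h list \<Rightarrow> 'k) \<Rightarrow> 'h list \<Rightarrow> 'h \<Rightarrow> 'k" where
  "\<Theta>' p g = (\<lambda>xs h. if xs \<in> L p \<and> h \<in> carrier H then g (xs @ [h]) else \<zero>\<^bsub>k\<^esub>)"

lemma \<Theta>_add: "f \<in> carrier (PL p) \<Longrightarrow> g \<in> carrier (PL p) \<Longrightarrow> \<Theta> p (f \<oplus>\<^bsub>PL p\<^esub> g) = \<Theta> p f \<oplus>\<^bsub>K (Suc p)\<^esub> \<Theta> p g"
  by (rule ext) (auto simp: \<Theta>_def A_simps)

lemma \<Theta>_zero: "\<Theta> p (\<lambda>_ _. \<zero>\<^bsub>k\<^esub>) = \<zero>\<^bsub>K (Suc p)\<^esub>"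
  by (rule ext) (simp add: \<Theta>_def)

lemma \<Theta>_gen:
  assumes "c \<in> carrier k" "h \<in> carrier H" "xs \<in> L p"
  shows "\<Theta> p (gen c h xs) = c \<odot>\<^bsub>K (Suc p)\<^esub> basis_vec k (xs @ [h])"
proof (rule ext)
  fix ys
  have "ys = xs @ [h] \<longleftrightarrow> ys \<in> L (Suc p) \<and> butlast ys = xs \<and> last ys = h"
    using snoc_L[OF assms(3,2)] by (cases ys rule: rev_cases) (auto simp: L_def)
  then show "\<Theta> p (gen c h xs) ys = (c \<odot>\<^bsub>K (Suc p)\<^esub> basis_vec k (xs @ [h])) ys"
    using assms(1) by (auto simp: \<Theta>_def gen_def basis_vec_def)
qed

lemma \<Theta>_closed: "f \<in> carrier (PL p) \<Longrightarrow> \<Theta> p f \<in> carrier (K (Suc p))"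
proof (induction f rule: gen_induct)
  case zero
  interpret K: left_module k "K (Suc p)" by (rule lK)
  show ?case unfolding \<Theta>_zero by (rule K.zero_closed)
next
  case (gen c h xs g)
  interpret K: left_module k "K (Suc p)" by (rule lK)
  show ?case unfolding \<Theta>_add[OF gen_closed[OF gen(1-3)] gen(4)] \<Theta>_gen[OF gen(1-3)]
    by (rule K.M.a_closed[OF K.smult_closed[OF gen(1) eK[OF snoc_L[OF gen(3,2)]]] gen(5)])
qed

lemma \<Theta>_inj:
  assumes "f \<in> carrier (PL p)" "g \<in> carrier (PL p)" "\<Theta> p f = \<Theta> p g" shows "f = g"
proof (intro ext)
  fix xs h
  have out: "y xs h = \<zero>\<^bsub>k\<^esub>" if "y \<in> carrier (PL p)" "\<not> (xs \<in> L p \<and> h \<in> carrier H)" for y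
  proof (cases "xs \<in> L p")
    case True
    then have "y xs \<in> carrier F" using that(1) by (simp add: free_module_carrier A_simps)
    then show ?thesis using True that(2) by (simp add: free_module_carrier)
  next
    case False
    then show ?thesis using that(1) by (simp add: free_module_carrier A_simps)
  qed
  show "f xs h = g xs h"
  proof (cases "xs \<in> L p \<and> h \<in> carrier H")
    case True
    then show ?thesis using fun_cong[OF assms(3), of "xs @ [h]"] snoc_L[of xs p h] by (simp add: \<Theta>_def)
  qed (simp add: out assms)
qed

lemma \<Theta>'_closed: assumes g: "g \<in> carrier (K (Suc p))" shows "\<Theta>' p g \<in> carrier (PL p)"
proof (rule free_moduleI)
  have fin: "finite {ys. g ys \<noteq> \<zero>\<^bsub>k\<^esub>}" by (rule free_module_finite[OF g])
  show "finite (butlast ` {ys. g ys \<noteq> \<zero>\<^bsub>k\<^esub>})" using fin by (rule finite_imageI)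
  show "\<Theta>' p g xs = \<zero>\<^bsub>opposite A\<^esub>" if "xs \<notin> butlast ` {ys. g ys \<noteq> \<zero>\<^bsub>k\<^esub>}" for xs
  proof -
    have "g (xs @ [h]) = \<zero>\<^bsub>k\<^esub>" for h using that by (force simp: image_iff)
    then show ?thesis by (auto simp: \<Theta>'_def A_simps)
  qed
  show "\<Theta>' p g xs = \<zero>\<^bsub>opposite A\<^esub>" if "xs \<notin> L p" for xs using that by (auto simp: \<Theta>'_def A_simps)
  show "\<Theta>' p g xs \<in> carrier (opposite A)" for xs
    unfolding opA
  proof (rule free_moduleI[OF _ _ finite_imageI[OF fin, of last]])
    show "\<Theta>' p g xs h = \<zero>\<^bsub>k\<^esub>" if "h \<notin> last ` {ys. g ys \<noteq> \<zero>\<^bsub>k\<^esub>}" for h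
    proof -
      have "g (xs @ [h]) = \<zero>\<^bsub>k\<^esub>" using that by (force simp: image_iff)
      then show ?thesis by (simp add: \<Theta>'_def)
    qed
  qed (use free_module_closed[OF k.ring_axioms g] in \<open>auto simp: \<Theta>'_def\<close>)
qed

lemma \<Theta>_\<Theta>': assumes g: "g \<in> carrier (K (Suc p))" shows "\<Theta> p (\<Theta>' p g) = g"
proof (rule ext)
  fix ys
  show "\<Theta> p (\<Theta>' p g) ys = g ys"
  proof (cases "ys \<in> L (Suc p)")
    case True
    then obtain xs h where "ys = xs @ [h]" "xs \<in> L p" "h \<in> carrier H" by (cases ys rule: rev_cases) (auto simp: L_def)
    then show ?thesis using True by (simp add: \<Theta>_def \<Theta>'_def)
  qed (use g in \<open>simp add: \<Theta>_def free_module_carrier\<close>)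
qed

definition dval :: "nat \<Rightarrow> 'h list \<Rightarrow> 'h list \<Rightarrow> 'h \<Rightarrow> 'k" where
  "dval p xs = (\<Oplus>\<^bsub>PL p\<^esub>i\<in>{0..Suc p}. gen (sg i) (split_off i xs) (bar_face H i xs))"

definition dP :: "nat \<Rightarrow> ('h list \<Rightarrow> 'h \<Rightarrow> 'k) \<Rightarrow> 'h list \<Rightarrow> 'h \<Rightarrow> 'k" where
  "dP p = lin_ext (opposite A) (PL p) (dval p)"

text \<open>The differential \<open>dP\<close> in the coordinates of \<open>\<Theta>\<close>. The
  last face of a tuple of length \<open>Suc (Suc p)\<close> is omitted, because the final letter
  records the group element acting from the right.\<close>

definition Dval :: "nat \<Rightarrow> 'h list \<Rightarrow> 'h list \<Rightarrow> 'k" where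
  "Dval p ys = (\<Oplus>\<^bsub>K (Suc p)\<^esub>i\<in>{0..Suc p}. sg i \<odot>\<^bsub>K (Suc p)\<^esub> basis_vec k (bar_face H i ys))"

definition D :: "nat \<Rightarrow> ('h list \<Rightarrow> 'k) \<Rightarrow> 'h list \<Rightarrow> 'k" where
  "D p = lin_ext k (K (Suc p)) (Dval p)"

lemma gens_closed: "xs \<in> L (Suc p) \<Longrightarrow> (\<lambda>i. gen (sg i) (split_off i xs) (bar_face H i xs)) \<in> {0..Suc p} \<rightarrow> carrier (PL p)"
  by (rule Pi_I) (rule gen_closed[OF sg_closed split_off_closed face_L], auto)

lemma dval_closed: "dval p \<in> L (Suc p) \<rightarrow> carrier (PL p)"
proof (rule Pi_I)
  interpret P: left_module "opposite A" "PL p" by (rule lP)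
  show "dval p xs \<in> carrier (PL p)" if "xs \<in> L (Suc p)" for xs
    unfolding dval_def by (rule P.M.finsum_closed[OF gens_closed[OF that]])
qed

lemma dP_lin: "dP p \<in> lin_maps (opposite A) (PL (Suc p)) (PL p)"
  unfolding dP_def by (rule left_module.lin_ext_lin[OF lP dval_closed])

lemma dP_basis: "xs \<in> L (Suc p) \<Longrightarrow> dP p (basis_vec (opposite A) xs) = dval p xs"
  unfolding dP_def by (rule left_module.lin_ext_basis_vec[OF lP dval_closed])

lemma faces_closed: "ys \<in> L (Suc (Suc p)) \<Longrightarrow> (\<lambda>i. sg i \<odot>\<^bsub>K (Suc p)\<^esub> basis_vec k (bar_face H i ys)) \<in> {0..Suc p} \<rightarrow> carrier (K (Suc p))"
proof (rule Pi_I)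
  interpret K: left_module k "K (Suc p)" by (rule lK)
  show "sg i \<odot>\<^bsub>K (Suc p)\<^esub> basis_vec k (bar_face H i ys) \<in> carrier (K (Suc p))"
    if "ys \<in> L (Suc (Suc p))" "i \<in> {0..Suc p}" for i
    by (rule K.smult_closed[OF sg_closed eK[OF face_L[OF that(1)]]]) (use that(2) in auto)
qed

lemma Dval_closed: "Dval p \<in> L (Suc (Suc p)) \<rightarrow> carrier (K (Suc p))"
proof (rule Pi_I)
  interpret K: left_module k "K (Suc p)" by (rule lK)
  show "Dval p ys \<in> carrier (K (Suc p))" if "ys \<in> L (Suc (Suc p))" for ys
    unfolding Dval_def by (rule K.M.finsum_closed[OF faces_closed[OF that]])
qed

lemma D_lin: "D p \<in> lin_maps k (K (Suc (Suc p))) (K (Suc p))"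
  unfolding D_def by (rule left_module.lin_ext_lin[OF lK Dval_closed])

lemma D_basis: "ys \<in> L (Suc (Suc p)) \<Longrightarrow> D p (basis_vec k ys) = Dval p ys"
  unfolding D_def by (rule left_module.lin_ext_basis_vec[OF lK Dval_closed])

lemma \<Theta>_finsum:
  assumes "v \<in> I \<rightarrow> carrier (PL p)"
  shows "\<Theta> p (\<Oplus>\<^bsub>PL p\<^esub>i\<in>I. v i) = (\<Oplus>\<^bsub>K (Suc p)\<^esub>i\<in>I. \<Theta> p (v i))"
proof -
  interpret P: left_module "opposite A" "PL p" by (rule lP)
  interpret K: left_module k "K (Suc p)" by (rule lK)
  have z: "\<Theta> p \<zero>\<^bsub>PL p\<^esub> = \<zero>\<^bsub>K (Suc p)\<^esub>" using \<Theta>_zero by (simp add: A_simps)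
  show ?thesis using assms
  proof (induction I rule: infinite_finite_induct)
    case (insert i I)
    then have v: "v i \<in> carrier (PL p)" "v \<in> I \<rightarrow> carrier (PL p)" by auto
    have "\<Theta> p (\<Oplus>\<^bsub>PL p\<^esub>i\<in>insert i I. v i) = \<Theta> p (v i) \<oplus>\<^bsub>K (Suc p)\<^esub> \<Theta> p (\<Oplus>\<^bsub>PL p\<^esub>i\<in>I. v i)"
      unfolding P.M.finsum_insert[OF insert.hyps v(2,1)] by (rule \<Theta>_add[OF v(1) P.M.finsum_closed[OF v(2)]])
    also have "\<dots> = (\<Oplus>\<^bsub>K (Suc p)\<^esub>i\<in>insert i I. \<Theta> p (v i))"
      unfolding insert.IH[OF v(2)]
      by (rule K.M.finsum_insert[OF insert.hyps, symmetric]) (use v \<Theta>_closed in auto)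
    finally show ?case .
  next
    case (infinite I)
    show ?case unfolding P.M.finsum_infinite[OF infinite(1)] K.M.finsum_infinite[OF infinite(1)] by (rule z)
  next
    case empty
    show ?case unfolding P.M.finsum_empty K.M.finsum_empty by (rule z)
  qed
qed

lemma \<Theta>_dP_gen:
  assumes "c \<in> carrier k" "h \<in> carrier H" "xs \<in> L (Suc p)"
  shows "\<Theta> p (dP p (gen c h xs)) = D p (\<Theta> (Suc p) (gen c h xs))"
proof -
  interpret P: left_module "opposite A" "PL p" by (rule lP)
  interpret K: left_module k "K (Suc p)" by (rule lK)
  let ?a = "c \<odot>\<^bsub>F\<^esub> basis_vec k h"
  have a: "?a \<in> carrier (opposite A)" unfolding opA by (rule F.smult_closed[OF assms(1) e[OF assms(2)]])
  note so = split_off_closed[OF assms(3)] and fa = face_L[OF assms(3)]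
  have "dP p (gen c h xs) = ?a \<odot>\<^bsub>PL p\<^esub> dval p xs"
    unfolding gen_eq[OF assms(1,2), of xs "Suc p"] lin_maps_smult[OF dP_lin a eP[OF assms(3)]] dP_basis[OF assms(3)] ..
  also have "\<dots> = (\<Oplus>\<^bsub>PL p\<^esub>i\<in>{0..Suc p}. ?a \<odot>\<^bsub>PL p\<^esub> gen (sg i) (split_off i xs) (bar_face H i xs))"
    unfolding dval_def by (rule P.smult_finsum[OF a gens_closed[OF assms(3)]])
  also have "\<dots> = (\<Oplus>\<^bsub>PL p\<^esub>i\<in>{0..Suc p}. gen (sg i \<otimes>\<^bsub>k\<^esub> c) (split_off i xs \<otimes>\<^bsub>H\<^esub> h) (bar_face H i xs))"
    by (rule P.M.finsum_cong') (use assms so fa smult_gen[OF assms(1,2) sg_closed so fa] gen_closed in auto)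
  finally have "\<Theta> p (dP p (gen c h xs))
      = (\<Oplus>\<^bsub>K (Suc p)\<^esub>i\<in>{0..Suc p}. \<Theta> p (gen (sg i \<otimes>\<^bsub>k\<^esub> c) (split_off i xs \<otimes>\<^bsub>H\<^esub> h) (bar_face H i xs)))"
    using assms so fa gen_closed by (simp only:) (rule \<Theta>_finsum, auto)
  also have "\<dots> = (\<Oplus>\<^bsub>K (Suc p)\<^esub>i\<in>{0..Suc p}. c \<odot>\<^bsub>K (Suc p)\<^esub> (sg i \<odot>\<^bsub>K (Suc p)\<^esub> basis_vec k (bar_face H i (xs @ [h]))))"
  proof (rule K.M.finsum_cong')
    fix i assume i: "i \<in> {0..Suc p}"
    then have fi: "bar_face H i (xs @ [h]) \<in> L (Suc p)" using face_L[OF snoc_L[OF assms(3,2)]] by simp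
    have "\<Theta> p (gen (sg i \<otimes>\<^bsub>k\<^esub> c) (split_off i xs \<otimes>\<^bsub>H\<^esub> h) (bar_face H i xs))
        = (sg i \<otimes>\<^bsub>k\<^esub> c) \<odot>\<^bsub>K (Suc p)\<^esub> basis_vec k (bar_face H i (xs @ [h]))"
      using i assms so fa by (subst \<Theta>_gen) (simp_all del: free_module_simps add: face_snoc)
    also have "\<dots> = c \<odot>\<^bsub>K (Suc p)\<^esub> (sg i \<odot>\<^bsub>K (Suc p)\<^esub> basis_vec k (bar_face H i (xs @ [h])))"
      unfolding k.m_comm[OF sg_closed assms(1)] by (rule K.smult_assoc[OF assms(1) sg_closed eK[OF fi]])
    finally show "\<Theta> p (gen (sg i \<otimes>\<^bsub>k\<^esub> c) (split_off i xs \<otimes>\<^bsub>H\<^esub> h) (bar_face H i xs))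
        = c \<odot>\<^bsub>K (Suc p)\<^esub> (sg i \<odot>\<^bsub>K (Suc p)\<^esub> basis_vec k (bar_face H i (xs @ [h])))" .
  next
    show "(\<lambda>i. c \<odot>\<^bsub>K (Suc p)\<^esub> (sg i \<odot>\<^bsub>K (Suc p)\<^esub> basis_vec k (bar_face H i (xs @ [h])))) \<in> {0..Suc p} \<rightarrow> carrier (K (Suc p))"
      by (rule Pi_I) (rule K.smult_closed[OF assms(1) funcset_mem[OF faces_closed[OF snoc_L[OF assms(3,2)]]]])
  qed simp
  also have "\<dots> = c \<odot>\<^bsub>K (Suc p)\<^esub> Dval p (xs @ [h])"
    unfolding Dval_def by (rule K.smult_finsum[OF assms(1) faces_closed[OF snoc_L[OF assms(3,2)]], symmetric])
  also have "\<dots> = D p (\<Theta> (Suc p) (gen c h xs))"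
    unfolding \<Theta>_gen[OF assms] lin_maps_smult[OF D_lin assms(1) eK[OF snoc_L[OF assms(3,2)]]] D_basis[OF snoc_L[OF assms(3,2)]] ..
  finally show ?thesis .
qed

lemma \<Theta>_dP: "f \<in> carrier (PL (Suc p)) \<Longrightarrow> \<Theta> p (dP p f) = D p (\<Theta> (Suc p) f)"
proof (induction f rule: gen_induct)
  case zero
  have "\<Theta> p (dP p \<zero>\<^bsub>PL (Suc p)\<^esub>) = D p (\<Theta> (Suc p) \<zero>\<^bsub>PL (Suc p)\<^esub>)"
    unfolding lin_maps_zero[OF lP lP dP_lin] using \<Theta>_zero lin_maps_zero[OF lK lK D_lin, of p] by (simp add: A_simps)
  then show ?case by (simp add: A_simps)
next
  case (gen c h xs g)
  note g = gen_closed[OF gen(1-3)]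
  show ?case
    unfolding lin_maps_add[OF dP_lin g gen(4)] \<Theta>_add[OF g gen(4)]
      \<Theta>_add[OF lin_maps_closed[OF dP_lin g] lin_maps_closed[OF dP_lin gen(4)]]
      lin_maps_add[OF D_lin \<Theta>_closed[OF g] \<Theta>_closed[OF gen(4)]] \<Theta>_dP_gen[OF gen(1-3)] gen(5) ..
qed

section \<open>The contracting homotopy\<close>

text \<open>The sign is that of the face with index \<open>Suc p\<close>, which multiplies the
  appended unit into the preceding letter and so gives back the original tuple.\<close>

definition s :: "nat \<Rightarrow> ('h list \<Rightarrow> 'k) \<Rightarrow> 'h list \<Rightarrow> 'k" where
  "s p = lin_ext k (K (Suc (Suc p))) (\<lambda>ys. sg (Suc p) \<odot>\<^bsub>K (Suc (Suc p))\<^esub> basis_vec k (ys @ [\<one>\<^bsub>H\<^esub>]))"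

lemma snoc_one: "ys \<in> L p \<Longrightarrow> ys @ [\<one>\<^bsub>H\<^esub>] \<in> L (Suc p)"
  by (rule snoc_L[OF _ H.one_closed])

lemma s_val: "(\<lambda>ys. sg (Suc p) \<odot>\<^bsub>K (Suc (Suc p))\<^esub> basis_vec k (ys @ [\<one>\<^bsub>H\<^esub>])) \<in> L (Suc p) \<rightarrow> carrier (K (Suc (Suc p)))"
proof (rule Pi_I)
  interpret K: left_module k "K (Suc (Suc p))" by (rule lK)
  show "sg (Suc p) \<odot>\<^bsub>K (Suc (Suc p))\<^esub> basis_vec k (ys @ [\<one>\<^bsub>H\<^esub>]) \<in> carrier (K (Suc (Suc p)))" if "ys \<in> L (Suc p)" for ys
    by (rule K.smult_closed[OF sg_closed eK[OF snoc_one[OF that]]])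
qed

lemma s_lin: "s p \<in> lin_maps k (K (Suc p)) (K (Suc (Suc p)))"
  unfolding s_def by (rule left_module.lin_ext_lin[OF lK s_val])

lemma s_basis: "ys \<in> L (Suc p) \<Longrightarrow> s p (basis_vec k ys) = sg (Suc p) \<odot>\<^bsub>K (Suc (Suc p))\<^esub> basis_vec k (ys @ [\<one>\<^bsub>H\<^esub>])"
  unfolding s_def by (rule left_module.lin_ext_basis_vec[OF lK s_val])

text \<open>The remaining faces of \<open>ys\<close> with the unit appended; each of them is a face
  of \<open>ys\<close> with the unit appended.\<close>

definition W :: "nat \<Rightarrow> 'h list \<Rightarrow> 'h list \<Rightarrow> 'k" where
  "W p ys = (\<Oplus>\<^bsub>K (Suc p)\<^esub>i\<in>{0..p}. sg i \<odot>\<^bsub>K (Suc p)\<^esub> basis_vec k (bar_face H i ys @ [\<one>\<^bsub>H\<^esub>]))"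

lemma W_terms:
  assumes "ys \<in> L (Suc p)"
  shows "(\<lambda>i. sg i \<odot>\<^bsub>K (Suc p)\<^esub> basis_vec k (bar_face H i ys @ [\<one>\<^bsub>H\<^esub>])) \<in> {0..p} \<rightarrow> carrier (K (Suc p))"
proof (rule Pi_I)
  interpret K: left_module k "K (Suc p)" by (rule lK)
  fix i assume "i \<in> {0..p}"
  then show "sg i \<odot>\<^bsub>K (Suc p)\<^esub> basis_vec k (bar_face H i ys @ [\<one>\<^bsub>H\<^esub>]) \<in> carrier (K (Suc p))"
    by (intro K.smult_closed sg_closed eK snoc_one face_L[OF assms]) simp
qed

lemma W_closed: "ys \<in> L (Suc p) \<Longrightarrow> W p ys \<in> carrier (K (Suc p))"
proof -
  interpret K: left_module k "K (Suc p)" by (rule lK)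
  show "ys \<in> L (Suc p) \<Longrightarrow> W p ys \<in> carrier (K (Suc p))"
    unfolding W_def by (rule K.M.finsum_closed[OF W_terms])
qed

lemma Dval_snoc_one:
  assumes ys: "ys \<in> L (Suc p)"
  shows "Dval p (ys @ [\<one>\<^bsub>H\<^esub>]) = sg (Suc p) \<odot>\<^bsub>K (Suc p)\<^esub> basis_vec k ys \<oplus>\<^bsub>K (Suc p)\<^esub> W p ys"
proof -
  interpret K: left_module k "K (Suc p)" by (rule lK)
  let ?v = "\<lambda>i. sg i \<odot>\<^bsub>K (Suc p)\<^esub> basis_vec k (bar_face H i (ys @ [\<one>\<^bsub>H\<^esub>]))"
  have v: "?v \<in> {..Suc p} \<rightarrow> carrier (K (Suc p))"
    using faces_closed[OF snoc_one[OF ys]] unfolding atLeast0AtMost .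
  have fs: "bar_face H i (ys @ [\<one>\<^bsub>H\<^esub>]) = bar_face H i ys @ [split_off i ys]" if "i \<le> Suc p" for i
    using face_snoc[OF ys H.one_closed that] split_off_closed[OF ys] by simp
  obtain zs z where zz: "ys = zs @ [z]" "length ys = Suc p" using ys by (cases ys rule: rev_cases) (auto simp: L_def)
  have last: "bar_face H (Suc p) (ys @ [\<one>\<^bsub>H\<^esub>]) = ys"
    unfolding fs[OF order_refl] using zz by (simp add: bar_face_def split_off_def)
  have "Dval p (ys @ [\<one>\<^bsub>H\<^esub>]) = ?v (Suc p) \<oplus>\<^bsub>K (Suc p)\<^esub> (\<Oplus>\<^bsub>K (Suc p)\<^esub>i\<in>{..p}. ?v i)"
    unfolding Dval_def atLeast0AtMost by (rule K.M.finsum_Suc[OF v])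
  moreover have "(\<Oplus>\<^bsub>K (Suc p)\<^esub>i\<in>{..p}. ?v i) = W p ys"
    unfolding W_def atLeast0AtMost
  proof (rule K.M.finsum_cong'[OF refl W_terms[OF ys, unfolded atLeast0AtMost]])
    fix i assume "i \<in> {..p}"
    then have "bar_face H i (ys @ [\<one>\<^bsub>H\<^esub>]) = bar_face H i ys @ [\<one>\<^bsub>H\<^esub>]"
      using fs[of i] zz(2) by (simp add: split_off_def)
    then show "?v i = sg i \<odot>\<^bsub>K (Suc p)\<^esub> basis_vec k (bar_face H i ys @ [\<one>\<^bsub>H\<^esub>])" by (simp only:)
  qed
  ultimately show ?thesis unfolding last by (simp only:)
qed

text \<open>The correction term is kept as \<open>W\<close>, not as \<open>s\<close> of a boundary,
  so that the formula also covers degree 0, where \<open>W 0 ys\<close> is the tuple consisting of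
  the unit alone and represents the augmentation.\<close>

lemma D_s_basis:
  assumes ys: "ys \<in> L (Suc p)"
  shows "D p (s p (basis_vec k ys)) = basis_vec k ys \<ominus>\<^bsub>K (Suc p)\<^esub> sg p \<odot>\<^bsub>K (Suc p)\<^esub> W p ys"
proof -
  interpret K: left_module k "K (Suc p)" by (rule lK)
  note W = W_closed[OF ys] and ey = eK[OF ys]
  have "D p (s p (basis_vec k ys)) = sg (Suc p) \<odot>\<^bsub>K (Suc p)\<^esub> (sg (Suc p) \<odot>\<^bsub>K (Suc p)\<^esub> basis_vec k ys \<oplus>\<^bsub>K (Suc p)\<^esub> W p ys)"
    unfolding s_basis[OF ys] lin_maps_smult[OF D_lin sg_closed eK[OF snoc_one[OF ys]]] D_basis[OF snoc_one[OF ys]]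
      Dval_snoc_one[OF ys] ..
  also have "\<dots> = basis_vec k ys \<oplus>\<^bsub>K (Suc p)\<^esub> sg (Suc p) \<odot>\<^bsub>K (Suc p)\<^esub> W p ys"
    unfolding K.smult_r_distr[OF sg_closed K.smult_closed[OF sg_closed ey] W]
      K.smult_assoc[OF sg_closed sg_closed ey, symmetric] sg_sg K.smult_one[OF ey] ..
  also have "sg (Suc p) \<odot>\<^bsub>K (Suc p)\<^esub> W p ys = \<ominus>\<^bsub>K (Suc p)\<^esub> (sg p \<odot>\<^bsub>K (Suc p)\<^esub> W p ys)"
  proof -
    have "sg (Suc p) = (\<ominus>\<^bsub>k\<^esub> \<one>\<^bsub>k\<^esub>) \<otimes>\<^bsub>k\<^esub> sg p" unfolding sg_Suc by (simp add: k.l_minus)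
    then have "sg (Suc p) \<odot>\<^bsub>K (Suc p)\<^esub> W p ys = (\<ominus>\<^bsub>k\<^esub> \<one>\<^bsub>k\<^esub>) \<odot>\<^bsub>K (Suc p)\<^esub> (sg p \<odot>\<^bsub>K (Suc p)\<^esub> W p ys)"
      using K.smult_assoc[OF k.a_inv_closed[OF k.one_closed] sg_closed W] by (simp only:)
    then show ?thesis using K.smult_minus_one[OF K.smult_closed[OF sg_closed W]] by (simp only:)
  qed
  finally show ?thesis unfolding a_minus_def .
qed

text \<open>In positive degree the correction term of \<open>D_s_basis\<close> is \<open>s p\<close>
  applied to the boundary: both append the unit to all faces, with the same signs.\<close>

lemma contraction:
  assumes "g \<in> carrier (K (Suc (Suc p)))"
  shows "D (Suc p) (s (Suc p) g) = g \<ominus>\<^bsub>K (Suc (Suc p))\<^esub> s p (D p g)"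
proof -
  interpret K: left_module k "K (Suc (Suc p))" by (rule lK)
  show ?thesis
  proof (rule lin_maps_basis_ext[OF lK lin_maps_comp[OF s_lin D_lin]
        K.lin_maps_minus[OF lK lin_maps_id lin_maps_comp[OF D_lin s_lin]] _ assms])
    fix ys assume ys: "ys \<in> L (Suc (Suc p))"
    let ?t = "\<lambda>i. sg i \<odot>\<^bsub>K (Suc (Suc p))\<^esub> basis_vec k (bar_face H i ys @ [\<one>\<^bsub>H\<^esub>])"
    have "s p (D p (basis_vec k ys)) = (\<Oplus>\<^bsub>K (Suc (Suc p))\<^esub>i\<in>{0..Suc p}. s p (sg i \<odot>\<^bsub>K (Suc p)\<^esub> basis_vec k (bar_face H i ys)))"
      unfolding D_basis[OF ys] Dval_def by (rule lin_maps_finsum[OF lK lK s_lin faces_closed[OF ys]])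
    also have "\<dots> = (\<Oplus>\<^bsub>K (Suc (Suc p))\<^esub>i\<in>{0..Suc p}. sg (Suc p) \<odot>\<^bsub>K (Suc (Suc p))\<^esub> ?t i)"
    proof (rule K.M.finsum_cong'[OF refl])
      fix i assume "i \<in> {0..Suc p}"
      then have f: "bar_face H i ys \<in> L (Suc p)" using face_L[OF ys, of i] by simp
      note ef = eK[OF snoc_one[OF f]]
      show "s p (sg i \<odot>\<^bsub>K (Suc p)\<^esub> basis_vec k (bar_face H i ys)) = sg (Suc p) \<odot>\<^bsub>K (Suc (Suc p))\<^esub> ?t i"
        unfolding lin_maps_smult[OF s_lin sg_closed eK[OF f]] s_basis[OF f]
          K.smult_assoc[OF sg_closed sg_closed ef, symmetric] k.m_comm[OF sg_closed sg_closed, of "Suc p" i] ..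
    next
      show "(\<lambda>i. sg (Suc p) \<odot>\<^bsub>K (Suc (Suc p))\<^esub> ?t i) \<in> {0..Suc p} \<rightarrow> carrier (K (Suc (Suc p)))"
        by (rule Pi_I) (rule K.smult_closed[OF sg_closed funcset_mem[OF W_terms[OF ys]]])
    qed
    also have "\<dots> = sg (Suc p) \<odot>\<^bsub>K (Suc (Suc p))\<^esub> W (Suc p) ys"
      unfolding W_def by (rule K.smult_finsum[OF sg_closed W_terms[OF ys], symmetric])
    finally show "D (Suc p) (s (Suc p) (basis_vec k ys))
        = basis_vec k ys \<ominus>\<^bsub>K (Suc (Suc p))\<^esub> s p (D p (basis_vec k ys))"
      unfolding D_s_basis[OF ys] by (simp only:)
  qed
qed

definition aug :: "('h list \<Rightarrow> 'k) \<Rightarrow> 'k" where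
  "aug = lin_ext k kk (\<lambda>_. \<one>\<^bsub>k\<^esub>)"

lemma aug_lin: "aug \<in> lin_maps k (K p) kk"
  unfolding aug_def by (rule left_module.lin_ext_lin[OF lkk]) (simp add: kk_simps)

lemma aug_basis: "xs \<in> L p \<Longrightarrow> aug (basis_vec k xs) = \<one>\<^bsub>k\<^esub>"
  unfolding aug_def by (rule left_module.lin_ext_basis_vec[OF lkk, of _ "L p"]) (simp_all add: kk_simps)

lemma contraction_0:
  assumes g: "g \<in> carrier (K (Suc 0))" and z: "aug g = \<zero>\<^bsub>k\<^esub>"
  shows "D 0 (s 0 g) = g"
proof -
  interpret K: left_module k "K (Suc 0)" by (rule lK)
  have one: "basis_vec k [\<one>\<^bsub>H\<^esub>] \<in> carrier (K (Suc 0))" by (rule eK) (simp add: L_def)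
  have l: "(\<lambda>g. aug g \<odot>\<^bsub>K (Suc 0)\<^esub> basis_vec k [\<one>\<^bsub>H\<^esub>]) \<in> lin_maps k (K (Suc 0)) (K (Suc 0))"
  proof (rule lin_mapsI)
    note ac = lin_maps_closed[OF aug_lin, unfolded kk_simps]
    show "aug x \<odot>\<^bsub>K (Suc 0)\<^esub> basis_vec k [\<one>\<^bsub>H\<^esub>] \<in> carrier (K (Suc 0))" if "x \<in> carrier (K (Suc 0))" for x
      by (rule K.smult_closed[OF ac[OF that] one])
    show "aug (x \<oplus>\<^bsub>K (Suc 0)\<^esub> y) \<odot>\<^bsub>K (Suc 0)\<^esub> basis_vec k [\<one>\<^bsub>H\<^esub>] = aug x \<odot>\<^bsub>K (Suc 0)\<^esub> basis_vec k [\<one>\<^bsub>H\<^esub>]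
        \<oplus>\<^bsub>K (Suc 0)\<^esub> aug y \<odot>\<^bsub>K (Suc 0)\<^esub> basis_vec k [\<one>\<^bsub>H\<^esub>]"
      if "x \<in> carrier (K (Suc 0))" "y \<in> carrier (K (Suc 0))" for x y
      unfolding lin_maps_add[OF aug_lin that] kk_simps by (rule K.smult_l_distr[OF ac[OF that(1)] ac[OF that(2)] one])
    show "aug (a \<odot>\<^bsub>K (Suc 0)\<^esub> x) \<odot>\<^bsub>K (Suc 0)\<^esub> basis_vec k [\<one>\<^bsub>H\<^esub>]
        = a \<odot>\<^bsub>K (Suc 0)\<^esub> (aug x \<odot>\<^bsub>K (Suc 0)\<^esub> basis_vec k [\<one>\<^bsub>H\<^esub>])"
      if "a \<in> carrier k" "x \<in> carrier (K (Suc 0))" for a x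
      unfolding lin_maps_smult[OF aug_lin that] kk_simps by (rule K.smult_assoc[OF that(1) ac[OF that(2)] one])
  qed
  have "D 0 (s 0 g) = g \<ominus>\<^bsub>K (Suc 0)\<^esub> aug g \<odot>\<^bsub>K (Suc 0)\<^esub> basis_vec k [\<one>\<^bsub>H\<^esub>]"
  proof (rule lin_maps_basis_ext[OF lK lin_maps_comp[OF s_lin D_lin] K.lin_maps_minus[OF lK lin_maps_id l] _ g])
    fix ys assume ys: "ys \<in> L (Suc 0)"
    then have "bar_face H 0 ys = []" by (cases ys) (auto simp: L_def bar_face_def)
    then have "W 0 ys = basis_vec k [\<one>\<^bsub>H\<^esub>]"
      using one K.smult_one[OF one] unfolding W_def
      by (simp del: free_module_simps add: sg_0 K.M.finsum_insert)
    then have "sg 0 \<odot>\<^bsub>K (Suc 0)\<^esub> W 0 ys = aug (basis_vec k ys) \<odot>\<^bsub>K (Suc 0)\<^esub> basis_vec k [\<one>\<^bsub>H\<^esub>]"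
      unfolding aug_basis[OF ys] sg_0 by (simp only:)
    then show "D 0 (s 0 (basis_vec k ys))
        = basis_vec k ys \<ominus>\<^bsub>K (Suc 0)\<^esub> aug (basis_vec k ys) \<odot>\<^bsub>K (Suc 0)\<^esub> basis_vec k [\<one>\<^bsub>H\<^esub>]"
      unfolding D_s_basis[OF ys] by (simp only:)
  qed
  also have "\<dots> = g \<ominus>\<^bsub>K (Suc 0)\<^esub> \<zero>\<^bsub>K (Suc 0)\<^esub>" unfolding z K.smult_l_null[OF one] ..
  also have "\<dots> = g" by (rule K.diff_zero[OF g])
  finally show ?thesis .
qed

text \<open>Only two faces occur in this degree, and their signs are opposite.\<close>

lemma aug_D: "g \<in> carrier (K (Suc (Suc 0))) \<Longrightarrow> aug (D 0 g) = \<zero>\<^bsub>k\<^esub>"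
proof (rule lin_maps_basis_ext[OF lkk lin_maps_comp[OF D_lin aug_lin] lin_maps_const_zero[OF lkk, unfolded kk_simps]])
  interpret kk: left_module k kk by (rule lkk)
  fix ys assume ys: "ys \<in> L (Suc (Suc 0))"
  have "aug (D 0 (basis_vec k ys)) = (\<Oplus>\<^bsub>kk\<^esub>i\<in>{0..Suc 0}. aug (sg i \<odot>\<^bsub>K (Suc 0)\<^esub> basis_vec k (bar_face H i ys)))"
    unfolding D_basis[OF ys] Dval_def by (rule lin_maps_finsum[OF lK lkk aug_lin faces_closed[OF ys]])
  also have "\<dots> = (\<Oplus>\<^bsub>kk\<^esub>i\<in>{0..Suc 0}. sg i)"
  proof (rule kk.M.finsum_cong'[OF refl])
    fix i assume "i \<in> {0..Suc 0}"
    then have f: "bar_face H i ys \<in> L (Suc 0)" using face_L[OF ys, of i] by simp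
    show "aug (sg i \<odot>\<^bsub>K (Suc 0)\<^esub> basis_vec k (bar_face H i ys)) = sg i"
      unfolding lin_maps_smult[OF aug_lin sg_closed eK[OF f]] aug_basis[OF f] kk_simps by simp
  qed (simp add: kk_simps)
  also have "\<dots> = sg (Suc 0) \<oplus>\<^bsub>k\<^esub> sg 0"
    by (simp add: atLeast0_atMost_Suc kk_simps kk.M.finsum_insert)
  also have "\<dots> = \<zero>\<^bsub>k\<^esub>" by (simp add: sg_Suc k.l_neg)
  finally show "aug (D 0 (basis_vec k ys)) = \<zero>\<^bsub>k\<^esub>" .
qed

lemma \<Theta>_basis:
  assumes "xs \<in> L p" shows "\<Theta> p (basis_vec (opposite A) xs) = basis_vec k (xs @ [\<one>\<^bsub>H\<^esub>])"
proof -
  interpret K: left_module k "K (Suc p)" by (rule lK)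
  have "basis_vec (opposite A) xs = gen \<one>\<^bsub>k\<^esub> \<one>\<^bsub>H\<^esub> xs"
  proof (intro ext)
    fix ys g
    show "basis_vec (opposite A) xs ys g = gen \<one>\<^bsub>k\<^esub> \<one>\<^bsub>H\<^esub> xs ys g"
      by (cases "ys = xs"; simp add: gen_def A_simps basis_vec_def[of "opposite A"]) (simp add: basis_vec_def)
  qed
  then show ?thesis
    using \<Theta>_gen[OF k.one_closed H.one_closed assms] K.smult_one[OF eK[OF snoc_one[OF assms]]] by (simp only:)
qed

text \<open>The identity \<open>d d = 0\<close> follows from the contraction alone: the basis of the free right module
  lies in the image of \<open>s\<close>, and \<open>d d s = d - d s d = 0\<close> by induction on the degree.\<close>

lemma D_D: "g \<in> carrier (K (Suc (Suc (Suc p)))) \<Longrightarrow> D p (D (Suc p) g) = \<zero>\<^bsub>K (Suc p)\<^esub>"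
  and dP_dP: "f \<in> carrier (PL (Suc (Suc p))) \<Longrightarrow> dP p (dP (Suc p) f) = \<zero>\<^bsub>PL p\<^esub>"
proof (induction p arbitrary: f g)
  \<comment> \<open>The premise \<open>C\<close> is the contraction identity one degree lower,
    restricted to boundaries, where it reads \<open>D p (s p y) = y\<close>.\<close>
  have dd: "dP p (dP (Suc p) f) = \<zero>\<^bsub>PL p\<^esub>"
    if f: "f \<in> carrier (PL (Suc (Suc p)))"
      and C: "\<And>y. y \<in> carrier (K (Suc p)) \<Longrightarrow> \<exists>x\<in>carrier (K (Suc (Suc p))). y = D p x \<Longrightarrow> D p (s p y) = y" for p f
  proof (rule lin_maps_basis_ext[OF lP lin_maps_comp[OF dP_lin dP_lin] lin_maps_const_zero[OF lP] _ f])
    interpret K: left_module k "K i" for i by (rule lK)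
    interpret P: left_module "opposite A" "PL i" for i by (rule lP)
    fix xs assume xs: "xs \<in> L (Suc (Suc p))"
    note ex = eP[OF xs] and ek = eK[OF xs] and es = eK[OF snoc_one[OF xs]]
    have s: "s (Suc p) (basis_vec k xs) \<in> carrier (K (Suc (Suc (Suc p))))" by (rule lin_maps_closed[OF s_lin ek])
    have Dx: "D p (basis_vec k xs) \<in> carrier (K (Suc p))" by (rule lin_maps_closed[OF D_lin ek])
    have "D p (D (Suc p) (s (Suc p) (basis_vec k xs))) = D p (basis_vec k xs) \<ominus>\<^bsub>K (Suc p)\<^esub> D p (s p (D p (basis_vec k xs)))"
      unfolding contraction[OF ek] by (rule lin_maps_diff[OF lK lK D_lin ek lin_maps_closed[OF s_lin Dx]])
    also have "D p (s p (D p (basis_vec k xs))) = D p (basis_vec k xs)" using C[OF Dx] ek by blast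
    finally have 0: "D p (D (Suc p) (s (Suc p) (basis_vec k xs))) = \<zero>\<^bsub>K (Suc p)\<^esub>"
      unfolding a_minus_def K.M.r_neg[OF Dx] .
    \<comment> \<open>Up to sign, the tuple of a basis vector of the free right module is
      \<open>s\<close> of the vector of \<open>xs\<close>, on which the square of the differential
      has just been seen to vanish.\<close>
    have b: "basis_vec k (xs @ [\<one>\<^bsub>H\<^esub>]) = sg (Suc (Suc p)) \<odot>\<^bsub>K (Suc (Suc (Suc p)))\<^esub> s (Suc p) (basis_vec k xs)"
      unfolding s_basis[OF xs] K.smult_assoc[OF sg_closed sg_closed es, symmetric] sg_sg K.smult_one[OF es] ..
    have "D p (D (Suc p) (basis_vec k (xs @ [\<one>\<^bsub>H\<^esub>]))) = \<zero>\<^bsub>K (Suc p)\<^esub>"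
      unfolding b lin_maps_smult[OF lin_maps_comp[OF D_lin D_lin] sg_closed s] 0 by (rule K.smult_r_null[OF sg_closed])
    then have "\<Theta> p (dP p (dP (Suc p) (basis_vec (opposite A) xs))) = \<Theta> p \<zero>\<^bsub>PL p\<^esub>"
      unfolding \<Theta>_dP[OF lin_maps_closed[OF dP_lin ex]] \<Theta>_dP[OF ex] \<Theta>_basis[OF xs]
      using \<Theta>_zero[of p] by (simp add: A_simps)
    then show "dP p (dP (Suc p) (basis_vec (opposite A) xs)) = \<zero>\<^bsub>PL p\<^esub>"
      by (rule \<Theta>_inj[OF lin_maps_closed[OF dP_lin lin_maps_closed[OF dP_lin ex]] P.zero_closed])
  qed
  \<comment> \<open>Conversely, the identity passes from the right module to tuples, since every
    vector on tuples is \<open>\<Theta>\<close> of one in the right module.\<close>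
  have DD: "D p (D (Suc p) g) = \<zero>\<^bsub>K (Suc p)\<^esub>"
    if g: "g \<in> carrier (K (Suc (Suc (Suc p))))"
      and 0: "\<And>f. f \<in> carrier (PL (Suc (Suc p))) \<Longrightarrow> dP p (dP (Suc p) f) = \<zero>\<^bsub>PL p\<^esub>" for p g
  proof -
    note f = \<Theta>'_closed[OF g]
    have "D p (D (Suc p) g) = \<Theta> p (dP p (dP (Suc p) (\<Theta>' (Suc (Suc p)) g)))"
      unfolding \<Theta>_dP[OF lin_maps_closed[OF dP_lin f]] \<Theta>_dP[OF f] \<Theta>_\<Theta>'[OF g] ..
    then show ?thesis unfolding 0[OF f] using \<Theta>_zero[of p] by (simp add: A_simps)
  qed
  {
    case 0
    have *: "dP 0 (dP (Suc 0) f) = \<zero>\<^bsub>PL 0\<^esub>" if "f \<in> carrier (PL (Suc (Suc 0)))" for f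
      by (rule dd[OF that]) (use contraction_0 aug_D in blast)
    {
      case 1 then show ?case by (rule DD[OF _ *])
    next
      case 2 then show ?case by (rule *)
    }
  next
    case (Suc p)
    \<comment> \<open>A boundary is a cycle by the preceding degree, so the term
      \<open>s p (D p y)\<close> of the contraction drops out.\<close>
    have C: "D (Suc p) (s (Suc p) y) = y" if y: "y \<in> carrier (K (Suc (Suc p)))"
      and "\<exists>x\<in>carrier (K (Suc (Suc (Suc p)))). y = D (Suc p) x" for y
    proof -
      interpret K: left_module k "K (Suc (Suc p))" by (rule lK)
      have "D p y = \<zero>\<^bsub>K (Suc p)\<^esub>" using that(2) Suc(1) by blast
      then have "D (Suc p) (s (Suc p) y) = y \<ominus>\<^bsub>K (Suc (Suc p))\<^esub> \<zero>\<^bsub>K (Suc (Suc p))\<^esub>"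
        unfolding contraction[OF y] using lin_maps_zero[OF lK lK s_lin, of p] by (simp only:)
      also have "\<dots> = y" by (rule K.diff_zero[OF y])
      finally show ?thesis .
    qed
    have *: "dP (Suc p) (dP (Suc (Suc p)) f) = \<zero>\<^bsub>PL (Suc p)\<^esub>" if "f \<in> carrier (PL (Suc (Suc (Suc p))))" for f
      by (rule dd[OF that C])
    {
      case 1 then show ?case by (rule DD[OF _ *])
    next
      case 2 then show ?case by (rule *)
    }
  }
qed

definition eP0 :: "('h list \<Rightarrow> 'h \<Rightarrow> 'k) \<Rightarrow> 'k" where
  "eP0 = lin_ext (opposite A) N (\<lambda>_. \<one>\<^bsub>k\<^esub>)"

lemma eP0_lin: "eP0 \<in> lin_maps (opposite A) (PL 0) N"
proof -
  interpret aug: augmented_algebra k A N \<epsilon> by (rule augmented)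
  show ?thesis unfolding eP0_def by (rule left_module.lin_ext_lin[OF aug.N_right]) (simp add: aug.N_carrier)
qed

lemma eP0_gen:
  assumes "c \<in> carrier k" "h \<in> carrier H" "xs \<in> L 0"
  shows "eP0 (gen c h xs) = c"
proof -
  interpret aug: augmented_algebra k A N \<epsilon> by (rule augmented)
  have a: "c \<odot>\<^bsub>F\<^esub> basis_vec k h \<in> carrier F" by (rule F.smult_closed[OF assms(1) e[OF assms(2)]])
  have b: "eP0 (basis_vec (opposite A) xs) = \<one>\<^bsub>k\<^esub>"
    unfolding eP0_def by (rule left_module.lin_ext_basis_vec[OF aug.N_right, of _ "L 0"]) (simp_all add: aug.N_carrier assms(3))
  have "eP0 (gen c h xs) = \<epsilon> (c \<odot>\<^bsub>F\<^esub> basis_vec k h) \<otimes>\<^bsub>k\<^esub> \<one>\<^bsub>k\<^esub>"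
    unfolding gen_eq[OF assms(1,2), of xs 0] lin_maps_smult[OF eP0_lin a[folded opA] eP[OF assms(3)]] b
    by (rule aug.N_smult) (use a in \<open>simp_all add: A_simps(1)\<close>)
  also have "\<dots> = c"
    unfolding lin_maps_smult[OF \<epsilon>_lin assms(1) e[OF assms(2)]] \<epsilon>_basis[OF assms(2)] using assms(1) by (simp add: kk_simps)
  finally show ?thesis .
qed

lemma aug_\<Theta>: "f \<in> carrier (PL 0) \<Longrightarrow> aug (\<Theta> 0 f) = eP0 f"
proof (induction f rule: gen_induct)
  case zero
  interpret aug: augmented_algebra k A N \<epsilon> by (rule augmented)
  show ?case unfolding \<Theta>_zero lin_maps_zero[OF lK lkk aug_lin]
    using lin_maps_zero[OF lP aug.N_right eP0_lin] by (simp add: A_simps kk_simps aug.N_zero)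
next
  case (gen c h xs g)
  interpret aug: augmented_algebra k A N \<epsilon> by (rule augmented)
  note g = gen_closed[OF gen(1-3)]
  note b = eK[OF snoc_L[OF gen(3,2)]]
  have "aug (\<Theta> 0 (gen c h xs)) = c"
    unfolding \<Theta>_gen[OF gen(1-3)] lin_maps_smult[OF aug_lin gen(1) b] aug_basis[OF snoc_L[OF gen(3,2)]] kk_simps
    using gen(1) by simp
  then show ?case
    unfolding \<Theta>_add[OF g gen(4)] lin_maps_add[OF aug_lin \<Theta>_closed[OF g] \<Theta>_closed[OF gen(4)]]
      lin_maps_add[OF eP0_lin g gen(4)] eP0_gen[OF gen(1-3)] gen(5) kk_simps aug.N_add by (simp only:)
qed

text \<open>Exactness is the contraction read through \<open>\<Theta>\<close>: a cycle
  \<open>f\<close> is the boundary of the element that corresponds to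
  \<open>s p (\<Theta> p f)\<close>.\<close>

lemma bar_resolution: "free_resolution (opposite A) N L dP eP0"
proof -
  interpret aug: augmented_algebra k A N \<epsilon> by (rule augmented)
  interpret K: left_module k "K i" for i by (rule lK)
  interpret P: left_module "opposite A" "PL i" for i by (rule lP)
  note dc = lin_maps_closed[OF dP_lin]
  have lift: "\<exists>f'\<in>carrier (PL (Suc p)). dP p f' = f" if "f \<in> carrier (PL p)" "D p (s p (\<Theta> p f)) = \<Theta> p f" for p f
  proof -
    have sc: "s p (\<Theta> p f) \<in> carrier (K (Suc (Suc p)))" by (rule lin_maps_closed[OF s_lin \<Theta>_closed[OF that(1)]])
    note c = \<Theta>'_closed[OF sc]
    have "\<Theta> p (dP p (\<Theta>' (Suc p) (s p (\<Theta> p f)))) = \<Theta> p f"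
      unfolding \<Theta>_dP[OF c] \<Theta>_\<Theta>'[OF sc] by (rule that(2))
    then have "dP p (\<Theta>' (Suc p) (s p (\<Theta> p f))) = f" by (rule \<Theta>_inj[OF dc[OF c] that(1)])
    then show ?thesis using c by blast
  qed
  have onto: "eP0 ` carrier (PL 0) = carrier N"
  proof (intro equalityI subsetI)
    show "x \<in> carrier N" if "x \<in> eP0 ` carrier (PL 0)" for x using that lin_maps_closed[OF eP0_lin] by blast
    fix x assume "x \<in> carrier N"
    then have x: "x \<in> carrier k" by (simp add: aug.N_carrier)
    have n: "[] \<in> L 0" by (simp add: L_def)
    show "x \<in> eP0 ` carrier (PL 0)"
      by (rule image_eqI[of _ _ "gen x \<one>\<^bsub>H\<^esub> []"])
        (rule eP0_gen[OF x H.one_closed n, symmetric], rule gen_closed[OF x H.one_closed n])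
  qed
  have ex0: "dP 0 ` carrier (PL (Suc 0)) = {f \<in> carrier (PL 0). eP0 f = \<zero>\<^bsub>N\<^esub>}"
  proof (intro equalityI subsetI)
    fix x assume "x \<in> dP 0 ` carrier (PL (Suc 0))"
    then obtain f where f: "f \<in> carrier (PL (Suc 0))" "x = dP 0 f" by blast
    have "eP0 (dP 0 f) = \<zero>\<^bsub>N\<^esub>"
      unfolding aug_\<Theta>[OF dc[OF f(1)], symmetric] \<Theta>_dP[OF f(1)] aug.N_zero by (rule aug_D[OF \<Theta>_closed[OF f(1)]])
    then show "x \<in> {f \<in> carrier (PL 0). eP0 f = \<zero>\<^bsub>N\<^esub>}" using dc[OF f(1)] f(2) by (simp only: mem_Collect_eq)
  next
    fix f assume "f \<in> {f \<in> carrier (PL 0). eP0 f = \<zero>\<^bsub>N\<^esub>}"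
    then have f: "f \<in> carrier (PL 0)" "eP0 f = \<zero>\<^bsub>N\<^esub>" by (simp_all only: mem_Collect_eq)
    have "aug (\<Theta> 0 f) = \<zero>\<^bsub>k\<^esub>" unfolding aug_\<Theta>[OF f(1)] f(2) by (rule aug.N_zero)
    then show "f \<in> dP 0 ` carrier (PL (Suc 0))" using lift[OF f(1) contraction_0[OF \<Theta>_closed[OF f(1)]]] by blast
  qed
  have exS: "dP (Suc p) ` carrier (PL (Suc (Suc p))) = {f \<in> carrier (PL (Suc p)). dP p f = \<zero>\<^bsub>PL p\<^esub>}" for p
  proof (intro equalityI subsetI)
    fix x assume "x \<in> dP (Suc p) ` carrier (PL (Suc (Suc p)))"
    then obtain f where f: "f \<in> carrier (PL (Suc (Suc p)))" "x = dP (Suc p) f" by blast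
    then show "x \<in> {f \<in> carrier (PL (Suc p)). dP p f = \<zero>\<^bsub>PL p\<^esub>}"
      using dc[OF f(1)] dP_dP[OF f(1)] by (simp only: mem_Collect_eq)
  next
    fix f assume "f \<in> {f \<in> carrier (PL (Suc p)). dP p f = \<zero>\<^bsub>PL p\<^esub>}"
    then have f: "f \<in> carrier (PL (Suc p))" "dP p f = \<zero>\<^bsub>PL p\<^esub>" by (simp_all only: mem_Collect_eq)
    have "\<Theta> p \<zero>\<^bsub>PL p\<^esub> = \<zero>\<^bsub>K (Suc p)\<^esub>" using \<Theta>_zero[of p] by (simp add: A_simps)
    then have 0: "s p (D p (\<Theta> (Suc p) f)) = \<zero>\<^bsub>K (Suc (Suc p))\<^esub>"
      unfolding \<Theta>_dP[OF f(1), symmetric] f(2) using lin_maps_zero[OF lK lK s_lin, of p] by (simp only:)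
    have "D (Suc p) (s (Suc p) (\<Theta> (Suc p) f)) = \<Theta> (Suc p) f"
      unfolding contraction[OF \<Theta>_closed[OF f(1)]] 0 by (rule K.diff_zero[OF \<Theta>_closed[OF f(1)]])
    then show "f \<in> dP (Suc p) ` carrier (PL (Suc (Suc p)))" using lift[OF f(1)] by blast
  qed
  show ?thesis unfolding free_resolution_def by (intro conjI allI dP_lin eP0_lin onto ex0 exS)
qed

lemma \<epsilon>_gen:
  assumes "c \<in> carrier k" "h \<in> carrier H" "xs \<in> L p"
  shows "\<epsilon> \<circ> gen c h xs = c \<odot>\<^bsub>K p\<^esub> basis_vec k xs"
proof (rule ext)
  fix ys
  have 1: "gen c h xs xs = c \<odot>\<^bsub>F\<^esub> basis_vec k h" using assms(1) by (intro ext) (simp add: gen_def basis_vec_def)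
  have 2: "gen c h xs ys = \<zero>\<^bsub>F\<^esub>" if "ys \<noteq> xs" using that by (intro ext) (simp add: gen_def)
  have 3: "\<epsilon> (c \<odot>\<^bsub>F\<^esub> basis_vec k h) = c"
    unfolding lin_maps_smult[OF \<epsilon>_lin assms(1) e[OF assms(2)]] \<epsilon>_basis[OF assms(2)] using assms(1) by (simp add: kk_simps)
  have 4: "\<epsilon> \<zero>\<^bsub>F\<^esub> = \<zero>\<^bsub>k\<^esub>" using lin_maps_zero[OF lF lkk \<epsilon>_lin] unfolding kk_simps .
  show "(\<epsilon> \<circ> gen c h xs) ys = (c \<odot>\<^bsub>K p\<^esub> basis_vec k xs) ys"
  proof (cases "ys = xs")
    case True
    have "(\<epsilon> \<circ> gen c h xs) xs = c" unfolding comp_apply 1 3 ..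
    then show ?thesis using True assms(1) by (simp add: basis_vec_def)
  next
    case False
    have "(\<epsilon> \<circ> gen c h xs) ys = \<zero>\<^bsub>k\<^esub>" unfolding comp_apply 2[OF False] 4 ..
    then show ?thesis using False assms(1) by (simp add: basis_vec_def)
  qed
qed

text \<open>Applying \<open>\<epsilon>\<close> to the coefficients of \<open>dval\<close> forgets
  the group element split off by the last face. What is left is the bar differential with trivial
  coefficients.\<close>

theorem Tor_group_homology: "module_iso k (Tor k A N N p) (group_homology k H p)"
proof -
  interpret aug: augmented_algebra k A N \<epsilon> by (rule augmented)
  have bm: "bar_module k H q = K q" for q by (simp add: bar_module_def L_def)
  have "homology K (\<lambda>p. aug.change (L p) (dP p)) p = homology K (bar_diff k H) p"
  proof (rule homology_cong)
    fix q x assume x: "x \<in> carrier (K (Suc q))"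
    interpret K: left_module k "K q" by (rule lK)
    let ?b = "\<lambda>xs. \<Oplus>\<^bsub>K q\<^esub>i\<in>{0..Suc q}. sg i \<odot>\<^bsub>K q\<^esub> basis_vec k (bar_face H i xs)"
    have t: "(\<lambda>i. sg i \<odot>\<^bsub>K q\<^esub> basis_vec k (bar_face H i xs)) \<in> {0..Suc q} \<rightarrow> carrier (K q)" if "xs \<in> L (Suc q)" for xs
      by (rule Pi_I) (rule K.smult_closed[OF sg_closed eK[OF face_L[OF that]]], simp)
    have bv: "?b \<in> L (Suc q) \<rightarrow> carrier (K q)" by (rule Pi_I) (rule K.M.finsum_closed[OF t])
    have bd: "bar_diff k H q = lin_ext k (K q) ?b" unfolding bar_diff_def bm sg_def ..
    have bl: "bar_diff k H q \<in> lin_maps k (K (Suc q)) (K q)" unfolding bd by (rule K.lin_ext_lin[OF bv])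
    show "aug.change (L q) (dP q) x = bar_diff k H q x"
    proof (rule lin_maps_basis_ext[OF lK aug.change(1)[OF dP_lin] bl _ x])
      fix xs assume xs: "xs \<in> L (Suc q)"
      note so = split_off_closed[OF xs] and fa = face_L[OF xs]
      have "aug.change (L q) (dP q) (basis_vec k xs) = \<epsilon> \<circ> dval q xs"
        using aug.change(2)[OF dP_lin eP[OF xs]] aug.comp_basis[of xs] dP_basis[OF xs] by (simp only:)
      also have "\<dots> = (\<Oplus>\<^bsub>K q\<^esub>i\<in>{0..Suc q}. \<epsilon> \<circ> gen (sg i) (split_off i xs) (bar_face H i xs))"
      proof -
        interpret P: left_module "opposite A" "PL q" by (rule lP)
        have z: "\<epsilon> \<circ> \<zero>\<^bsub>PL q\<^esub> = \<zero>\<^bsub>K q\<^esub>" by (rule aug.comp_zero)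
        have "\<epsilon> \<circ> (\<Oplus>\<^bsub>PL q\<^esub>i\<in>I. v i) = (\<Oplus>\<^bsub>K q\<^esub>i\<in>I. \<epsilon> \<circ> v i)"
          if "finite I" "v \<in> I \<rightarrow> carrier (PL q)" for I :: "nat set" and v
          using that
        proof (induction I rule: finite_induct)
          case empty
          show ?case unfolding P.M.finsum_empty K.M.finsum_empty by (rule z)
        next
          case (insert i I)
          then have v: "v i \<in> carrier (PL q)" "v \<in> I \<rightarrow> carrier (PL q)" by auto
          have "(\<Oplus>\<^bsub>K q\<^esub>i\<in>insert i I. \<epsilon> \<circ> v i) = (\<epsilon> \<circ> v i) \<oplus>\<^bsub>K q\<^esub> (\<Oplus>\<^bsub>K q\<^esub>i\<in>I. \<epsilon> \<circ> v i)"
            by (rule K.M.finsum_insert[OF insert.hyps]) (use v aug.comp_closed in auto)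
          then show ?case
            unfolding P.M.finsum_insert[OF insert.hyps v(2,1)]
              aug.comp_add[OF v(1) P.M.finsum_closed[OF v(2)]] insert.IH[OF v(2)] by (rule sym)
        qed
        then show ?thesis unfolding dval_def using gens_closed[OF xs] by (simp only: finite_atLeastAtMost)
      qed
      also have "\<dots> = ?b xs"
        by (rule K.M.finsum_cong'[OF refl t[OF xs] \<epsilon>_gen[OF sg_closed so fa]]) simp
      also have "\<dots> = bar_diff k H q (basis_vec k xs)" unfolding bd by (rule K.lin_ext_basis_vec[OF bv xs, symmetric])
      finally show "aug.change (L q) (dP q) (basis_vec k xs) = bar_diff k H q (basis_vec k xs)" .
    qed
  qed
  then show ?thesis
    using aug.Tor_iso(1)[OF bar_resolution, of p] unfolding group_homology_def bm[abs_def] by (simp only:)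
qed

end

section \<open>Labelled graphs and their contraction\<close>

definition adj :: "('v set \<times> 'g) set \<Rightarrow> ('v \<times> 'v) set" where
  "adj E = {(u, v). \<exists>(e, g)\<in>E. u \<in> e \<and> v \<in> e}"

definition component :: "('v set \<times> 'g) set \<Rightarrow> 'v \<Rightarrow> 'v set" where
  "component E v = (adj E)\<^sup>* `` {v}"

definition comps :: "('v set \<times> 'g) set \<Rightarrow> 'v set \<Rightarrow> 'v set set" where
  "comps E V = component E ` V"

definition label :: "('g, 'a) monoid_scheme \<Rightarrow> ('v set \<times> 'g) set \<Rightarrow> 'v set \<Rightarrow> 'g" where
  "label G E C = (\<Otimes>\<^bsub>G\<^esub>eg\<in>{eg \<in> E. fst eg \<subseteq> C}. snd eg)"

lemma adj_sym: "sym (adj E)" by (auto simp: adj_def sym_def)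

lemma adjI: "eg \<in> E \<Longrightarrow> u \<in> fst eg \<Longrightarrow> v \<in> fst eg \<Longrightarrow> (u, v) \<in> adj E"
  by (cases eg) (auto simp: adj_def)

lemma adjE:
  assumes "(u, v) \<in> adj E" obtains eg where "eg \<in> E" "u \<in> fst eg" "v \<in> fst eg"
  using assms by (fastforce simp: adj_def)

lemma conn_sym: "(u, v) \<in> (adj E)\<^sup>* \<Longrightarrow> (v, u) \<in> (adj E)\<^sup>*"
  using sym_rtrancl[OF adj_sym, of E] by (rule symD)

lemma component_self: "v \<in> component E v" by (simp add: component_def)

lemma component_mem: "w \<in> component E v \<longleftrightarrow> (v, w) \<in> (adj E)\<^sup>*" by (simp add: component_def)

lemma component_eq: "w \<in> component E v \<Longrightarrow> component E w = component E v"
  unfolding component_def using conn_sym[of _ _ E] by (auto intro: rtrancl_trans)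

lemma comps_disjoint: "C \<in> comps E V \<Longrightarrow> C' \<in> comps E V' \<Longrightarrow> x \<in> C \<Longrightarrow> x \<in> C' \<Longrightarrow> C = C'"
  unfolding comps_def using component_eq by (metis imageE)

lemma comps_mem: "C \<in> comps E V \<Longrightarrow> v \<in> C \<Longrightarrow> C = component E v"
  unfolding comps_def using component_eq by (metis imageE)

lemma edge_component: "eg \<in> E \<Longrightarrow> x \<in> fst eg \<Longrightarrow> x \<in> component E v \<Longrightarrow> fst eg \<subseteq> component E v"
  unfolding component_def by (auto intro: rtrancl_into_rtrancl adjI)

lemma component_closed:
  assumes "v \<in> C" "\<And>eg. eg \<in> E \<Longrightarrow> fst eg \<inter> C \<noteq> {} \<Longrightarrow> fst eg \<subseteq> C"
  shows "component E v \<subseteq> C"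
proof
  fix w assume "w \<in> component E v"
  then have "(v, w) \<in> (adj E)\<^sup>*" by (simp add: component_mem)
  then show "w \<in> C"
  proof (induction rule: rtrancl_induct)
    case (step y z)
    then show ?case using assms(2) by (elim adjE) blast
  qed (rule assms(1))
qed

lemma component_sub:
  assumes "v \<in> V" "\<And>eg. eg \<in> E \<Longrightarrow> fst eg \<subseteq> V" shows "component E v \<subseteq> V"
  by (rule component_closed) (use assms in auto)

lemma component_mono: "E \<subseteq> E' \<Longrightarrow> component E v \<subseteq> component E' v"
  unfolding component_def adj_def by (rule Image_mono) (auto intro!: rtrancl_mono)

lemma comps_finite: "finite V \<Longrightarrow> finite (comps E V)" by (simp add: comps_def)

section \<open>Forgetting the hidden nodes of a glued graph\<close>

text \<open>\<open>E\<^sub>1\<close> and \<open>E\<^sub>2\<close> are glued along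
  \<open>hid\<close>, and \<open>Y\<close> is a third graph that avoids \<open>hid\<close>.
  Contracting the glued graph to its visible nodes before adding \<open>Y\<close> must lose nothing.
  The two edge sets stay separate because a labelled edge occurring in both has to be counted twice
  in a label. Edges may be nonempty sets of any size, so the arguments concern components only, not
  paths.\<close>

locale contraction = comm_group G for G :: "('g, 'a) monoid_scheme" (structure) +
  fixes E\<^sub>1 E\<^sub>2 Y :: "('v set \<times> 'g) set" and V\<^sub>1 V hid :: "'v set"
  assumes E_fin: "finite E\<^sub>1" "finite E\<^sub>2"
    and E_edges: "\<And>eg. eg \<in> E\<^sub>1 \<union> E\<^sub>2 \<Longrightarrow> fst eg \<subseteq> V\<^sub>1 \<and> fst eg \<noteq> {} \<and> snd eg \<in> carrier G"
    and Y_edges: "\<And>eg. eg \<in> Y \<Longrightarrow> fst eg \<inter> hid = {} \<and> fst eg \<subseteq> V \<and> fst eg \<noteq> {} \<and> snd eg \<in> carrier G"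
    and V: "finite V" "V\<^sub>1 \<subseteq> V" "hid \<subseteq> V\<^sub>1"
begin

definition E\<^sub>0 where "E\<^sub>0 = E\<^sub>1 \<union> E\<^sub>2"

definition Z where
  "Z = (\<lambda>C. (C - hid, label G E\<^sub>1 C \<otimes> label G E\<^sub>2 C)) ` {C \<in> comps E\<^sub>0 V\<^sub>1. C - hid \<noteq> {}}"

lemma label_closed: "(\<And>eg. eg \<in> E \<Longrightarrow> snd eg \<in> carrier G) \<Longrightarrow> label G E C \<in> carrier G"
  unfolding label_def by (rule finprod_closed) auto

lemma E_comp_sub: "v \<in> V\<^sub>1 \<Longrightarrow> component E\<^sub>0 v \<subseteq> V\<^sub>1"
  by (rule component_sub) (use E_edges in \<open>auto simp: E\<^sub>0_def\<close>)

lemma Z_edge: "v \<in> V\<^sub>1 \<Longrightarrow> v \<notin> hid \<Longrightarrow>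
    (component E\<^sub>0 v - hid, label G E\<^sub>1 (component E\<^sub>0 v) \<otimes> label G E\<^sub>2 (component E\<^sub>0 v)) \<in> Z"
  unfolding Z_def comps_def using component_self[of v E\<^sub>0] by (intro imageI) blast

text \<open>An edge of \<open>Y\<close> has no hidden ends, so a walk can leave a component of the
  glued graph only at a visible node. The walk is thereby shadowed by one in
  \<open>Z \<union> Y\<close>, always staying in the glued component of a visible node
  \<open>w'\<close>.\<close>

lemma reach_visible:
  assumes "w \<in> component (E\<^sub>0 \<union> Y) u" "u \<notin> hid"
  shows "\<exists>w'. w' \<notin> hid \<and> w \<in> component E\<^sub>0 w' \<and> w' \<in> component (Z \<union> Y) u"
proof -
  have same: "w \<in> component (Z \<union> Y) w'" if "w \<in> component E\<^sub>0 w'" "w \<notin> hid" "w' \<notin> hid" for w w'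
  proof (cases "w' \<in> V\<^sub>1")
    case True
    let ?eg = "(component E\<^sub>0 w' - hid, label G E\<^sub>1 (component E\<^sub>0 w') \<otimes> label G E\<^sub>2 (component E\<^sub>0 w'))"
    have "?eg \<in> Z \<union> Y" using Z_edge[OF True that(3)] by blast
    moreover have "w' \<in> fst ?eg" "w \<in> fst ?eg" using component_self[of w' E\<^sub>0] that by simp_all
    ultimately have "(w', w) \<in> adj (Z \<union> Y)" by (rule adjI)
    then show ?thesis unfolding component_mem by (rule r_into_rtrancl)
  next
    case False
    have "component E\<^sub>0 w' \<subseteq> {w'}" by (rule component_closed) (use False E_edges in \<open>auto simp: E\<^sub>0_def\<close>)
    then have "w = w'" using that(1) by blast
    then show ?thesis using component_self[of w' "Z \<union> Y"] by simp
  qed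
  have "(u, w) \<in> (adj (E\<^sub>0 \<union> Y))\<^sup>*" using assms(1) by (simp add: component_mem)
  then show ?thesis
  proof (induction rule: rtrancl_induct)
    case base
    then show ?case using assms(2) component_self[of u E\<^sub>0] component_self[of u "Z \<union> Y"] by blast
  next
    case (step y z)
    then obtain w' where w': "w' \<notin> hid" "y \<in> component E\<^sub>0 w'" "w' \<in> component (Z \<union> Y) u" by blast
    obtain eg where eg: "eg \<in> E\<^sub>0 \<union> Y" "y \<in> fst eg" "z \<in> fst eg" using step(2) by (rule adjE)
    show ?case
    proof (cases "eg \<in> E\<^sub>0")
      case True
      then have "z \<in> component E\<^sub>0 w'" using edge_component[OF True eg(2) w'(2)] eg(3) by blast
      then show ?thesis using w' by blast
    next
      case False
      then have Y: "eg \<in> Y" using eg(1) by blast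
      then have "y \<notin> hid" "z \<notin> hid" using Y_edges[OF Y] eg by auto
      then have "y \<in> component (Z \<union> Y) w'" using same w' by blast
      then have "y \<in> component (Z \<union> Y) u" using component_eq[OF w'(3)] by simp
      moreover have "eg \<in> Z \<union> Y" using Y by blast
      ultimately have "z \<in> component (Z \<union> Y) u" using edge_component[OF _ eg(2)] eg(3) by blast
      then show ?thesis using \<open>z \<notin> hid\<close> component_self[of z E\<^sub>0] by blast
    qed
  qed
qed

lemma Z_Y_edges: "eg \<in> Z \<union> Y \<Longrightarrow> fst eg \<inter> hid = {}"
  using Y_edges[of eg] unfolding Z_def by auto

lemma component_Z:
  assumes u: "u \<notin> hid"
  shows "component (Z \<union> Y) u = component (E\<^sub>0 \<union> Y) u - hid"
proof
  have 1: "component (Z \<union> Y) u \<subseteq> - hid"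
    by (rule component_closed) (use u Z_Y_edges in auto)
  have 2: "component (Z \<union> Y) u \<subseteq> component (E\<^sub>0 \<union> Y) u"
  proof (rule component_closed[OF component_self])
    fix eg assume eg: "eg \<in> Z \<union> Y" "fst eg \<inter> component (E\<^sub>0 \<union> Y) u \<noteq> {}"
    show "fst eg \<subseteq> component (E\<^sub>0 \<union> Y) u"
    proof (cases "eg \<in> Y")
      case True
      then show ?thesis using edge_component[of eg "E\<^sub>0 \<union> Y" _ u] eg(2) by blast
    next
      case False
      then have "eg \<in> Z" using eg(1) by blast
      then obtain C where C: "C \<in> comps E\<^sub>0 V\<^sub>1"
        "eg = (C - hid, label G E\<^sub>1 C \<otimes> label G E\<^sub>2 C)" unfolding Z_def by blast
      then have C: "C \<in> comps E\<^sub>0 V\<^sub>1" "fst eg = C - hid" by simp_all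
      obtain x where x: "x \<in> C" "x \<in> component (E\<^sub>0 \<union> Y) u" using eg(2) C(2) by blast
      have "C = component E\<^sub>0 x" by (rule comps_mem[OF C(1) x(1)])
      also have "\<dots> \<subseteq> component (E\<^sub>0 \<union> Y) x" by (rule component_mono) blast
      also have "\<dots> = component (E\<^sub>0 \<union> Y) u" by (rule component_eq[OF x(2)])
      finally show ?thesis using C(2) by blast
    qed
  qed
  show "component (Z \<union> Y) u \<subseteq> component (E\<^sub>0 \<union> Y) u - hid" using 1 2 by blast
  show "component (E\<^sub>0 \<union> Y) u - hid \<subseteq> component (Z \<union> Y) u"
  proof
    fix w assume w: "w \<in> component (E\<^sub>0 \<union> Y) u - hid"
    then obtain w' where w': "w' \<notin> hid" "w \<in> component E\<^sub>0 w'" "w' \<in> component (Z \<union> Y) u"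
      using reach_visible[of w u] u by blast
    show "w \<in> component (Z \<union> Y) u"
    proof (cases "w' \<in> V\<^sub>1")
      case True
      let ?eg = "(component E\<^sub>0 w' - hid, label G E\<^sub>1 (component E\<^sub>0 w') \<otimes> label G E\<^sub>2 (component E\<^sub>0 w'))"
      have "?eg \<in> Z \<union> Y" using Z_edge[OF True w'(1)] by blast
      then have "fst ?eg \<subseteq> component (Z \<union> Y) u"
        by (rule edge_component[OF _ _ w'(3)]) (use w' component_self in auto)
      then show ?thesis using w w' by auto
    next
      case False
      have "component E\<^sub>0 w' \<subseteq> {w'}" by (rule component_closed) (use False E_edges in \<open>auto simp: E\<^sub>0_def\<close>)
      then show ?thesis using w' by blast
    qed
  qed
qed

text \<open>Each edge of \<open>E\<close> inside \<open>C\<close> lies in exactly one component of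
  the glued graph, and that component is contained in \<open>C\<close>; the product over edges
  splits accordingly.\<close>

lemma label_sub_comps:
  assumes E: "E = E\<^sub>1 \<or> E = E\<^sub>2" and C: "C = component (E\<^sub>0 \<union> Y) u" "u \<notin> hid"
  shows "label G E C = (\<Otimes>C'\<in>{C' \<in> comps E\<^sub>0 V\<^sub>1. C' \<subseteq> C}. label G E C')"
proof -
  let ?K = "{C' \<in> comps E\<^sub>0 V\<^sub>1. C' \<subseteq> C}"
  have EX: "E \<subseteq> E\<^sub>0" and fE: "finite E" and ne: "eg \<in> E \<Longrightarrow> fst eg \<noteq> {} \<and> fst eg \<subseteq> V\<^sub>1"
    and cE: "eg \<in> E \<Longrightarrow> snd eg \<in> carrier G" for eg
    using E E_fin E_edges unfolding E\<^sub>0_def by blast+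
  have fV: "finite V\<^sub>1" using V finite_subset by blast
  have "{eg \<in> E. fst eg \<subseteq> C} = (\<Union>C'\<in>?K. {eg \<in> E. fst eg \<subseteq> C'})"
  proof (intro equalityI subsetI)
    fix eg assume "eg \<in> {eg \<in> E. fst eg \<subseteq> C}"
    then have eg: "eg \<in> E" "fst eg \<subseteq> C" by auto
    then obtain x where x: "x \<in> fst eg" using ne by blast
    have "fst eg \<subseteq> component E\<^sub>0 x" by (rule edge_component[OF subsetD[OF EX eg(1)] x component_self])
    moreover have "component E\<^sub>0 x \<subseteq> component (E\<^sub>0 \<union> Y) x" by (rule component_mono) blast
    moreover have "component (E\<^sub>0 \<union> Y) x = C" unfolding C(1) by (rule component_eq) (use x eg C in blast)
    moreover have "component E\<^sub>0 x \<in> comps E\<^sub>0 V\<^sub>1" using ne[OF eg(1)] x unfolding comps_def by blast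
    ultimately show "eg \<in> (\<Union>C'\<in>?K. {eg \<in> E. fst eg \<subseteq> C'})" using eg(1) by blast
  qed blast
  then have "label G E C = (\<Otimes>eg\<in>(\<Union>C'\<in>?K. {eg \<in> E. fst eg \<subseteq> C'}). snd eg)"
    unfolding label_def by simp
  also have "\<dots> = (\<Otimes>C'\<in>?K. label G E C')"
    unfolding label_def
  proof (rule finprod_UN_disjoint)
    show "finite ?K" by (rule finite_subset[OF _ comps_finite[OF fV]]) blast
    show "finite {eg \<in> E. fst eg \<subseteq> C'}" for C' using fE by simp
    show "snd eg \<in> carrier G" if "C' \<in> ?K" "eg \<in> {eg \<in> E. fst eg \<subseteq> C'}" for C' eg using that cE by auto
    show "pairwise (\<lambda>i j. disjnt {eg \<in> E. fst eg \<subseteq> i} {eg \<in> E. fst eg \<subseteq> j}) ?K"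
    proof (rule pairwiseI)
      fix A B assume AB: "A \<in> ?K" "B \<in> ?K" "A \<noteq> B"
      show "disjnt {eg \<in> E. fst eg \<subseteq> A} {eg \<in> E. fst eg \<subseteq> B}"
        unfolding disjnt_iff
      proof (intro allI notI, elim conjE)
        fix eg assume "eg \<in> {eg \<in> E. fst eg \<subseteq> A}" "eg \<in> {eg \<in> E. fst eg \<subseteq> B}"
        then obtain x where "x \<in> A" "x \<in> B" using ne by blast
        then show False using comps_disjoint AB by (metis (mono_tags, lifting) mem_Collect_eq)
      qed
    qed
  qed
  finally show ?thesis .
qed

text \<open>A hidden component of the glued graph is not touched by \<open>Y\<close> and cannot
  belong to a component with a visible node. Hence no factor of a label is lost in passing to
  \<open>Z\<close>.\<close>

lemma sub_comp_visible:
  assumes C: "C = component (E\<^sub>0 \<union> Y) u" "u \<notin> hid" and C': "C' \<in> comps E\<^sub>0 V\<^sub>1" "C' \<subseteq> C"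
  shows "C' - hid \<noteq> {}"
proof -
  obtain x where x: "C' = component E\<^sub>0 x" using C'(1) unfolding comps_def by blast
  then have "x \<in> component (E\<^sub>0 \<union> Y) u" using C(1) C'(2) component_self[of x E\<^sub>0] by blast
  then obtain w' where w': "w' \<notin> hid" "x \<in> component E\<^sub>0 w'" using reach_visible[of x u] C(2) by blast
  have "w' \<in> C'" unfolding x component_eq[OF w'(2)] by (rule component_self)
  then show ?thesis using w'(1) by blast
qed

lemma label_E_closed: "label G E\<^sub>1 C \<in> carrier G" "label G E\<^sub>2 C \<in> carrier G"
  by (rule label_closed, use E_edges in blast)+

lemma label_Z:
  assumes C: "C = component (E\<^sub>0 \<union> Y) u" "u \<notin> hid"
  shows "label G Z (C - hid) = label G E\<^sub>1 C \<otimes> label G E\<^sub>2 C"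
proof -
  let ?K = "{C' \<in> comps E\<^sub>0 V\<^sub>1. C' \<subseteq> C}"
  let ?z = "\<lambda>C. (C - hid, label G E\<^sub>1 C \<otimes> label G E\<^sub>2 C)"
  have K: "C' \<subseteq> C" if C': "C' \<in> comps E\<^sub>0 V\<^sub>1" "C' - hid \<subseteq> C - hid" "C' - hid \<noteq> {}" for C'
  proof -
    obtain x where x: "x \<in> C'" "x \<in> C" using C' by blast
    have "C' = component E\<^sub>0 x" by (rule comps_mem[OF C'(1) x(1)])
    also have "\<dots> \<subseteq> component (E\<^sub>0 \<union> Y) x" by (rule component_mono) blast
    also have "\<dots> = C" unfolding C(1) by (rule component_eq) (use x C in blast)
    finally show ?thesis .
  qed
  have "{eg \<in> Z. fst eg \<subseteq> C - hid} = ?z ` ?K"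
  proof (intro equalityI subsetI)
    fix eg assume "eg \<in> {eg \<in> Z. fst eg \<subseteq> C - hid}"
    then have eg: "eg \<in> Z" "fst eg \<subseteq> C - hid" by simp_all
    from eg(1) obtain C' where C': "C' \<in> comps E\<^sub>0 V\<^sub>1" "C' - hid \<noteq> {}" "eg = ?z C'"
      unfolding Z_def by blast
    then have "C' \<subseteq> C" using K eg(2) by simp
    then show "eg \<in> ?z ` ?K" using C' by blast
  next
    fix eg assume "eg \<in> ?z ` ?K"
    then obtain C' where C': "C' \<in> comps E\<^sub>0 V\<^sub>1" "C' \<subseteq> C" "eg = ?z C'" by blast
    then show "eg \<in> {eg \<in> Z. fst eg \<subseteq> C - hid}"
      using sub_comp_visible[OF C C'(1,2)] by (auto simp: Z_def)
  qed
  then have "label G Z (C - hid) = (\<Otimes>eg\<in>?z ` ?K. snd eg)" unfolding label_def by simp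
  also have "\<dots> = (\<Otimes>C'\<in>?K. snd (?z C'))"
  proof (rule finprod_reindex)
    show "snd \<in> ?z ` ?K \<rightarrow> carrier G" using label_E_closed by auto
    \<comment> \<open>Distinct components must give distinct elements of the set \<open>Z\<close>,
      or the product would lose factors. They do, because their visible parts are nonempty and
      disjoint.\<close>
    show "inj_on ?z ?K"
    proof (rule inj_onI)
      fix A B assume AB: "A \<in> ?K" "B \<in> ?K" "?z A = ?z B"
      then obtain x where "x \<in> A - hid" using sub_comp_visible[OF C] by blast
      then have "x \<in> A" "x \<in> B" using AB(3) by auto
      then show "A = B" using comps_disjoint AB(1,2) by (metis (mono_tags, lifting) mem_Collect_eq)
    qed
  qed
  also have "\<dots> = (\<Otimes>C'\<in>?K. label G E\<^sub>1 C') \<otimes> (\<Otimes>C'\<in>?K. label G E\<^sub>2 C')"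
    unfolding snd_conv by (rule finprod_multf) (use label_E_closed in auto)
  also have "\<dots> = label G E\<^sub>1 C \<otimes> label G E\<^sub>2 C"
    using label_sub_comps[OF _ C] by simp
  finally show ?thesis .
qed

lemma label_Y: "label G Y (C - hid) = label G Y C"
proof -
  have "{eg \<in> Y. fst eg \<subseteq> C - hid} = {eg \<in> Y. fst eg \<subseteq> C}" using Y_edges by blast
  then show ?thesis unfolding label_def by simp
qed

lemma comps_Z: "comps (Z \<union> Y) (V - hid) = (\<lambda>C. C - hid) ` {C \<in> comps (E\<^sub>0 \<union> Y) V. C - hid \<noteq> {}}"
proof (intro equalityI subsetI)
  fix C assume "C \<in> comps (Z \<union> Y) (V - hid)"
  then obtain v where v: "v \<in> V" "v \<notin> hid" "C = component (Z \<union> Y) v" unfolding comps_def by blast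
  have "component (E\<^sub>0 \<union> Y) v \<in> comps (E\<^sub>0 \<union> Y) V" unfolding comps_def using v(1) by blast
  moreover have "v \<in> component (E\<^sub>0 \<union> Y) v" by (rule component_self)
  ultimately show "C \<in> (\<lambda>C. C - hid) ` {C \<in> comps (E\<^sub>0 \<union> Y) V. C - hid \<noteq> {}}"
    unfolding v(3) component_Z[OF v(2)] using v(2) by blast
next
  fix C assume "C \<in> (\<lambda>C. C - hid) ` {C \<in> comps (E\<^sub>0 \<union> Y) V. C - hid \<noteq> {}}"
  then obtain D where D: "D \<in> comps (E\<^sub>0 \<union> Y) V" "C = D - hid" "D - hid \<noteq> {}" by blast
  then obtain v where v: "v \<in> D" "v \<notin> hid" by blast
  then have Dv: "D = component (E\<^sub>0 \<union> Y) v" by (intro comps_mem[OF D(1)])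
  have "v \<in> V"
  proof -
    obtain v0 where "v0 \<in> V" "D = component (E\<^sub>0 \<union> Y) v0" using D(1) unfolding comps_def by blast
    then have "D \<subseteq> V" using component_sub[of v0 V "E\<^sub>0 \<union> Y"] E_edges Y_edges V(2) unfolding E\<^sub>0_def by blast
    then show ?thesis using v by blast
  qed
  moreover have "C = component (Z \<union> Y) v" unfolding component_Z[OF v(2)] D(2) Dv[symmetric] ..
  ultimately show "C \<in> comps (Z \<union> Y) (V - hid)" unfolding comps_def using v(2) by blast
qed

text \<open>Loops that close up in the first gluing are unaffected by \<open>Y\<close>, none of
  whose edges has a hidden end.\<close>

lemma comps_hidden: "{C \<in> comps (E\<^sub>0 \<union> Y) V. C \<subseteq> hid} = {C \<in> comps E\<^sub>0 V\<^sub>1. C \<subseteq> hid}"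
proof (intro equalityI subsetI)
  fix C assume "C \<in> {C \<in> comps (E\<^sub>0 \<union> Y) V. C \<subseteq> hid}"
  then obtain v where v: "C = component (E\<^sub>0 \<union> Y) v" "C \<subseteq> hid" unfolding comps_def by blast
  have "component (E\<^sub>0 \<union> Y) v \<subseteq> component E\<^sub>0 v"
  proof (rule component_closed[OF component_self])
    fix eg assume eg: "eg \<in> E\<^sub>0 \<union> Y" "fst eg \<inter> component E\<^sub>0 v \<noteq> {}"
    have "component E\<^sub>0 v \<subseteq> hid" using component_mono[of E\<^sub>0 "E\<^sub>0 \<union> Y" v] v by blast
    then have "eg \<in> E\<^sub>0" using eg Y_edges by blast
    then show "fst eg \<subseteq> component E\<^sub>0 v" using edge_component[of eg E\<^sub>0 _ v] eg(2) by blast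
  qed
  then have "C = component E\<^sub>0 v" using component_mono[of E\<^sub>0 "E\<^sub>0 \<union> Y" v] v by blast
  moreover have "v \<in> V\<^sub>1" using v component_self V(3) by fast
  ultimately show "C \<in> {C \<in> comps E\<^sub>0 V\<^sub>1. C \<subseteq> hid}" using v(2) unfolding comps_def by blast
next
  fix C assume "C \<in> {C \<in> comps E\<^sub>0 V\<^sub>1. C \<subseteq> hid}"
  then obtain v where v: "C = component E\<^sub>0 v" "C \<subseteq> hid" "v \<in> V\<^sub>1" unfolding comps_def by blast
  have "component (E\<^sub>0 \<union> Y) v \<subseteq> C"
  proof (rule component_closed)
    show "v \<in> C" using v component_self by fast
    fix eg assume eg: "eg \<in> E\<^sub>0 \<union> Y" "fst eg \<inter> C \<noteq> {}"
    then have "eg \<in> E\<^sub>0" using Y_edges v(2) by blast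
    then show "fst eg \<subseteq> C" using edge_component[of eg E\<^sub>0 _ v] eg(2) v(1) by blast
  qed
  then have "C = component (E\<^sub>0 \<union> Y) v" using component_mono[of E\<^sub>0 "E\<^sub>0 \<union> Y" v] v by blast
  then show "C \<in> {C \<in> comps (E\<^sub>0 \<union> Y) V. C \<subseteq> hid}" using v V(2) unfolding comps_def by blast
qed

lemma label_Y_hidden: "C \<subseteq> hid \<Longrightarrow> label G Y C = \<one>"
proof -
  assume "C \<subseteq> hid"
  then have "{eg \<in> Y. fst eg \<subseteq> C} = {}" using Y_edges by blast
  then show ?thesis unfolding label_def by (simp only: finprod_empty)
qed

lemma outer_edges:
  assumes Q: "Q \<inter> hid = {}"
  shows "(\<lambda>C. (C \<inter> Q, label G Z C \<otimes> label G Y C)) ` {C \<in> comps (Z \<union> Y) (V - hid). C \<inter> Q \<noteq> {}}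
    = (\<lambda>C. (C \<inter> Q, label G E\<^sub>1 C \<otimes> label G E\<^sub>2 C \<otimes> label G Y C)) ` {C \<in> comps (E\<^sub>0 \<union> Y) V. C \<inter> Q \<noteq> {}}"
    (is "?f ` ?A = ?g ` ?B")
proof -
  have A: "?A = (\<lambda>C. C - hid) ` ?B" unfolding comps_Z using Q by blast
  have "?f (C - hid) = ?g C" if CB: "C \<in> ?B" for C
  proof -
    obtain u where u: "u \<in> C" "u \<notin> hid" "C \<in> comps (E\<^sub>0 \<union> Y) V" using CB Q by blast
    have C: "C = component (E\<^sub>0 \<union> Y) u" by (rule comps_mem[OF u(3,1)])
    show ?thesis unfolding label_Z[OF C u(2)] label_Y using Q by auto
  qed
  then show ?thesis unfolding A image_image by (intro image_cong) auto
qed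

text \<open>The loops of the whole graph are of two kinds: the entirely hidden ones close up in the
  first gluing, the others when \<open>Y\<close> is added. This product formula is the source of the
  cocycle identity.\<close>

lemma loops:
  assumes k: "cring k" and w: "\<And>g. g \<in> carrier G \<Longrightarrow> w g \<in> carrier k" and Q: "Q \<inter> hid = {}"
  shows "(\<Otimes>\<^bsub>k\<^esub>C\<in>{C \<in> comps E\<^sub>0 V\<^sub>1. C - hid = {}}. w (label G E\<^sub>1 C \<otimes> label G E\<^sub>2 C)) \<otimes>\<^bsub>k\<^esub>
      (\<Otimes>\<^bsub>k\<^esub>C\<in>{C \<in> comps (Z \<union> Y) (V - hid). C \<inter> Q = {}}. w (label G Z C \<otimes> label G Y C))
    = (\<Otimes>\<^bsub>k\<^esub>C\<in>{C \<in> comps (E\<^sub>0 \<union> Y) V. C \<inter> Q = {}}. w (label G E\<^sub>1 C \<otimes> label G E\<^sub>2 C \<otimes> label G Y C))"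
proof -
  interpret k: cring k by (rule k)
  let ?h = "\<lambda>C. w (label G E\<^sub>1 C \<otimes> label G E\<^sub>2 C \<otimes> label G Y C)"
  have lY: "label G Y C \<in> carrier G" for C by (rule label_closed) (use Y_edges in blast)
  have hc: "?h C \<in> carrier k" for C using label_E_closed lY by (intro w) simp
  let ?A = "{C \<in> comps E\<^sub>0 V\<^sub>1. C - hid = {}}" and ?B = "{C \<in> comps (E\<^sub>0 \<union> Y) V. C \<inter> Q = {} \<and> C - hid \<noteq> {}}"
  have A: "?A = {C \<in> comps (E\<^sub>0 \<union> Y) V. C \<subseteq> hid}" using comps_hidden by blast
  have 1: "(\<Otimes>\<^bsub>k\<^esub>C\<in>?A. w (label G E\<^sub>1 C \<otimes> label G E\<^sub>2 C)) = (\<Otimes>\<^bsub>k\<^esub>C\<in>?A. ?h C)"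
  proof (rule k.finprod_cong')
    fix C assume "C \<in> ?A"
    then have "label G Y C = \<one>" using label_Y_hidden by blast
    then show "w (label G E\<^sub>1 C \<otimes> label G E\<^sub>2 C) = ?h C" using label_E_closed by simp
  qed (use hc in auto)
  have Z: "{C \<in> comps (Z \<union> Y) (V - hid). C \<inter> Q = {}} = (\<lambda>C. C - hid) ` ?B"
    unfolding comps_Z using Q by blast
  have comp: "\<exists>u. u \<notin> hid \<and> u \<in> C \<and> C = component (E\<^sub>0 \<union> Y) u" if "C \<in> ?B" for C
  proof -
    obtain u where u: "u \<in> C" "u \<notin> hid" "C \<in> comps (E\<^sub>0 \<union> Y) V" using \<open>C \<in> ?B\<close> by blast
    then show ?thesis using comps_mem[OF u(3,1)] by blast
  qed
  have 2: "(\<Otimes>\<^bsub>k\<^esub>C\<in>{C \<in> comps (Z \<union> Y) (V - hid). C \<inter> Q = {}}. w (label G Z C \<otimes> label G Y C)) = (\<Otimes>\<^bsub>k\<^esub>C\<in>?B. ?h C)"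
  proof -
    have eq: "w (label G Z (C - hid) \<otimes> label G Y (C - hid)) = ?h C" if C: "C \<in> ?B" for C
    proof -
      obtain u where u: "u \<notin> hid" "C = component (E\<^sub>0 \<union> Y) u" using comp[OF C] by blast
      show ?thesis unfolding label_Z[OF u(2,1)] label_Y ..
    qed
    have "(\<Otimes>\<^bsub>k\<^esub>C\<in>(\<lambda>C. C - hid) ` ?B. w (label G Z C \<otimes> label G Y C)) = (\<Otimes>\<^bsub>k\<^esub>C\<in>?B. w (label G Z (C - hid) \<otimes> label G Y (C - hid)))"
    proof (rule k.finprod_reindex)
      show "(\<lambda>C. w (label G Z C \<otimes> label G Y C)) \<in> (\<lambda>C. C - hid) ` ?B \<rightarrow> carrier k"
      proof (rule Pi_I, elim imageE)
        fix C' C assume C: "C' = C - hid" "C \<in> ?B"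
        show "w (label G Z C' \<otimes> label G Y C') \<in> carrier k" unfolding C(1) eq[OF C(2)] by (rule hc)
      qed
      show "inj_on (\<lambda>C. C - hid) ?B"
      proof (rule inj_onI)
        fix C D assume CD: "C \<in> ?B" "D \<in> ?B" "C - hid = D - hid"
        obtain u where u: "u \<notin> hid" "u \<in> C" using comp[OF CD(1)] by blast
        then have "u \<in> D" using CD(3) by blast
        then show "C = D" using u comps_disjoint CD(1,2) by (metis (mono_tags, lifting) mem_Collect_eq)
      qed
    qed
    also have "\<dots> = (\<Otimes>\<^bsub>k\<^esub>C\<in>?B. ?h C)" by (rule k.finprod_cong') (use hc eq in auto)
    finally show ?thesis unfolding Z .
  qed
  have S: "{C \<in> comps (E\<^sub>0 \<union> Y) V. C \<inter> Q = {}} = ?A \<union> ?B" unfolding A using Q by blast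
  have U: "(\<Otimes>\<^bsub>k\<^esub>C\<in>?A \<union> ?B. ?h C) = (\<Otimes>\<^bsub>k\<^esub>C\<in>?A. ?h C) \<otimes>\<^bsub>k\<^esub> (\<Otimes>\<^bsub>k\<^esub>C\<in>?B. ?h C)"
  proof (rule k.finprod_Un_disjoint)
    show "finite ?A" unfolding A by (rule finite_subset[OF _ comps_finite[OF V(1)]]) blast
    show "finite ?B" by (rule finite_subset[OF _ comps_finite[OF V(1)]]) blast
  qed (use hc in auto)
  show ?thesis unfolding 1 2 S U ..
qed

end

section \<open>Composition of diagrams\<close>

definition place :: "('v \<Rightarrow> 'w) \<Rightarrow> ('v set \<times> 'g) set \<Rightarrow> ('w set \<times> 'g) set" where
  "place \<sigma> E = (\<lambda>(e, g). (\<sigma> ` e, g)) ` E"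

lemma first_half_place: "first_half D = place (map_prod (id(Rgt := Mid)) id) D"
  and second_half_place: "second_half D = place (map_prod (id(Lft := Mid)) id) D"
  by (simp_all add: first_half_def second_half_def move_def place_def)

lemma place_place: "place \<sigma> (place \<tau> E) = place (\<sigma> \<circ> \<tau>) E"
  by (auto simp: place_def image_image case_prod_beta image_comp)

lemma place_cong:
  assumes "\<And>v. v \<in> V \<Longrightarrow> \<sigma> v = \<tau> v" "\<And>eg. eg \<in> E \<Longrightarrow> fst eg \<subseteq> V"
  shows "place \<sigma> E = place \<tau> E"
  unfolding place_def
proof (rule image_cong[OF refl])
  fix eg assume "eg \<in> E"
  then have "\<sigma> ` fst eg = \<tau> ` fst eg" using assms by (intro image_cong refl) blast
  then show "(case eg of (e, g) \<Rightarrow> (\<sigma> ` e, g)) = (case eg of (e, g) \<Rightarrow> (\<tau> ` e, g))" by (cases eg) simp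
qed

lemma place_Un: "place \<sigma> (E \<union> E') = place \<sigma> E \<union> place \<sigma> E'"
  by (simp add: place_def image_Un)

lemma place_mem: "eg \<in> place \<sigma> E \<longleftrightarrow> (\<exists>e g. (e, g) \<in> E \<and> eg = (\<sigma> ` e, g))"
  by (force simp: place_def)

lemma place_inj:
  assumes "inj \<sigma>" "place \<sigma> E = place \<sigma> E'" shows "E = E'"
proof -
  have "inj (\<lambda>(e, g). (\<sigma> ` e, g))" using assms(1) by (auto intro!: injI simp: inj_image_eq_iff)
  then show ?thesis using assms(2) unfolding place_def by (rule inj_image_eq_iff[THEN iffD1])
qed

lemma place_finite: "finite E \<Longrightarrow> finite (place \<sigma> E)" by (simp add: place_def)

lemma component_place:
  assumes "inj \<sigma>" shows "component (place \<sigma> E) (\<sigma> v) = \<sigma> ` component E v"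
proof
  show "component (place \<sigma> E) (\<sigma> v) \<subseteq> \<sigma> ` component E v"
  proof (rule component_closed)
    show "\<sigma> v \<in> \<sigma> ` component E v" by (rule imageI) (rule component_self)
    fix eg assume eg: "eg \<in> place \<sigma> E" "fst eg \<inter> \<sigma> ` component E v \<noteq> {}"
    then obtain e g where e: "(e, g) \<in> E" "eg = (\<sigma> ` e, g)" by (auto simp: place_mem)
    then obtain x where "x \<in> e" "x \<in> component E v" using eg(2) assms by (auto dest: injD)
    then have "e \<subseteq> component E v" using edge_component[OF e(1), of x v] by simp
    then show "fst eg \<subseteq> \<sigma> ` component E v" using e(2) by auto
  qed
  show "\<sigma> ` component E v \<subseteq> component (place \<sigma> E) (\<sigma> v)"
  proof (rule image_subsetI)
    fix w assume "w \<in> component E v"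
    then have "(v, w) \<in> (adj E)\<^sup>*" by (simp add: component_mem)
    then show "\<sigma> w \<in> component (place \<sigma> E) (\<sigma> v)"
    proof (induction rule: rtrancl_induct)
      case base
      show ?case by (rule component_self)
    next
      case (step y z)
      obtain eg where eg: "eg \<in> E" "y \<in> fst eg" "z \<in> fst eg" using step(2) by (rule adjE)
      have p: "(\<sigma> ` fst eg, snd eg) \<in> place \<sigma> E" using eg(1) by (force simp: place_mem)
      have "\<sigma> ` fst eg \<subseteq> component (place \<sigma> E) (\<sigma> v)"
        using edge_component[OF p, of "\<sigma> y" "\<sigma> v"] eg(2) step(3) by simp
      then show ?case using eg(3) by blast
    qed
  qed
qed

lemma comps_place: "inj \<sigma> \<Longrightarrow> comps (place \<sigma> E) (\<sigma> ` V) = (`) \<sigma> ` comps E V"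
  unfolding comps_def image_image by (simp add: component_place)

text \<open>\<open>outer_part\<close> and \<open>loop_part\<close> are the composite and the loop
  factor for arbitrary labelled graphs, with \<open>V\<close> the set of all nodes and
  \<open>Q\<close> the nodes that survive. Freed from the three fixed columns, they can be
  iterated.\<close>

definition outer_part where
  "outer_part G Q V A B =
     (\<lambda>C. (C \<inter> Q, label G A C \<otimes>\<^bsub>G\<^esub> label G B C)) ` {C \<in> comps (A \<union> B) V. C \<inter> Q \<noteq> {}}"

definition loop_part where
  "loop_part G k w Q V A B =
     (\<Otimes>\<^bsub>k\<^esub>C\<in>{C \<in> comps (A \<union> B) V. C \<inter> Q = {}}. w (label G A C \<otimes>\<^bsub>G\<^esub> label G B C))"

definition all_nodes :: "nat \<Rightarrow> node set" where "all_nodes n = {Lft, Mid, Rgt} \<times> {1..n}"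

lemma diagram_comp_alt:
  "diagram_comp G n D E = outer_part G (outer_nodes n) (all_nodes n) (first_half D) (second_half E)"
  unfolding diagram_comp_def outer_part_def components_def comps_def component_def joined_def adj_def
    component_label_def label_def all_nodes_def ..

lemma loop_factor_alt:
  "loop_factor G k act n \<delta> D E =
     loop_part G k (\<lambda>g. act g \<delta>) (outer_nodes n) (all_nodes n) (first_half D) (second_half E)"
  unfolding loop_factor_def loop_part_def components_def comps_def component_def joined_def adj_def
    component_label_def label_def all_nodes_def ..

definition labels_in :: "('g, 'a) monoid_scheme \<Rightarrow> ('v set \<times> 'g) set \<Rightarrow> bool" where
  "labels_in G E \<longleftrightarrow> snd ` E \<subseteq> carrier G"

lemma labels_in_place [simp]: "labels_in G (place \<sigma> E) = labels_in G E"
  unfolding labels_in_def place_def image_image by (simp add: case_prod_beta)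

context comm_group
begin

lemma label_closed: "labels_in G E \<Longrightarrow> label G E C \<in> carrier G"
  unfolding label_def labels_in_def by (rule finprod_closed) auto

lemma label_place:
  assumes \<sigma>: "inj \<sigma>" and E: "labels_in G E"
  shows "label G (place \<sigma> E) (\<sigma> ` C) = label G E C"
proof -
  let ?h = "\<lambda>(e, g). (\<sigma> ` e, g)"
  have "{eg \<in> place \<sigma> E. fst eg \<subseteq> \<sigma> ` C} = ?h ` {eg \<in> E. fst eg \<subseteq> C}"
    using inj_image_subset_iff[OF \<sigma>] by (force simp: place_def)
  then have "label G (place \<sigma> E) (\<sigma> ` C) = (\<Otimes>eg\<in>?h ` {eg \<in> E. fst eg \<subseteq> C}. snd eg)"
    unfolding label_def by simp
  also have "\<dots> = (\<Otimes>eg\<in>{eg \<in> E. fst eg \<subseteq> C}. snd (?h eg))"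
  proof (rule finprod_reindex)
    show "snd \<in> ?h ` {eg \<in> E. fst eg \<subseteq> C} \<rightarrow> carrier G" using E by (auto simp: labels_in_def)
    show "inj_on ?h {eg \<in> E. fst eg \<subseteq> C}" using \<sigma> by (auto intro!: inj_onI simp: inj_image_eq_iff)
  qed
  finally show ?thesis unfolding label_def by (simp add: case_prod_beta)
qed

lemma place_outer_part:
  assumes \<sigma>: "inj \<sigma>" and A: "labels_in G A" and B: "labels_in G B"
  shows "place \<sigma> (outer_part G Q V A B) = outer_part G (\<sigma> ` Q) (\<sigma> ` V) (place \<sigma> A) (place \<sigma> B)"
proof -
  have i: "\<sigma> ` C \<inter> \<sigma> ` Q = \<sigma> ` (C \<inter> Q)" for C using \<sigma> by (simp add: image_Int)
  have "{C \<in> comps (place \<sigma> A \<union> place \<sigma> B) (\<sigma> ` V). C \<inter> \<sigma> ` Q \<noteq> {}} = (`) \<sigma> ` {C \<in> comps (A \<union> B) V. C \<inter> Q \<noteq> {}}"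
    unfolding place_Un[symmetric] comps_place[OF \<sigma>] using i by auto
  then show ?thesis
    unfolding outer_part_def place_def[of \<sigma> "_ ` _"] image_image
    using label_place[OF \<sigma> A] label_place[OF \<sigma> B] i by (simp add: image_image)
qed

lemma loop_part_place:
  assumes k: "cring k" and w: "\<And>g. g \<in> carrier G \<Longrightarrow> w g \<in> carrier k"
    and \<sigma>: "inj \<sigma>" and A: "labels_in G A" and B: "labels_in G B"
  shows "loop_part G k w (\<sigma> ` Q) (\<sigma> ` V) (place \<sigma> A) (place \<sigma> B) = loop_part G k w Q V A B"
proof -
  interpret k: cring k by (rule k)
  have i: "\<sigma> ` C \<inter> \<sigma> ` Q = \<sigma> ` (C \<inter> Q)" for C using \<sigma> by (simp add: image_Int)
  have S: "{C \<in> comps (place \<sigma> A \<union> place \<sigma> B) (\<sigma> ` V). C \<inter> \<sigma> ` Q = {}} = (`) \<sigma> ` {C \<in> comps (A \<union> B) V. C \<inter> Q = {}}"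
    unfolding place_Un[symmetric] comps_place[OF \<sigma>] using i by auto
  have wc: "w (label G A C \<otimes> label G B C) \<in> carrier k" for C using label_closed[OF A] label_closed[OF B] by (intro w) simp
  have "loop_part G k w (\<sigma> ` Q) (\<sigma> ` V) (place \<sigma> A) (place \<sigma> B)
    = (\<Otimes>\<^bsub>k\<^esub>C\<in>{C \<in> comps (A \<union> B) V. C \<inter> Q = {}}.
        w (label G (place \<sigma> A) (\<sigma> ` C) \<otimes> label G (place \<sigma> B) (\<sigma> ` C)))"
    unfolding loop_part_def S
  proof (rule k.finprod_reindex)
    show "inj_on ((`) \<sigma>) {C \<in> comps (A \<union> B) V. C \<inter> Q = {}}" using \<sigma> by (auto intro!: inj_onI simp: inj_image_eq_iff)
  qed (use wc label_place[OF \<sigma> A] label_place[OF \<sigma> B] in auto)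
  then show ?thesis unfolding label_place[OF \<sigma> A] label_place[OF \<sigma> B] loop_part_def .
qed

lemma outer_part_commute:
  assumes "labels_in G A" "labels_in G B" shows "outer_part G Q V A B = outer_part G Q V B A"
  unfolding outer_part_def Un_commute[of A B]
  using m_comm[OF label_closed[OF assms(1)] label_closed[OF assms(2)]] by simp

lemma loop_part_commute:
  assumes "labels_in G A" "labels_in G B" shows "loop_part G k w Q V A B = loop_part G k w Q V B A"
  unfolding loop_part_def Un_commute[of A B]
  using m_comm[OF label_closed[OF assms(1)] label_closed[OF assms(2)]] by simp

end

context contraction
begin

lemma Z_outer_part: "outer_part G (V\<^sub>1 - hid) V\<^sub>1 E\<^sub>1 E\<^sub>2 = Z"
proof -
  have "C \<inter> (V\<^sub>1 - hid) = C - hid" if "C \<in> comps E\<^sub>0 V\<^sub>1" for C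
    using that E_comp_sub unfolding comps_def by blast
  then show ?thesis unfolding outer_part_def Z_def E\<^sub>0_def[symmetric] by (intro image_cong) auto
qed

lemma outer_part_Z:
  assumes "Q \<inter> hid = {}"
  shows "outer_part G Q (V - hid) Z Y
    = (\<lambda>C. (C \<inter> Q, label G E\<^sub>1 C \<otimes> label G E\<^sub>2 C \<otimes> label G Y C)) ` {C \<in> comps (E\<^sub>1 \<union> E\<^sub>2 \<union> Y) V. C \<inter> Q \<noteq> {}}"
  using outer_edges[OF assms] unfolding outer_part_def E\<^sub>0_def .

lemma loop_part_Z:
  assumes k: "cring k" and w: "\<And>g. g \<in> carrier G \<Longrightarrow> w g \<in> carrier k" and Q: "Q \<inter> hid = {}"
  shows "loop_part G k w (V\<^sub>1 - hid) V\<^sub>1 E\<^sub>1 E\<^sub>2 \<otimes>\<^bsub>k\<^esub> loop_part G k w Q (V - hid) Z Y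
    = (\<Otimes>\<^bsub>k\<^esub>C\<in>{C \<in> comps (E\<^sub>1 \<union> E\<^sub>2 \<union> Y) V. C \<inter> Q = {}}. w (label G E\<^sub>1 C \<otimes> label G E\<^sub>2 C \<otimes> label G Y C))"
proof -
  have "{C \<in> comps E\<^sub>0 V\<^sub>1. C \<inter> (V\<^sub>1 - hid) = {}} = {C \<in> comps E\<^sub>0 V\<^sub>1. C - hid = {}}"
    using E_comp_sub unfolding comps_def by blast
  then show ?thesis using loops[OF k w Q] unfolding loop_part_def E\<^sub>0_def by simp
qed

lemma Z_labels: "labels_in G Z"
  unfolding labels_in_def Z_def using label_E_closed by auto

end

definition col :: "nat \<Rightarrow> nat \<Rightarrow> nat \<Rightarrow> column \<Rightarrow> nat" where
  "col a b c x = (case x of Lft \<Rightarrow> a | Mid \<Rightarrow> b | Rgt \<Rightarrow> c)"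

text \<open>Columns are numbered: in a triple product the diagrams occupy the columns 0--1, 1--2 and 2--3.\<close>

definition strip :: "nat \<Rightarrow> nat \<Rightarrow> 'g diagram \<Rightarrow> ((nat \<times> nat) set \<times> 'g) set" where
  "strip a c D = place (map_prod (col a a c) id) D"

lemma col_inj: "a \<noteq> b \<Longrightarrow> a \<noteq> c \<Longrightarrow> b \<noteq> c \<Longrightarrow> inj (map_prod (col a b c) (id :: nat \<Rightarrow> nat))"
  by (intro prod.inj_map injI) (auto simp: col_def split: column.splits)

locale diagrams = comm_group G for G :: "('g, 'a) monoid_scheme" (structure) +
  fixes n :: nat
begin

text \<open>Weaker than being a diagram: no matching condition is imposed. Composition preserves it
  at once, so associativity can be proved without knowing that composites are matchings.\<close>

definition valid :: "'g diagram \<Rightarrow> bool" where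
  "valid D \<longleftrightarrow> finite D \<and> (\<forall>eg\<in>D. fst eg \<subseteq> outer_nodes n \<and> fst eg \<noteq> {} \<and> snd eg \<in> carrier G)"

lemma valid_labels: "valid D \<Longrightarrow> labels_in G D" by (auto simp: valid_def labels_in_def)

lemma valid_sub: "valid D \<Longrightarrow> eg \<in> D \<Longrightarrow> fst eg \<subseteq> outer_nodes n" by (auto simp: valid_def)

lemma strip_place: "valid D \<Longrightarrow> place (map_prod (col a b c) id) D = strip a c D"
  unfolding strip_def by (rule place_cong[OF _ valid_sub]) (auto simp: outer_nodes_def col_def)

lemma strip_first: "valid D \<Longrightarrow> place (map_prod (col a b c) id) (first_half D) = strip a b D"
  unfolding strip_def first_half_place place_place
  by (rule place_cong[OF _ valid_sub]) (auto simp: outer_nodes_def col_def)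

lemma strip_second: "valid D \<Longrightarrow> place (map_prod (col a b c) id) (second_half D) = strip b c D"
  unfolding strip_def second_half_place place_place
  by (rule place_cong[OF _ valid_sub]) (auto simp: outer_nodes_def col_def)

lemma strip_labels: "valid D \<Longrightarrow> labels_in G (strip a c D)" unfolding strip_def using valid_labels by simp

lemma half_labels: "valid D \<Longrightarrow> labels_in G (first_half D)" "valid D \<Longrightarrow> labels_in G (second_half D)"
  unfolding first_half_place second_half_place using valid_labels by simp_all

lemma strip_edges: "valid D \<Longrightarrow> eg \<in> strip a c D \<Longrightarrow> fst eg \<subseteq> {a, c} \<times> {1..n} \<and> fst eg \<noteq> {} \<and> snd eg \<in> carrier G"
  unfolding strip_def place_mem valid_def by (fastforce simp: outer_nodes_def col_def)

lemma strip_finite: "valid D \<Longrightarrow> finite (strip a c D)" unfolding strip_def valid_def by (simp add: place_finite)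

lemma col_nodes:
  "map_prod (col a b c) id ` outer_nodes n = {a, c} \<times> {1..n}"
  "map_prod (col a b c) id ` all_nodes n = {a, b, c} \<times> {1..n}"
  by (force simp: outer_nodes_def all_nodes_def col_def image_iff)+

lemma valid_comp: assumes "valid D" "valid E" shows "valid (diagram_comp G n D E)"
  unfolding valid_def
proof (intro conjI ballI)
  show "finite (diagram_comp G n D E)"
    unfolding diagram_comp_alt outer_part_def by (simp add: comps_def all_nodes_def)
  fix eg assume "eg \<in> diagram_comp G n D E"
  then show "fst eg \<subseteq> outer_nodes n" "fst eg \<noteq> {}" "snd eg \<in> carrier G"
    unfolding diagram_comp_alt outer_part_def
    using label_closed[OF half_labels(1)[OF assms(1)]] label_closed[OF half_labels(2)[OF assms(2)]] by auto
qed

lemma strip_comp: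
  assumes D: "valid D" and E: "valid E" and "a \<noteq> b" "a \<noteq> c" "b \<noteq> c"
  shows "strip a c (diagram_comp G n D E)
    = outer_part G ({a, c} \<times> {1..n}) ({a, b, c} \<times> {1..n}) (strip a b D) (strip b c E)"
proof -
  have "strip a c (diagram_comp G n D E) = place (map_prod (col a b c) id) (diagram_comp G n D E)"
    by (rule strip_place[OF valid_comp[OF D E], symmetric])
  also have "\<dots> = outer_part G (map_prod (col a b c) id ` outer_nodes n) (map_prod (col a b c) id ` all_nodes n)
      (place (map_prod (col a b c) id) (first_half D)) (place (map_prod (col a b c) id) (second_half E))"
    unfolding diagram_comp_alt
    by (rule place_outer_part[OF col_inj[OF assms(3-5)] half_labels(1)[OF D] half_labels(2)[OF E]])
  finally show ?thesis unfolding col_nodes strip_first[OF D] strip_second[OF E] .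
qed

lemma strip_loop:
  assumes D: "valid D" and E: "valid E" and c: "a \<noteq> b" "a \<noteq> c" "b \<noteq> c"
    and k: "cring k" and w: "\<And>g. g \<in> carrier G \<Longrightarrow> act g \<delta> \<in> carrier k"
  shows "loop_factor G k act n \<delta> D E
    = loop_part G k (\<lambda>g. act g \<delta>) ({a, c} \<times> {1..n}) ({a, b, c} \<times> {1..n}) (strip a b D) (strip b c E)"
proof -
  have "loop_factor G k act n \<delta> D E = loop_part G k (\<lambda>g. act g \<delta>)
      (map_prod (col a b c) id ` outer_nodes n) (map_prod (col a b c) id ` all_nodes n)
      (place (map_prod (col a b c) id) (first_half D)) (place (map_prod (col a b c) id) (second_half E))"
    unfolding loop_factor_alt
    by (rule loop_part_place[OF k w col_inj[OF c] half_labels(1)[OF D] half_labels(2)[OF E], symmetric])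
  then show ?thesis unfolding col_nodes strip_first[OF D] strip_second[OF E] .
qed

lemma Int_empty_mono: "A \<subseteq> B \<Longrightarrow> B \<inter> C = {} \<Longrightarrow> A \<inter> C = {}" by blast

lemma contract:
  assumes D: "valid D" and E: "valid E" and F: "valid F" and i: "{a, b, c, i, j} = {0, 1, 2, 3}"
    and d: "a \<noteq> b" "a \<noteq> c" "b \<noteq> c" "b \<noteq> i" "b \<noteq> j"
  shows "contraction G (strip a b D) (strip b c E) (strip i j F) ({a, b, c} \<times> {1..n}) ({0, 1, 2, 3} \<times> {1..n}) ({b} \<times> {1..n})"
proof (unfold_locales)
  show "finite (strip a b D)" "finite (strip b c E)" by (rule strip_finite D E)+
  show "finite ({0, 1, 2, 3 :: nat} \<times> {1..n})" by simp
  have "{a, b, c} \<subseteq> {0, 1, 2, 3}" unfolding i[symmetric] by simp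
  then show "{a, b, c} \<times> {1..n} \<subseteq> {0, 1, 2, 3} \<times> {1..n}" by (rule Sigma_mono) simp
  show "{b} \<times> {1..n} \<subseteq> {a, b, c} \<times> {1..n}" by blast
  show "fst eg \<subseteq> {a, b, c} \<times> {1..n} \<and> fst eg \<noteq> {} \<and> snd eg \<in> carrier G" if "eg \<in> strip a b D \<union> strip b c E" for eg
    using that strip_edges[OF D, of eg a b] strip_edges[OF E, of eg b c] by blast
  show "fst eg \<inter> {b} \<times> {1..n} = {} \<and> fst eg \<subseteq> {0, 1, 2, 3} \<times> {1..n} \<and> fst eg \<noteq> {} \<and> snd eg \<in> carrier G"
    if "eg \<in> strip i j F" for eg
  proof -
    note e = strip_edges[OF F that]
    have "{i, j} \<subseteq> {0, 1, 2, 3}" unfolding i[symmetric] by simp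
    then have 1: "{i, j} \<times> {1..n} \<subseteq> {0, 1, 2, 3} \<times> {1..n}" by (rule Sigma_mono) simp
    have 2: "{i, j} \<times> {1..n} \<inter> {b} \<times> {1..n} = {}" using d(4,5) by auto
    have "fst eg \<subseteq> {0, 1, 2, 3} \<times> {1..n}" using e 1 by (meson order_trans)
    moreover have "fst eg \<inter> {b} \<times> {1..n} = {}"
      by (rule Int_empty_mono[OF conjunct1[OF e] 2])
    ultimately show ?thesis using e by simp
  qed
qed

text \<open>The three diagrams are placed side by side on four columns. \<open>L\<close> forgets
  column 1 first and \<open>R\<close> column 2 first, and both bracketings agree with one expression
  in the graph on all four columns, loops included. In \<open>R\<close> the diagram \<open>D\<close>
  is added last although it stands on the left, which commutativity of \<open>G\<close> permits.
  Injectivity of the placement undoes \<open>strip 0 3\<close> at the end.\<close>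

lemma associative:
  assumes D: "valid D" and E: "valid E" and F: "valid F"
  shows "diagram_comp G n (diagram_comp G n D E) F = diagram_comp G n D (diagram_comp G n E F)"
    and "cring k \<Longrightarrow> (\<And>g. g \<in> carrier G \<Longrightarrow> act g \<delta> \<in> carrier k) \<Longrightarrow>
      loop_factor G k act n \<delta> D E \<otimes>\<^bsub>k\<^esub> loop_factor G k act n \<delta> (diagram_comp G n D E) F
      = loop_factor G k act n \<delta> E F \<otimes>\<^bsub>k\<^esub> loop_factor G k act n \<delta> D (diagram_comp G n E F)"
proof -
  let ?N = "{1..n}"
  let ?X = "strip 0 1 D" and ?Y = "strip 1 2 E" and ?W = "strip 2 3 F"
  interpret L: contraction G ?X ?Y ?W "{0, 1, 2} \<times> ?N" "{0, 1, 2, 3} \<times> ?N" "{1} \<times> ?N"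
    by (rule contract[OF D E F]) auto
  interpret R: contraction G ?Y ?W ?X "{1, 2, 3} \<times> ?N" "{0, 1, 2, 3} \<times> ?N" "{2} \<times> ?N"
    by (rule contract[OF E F D]) auto
  have sets: "{0, 1, 2} \<times> ?N - {1} \<times> ?N = {0, 2 :: nat} \<times> ?N" "{1, 2, 3} \<times> ?N - {2} \<times> ?N = {1, 3 :: nat} \<times> ?N"
    "{0, 1, 2, 3} \<times> ?N - {1} \<times> ?N = {0, 2, 3 :: nat} \<times> ?N" "{0, 1, 2, 3} \<times> ?N - {2} \<times> ?N = {0, 1, 3 :: nat} \<times> ?N"
    by auto
  have Q: "({0, 3 :: nat} \<times> ?N) \<inter> ({1} \<times> ?N) = {}" "({0, 3 :: nat} \<times> ?N) \<inter> ({2} \<times> ?N) = {}" by auto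
  note lab = strip_labels[OF D] strip_labels[OF E] strip_labels[OF F]
  have ZL: "L.Z = strip 0 2 (diagram_comp G n D E)"
    using L.Z_outer_part strip_comp[OF D E, of 0 1 2] unfolding sets by simp
  have ZR: "R.Z = strip 1 3 (diagram_comp G n E F)"
    using R.Z_outer_part strip_comp[OF E F, of 1 2 3] unfolding sets by simp
  have un: "?Y \<union> ?W \<union> ?X = ?X \<union> ?Y \<union> ?W" by blast
  have lc: "label G ?Y C \<otimes> label G ?W C \<otimes> label G ?X C = label G ?X C \<otimes> label G ?Y C \<otimes> label G ?W C" for C
    using label_closed[OF lab(1)] label_closed[OF lab(2)] label_closed[OF lab(3)] by (simp add: m_ac)
  have "strip 0 3 (diagram_comp G n (diagram_comp G n D E) F) = outer_part G ({0, 3} \<times> ?N) ({0, 2, 3} \<times> ?N) L.Z ?W"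
    unfolding ZL by (rule strip_comp[OF valid_comp[OF D E] F]) auto
  also have "\<dots> = (\<lambda>C. (C \<inter> {0, 3} \<times> ?N, label G ?X C \<otimes> label G ?Y C \<otimes> label G ?W C)) `
      {C \<in> comps (?X \<union> ?Y \<union> ?W) ({0, 1, 2, 3} \<times> ?N). C \<inter> {0, 3} \<times> ?N \<noteq> {}}"
    by (rule L.outer_part_Z[OF Q(1), unfolded sets])
  also have "\<dots> = outer_part G ({0, 3} \<times> ?N) ({0, 1, 3} \<times> ?N) R.Z ?X"
    unfolding R.outer_part_Z[OF Q(2), unfolded sets un lc] ..
  also have "\<dots> = outer_part G ({0, 3} \<times> ?N) ({0, 1, 3} \<times> ?N) ?X R.Z"
    by (rule outer_part_commute[OF R.Z_labels lab(1)])
  also have "\<dots> = strip 0 3 (diagram_comp G n D (diagram_comp G n E F))"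
    unfolding ZR by (rule strip_comp[OF D valid_comp[OF E F], symmetric]) auto
  finally have "place (map_prod (col 0 1 3) id) (diagram_comp G n (diagram_comp G n D E) F)
      = place (map_prod (col 0 1 3) id) (diagram_comp G n D (diagram_comp G n E F))"
    unfolding strip_place[OF valid_comp[OF valid_comp[OF D E] F]] strip_place[OF valid_comp[OF D valid_comp[OF E F]]] .
  then show "diagram_comp G n (diagram_comp G n D E) F = diagram_comp G n D (diagram_comp G n E F)"
    by (rule place_inj[OF col_inj, rotated 3]) auto
  assume k: "cring k" and w: "\<And>g. g \<in> carrier G \<Longrightarrow> act g \<delta> \<in> carrier k"
  have l1: "loop_factor G k act n \<delta> D E = loop_part G k (\<lambda>g. act g \<delta>) ({0, 2} \<times> ?N) ({0, 1, 2} \<times> ?N) ?X ?Y"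
    by (rule strip_loop[where act = act and \<delta> = \<delta>, OF D E _ _ _ k w]) auto
  have l2: "loop_factor G k act n \<delta> (diagram_comp G n D E) F
      = loop_part G k (\<lambda>g. act g \<delta>) ({0, 3} \<times> ?N) ({0, 2, 3} \<times> ?N) L.Z ?W"
    unfolding ZL by (rule strip_loop[where act = act and \<delta> = \<delta>, OF valid_comp[OF D E] F _ _ _ k w]) auto
  have l3: "loop_factor G k act n \<delta> E F = loop_part G k (\<lambda>g. act g \<delta>) ({1, 3} \<times> ?N) ({1, 2, 3} \<times> ?N) ?Y ?W"
    by (rule strip_loop[where act = act and \<delta> = \<delta>, OF E F _ _ _ k w]) auto
  have l4: "loop_factor G k act n \<delta> D (diagram_comp G n E F)
      = loop_part G k (\<lambda>g. act g \<delta>) ({0, 3} \<times> ?N) ({0, 1, 3} \<times> ?N) R.Z ?X"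
    unfolding loop_part_commute[OF R.Z_labels lab(1), of k] unfolding ZR by (rule strip_loop[where act = act and \<delta> = \<delta>, OF D valid_comp[OF E F] _ _ _ k w]) auto
  show "loop_factor G k act n \<delta> D E \<otimes>\<^bsub>k\<^esub> loop_factor G k act n \<delta> (diagram_comp G n D E) F
      = loop_factor G k act n \<delta> E F \<otimes>\<^bsub>k\<^esub> loop_factor G k act n \<delta> D (diagram_comp G n E F)"
    unfolding l1 l2 l3 l4
    using L.loop_part_Z[where w = "\<lambda>g. act g \<delta>", OF k w Q(1), unfolded sets] R.loop_part_Z[where w = "\<lambda>g. act g \<delta>", OF k w Q(2), unfolded sets un lc]
    by simp
qed

end

section \<open>Perfect matchings\<close>

definition matching :: "'v set \<Rightarrow> ('v set \<times> 'g) set \<Rightarrow> bool" where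
  "matching V E \<longleftrightarrow> (\<forall>eg\<in>E. fst eg \<subseteq> V \<and> card (fst eg) = 2) \<and> (\<forall>v\<in>V. \<exists>!eg. eg \<in> E \<and> v \<in> fst eg)"

lemma matching_sub: "matching V E \<Longrightarrow> eg \<in> E \<Longrightarrow> fst eg \<subseteq> V"
  and matching_card: "matching V E \<Longrightarrow> eg \<in> E \<Longrightarrow> card (fst eg) = 2"
  by (simp_all add: matching_def)

lemma matching_unique:
  assumes "matching V E" "eg \<in> E" "eg' \<in> E" "v \<in> fst eg" "v \<in> fst eg'" shows "eg = eg'"
proof -
  have "v \<in> V" using matching_sub[OF assms(1,2)] assms(4) by blast
  then have "\<exists>!eg. eg \<in> E \<and> v \<in> fst eg" using assms(1) by (simp add: matching_def)
  then show ?thesis using assms(2-5) by (elim ex1E) metis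
qed

lemma matching_edge:
  assumes "matching V E" "v \<in> V" obtains eg where "eg \<in> E" "v \<in> fst eg"
  using assms unfolding matching_def by blast

lemma matching_nonempty: "matching V E \<Longrightarrow> eg \<in> E \<Longrightarrow> fst eg \<noteq> {}"
  using matching_card[of V E eg] by auto

lemma matching_edge_finite: "matching V E \<Longrightarrow> eg \<in> E \<Longrightarrow> finite (fst eg)"
  using matching_card[of V E eg] by (intro card_ge_0_finite) simp

lemma matching_finite:
  assumes "matching V E" "finite V" shows "finite E"
proof (rule inj_on_finite[of fst _ "Pow V"])
  show "inj_on fst E"
  proof (rule inj_onI)
    fix x y assume xy: "x \<in> E" "y \<in> E" "fst x = fst y"
    then obtain v where "v \<in> fst x" using matching_nonempty[OF assms(1)] by blast
    then show "x = y" using matching_unique[OF assms(1) xy(1,2)] xy(3) by simp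
  qed
  show "fst ` E \<subseteq> Pow V" using matching_sub[OF assms(1)] by blast
  show "finite (Pow V)" using assms(2) by simp
qed

text \<open>Every node already has its edge in the smaller matching. Consequently two diagrams are
  equal as soon as one contains the other, which is how all composites below are computed.\<close>

lemma matching_subset_eq:
  assumes "matching V D" "matching V E" "D \<subseteq> E" shows "D = E"
proof
  show "E \<subseteq> D"
  proof
    fix eg assume eg: "eg \<in> E"
    then obtain v where v: "v \<in> fst eg" using matching_nonempty[OF assms(2)] by blast
    then have "v \<in> V" using matching_sub[OF assms(2) eg] by blast
    then obtain eg' where eg': "eg' \<in> D" "v \<in> fst eg'" by (rule matching_edge[OF assms(1)])
    have "eg = eg'" by (rule matching_unique[OF assms(2) eg _ v eg'(2)]) (use eg' assms(3) in blast)
    then show "eg \<in> D" using eg'(1) by simp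
  qed
qed (rule assms(3))

lemma matching_count:
  assumes E: "matching V E" "finite V" and W: "W \<subseteq> V"
  shows "card W = (\<Sum>eg\<in>E. card (fst eg \<inter> W))"
proof -
  have "W \<subseteq> (\<Union>eg\<in>E. fst eg)"
  proof
    fix v assume "v \<in> W"
    then have "v \<in> V" using W by blast
    then obtain eg where "eg \<in> E" "v \<in> fst eg" by (rule matching_edge[OF E(1)])
    then show "v \<in> (\<Union>eg\<in>E. fst eg)" by blast
  qed
  then have "W = (\<Union>eg\<in>E. fst eg \<inter> W)" by blast
  then have "card W = card (\<Union>eg\<in>E. fst eg \<inter> W)" by simp
  also have "\<dots> = (\<Sum>eg\<in>E. card (fst eg \<inter> W))"
  proof (rule card_UN_disjoint)
    show "finite E" by (rule matching_finite[OF E])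
    show "\<forall>eg\<in>E. finite (fst eg \<inter> W)" using matching_edge_finite[OF E(1)] by simp
    show "\<forall>eg\<in>E. \<forall>eg'\<in>E. eg \<noteq> eg' \<longrightarrow> fst eg \<inter> W \<inter> (fst eg' \<inter> W) = {}"
    proof (intro ballI impI equals0I)
      fix eg eg' v assume "eg \<in> E" "eg' \<in> E" "eg \<noteq> eg'" "v \<in> fst eg \<inter> W \<inter> (fst eg' \<inter> W)"
      then show False using matching_unique[OF E(1), of eg eg' v] by simp
    qed
  qed
  finally show ?thesis .
qed

text \<open>An edge meets \<open>C\<close> in both ends or in none, so the nodes of \<open>C\<close>
  in \<open>V\<close> are counted twice by the edges inside.\<close>

lemma matching_closed_card:
  assumes E: "matching V E" "finite V"
    and C: "\<And>eg. eg \<in> E \<Longrightarrow> fst eg \<inter> C \<noteq> {} \<Longrightarrow> fst eg \<subseteq> C"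
  shows "card (C \<inter> V) = 2 * card {eg \<in> E. fst eg \<subseteq> C}"
proof -
  have fin: "finite E" by (rule matching_finite[OF E])
  have "card (C \<inter> V) = (\<Sum>eg\<in>E. card (fst eg \<inter> (C \<inter> V)))" by (rule matching_count[OF E]) blast
  also have "\<dots> = (\<Sum>eg\<in>E. if fst eg \<subseteq> C then 2 else 0)"
  proof (rule sum.cong[OF refl])
    fix eg assume eg: "eg \<in> E"
    have "fst eg \<inter> (C \<inter> V) = (if fst eg \<subseteq> C then fst eg else {})"
      using C[OF eg] matching_sub[OF E(1) eg] by auto
    then show "card (fst eg \<inter> (C \<inter> V)) = (if fst eg \<subseteq> C then 2 else 0)" using matching_card[OF E(1) eg] by simp
  qed
  also have "\<dots> = 2 * card {eg \<in> E. fst eg \<subseteq> C}" using fin by (simp add: sum.If_cases Int_def)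
  finally show ?thesis .
qed

lemma matching_place:
  assumes \<sigma>: "inj \<sigma>" and E: "matching V E" shows "matching (\<sigma> ` V) (place \<sigma> E)"
  unfolding matching_def
proof (intro conjI ballI)
  fix eg assume "eg \<in> place \<sigma> E"
  then obtain e g where e: "(e, g) \<in> E" "eg = (\<sigma> ` e, g)" by (auto simp: place_mem)
  show "fst eg \<subseteq> \<sigma> ` V" using matching_sub[OF E e(1)] e(2) by auto
  show "card (fst eg) = 2" using matching_card[OF E e(1)] e(2) card_image[OF inj_on_subset[OF \<sigma> subset_UNIV], of e] by simp
next
  fix v assume "v \<in> \<sigma> ` V"
  then obtain w where w: "w \<in> V" "v = \<sigma> w" by blast
  from w(1) obtain eg where eg: "eg \<in> E" "w \<in> fst eg" by (rule matching_edge[OF E])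
  show "\<exists>!eg. eg \<in> place \<sigma> E \<and> v \<in> fst eg"
  proof (rule ex1I[of _ "(\<sigma> ` fst eg, snd eg)"])
    show "(\<sigma> ` fst eg, snd eg) \<in> place \<sigma> E \<and> v \<in> fst (\<sigma> ` fst eg, snd eg)"
      unfolding place_mem using eg(2) w(2) by (auto intro!: exI[of _ "fst eg"] exI[of _ "snd eg"] simp: eg(1))
    fix eg' assume eg': "eg' \<in> place \<sigma> E \<and> v \<in> fst eg'"
    then obtain e g where e: "(e, g) \<in> E" "eg' = (\<sigma> ` e, g)" by (auto simp: place_mem)
    then have "w \<in> e" using eg' w(2) \<sigma> by (auto dest: injD)
    then have "(e, g) = eg" using matching_unique[OF E e(1) eg(1), of w] eg(2) by simp
    then show "eg' = (\<sigma> ` fst eg, snd eg)" using e(2) by auto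
  qed
qed

text \<open>Growing a connected set one edge at a time shows that a connected graph with \<open>m\<close> edges has at most
  \<open>m + 1\<close> nodes.\<close>

lemma component_card:
  assumes fin: "finite E" "finite (component E v)" and E: "\<And>eg. eg \<in> E \<Longrightarrow> card (fst eg) = 2"
  shows "card (component E v) \<le> card {eg \<in> E. fst eg \<subseteq> component E v} + 1"
proof -
  let ?C = "component E v"
  let ?T = "{S. S \<subseteq> ?C \<and> v \<in> S \<and> card S \<le> card {eg \<in> E. fst eg \<subseteq> S} + 1}"
  have "finite ?T" by (rule finite_subset[of _ "Pow ?C"]) (use fin in auto)
  moreover have "{v} \<in> ?T" using component_self[of v E] by simp
  \<comment> \<open>By finiteness some set is maximal for the edge bound. An edge leaving it would
    add one node and at least one edge, so it must be the whole component.\<close>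
  ultimately have "\<exists>S\<in>?T. {v} \<subseteq> S \<and> (\<forall>S'\<in>?T. S \<subseteq> S' \<longrightarrow> S = S')" by (rule finite_has_maximal2)
  then obtain S where S: "S \<in> ?T" and mx: "\<forall>S'\<in>?T. S \<subseteq> S' \<longrightarrow> S = S'" by (elim bexE conjE)
  have fS: "finite S" using S fin(2) finite_subset by blast
  have "?C \<subseteq> S"
  proof (rule component_closed)
    show "v \<in> S" using S by blast
    fix eg assume eg: "eg \<in> E" "fst eg \<inter> S \<noteq> {}"
    show "fst eg \<subseteq> S"
    proof (rule ccontr)
      assume "\<not> fst eg \<subseteq> S"
      then obtain x y where xy: "x \<in> fst eg" "x \<in> S" "y \<in> fst eg" "y \<notin> S" using eg(2) by blast
      have "fst eg = {x, y}"
      proof (rule card_subset_eq[symmetric])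
        show "finite (fst eg)" using E[OF eg(1)] by (intro card_ge_0_finite) simp
        show "{x, y} \<subseteq> fst eg" using xy by simp
        have "x \<noteq> y" using xy by blast
        then show "card {x, y} = card (fst eg)" using E[OF eg(1)] by simp
      qed
      then have sub: "fst eg \<subseteq> insert y S" using xy by auto
      have "x \<in> ?C" using S xy(2) by blast
      then have yC: "y \<in> ?C" using edge_component[OF eg(1) xy(1)] xy(3) by blast
      have "card (insert eg {eg \<in> E. fst eg \<subseteq> S}) \<le> card {eg \<in> E. fst eg \<subseteq> insert y S}"
        by (rule card_mono) (use fin(1) sub eg(1) in auto)
      moreover have "card (insert eg {eg \<in> E. fst eg \<subseteq> S}) = card {eg \<in> E. fst eg \<subseteq> S} + 1"
        using fin(1) xy by (subst card_insert_disjoint) auto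
      moreover have "card (insert y S) = card S + 1" using fS xy(4) by simp
      ultimately have "insert y S \<in> ?T" using S yC by simp
      then have "S = insert y S" using mx by (meson subset_insertI)
      then show False using xy(4) by blast
    qed
  qed
  then have "?C = S" using S by blast
  then show ?thesis using S by simp
qed

section \<open>Composites of diagrams are perfect matchings\<close>

context diagrams
begin

abbreviation "BD \<equiv> brauer_diagrams G n"
abbreviation "V0 \<equiv> outer_nodes n"

lemma brauer_iff: "D \<in> BD \<longleftrightarrow> matching V0 D \<and> (\<forall>eg\<in>D. snd eg \<in> carrier G)"
  unfolding brauer_diagrams_def matching_def by (auto simp: case_prod_beta)

lemma outer_finite: "finite V0" by (simp add: outer_nodes_def)

lemma brauer_matching: "D \<in> BD \<Longrightarrow> matching V0 D" by (simp add: brauer_iff)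
lemma brauer_label: "D \<in> BD \<Longrightarrow> eg \<in> D \<Longrightarrow> snd eg \<in> carrier G" by (simp add: brauer_iff)

lemma brauer_valid: assumes "D \<in> BD" shows "valid D"
proof -
  note m = brauer_matching[OF assms]
  show ?thesis unfolding valid_def
    using matching_finite[OF m outer_finite] matching_sub[OF m] matching_nonempty[OF m] brauer_label[OF assms] by blast
qed

abbreviation "VL \<equiv> {Lft, Mid} \<times> {1..n}"
abbreviation "VR \<equiv> {Mid, Rgt} \<times> {1..n}"

lemma first_matching: assumes "D \<in> BD" shows "matching VL (first_half D)"
proof -
  \<comment> \<open>On outer nodes the transposition does the same as sending the right column to
    the middle, but it is injective on all nodes, as \<open>matching_place\<close> requires.\<close>
  let ?\<sigma> = "map_prod (transpose Mid Rgt) id :: node \<Rightarrow> node"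
  have i: "inj ?\<sigma>" by (rule prod.inj_map) simp_all
  have "first_half D = place ?\<sigma> D" unfolding first_half_place
    by (rule place_cong[OF _ valid_sub[OF brauer_valid[OF assms]]]) (auto simp: outer_nodes_def transpose_def)
  moreover have "?\<sigma> ` V0 = VL" by (force simp: outer_nodes_def transpose_def image_iff)
  ultimately show ?thesis using matching_place[OF i brauer_matching[OF assms]] by simp
qed

lemma second_matching: assumes "D \<in> BD" shows "matching VR (second_half D)"
proof -
  let ?\<sigma> = "map_prod (transpose Mid Lft) id :: node \<Rightarrow> node"
  have i: "inj ?\<sigma>" by (rule prod.inj_map) simp_all
  have "second_half D = place ?\<sigma> D" unfolding second_half_place
    by (rule place_cong[OF _ valid_sub[OF brauer_valid[OF assms]]]) (auto simp: outer_nodes_def transpose_def)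
  moreover have "?\<sigma> ` V0 = VR" by (force simp: outer_nodes_def transpose_def image_iff)
  ultimately show ?thesis using matching_place[OF i brauer_matching[OF assms]] by simp
qed

abbreviation "joint D E \<equiv> first_half D \<union> second_half E"

lemma joint_edges:
  assumes "D \<in> BD" "E \<in> BD" "eg \<in> joint D E" shows "fst eg \<subseteq> all_nodes n" "card (fst eg) = 2" "fst eg \<noteq> {}"
proof -
  note m = first_matching[OF assms(1)] second_matching[OF assms(2)]
  have "fst eg \<subseteq> VL \<or> fst eg \<subseteq> VR" using assms(3) matching_sub[OF m(1)] matching_sub[OF m(2)] by blast
  then show "fst eg \<subseteq> all_nodes n" unfolding all_nodes_def by blast
  show "card (fst eg) = 2" using assms(3) matching_card[OF m(1)] matching_card[OF m(2)] by blast
  then show "fst eg \<noteq> {}" by auto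
qed

lemma joint_component_sub:
  assumes "D \<in> BD" "E \<in> BD" "v \<in> all_nodes n" shows "component (joint D E) v \<subseteq> all_nodes n"
  by (rule component_sub[OF assms(3) joint_edges(1)[OF assms(1,2)]])

text \<open>A count replaces the description of components as paths. Let \<open>C\<close> have
  \<open>l\<close>, \<open>m\<close>, \<open>r\<close> nodes in the three columns and
  \<open>a\<close>, \<open>b\<close> edges from the two halves. Matching gives
  \<open>l + m = 2 a\<close> and \<open>m + r = 2 b\<close>, so \<open>l + r\<close> is even;
  connectedness gives \<open>l + m + r \<le> a + b + 1\<close>, so
  \<open>l + r \<le> 2\<close>.\<close>

lemma outer_ends:
  assumes D: "D \<in> BD" and E: "E \<in> BD" and C: "C = component (joint D E) v" "v \<in> all_nodes n" "C \<inter> V0 \<noteq> {}"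
  shows "card (C \<inter> V0) = 2"
proof -
  note mD = first_matching[OF D] and mE = second_matching[OF E]
  have fin: "finite VL" "finite VR" "finite (all_nodes n)" by (simp_all add: all_nodes_def)
  have Cs: "C \<subseteq> all_nodes n" unfolding C(1) by (rule joint_component_sub[OF D E C(2)])
  have fC: "finite C" by (rule finite_subset[OF Cs fin(3)])
  have fA: "finite (first_half D)" and fB: "finite (second_half E)"
    using matching_finite[OF mD fin(1)] matching_finite[OF mE fin(2)] .
  let ?a = "card {eg \<in> first_half D. fst eg \<subseteq> C}" and ?b = "card {eg \<in> second_half E. fst eg \<subseteq> C}"
  have closed: "fst eg \<subseteq> C" if "eg \<in> joint D E" "fst eg \<inter> C \<noteq> {}" for eg
    using edge_component[OF that(1), of _ v] that(2) unfolding C(1) by blast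
  have a: "card (C \<inter> VL) = 2 * ?a" by (rule matching_closed_card[OF mD fin(1) closed]) blast
  have b: "card (C \<inter> VR) = 2 * ?b" by (rule matching_closed_card[OF mE fin(2) closed]) blast
  have "card C \<le> card {eg \<in> joint D E. fst eg \<subseteq> C} + 1"
    unfolding C(1) by (rule component_card) (use fA fB fC C(1) joint_edges(2)[OF D E] in auto)
  also have "card {eg \<in> joint D E. fst eg \<subseteq> C} \<le> ?a + ?b"
    by (rule order_trans[OF card_mono card_Un_le]) (use fA fB in auto)
  finally have c: "card C \<le> ?a + ?b + 1" by simp
  let ?l = "card (C \<inter> {Lft} \<times> {1..n})" and ?m = "card (C \<inter> {Mid} \<times> {1..n})" and ?r = "card (C \<inter> {Rgt} \<times> {1..n})"
  have l: "card (C \<inter> VL) = ?l + ?m"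
    by (subst card_Un_disjoint[symmetric]) (use fC in \<open>auto intro!: arg_cong[of _ _ card]\<close>)
  have r: "card (C \<inter> VR) = ?m + ?r"
    by (subst card_Un_disjoint[symmetric]) (use fC in \<open>auto intro!: arg_cong[of _ _ card]\<close>)
  have o: "card (C \<inter> V0) = ?l + ?r"
    by (subst card_Un_disjoint[symmetric]) (use fC in \<open>auto simp: outer_nodes_def intro!: arg_cong[of _ _ card]\<close>)
  have t: "card C = card (C \<inter> V0) + ?m"
    by (subst card_Un_disjoint[symmetric]) (use fC Cs in \<open>auto simp: outer_nodes_def all_nodes_def intro!: arg_cong[of _ _ card]\<close>)
  have pos: "0 < card (C \<inter> V0)" using C(3) fC by (simp add: card_gt_0_iff)
  have num: "L + R = 2" if "L + M = 2 * A" "M + R = 2 * B" "L + R + M \<le> A + B + 1" "0 < L + R" for L M R A B :: nat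
  proof -
    define q where "q = A + B - M"
    have q: "L + R = 2 * q" unfolding q_def using that(1,2) by (simp add: diff_mult_distrib2)
    moreover have "L + R \<le> 2" using that(1-3) by linarith
    ultimately have "q = 1" using that(4) by linarith
    then show ?thesis using q by simp
  qed
  show ?thesis unfolding o by (rule num[OF a[unfolded l] b[unfolded r] c[unfolded t o] pos[unfolded o]])
qed

lemma comp_mem_iff:
  "eg \<in> diagram_comp G n D E \<longleftrightarrow> (\<exists>v\<in>all_nodes n. component (joint D E) v \<inter> V0 \<noteq> {} \<and>
     eg = (component (joint D E) v \<inter> V0,
       label G (first_half D) (component (joint D E) v) \<otimes> label G (second_half E) (component (joint D E) v)))"
  unfolding diagram_comp_alt outer_part_def comps_def by blast

lemma comp_closed: assumes D: "D \<in> BD" and E: "E \<in> BD" shows "diagram_comp G n D E \<in> BD"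
  unfolding brauer_iff
proof
  note vc = valid_comp[OF brauer_valid[OF D] brauer_valid[OF E]]
  then show "\<forall>eg\<in>diagram_comp G n D E. snd eg \<in> carrier G" unfolding valid_def by blast
  show "matching V0 (diagram_comp G n D E)"
    unfolding matching_def
  proof (intro conjI ballI)
    fix eg assume eg: "eg \<in> diagram_comp G n D E"
    then show "fst eg \<subseteq> V0" by (rule valid_sub[OF vc])
    from eg obtain v where v: "v \<in> all_nodes n" "component (joint D E) v \<inter> V0 \<noteq> {}"
      "fst eg = component (joint D E) v \<inter> V0" unfolding comp_mem_iff by (metis fst_conv)
    show "card (fst eg) = 2" unfolding v(3) by (rule outer_ends[OF D E refl v(1,2)])
  next
    fix v assume v: "v \<in> V0"
    then have va: "v \<in> all_nodes n" by (auto simp: outer_nodes_def all_nodes_def)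
    let ?C = "component (joint D E) v"
    let ?eg = "(?C \<inter> V0, label G (first_half D) ?C \<otimes> label G (second_half E) ?C)"
    show "\<exists>!eg. eg \<in> diagram_comp G n D E \<and> v \<in> fst eg"
    proof (rule ex1I[of _ ?eg])
      have "v \<in> ?C \<inter> V0" using v component_self[of v "joint D E"] by simp
      then show "?eg \<in> diagram_comp G n D E \<and> v \<in> fst ?eg" unfolding comp_mem_iff using va by auto
      fix eg assume eg: "eg \<in> diagram_comp G n D E \<and> v \<in> fst eg"
      then obtain w where w: "eg = (component (joint D E) w \<inter> V0,
          label G (first_half D) (component (joint D E) w) \<otimes> label G (second_half E) (component (joint D E) w))"
        unfolding comp_mem_iff by blast
      then have "v \<in> component (joint D E) w" using eg by simp
      then have "component (joint D E) v = component (joint D E) w" by (rule component_eq)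
      then show "eg = ?eg" unfolding w by (simp only:)
    qed
  qed
qed

end

section \<open>Turns\<close>

definition turns :: "column \<Rightarrow> 'g diagram \<Rightarrow> 'g diagram" where
  "turns c D = {eg \<in> D. fst ` fst eg \<subseteq> {c}}"

lemma no_turns_iff: "no_turns D \<longleftrightarrow> turns Lft D = {} \<and> turns Rgt D = {}"
  unfolding no_turns_def turns_def case_prod_beta by blast

context diagrams
begin

lemma label_one:
  assumes "\<And>eg. eg \<in> E \<Longrightarrow> fst eg \<subseteq> C \<Longrightarrow> snd eg = \<one>" shows "label G E C = \<one>"
  unfolding label_def by (rule finprod_one_eqI) (use assms in simp)

lemma label_empty: "(\<And>eg. eg \<in> E \<Longrightarrow> \<not> fst eg \<subseteq> C) \<Longrightarrow> label G E C = \<one>"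
  by (rule label_one) blast

lemma label_single:
  assumes "eg \<in> E" "fst eg \<subseteq> C" "\<And>eg'. eg' \<in> E \<Longrightarrow> fst eg' \<subseteq> C \<Longrightarrow> eg' = eg" "snd eg \<in> carrier G"
  shows "label G E C = snd eg"
proof -
  have "{eg \<in> E. fst eg \<subseteq> C} = {eg}" using assms(1-3) by blast
  then show ?thesis unfolding label_def using assms(4) by simp
qed

text \<open>A connected set that no edge leaves is a component. This is how single edges of
  composites are exhibited.\<close>

lemma comp_edgeI:
  assumes v: "v \<in> C" "v \<in> all_nodes n"
    and closed: "\<And>eg. eg \<in> joint D E \<Longrightarrow> fst eg \<inter> C \<noteq> {} \<Longrightarrow> fst eg \<subseteq> C"
    and conn: "C \<subseteq> component (joint D E) v"
    and C: "C \<inter> V0 = e" "e \<noteq> {}" and g: "label G (first_half D) C \<otimes> label G (second_half E) C = g"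
  shows "(e, g) \<in> diagram_comp G n D E"
proof -
  have "component (joint D E) v = C" using component_closed[OF v(1) closed] conn by (rule subset_antisym)
  then show ?thesis unfolding comp_mem_iff using v(2) C g by (intro bexI[of _ v]) simp_all
qed

lemma turns_sub: "turns c D \<subseteq> D" by (auto simp: turns_def)

lemma turns_nodes: "D \<in> BD \<Longrightarrow> eg \<in> turns c D \<Longrightarrow> fst eg \<subseteq> {c} \<times> {1..n}"
  using matching_sub[OF brauer_matching, of D eg] by (fastforce simp: turns_def outer_nodes_def)

lemma half_image:
  "(e, g) \<in> D \<Longrightarrow> (map_prod (id(Rgt := Mid)) id ` e, g) \<in> first_half D"
  "(e, g) \<in> D \<Longrightarrow> (map_prod (id(Lft := Mid)) id ` e, g) \<in> second_half D"
  unfolding first_half_place second_half_place place_mem by blast+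

text \<open>A right-hand turn of \<open>E\<close> does not touch the middle column, so it is a whole
  component of the joined graph and survives with its label.\<close>

lemma turn_persists_right:
  assumes D: "D \<in> BD" and E: "E \<in> BD" shows "turns Rgt E \<subseteq> turns Rgt (diagram_comp G n D E)"
proof
  fix eg assume t: "eg \<in> turns Rgt E"
  obtain e g where eg: "eg = (e, g)" by (cases eg)
  note mE = second_matching[OF E] and mD = first_matching[OF D]
  have eE: "(e, g) \<in> E" using t eg by (simp add: turns_def)
  have sub: "e \<subseteq> {Rgt} \<times> {1..n}" using turns_nodes[OF E t] eg by simp
  have e2: "map_prod (id(Lft := Mid)) id ` e = e"
  proof -
    have "map_prod (id(Lft := Mid)) id ` e = id ` e" by (rule image_cong) (use sub in auto)
    then show ?thesis by simp
  qed
  have h: "(e, g) \<in> second_half E" using half_image(2)[OF eE] e2 by simp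
  obtain v where v: "v \<in> e" using matching_nonempty[OF mE h] by auto
  have D_off: "fst eg' \<inter> e = {}" if "eg' \<in> first_half D" for eg'
    using matching_sub[OF mD that] sub by auto
  have only: "eg' = (e, g)" if "eg' \<in> second_half E" "fst eg' \<inter> e \<noteq> {}" for eg'
    using matching_unique[OF mE that(1) h] that(2) by auto
  have "(e, g) \<in> diagram_comp G n D E"
  proof (rule comp_edgeI[OF v])
    show "v \<in> all_nodes n" using v sub by (auto simp: all_nodes_def)
    show "fst eg' \<subseteq> e" if "eg' \<in> joint D E" "fst eg' \<inter> e \<noteq> {}" for eg'
      using that D_off[of eg'] only[of eg'] by auto
    show "e \<subseteq> component (joint D E) v"
      using edge_component[of "(e, g)" "joint D E" v v] h v component_self[of v "joint D E"] by simp
    show "e \<inter> V0 = e" using sub by (auto simp: outer_nodes_def)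
    show "e \<noteq> {}" using v by blast
    have "label G (first_half D) e = \<one>"
      by (rule label_empty) (use D_off matching_nonempty[OF mD] in blast)
    moreover have "label G (second_half E) e = snd (e, g)"
    proof (rule label_single[OF h])
      show "eg' = (e, g)" if "eg' \<in> second_half E" "fst eg' \<subseteq> e" for eg'
        using only[OF that(1)] that(2) matching_nonempty[OF mE that(1)] by blast
    qed (use brauer_label[OF E eE] in simp_all)
    ultimately show "label G (first_half D) e \<otimes> label G (second_half E) e = g"
      using brauer_label[OF E eE] by simp
  qed
  then show "eg \<in> turns Rgt (diagram_comp G n D E)" using eg t by (simp add: turns_def)
qed

text \<open>Reflection that exchanges the outer columns and keeps the labels. It reverses
  composition, because \<open>G\<close> is commutative, and carries facts about right-hand turns
  over to left-hand turns.\<close>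

definition flip :: "'g diagram \<Rightarrow> 'g diagram" where
  "flip D = place (map_prod (transpose Lft Rgt) id) D"

lemma flip_inj: "inj (map_prod (transpose Lft Rgt) id :: node \<Rightarrow> node)"
  by (rule prod.inj_map) simp_all

lemma flip_nodes:
  "map_prod (transpose Lft Rgt) id ` V0 = V0" "map_prod (transpose Lft Rgt) id ` all_nodes n = all_nodes n"
  by (force simp: outer_nodes_def all_nodes_def transpose_def image_iff)+

lemma flip_flip: "flip (flip D) = D"
proof -
  have "map_prod (transpose Lft Rgt) id \<circ> map_prod (transpose Lft Rgt) id = (id :: node \<Rightarrow> node)"
    by (rule ext) (auto simp: transpose_def)
  then show ?thesis unfolding flip_def place_place by (simp add: place_def)
qed

lemma flip_closed: assumes "D \<in> BD" shows "flip D \<in> BD"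
proof -
  have "labels_in G (flip D)" unfolding flip_def using valid_labels[OF brauer_valid[OF assms]] by simp
  then show ?thesis unfolding brauer_iff labels_in_def
    using matching_place[OF flip_inj brauer_matching[OF assms]] unfolding flip_nodes flip_def by blast
qed

lemma flip_halves:
  assumes "D \<in> BD"
  shows "place (map_prod (transpose Lft Rgt) id) (first_half D) = second_half (flip D)"
    and "place (map_prod (transpose Lft Rgt) id) (second_half D) = first_half (flip D)"
proof -
  note c = place_cong[OF _ valid_sub[OF brauer_valid[OF assms]]]
  show "place (map_prod (transpose Lft Rgt) id) (first_half D) = second_half (flip D)"
    unfolding first_half_place second_half_place flip_def place_place
    by (rule c) (auto simp: outer_nodes_def transpose_def)
  show "place (map_prod (transpose Lft Rgt) id) (second_half D) = first_half (flip D)"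
    unfolding first_half_place second_half_place flip_def place_place
    by (rule c) (auto simp: outer_nodes_def transpose_def)
qed

lemma flip_comp:
  assumes D: "D \<in> BD" and E: "E \<in> BD"
  shows "flip (diagram_comp G n D E) = diagram_comp G n (flip E) (flip D)"
proof -
  note l = half_labels(1)[OF brauer_valid[OF D]] half_labels(2)[OF brauer_valid[OF E]]
    half_labels(2)[OF brauer_valid[OF flip_closed[OF D]]] half_labels(1)[OF brauer_valid[OF flip_closed[OF E]]]
  have "flip (diagram_comp G n D E) = outer_part G V0 (all_nodes n) (second_half (flip D)) (first_half (flip E))"
    using place_outer_part[OF flip_inj l(1,2), of V0 "all_nodes n"]
    unfolding flip_nodes flip_halves(1)[OF D] flip_halves(2)[OF E] diagram_comp_alt[symmetric]
    unfolding flip_def[symmetric] .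
  then show ?thesis unfolding diagram_comp_alt[of G n "flip E"] outer_part_commute[OF l(3,4)] .
qed

lemma flip_turns: "turns Rgt (flip D) = flip (turns Lft D)"
proof -
  have t: "fst ` map_prod (transpose Lft Rgt) id ` e \<subseteq> {Rgt} \<longleftrightarrow> fst ` e \<subseteq> {Lft}" for e :: "node set"
  proof -
    have "transpose Lft Rgt a = Rgt \<longleftrightarrow> a = Lft" for a by (auto simp: transpose_def)
    then show ?thesis by (simp add: image_subset_iff)
  qed
  let ?f = "\<lambda>eg. (map_prod (transpose Lft Rgt) id ` fst eg, snd eg)"
  have "{eg \<in> ?f ` D. fst ` fst eg \<subseteq> {Rgt}} = ?f ` {eg \<in> D. fst ` fst (?f eg) \<subseteq> {Rgt}}" by blast
  then show ?thesis unfolding turns_def flip_def place_def case_prod_beta fst_conv t .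
qed

lemma turn_persists_left:
  assumes D: "D \<in> BD" and E: "E \<in> BD" shows "turns Lft D = {} \<or> turns Lft (diagram_comp G n D E) \<noteq> {}"
proof -
  have "turns Rgt (flip D) \<subseteq> turns Rgt (flip (diagram_comp G n D E))"
    unfolding flip_comp[OF D E] by (rule turn_persists_right[OF flip_closed[OF E] flip_closed[OF D]])
  then show ?thesis unfolding flip_turns by (auto simp: flip_def place_def)
qed

lemma side_count:
  assumes D: "D \<in> BD" and c: "c = Lft \<or> c = Rgt"
  shows "(\<Sum>eg\<in>D. card (fst eg \<inter> {c} \<times> {1..n})) = n"
proof -
  have "card ({c} \<times> {1..n}) = (\<Sum>eg\<in>D. card (fst eg \<inter> {c} \<times> {1..n}))"
    by (rule matching_count[OF brauer_matching[OF D] outer_finite]) (use c in \<open>auto simp: outer_nodes_def\<close>)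
  then show ?thesis by (simp add: card_cartesian_product)
qed

lemma brauer_finite: "D \<in> BD \<Longrightarrow> finite D"
  using brauer_valid unfolding valid_def by blast

lemma turns_card: assumes D: "D \<in> BD" shows "card (turns Rgt D) \<le> n"
proof -
  have f: "finite D" by (rule brauer_finite[OF D])
  have "card (turns Rgt D) = (\<Sum>eg\<in>turns Rgt D. 1)" by simp
  also have "\<dots> \<le> (\<Sum>eg\<in>turns Rgt D. card (fst eg \<inter> {Rgt} \<times> {1..n}))"
  proof (rule sum_mono)
    fix eg assume eg: "eg \<in> turns Rgt D"
    then have "fst eg \<inter> {Rgt} \<times> {1..n} = fst eg" using turns_nodes[OF D] by blast
    then show "1 \<le> card (fst eg \<inter> {Rgt} \<times> {1..n})"
      using matching_card[OF brauer_matching[OF D]] turns_sub eg by (metis one_le_numeral subsetD)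
  qed
  also have "\<dots> \<le> (\<Sum>eg\<in>D. card (fst eg \<inter> {Rgt} \<times> {1..n}))"
    by (rule sum_mono2[OF f turns_sub]) simp
  also have "\<dots> = n" by (rule side_count[OF D]) simp
  finally show ?thesis .
qed

text \<open>Both columns have \<open>n\<close> nodes, so there are as many right-hand as left-hand turns.\<close>

lemma no_turns_right: assumes D: "D \<in> BD" shows "no_turns D \<longleftrightarrow> turns Rgt D = {}"
proof
  let ?l = "\<lambda>eg. card (fst eg \<inter> {Lft} \<times> {1..n})" and ?r = "\<lambda>eg. card (fst eg \<inter> {Rgt} \<times> {1..n})"
  assume r0: "turns Rgt D = {}"
  note m = brauer_matching[OF D]
  have two: "?l eg + ?r eg = 2" if "eg \<in> D" for eg
  proof -
    have "?l eg + ?r eg = card (fst eg \<inter> {Lft} \<times> {1..n} \<union> fst eg \<inter> {Rgt} \<times> {1..n})"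
      by (rule card_Un_disjoint[symmetric]) (use matching_edge_finite[OF m that] in auto)
    also have "fst eg \<inter> {Lft} \<times> {1..n} \<union> fst eg \<inter> {Rgt} \<times> {1..n} = fst eg"
      using matching_sub[OF m that] by (auto simp: outer_nodes_def)
    finally show ?thesis using matching_card[OF m that] by simp
  qed
  have pos: "1 \<le> ?l eg" if "eg \<in> D" for eg
  proof -
    have "fst eg \<inter> {Lft} \<times> {1..n} \<noteq> {}"
      using r0 that matching_sub[OF m that] unfolding turns_def outer_nodes_def by fastforce
    then show ?thesis using matching_edge_finite[OF m that] by (simp add: Suc_le_eq card_gt_0_iff)
  qed
  \<comment> \<open>Without right-hand turns no edge has more right ends than left ends, while the
    totals are both \<open>n\<close>; so the numbers agree edge by edge.\<close>
  have "?r eg = ?l eg" if "eg \<in> D" for eg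
  proof (rule sum_mono_inv[of ?r D ?l])
    show "sum ?r D = sum ?l D" using side_count[OF D] by simp
    show "?r i \<le> ?l i" if "i \<in> D" for i using two[OF that] pos[OF that] by linarith
  qed (use that brauer_finite[OF D] in auto)
  then have "?r eg = 1" if "eg \<in> D" for eg using two[OF that] that by fastforce
  then have "fst eg \<inter> {Rgt} \<times> {1..n} \<noteq> {}" if "eg \<in> D" for eg using that by fastforce
  then have "turns Lft D = {}" unfolding turns_def by fastforce
  then show "no_turns D" using r0 by (simp add: no_turns_iff)
qed (simp add: no_turns_iff)

end

section \<open>Units up to turns\<close>

text \<open>Indexed by the right-hand node, so that composing diagrams from left to right composes
  the maps as \<open>s \<circ> t\<close>.\<close>

definition links :: "(nat \<Rightarrow> nat) \<Rightarrow> (nat \<Rightarrow> 'g) \<Rightarrow> nat set \<Rightarrow> 'g diagram" where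
  "links s l J = (\<lambda>j. ({(Lft, s j), (Rgt, j)}, l j)) ` J"

lemma matching_Un:
  assumes E: "matching V E" and E': "matching V' E'" and "V \<inter> V' = {}"
  shows "matching (V \<union> V') (E \<union> E')"
  unfolding matching_def
proof (intro conjI ballI)
  show "fst eg \<subseteq> V \<union> V'" "card (fst eg) = 2" if "eg \<in> E \<union> E'" for eg
    using that matching_sub[OF E] matching_sub[OF E'] matching_card[OF E] matching_card[OF E'] by blast+
  fix v assume v: "v \<in> V \<union> V'"
  have off: "v \<notin> fst eg" if "v \<in> V" "eg \<in> E'" for eg using that matching_sub[OF E'] assms(3) by blast
  have off': "v \<notin> fst eg" if "v \<in> V'" "eg \<in> E" for eg using that matching_sub[OF E] assms(3) by blast
  show "\<exists>!eg. eg \<in> E \<union> E' \<and> v \<in> fst eg"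
  proof (cases "v \<in> V")
    case True
    then have "\<exists>!eg. eg \<in> E \<and> v \<in> fst eg" using E unfolding matching_def by blast
    then show ?thesis using off[OF True] by (metis Un_iff)
  next
    case False
    then have "v \<in> V'" using v by blast
    then have "\<exists>!eg. eg \<in> E' \<and> v \<in> fst eg" using E' unfolding matching_def by blast
    then show ?thesis using off'[OF \<open>v \<in> V'\<close>] by (metis Un_iff)
  qed
qed

lemma matching_subset:
  assumes E: "matching V E" and S: "S \<subseteq> E" shows "matching (\<Union>(fst ` S)) S"
  unfolding matching_def
proof (intro conjI ballI)
  show "fst eg \<subseteq> \<Union>(fst ` S)" "card (fst eg) = 2" if "eg \<in> S" for eg
    using that S matching_card[OF E] by blast+
  fix v assume "v \<in> \<Union>(fst ` S)"
  then obtain eg where eg: "eg \<in> S" "v \<in> fst eg" by blast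
  show "\<exists>!eg. eg \<in> S \<and> v \<in> fst eg"
  proof (rule ex1I[of _ eg])
    show "eg' = eg" if "eg' \<in> S \<and> v \<in> fst eg'" for eg'
      by (rule matching_unique[OF E]) (use that eg S in auto)
  qed (use eg in simp)
qed

lemma matching_relabel:
  assumes E: "matching V E" shows "matching V ((\<lambda>eg. (fst eg, f (snd eg))) ` E)"
  unfolding matching_def
proof (intro conjI ballI)
  show "fst eg \<subseteq> V" "card (fst eg) = 2" if "eg \<in> (\<lambda>eg. (fst eg, f (snd eg))) ` E" for eg
    using that by (elim imageE, simp add: matching_sub[OF E] matching_card[OF E])+
  fix v assume "v \<in> V"
  then obtain eg where eg: "eg \<in> E" "v \<in> fst eg" by (rule matching_edge[OF E])
  show "\<exists>!eg. eg \<in> (\<lambda>eg. (fst eg, f (snd eg))) ` E \<and> v \<in> fst eg"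
  proof (rule ex1I[of _ "(fst eg, f (snd eg))"])
    show "eg' = (fst eg, f (snd eg))" if eg': "eg' \<in> (\<lambda>eg. (fst eg, f (snd eg))) ` E \<and> v \<in> fst eg'" for eg'
    proof -
      from eg' obtain x where x: "x \<in> E" "eg' = (fst x, f (snd x))" "v \<in> fst x" by auto
      have "x = eg" by (rule matching_unique[OF E x(1) eg(1) x(3) eg(2)])
      then show ?thesis using x(2) by simp
    qed
  qed (use eg in simp)
qed

lemma links_matching:
  assumes "inj_on s J" shows "matching ({Lft} \<times> s ` J \<union> {Rgt} \<times> J) (links s l J)"
  unfolding matching_def
proof (intro conjI ballI)
  show "fst eg \<subseteq> {Lft} \<times> s ` J \<union> {Rgt} \<times> J" "card (fst eg) = 2" if "eg \<in> links s l J" for eg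
    using that by (auto simp: links_def)
  fix v assume "v \<in> {Lft} \<times> s ` J \<union> {Rgt} \<times> J"
  then obtain j where j: "j \<in> J" "v = (Lft, s j) \<or> v = (Rgt, j)" by blast
  show "\<exists>!eg. eg \<in> links s l J \<and> v \<in> fst eg"
  proof (rule ex1I[of _ "({(Lft, s j), (Rgt, j)}, l j)"])
    show "({(Lft, s j), (Rgt, j)}, l j) \<in> links s l J \<and> v \<in> fst ({(Lft, s j), (Rgt, j)}, l j)"
      using j by (auto simp: links_def)
    fix eg assume eg: "eg \<in> links s l J \<and> v \<in> fst eg"
    then obtain i where i: "i \<in> J" "eg = ({(Lft, s i), (Rgt, i)}, l i)" by (auto simp: links_def)
    have "v \<in> {(Lft, s i), (Rgt, i)}" using eg unfolding i(2) by simp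
    then have "s i = s j \<or> i = j" using j(2) by auto
    then have "i = j" using inj_onD[OF assms _ i(1) j(1)] by blast
    then show "eg = ({(Lft, s j), (Rgt, j)}, l j)" using i by simp
  qed
qed

lemma id_diagram_links: "id_diagram G n = links (\<lambda>i. i) (\<lambda>_. \<one>\<^bsub>G\<^esub>) {1..n}"
  by (simp add: id_diagram_def links_def)

lemma first_half_links: "first_half (links s l J) = (\<lambda>j. ({(Lft, s j), (Mid, j)}, l j)) ` J"
  and second_half_links: "second_half (links s l J) = (\<lambda>j. ({(Mid, s j), (Rgt, j)}, l j)) ` J"
  by (simp_all add: links_def first_half_def second_half_def move_def image_image)

definition mid :: "node \<Rightarrow> node" where "mid = map_prod (id(Rgt := Mid)) id"

lemma mid_simps [simp]: "mid (Lft, i) = (Lft, i)" "mid (Mid, i) = (Mid, i)" "mid (Rgt, i) = (Mid, i)"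
  by (simp_all add: mid_def)

context diagrams
begin

lemma links_closed:
  assumes "s permutes {1..n}" "\<And>j. j \<in> {1..n} \<Longrightarrow> l j \<in> carrier G"
  shows "links s l {1..n} \<in> BD"
proof -
  have "{Lft} \<times> s ` {1..n} \<union> {Rgt} \<times> {1..n} = V0" unfolding permutes_image[OF assms(1)] by (auto simp: outer_nodes_def)
  then have "matching V0 (links s l {1..n})"
    using links_matching[OF permutes_inj_on[OF assms(1)], of "{1..n}" l] by (simp only:)
  then show ?thesis using assms(2) by (auto simp: brauer_iff links_def)
qed

lemma id_closed: "id_diagram G n \<in> BD"
  unfolding id_diagram_links using links_closed[OF permutes_id] by (simp add: id_def)

lemma links_no_turns: "turns c (links s l J) = {}"
  by (cases c) (auto simp: turns_def links_def)

definition cap_unit :: "'g diagram \<Rightarrow> 'g diagram" where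
  "cap_unit S = S \<union> (\<lambda>eg. (fst eg, inv snd eg)) ` flip S
     \<union> links (\<lambda>i. i) (\<lambda>_. \<one>) {i \<in> {1..n}. (Rgt, i) \<notin> \<Union>(fst ` S)}"

lemma cap_unit_empty: "cap_unit {} = id_diagram G n"
proof -
  have "{i \<in> {1..n}. (Rgt, i) \<notin> \<Union>(fst ` {})} = {1..n}" by auto
  then show ?thesis unfolding cap_unit_def id_diagram_links flip_def place_def
    by (simp only: image_empty Un_empty_left)
qed

lemma cap_unit_closed:
  assumes x: "x \<in> BD" and S: "S \<subseteq> turns Rgt x" shows "cap_unit S \<in> BD"
proof -
  let ?U = "\<Union>(fst ` S)" and ?J = "{i \<in> {1..n}. (Rgt, i) \<notin> \<Union>(fst ` S)}"
  let ?\<sigma> = "map_prod (transpose Lft Rgt) id :: node \<Rightarrow> node"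
  have Sx: "S \<subseteq> x" using S turns_sub by blast
  have U: "?U \<subseteq> {Rgt} \<times> {1..n}" using S turns_nodes[OF x] by blast
  have mS: "matching ?U S" by (rule matching_subset[OF brauer_matching[OF x] Sx])
  have mF: "matching (?\<sigma> ` ?U) ((\<lambda>eg. (fst eg, inv snd eg)) ` flip S)"
    unfolding flip_def by (rule matching_relabel[OF matching_place[OF flip_inj mS]])
  have mJ: "matching ({Lft, Rgt} \<times> ?J) (links (\<lambda>i. i) (\<lambda>_. \<one>) ?J)"
  proof -
    have "{Lft} \<times> (\<lambda>i. i) ` ?J \<union> {Rgt} \<times> ?J = {Lft, Rgt} \<times> ?J" by blast
    then show ?thesis using links_matching[of "\<lambda>i. i" ?J "\<lambda>_. \<one>"] by (simp only: inj_on_id2)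
  qed
  obtain A where A: "?U = {Rgt} \<times> A" "A \<subseteq> {1..n}"
  proof
    show "?U = {Rgt} \<times> {i. (Rgt, i) \<in> ?U}" using U by blast
    show "{i. (Rgt, i) \<in> ?U} \<subseteq> {1..n}" using U by blast
  qed
  have U': "?\<sigma> ` ({Rgt} \<times> A) = {Lft} \<times> A" by force
  have J: "?J = {1..n} - A" unfolding A(1) by blast
  have d1: "?U \<inter> ?\<sigma> ` ?U = {}" unfolding A(1) U' by blast
  have d2: "(?U \<union> ?\<sigma> ` ?U) \<inter> {Lft, Rgt} \<times> ?J = {}" unfolding J A(1) U' by blast
  have "?U \<union> ?\<sigma> ` ?U \<union> {Lft, Rgt} \<times> ?J = V0"
    unfolding J outer_nodes_def A(1) U' using A(2) by blast
  then have "matching V0 (cap_unit S)"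
    unfolding cap_unit_def using matching_Un[OF matching_Un[OF mS mF d1] mJ d2] by simp
  moreover have "snd eg \<in> carrier G" if "eg \<in> cap_unit S" for eg
  proof -
    have l: "snd eg \<in> carrier G" if "eg \<in> S" for eg using that Sx brauer_label[OF x] by blast
    then have f: "snd eg \<in> carrier G" if "eg \<in> flip S" for eg using that by (auto simp: flip_def place_mem)
    from that have "eg \<in> S \<or> (\<exists>y\<in>flip S. snd eg = inv snd y) \<or> snd eg = \<one>"
      unfolding cap_unit_def links_def by (elim UnE imageE) (simp_all, blast)
    then show ?thesis by (elim disjE bexE) (simp_all add: l f)
  qed
  ultimately show ?thesis by (simp add: brauer_iff)
qed

lemma cap_unit_turns: "S \<subseteq> turns Rgt x \<Longrightarrow> S \<subseteq> turns Rgt (cap_unit S)"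
  by (auto simp: turns_def cap_unit_def)

lemma first_mem: "eg \<in> first_half D \<longleftrightarrow> (\<exists>x\<in>D. eg = (mid ` fst x, snd x))"
  unfolding first_half_place place_def mid_def by (force simp: case_prod_beta)

lemma mid_flip:
  assumes "\<And>v. v \<in> e \<Longrightarrow> v \<in> {Rgt} \<times> {1..n}"
  shows "map_prod (id(Lft := Mid)) id ` map_prod (transpose Lft Rgt) id ` e = mid ` e"
  unfolding image_image mid_def
proof (rule image_cong[OF refl])
  fix v assume "v \<in> e"
  then have "v \<in> {Rgt} \<times> {1..n}" by (rule assms)
  then show "map_prod (id(Lft := Mid)) id (map_prod (transpose Lft Rgt) id v) = map_prod (id(Rgt := Mid)) id v" by auto
qed

text \<open>Moving the left column to the middle leaves \<open>S\<close> in place, puts its mirror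
  image where \<open>mid\<close> puts \<open>S\<close>, and makes the horizontal edges join middle
  to right. A component of a composite can only continue along these edges.\<close>

lemma second_cap_unit:
  assumes x: "x \<in> BD" and S: "S \<subseteq> turns Rgt x" and eg: "eg \<in> second_half (cap_unit S)"
  shows "eg \<in> S \<or> (\<exists>y\<in>S. eg = (mid ` fst y, inv snd y)) \<or>
    (\<exists>i\<in>{1..n}. (Rgt, i) \<notin> \<Union>(fst ` S) \<and> eg = ({(Mid, i), (Rgt, i)}, \<one>))"
proof -
  let ?J = "{i \<in> {1..n}. (Rgt, i) \<notin> \<Union>(fst ` S)}"
  let ?\<tau> = "map_prod (id(Lft := Mid)) id :: node \<Rightarrow> node"
  have r: "v \<in> {Rgt} \<times> {1..n}" if "y \<in> S" "v \<in> fst y" for y v using that S turns_nodes[OF x] by blast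
  consider (a) y where "y \<in> S" "eg = (?\<tau> ` fst y, snd y)"
    | (b) y where "y \<in> S" "eg = (?\<tau> ` map_prod (transpose Lft Rgt) id ` fst y, inv snd y)"
    | (c) "eg \<in> second_half (links (\<lambda>i. i) (\<lambda>_. \<one>) ?J)"
    using eg unfolding second_half_place cap_unit_def place_Un
    by (fastforce simp: place_def flip_def case_prod_beta)
  then show ?thesis
  proof cases
    case a
    have "?\<tau> ` fst y = id ` fst y"
    proof (rule image_cong[OF refl])
      fix v assume "v \<in> fst y"
      then have "v \<in> {Rgt} \<times> {1..n}" by (rule r[OF a(1)])
      then show "?\<tau> v = id v" by auto
    qed
    then show ?thesis using a by simp
  next
    case b
    have "?\<tau> ` map_prod (transpose Lft Rgt) id ` fst y = mid ` fst y" by (rule mid_flip[OF r[OF b(1)]])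
    then show ?thesis using b by blast
  next
    case c
    then show ?thesis unfolding second_half_links by blast
  qed
qed

lemma second_cap_unitI:
  assumes x: "x \<in> BD" and S: "S \<subseteq> turns Rgt x"
  shows "y \<in> S \<Longrightarrow> (mid ` fst y, inv snd y) \<in> second_half (cap_unit S)"
    and "i \<in> {1..n} \<Longrightarrow> (Rgt, i) \<notin> \<Union>(fst ` S) \<Longrightarrow> ({(Mid, i), (Rgt, i)}, \<one>) \<in> second_half (cap_unit S)"
proof -
  let ?J = "{i \<in> {1..n}. (Rgt, i) \<notin> \<Union>(fst ` S)}"
  let ?\<tau> = "map_prod (id(Lft := Mid)) id :: node \<Rightarrow> node"
  have r: "v \<in> {Rgt} \<times> {1..n}" if "y \<in> S" "v \<in> fst y" for y v using that S turns_nodes[OF x] by blast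
  show "(mid ` fst y, inv snd y) \<in> second_half (cap_unit S)" if y: "y \<in> S"
  proof -
    have e: "?\<tau> ` map_prod (transpose Lft Rgt) id ` fst y = mid ` fst y" by (rule mid_flip[OF r[OF y]])
    have "(map_prod (transpose Lft Rgt) id ` fst y, snd y) \<in> flip S"
      using y unfolding flip_def place_def case_prod_beta by (rule imageI)
    from imageI[OF this, of "\<lambda>eg. (fst eg, inv snd eg)"]
    have "(map_prod (transpose Lft Rgt) id ` fst y, inv snd y) \<in> cap_unit S"
      unfolding cap_unit_def fst_conv snd_conv by blast
    from half_image(2)[OF this] show ?thesis unfolding e .
  qed
  show "({(Mid, i), (Rgt, i)}, \<one>) \<in> second_half (cap_unit S)" if "i \<in> {1..n}" "(Rgt, i) \<notin> \<Union>(fst ` S)"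
  proof -
    have "({(Mid, i), (Rgt, i)}, \<one>) \<in> second_half (links (\<lambda>i. i) (\<lambda>_. \<one>) ?J)"
      unfolding second_half_links using that by blast
    then show ?thesis unfolding cap_unit_def second_half_place place_Un by blast
  qed
qed

end

context diagrams
begin

lemma mid_outer_inj: "u \<in> V0 \<Longrightarrow> v \<in> V0 \<Longrightarrow> mid u = mid v \<longleftrightarrow> u = v"
  by (auto simp: outer_nodes_def)

lemma first_meet:
  assumes D: "D \<in> BD" and x: "x \<in> D" "y \<in> D" "mid ` fst x \<inter> mid ` fst y \<noteq> {}" shows "x = y"
proof -
  note m = brauer_matching[OF D]
  obtain u v where uv: "u \<in> fst x" "v \<in> fst y" "mid u = mid v" using x(3) by blast
  have "u = v" using mid_outer_inj[of u v] uv matching_sub[OF m x(1)] matching_sub[OF m x(2)] by blast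
  then show ?thesis using matching_unique[OF m x(1,2) uv(1)] uv(2) by simp
qed

lemma first_label:
  assumes D: "D \<in> BD" and x: "x \<in> D" "mid ` fst x \<subseteq> C"
    and C: "\<And>y. y \<in> D \<Longrightarrow> mid ` fst y \<subseteq> C \<Longrightarrow> mid ` fst y \<inter> mid ` fst x \<noteq> {}"
  shows "label G (first_half D) C = snd x"
proof -
  have "label G (first_half D) C = snd (mid ` fst x, snd x)"
  proof (rule label_single)
    show "(mid ` fst x, snd x) \<in> first_half D" unfolding first_mem using x(1) by blast
    fix eg assume eg: "eg \<in> first_half D" "fst eg \<subseteq> C"
    then obtain y where y: "y \<in> D" "eg = (mid ` fst y, snd y)" unfolding first_mem by blast
    have "y = x" by (rule first_meet[OF D y(1) x(1) C]) (use y eg in simp_all)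
    then show "eg = (mid ` fst x, snd x)" using y(2) by simp
  qed (use x brauer_label[OF D x(1)] in simp_all)
  then show ?thesis by simp
qed

text \<open>A closed loop stays in the middle column, so its edges from \<open>D\<close> are
  right-hand turns of \<open>D\<close> and its edges from \<open>E\<close> are left-hand turns of
  \<open>E\<close>, and each of its nodes has an edge of both kinds.\<close>

lemma loop_free:
  assumes D: "D \<in> BD" and E: "E \<in> BD" and t: "turns Rgt D = {} \<or> turns Lft E = {}"
    and k: "cring k"
  shows "loop_factor G k act n \<delta> D E = \<one>\<^bsub>k\<^esub>"
proof -
  interpret k: cring k by (rule k)
  have "C \<inter> V0 \<noteq> {}" if C: "C \<in> comps (joint D E) (all_nodes n)" for C
  proof
    assume C0: "C \<inter> V0 = {}"
    obtain v where v: "v \<in> all_nodes n" "C = component (joint D E) v" using C unfolding comps_def by blast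
    have vC: "v \<in> C" unfolding v(2) by (rule component_self)
    then have "v \<notin> V0" using C0 by blast
    then obtain i where i: "v = (Mid, i)" "i \<in> {1..n}" using v(1) by (auto simp: all_nodes_def outer_nodes_def)
    from t show False
    proof
      assume t: "turns Rgt D = {}"
      have "(Rgt, i) \<in> V0" using i(2) by (simp add: outer_nodes_def)
      then obtain x where x: "x \<in> D" "(Rgt, i) \<in> fst x" by (rule matching_edge[OF brauer_matching[OF D]])
      have m: "(mid ` fst x, snd x) \<in> joint D E" using x(1) unfolding Un_iff first_mem by blast
      have vx: "v \<in> mid ` fst x" using x(2) i(1) by force
      have sub: "mid ` fst x \<subseteq> C" using edge_component[OF m, of v v] vx vC unfolding v(2) by simp
      have "fst ` fst x \<subseteq> {Rgt}"
      proof (rule image_subsetI, rule ccontr)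
        fix u assume u: "u \<in> fst x" "fst u \<notin> {Rgt}"
        have "u \<in> V0" using u(1) matching_sub[OF brauer_matching[OF D] x(1)] by blast
        then have "mid u \<in> V0" using u(2) by (auto simp: outer_nodes_def)
        then show False using sub u(1) C0 by blast
      qed
      then show False using t x(1) unfolding turns_def by blast
    next
      assume t: "turns Lft E = {}"
      let ?\<tau> = "map_prod (id(Lft := Mid)) id :: node \<Rightarrow> node"
      have "(Lft, i) \<in> V0" using i(2) by (simp add: outer_nodes_def)
      then obtain x where x: "x \<in> E" "(Lft, i) \<in> fst x" by (rule matching_edge[OF brauer_matching[OF E]])
      have m: "(?\<tau> ` fst x, snd x) \<in> joint D E" using half_image(2)[of "fst x" "snd x" E] x(1) by simp
      have vx: "v \<in> ?\<tau> ` fst x" using x(2) i(1) by force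
      have sub: "?\<tau> ` fst x \<subseteq> C" using edge_component[OF m, of v v] vx vC unfolding v(2) by simp
      have "fst ` fst x \<subseteq> {Lft}"
      proof (rule image_subsetI, rule ccontr)
        fix u assume u: "u \<in> fst x" "fst u \<notin> {Lft}"
        have "u \<in> V0" using u(1) matching_sub[OF brauer_matching[OF E] x(1)] by blast
        then have "?\<tau> u \<in> V0" using u(2) by (auto simp: outer_nodes_def)
        then show False using sub u(1) C0 by blast
      qed
      then show False using t x(1) unfolding turns_def by blast
    qed
  qed
  then have "{C \<in> comps (joint D E) (all_nodes n). C \<inter> V0 = {}} = {}" by blast
  then show ?thesis unfolding loop_factor_alt loop_part_def by (simp only: k.finprod_empty)
qed

text \<open>Composing with \<open>cap_unit S\<close> cuts off each turn in \<open>S\<close> as a loop, whose label cancels, and puts the turn back.\<close>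

lemma cap_unit_right:
  assumes y: "y \<in> BD" and S: "S \<subseteq> turns Rgt y"
  shows "diagram_comp G n y (cap_unit S) = y"
proof -
  let ?w = "cap_unit S" and ?U = "\<Union>(fst ` S)"
  have w: "?w \<in> BD" by (rule cap_unit_closed[OF y S])
  note m = brauer_matching[OF y] and sec = second_cap_unit[OF y S] and secI = second_cap_unitI[OF y S]
  have Sy: "S \<subseteq> y" using S turns_sub by blast
  have Sr: "fst eg \<subseteq> {Rgt} \<times> {1..n}" if "eg \<in> S" for eg using that S turns_nodes[OF y] by blast
  \<comment> \<open>One inclusion suffices, by \<open>matching_subset_eq\<close>.\<close>
  have "y \<subseteq> diagram_comp G n y ?w"
  proof
    fix eg assume eg: "eg \<in> y"
    show "eg \<in> diagram_comp G n y ?w"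
    proof (cases "eg \<in> S")
      case True
      then show ?thesis using cap_unit_turns[OF S] turn_persists_right[OF y w] turns_sub by blast
    next
      case False
      have off: "v \<notin> ?U" if "v \<in> fst eg" for v
        using matching_unique[OF m eg _ that] Sy False by blast
      have eV: "fst eg \<subseteq> V0" by (rule matching_sub[OF m eg])
      \<comment> \<open>The component of an edge outside \<open>S\<close>: its right ends become
        middle nodes, and each is prolonged to the right by a horizontal edge with trivial label.
        Left ends are fixed by \<open>mid\<close>.\<close>
      let ?C = "fst eg \<union> mid ` fst eg"
      have mem: "(Rgt, i) \<in> fst eg" if "(Rgt, i) \<in> ?C \<or> (Mid, i) \<in> ?C" for i
        using that eV by (auto simp: outer_nodes_def split: if_splits)
      have A: "x = eg" if x: "x \<in> y" "mid ` fst x \<inter> ?C \<noteq> {}" for x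
      proof -
        obtain u where u: "u \<in> fst x" "mid u \<in> ?C" using x(2) by blast
        have uV: "u \<in> V0" using u(1) matching_sub[OF m x(1)] by blast
        have "u \<in> fst eg"
        proof (cases "mid u \<in> fst eg")
          case True
          then have "mid u \<in> V0" using eV by blast
          then have "mid u = u" using uV by (auto simp: outer_nodes_def)
          then show ?thesis using True by simp
        next
          case False
          then obtain v where "v \<in> fst eg" "mid u = mid v" using u(2) by blast
          then show ?thesis using mid_outer_inj[OF uV, of v] eV by blast
        qed
        then show ?thesis using matching_unique[OF m x(1) eg u(1)] by simp
      qed
      have B: "fst x \<subseteq> ?C \<and> snd x = \<one>" if x: "x \<in> second_half ?w" "fst x \<inter> ?C \<noteq> {}" for x
      proof -
        consider "x \<in> S" | z where "z \<in> S" "x = (mid ` fst z, inv snd z)"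
          | i where "i \<in> {1..n}" "(Rgt, i) \<notin> ?U" "x = ({(Mid, i), (Rgt, i)}, \<one>)"
          using sec[OF x(1)] by blast
        then show ?thesis
        proof cases
          case 1
          obtain u where u: "u \<in> fst x" "u \<in> ?C" using x(2) by blast
          have "u \<in> {Rgt} \<times> {1..n}" using Sr[OF 1] u(1) by blast
          then obtain i where "u = (Rgt, i)" by blast
          then have i: "(Rgt, i) \<in> fst x" "(Rgt, i) \<in> ?C" using u by simp_all
          then show ?thesis using off[OF mem[OF disjI1[OF i(2)]]] 1 by blast
        next
          case 2
          have "mid ` fst z \<inter> ?C \<noteq> {}" using x(2) unfolding 2(2) by simp
          then have "z = eg" using A Sy 2(1) by blast
          then show ?thesis using 2(1) False by simp
        next
          case 3
          then have "(Rgt, i) \<in> ?C \<or> (Mid, i) \<in> ?C" using x(2) by auto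
          then have "(Rgt, i) \<in> fst eg" by (rule mem)
          then have "(Rgt, i) \<in> ?C" "(Mid, i) \<in> ?C" by force+
          then show ?thesis using 3(3) by simp
        qed
      qed
      obtain v where v: "v \<in> fst eg" using matching_nonempty[OF m eg] by blast
      have jA: "(mid ` fst eg, snd eg) \<in> joint y ?w" using eg unfolding Un_iff first_mem by blast
      have "(fst eg, snd eg) \<in> diagram_comp G n y ?w"
      proof (rule comp_edgeI[of "mid v"])
        show "mid v \<in> ?C" using v by blast
        show "mid v \<in> all_nodes n" using v eV by (auto simp: outer_nodes_def all_nodes_def)
        show "fst x \<subseteq> ?C" if x: "x \<in> joint y ?w" "fst x \<inter> ?C \<noteq> {}" for x
        proof (cases "x \<in> second_half ?w")
          case True
          then show ?thesis using B x(2) by blast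
        next
          case False
          then obtain z where z: "z \<in> y" "x = (mid ` fst z, snd z)" using x(1) unfolding Un_iff first_mem by blast
          then have "z = eg" using A x(2) by simp
          then show ?thesis using z(2) by simp
        qed
        have mc: "mid ` fst eg \<subseteq> component (joint y ?w) (mid v)"
          using edge_component[OF jA, of "mid v" "mid v"] v component_self[of "mid v" "joint y ?w"] by simp
        moreover have "u \<in> component (joint y ?w) (mid v)" if u: "u \<in> fst eg" for u
        proof (cases "mid u = u")
          case True
          then show ?thesis using mc u by (metis imageI subsetD)
        next
          case False
          then obtain i where i: "u = (Rgt, i)" "i \<in> {1..n}" using u eV by (auto simp: outer_nodes_def)
          then have "({(Mid, i), (Rgt, i)}, \<one>) \<in> joint y ?w" using secI(2) off[OF u] by blast
          from edge_component[OF this, of "(Mid, i)" "mid v"] mc u i(1)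
          show ?thesis by force
        qed
        ultimately show "?C \<subseteq> component (joint y ?w) (mid v)" by blast
        show "?C \<inter> V0 = fst eg"
        proof (intro equalityI subsetI)
          fix u assume "u \<in> ?C \<inter> V0"
          then have "u \<in> fst eg \<or> (\<exists>v\<in>fst eg. u = mid v)" "u \<in> V0" by blast+
          then show "u \<in> fst eg" using eV by (auto simp: outer_nodes_def split: if_splits)
        qed (use eV in blast)
        show "fst eg \<noteq> {}" using v by blast
        have "label G (first_half y) ?C = snd eg"
        proof (rule first_label[OF y eg])
          fix z assume z: "z \<in> y" "mid ` fst z \<subseteq> ?C"
          have "mid ` fst z \<noteq> {}" using matching_nonempty[OF m z(1)] by simp
          then have "z = eg" using A[OF z(1)] z(2) by blast
          then show "mid ` fst z \<inter> mid ` fst eg \<noteq> {}" using v by blast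
        qed blast
        moreover have "label G (second_half ?w) ?C = \<one>"
        proof (rule label_one)
          fix x assume x: "x \<in> second_half ?w" "fst x \<subseteq> ?C"
          have "fst x \<noteq> {}" using matching_nonempty[OF second_matching[OF w] x(1)] .
          then show "snd x = \<one>" using B[OF x(1)] x(2) by blast
        qed
        ultimately show "label G (first_half y) ?C \<otimes> label G (second_half ?w) ?C = snd eg"
          using brauer_label[OF y eg] by simp
      qed
      then show ?thesis by simp
    qed
  qed
  then show ?thesis using matching_subset_eq[OF m brauer_matching[OF comp_closed[OF y w]]] by simp
qed

text \<open>Each turn of \<open>S\<close> meets its mirror image in the middle, giving a loop of two
  parallel edges with inverse labels; its factor is \<open>act \<one> \<delta>\<close>, that is
  \<open>\<delta>\<close>. A middle node outside these loops is joined to the right column. The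
  exponent depends on \<open>S\<close> but not on \<open>y\<close>, as \<open>rt_unit\<close>
  demands.\<close>

lemma cap_unit_loops:
  assumes y: "y \<in> BD" and S: "S \<subseteq> turns Rgt y"
    and k: "cring k" and \<delta>: "\<delta> \<in> carrier k" "act \<one> \<delta> = \<delta>"
  shows "loop_factor G k act n \<delta> y (cap_unit S) = \<delta> [^]\<^bsub>k\<^esub> card ((\<lambda>eg. mid ` fst eg) ` S)"
proof -
  interpret k: cring k by (rule k)
  let ?w = "cap_unit S" and ?U = "\<Union>(fst ` S)"
  have w: "?w \<in> BD" by (rule cap_unit_closed[OF y S])
  note m = brauer_matching[OF y] and sec = second_cap_unit[OF y S] and secI = second_cap_unitI[OF y S]
  have Sy: "S \<subseteq> y" using S turns_sub by blast
  have Sr: "fst eg \<subseteq> {Rgt} \<times> {1..n}" if "eg \<in> S" for eg using that S turns_nodes[OF y] by blast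
  have Sm: "\<exists>i\<in>{1..n}. u = (Mid, i) \<and> (Rgt, i) \<in> fst eg" if "eg \<in> S" "u \<in> mid ` fst eg" for eg u
    using that Sr[OF that(1)] by fastforce
  have A: "x = eg" if "eg \<in> S" "x \<in> y" "mid ` fst x \<inter> mid ` fst eg \<noteq> {}" for x eg
    using first_meet[OF y that(2) _ that(3)] that(1) Sy by blast
  have B: "x = (mid ` fst eg, inv snd eg)" if eg: "eg \<in> S" and x: "x \<in> second_half ?w" "fst x \<inter> mid ` fst eg \<noteq> {}" for x eg
  proof -
    obtain u where u: "u \<in> fst x" "u \<in> mid ` fst eg" using x(2) by blast
    obtain i where i: "u = (Mid, i)" "(Rgt, i) \<in> fst eg" using Sm[OF eg u(2)] by blast
    consider "x \<in> S" | z where "z \<in> S" "x = (mid ` fst z, inv snd z)"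
      | j where "(Rgt, j) \<notin> ?U" "x = ({(Mid, j), (Rgt, j)}, \<one>)"
      using sec[OF x(1)] by blast
    then show ?thesis
    proof cases
      case 1
      then have "u \<in> {Rgt} \<times> {1..n}" using Sr u(1) by blast
      then show ?thesis using i(1) by simp
    next
      case 2
      have "u \<in> mid ` fst z" using u(1) unfolding 2(2) by simp
      then have "z = eg" using A[OF eg, of z] u(2) 2(1) Sy by blast
      then show ?thesis using 2(2) by simp
    next
      case 3
      then have "j = i" using u(1) i(1) by simp
      then show ?thesis using 3(1) i(2) eg by blast
    qed
  qed
  have comp: "component (joint y ?w) v = mid ` fst eg" if eg: "eg \<in> S" and v: "v \<in> mid ` fst eg" for v eg
  proof
    show "component (joint y ?w) v \<subseteq> mid ` fst eg"
    proof (rule component_closed[OF v])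
      fix x assume x: "x \<in> joint y ?w" "fst x \<inter> mid ` fst eg \<noteq> {}"
      show "fst x \<subseteq> mid ` fst eg"
      proof (cases "x \<in> second_half ?w")
        case True
        then show ?thesis using B[OF eg True x(2)] by simp
      next
        case False
        then obtain z where z: "z \<in> y" "x = (mid ` fst z, snd z)" using x(1) unfolding Un_iff first_mem by blast
        then have "z = eg" using A[OF eg z(1)] x(2) by simp
        then show ?thesis using z(2) by simp
      qed
    qed
    have j: "(mid ` fst eg, snd eg) \<in> joint y ?w" using eg Sy unfolding Un_iff first_mem by blast
    show "mid ` fst eg \<subseteq> component (joint y ?w) v"
      using edge_component[OF j, of v v] v component_self[of v "joint y ?w"] unfolding fst_conv .
  qed
  have lab: "label G (first_half y) (mid ` fst eg) \<otimes> label G (second_half ?w) (mid ` fst eg) = \<one>" if eg: "eg \<in> S" for eg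
  proof -
    have c: "snd eg \<in> carrier G" using eg Sy brauer_label[OF y] by blast
    have ne: "mid ` fst eg \<noteq> {}" using matching_nonempty[OF m] eg Sy by blast
    have "label G (first_half y) (mid ` fst eg) = snd eg"
    proof (rule first_label[OF y])
      fix z assume z: "z \<in> y" "mid ` fst z \<subseteq> mid ` fst eg"
      then show "mid ` fst z \<inter> mid ` fst eg \<noteq> {}" using matching_nonempty[OF m z(1)] by blast
    qed (use eg Sy in auto)
    moreover have "label G (second_half ?w) (mid ` fst eg) = snd (mid ` fst eg, inv snd eg)"
    proof (rule label_single[OF secI(1)[OF eg]])
      fix x assume x: "x \<in> second_half ?w" "fst x \<subseteq> mid ` fst eg"
      have "fst x \<noteq> {}" using matching_nonempty[OF second_matching[OF w] x(1)] .
      then show "x = (mid ` fst eg, inv snd eg)" using B[OF eg x(1)] x(2) by blast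
    qed (use c in simp_all)
    ultimately show ?thesis using c by simp
  qed
  have "{C \<in> comps (joint y ?w) (all_nodes n). C \<inter> V0 = {}} = (\<lambda>eg. mid ` fst eg) ` S"
  proof (intro equalityI subsetI)
    fix C assume C: "C \<in> {C \<in> comps (joint y ?w) (all_nodes n). C \<inter> V0 = {}}"
    then obtain v where v: "v \<in> all_nodes n" "C = component (joint y ?w) v" unfolding comps_def by blast
    have vC: "v \<in> C" unfolding v(2) by (rule component_self)
    then have "v \<notin> V0" using C by blast
    then obtain i where i: "v = (Mid, i)" "i \<in> {1..n}" using v(1) by (auto simp: all_nodes_def outer_nodes_def)
    have "(Rgt, i) \<in> ?U"
    proof (rule ccontr)
      assume "(Rgt, i) \<notin> ?U"
      then have "({(Mid, i), (Rgt, i)}, \<one>) \<in> joint y ?w" using secI(2)[OF i(2)] by blast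
      from edge_component[OF this, of v v] vC have "(Rgt, i) \<in> C" unfolding v(2) i(1) by simp
      then show False using C i(2) by (auto simp: outer_nodes_def)
    qed
    then obtain eg where eg: "eg \<in> S" "(Rgt, i) \<in> fst eg" by blast
    have "C = mid ` fst eg" unfolding v(2) by (rule comp[OF eg(1)]) (use eg(2) i(1) in force)
    then show "C \<in> (\<lambda>eg. mid ` fst eg) ` S" using eg(1) by blast
  next
    fix C assume "C \<in> (\<lambda>eg. mid ` fst eg) ` S"
    then obtain eg where eg: "eg \<in> S" "C = mid ` fst eg" by blast
    obtain v where v: "v \<in> mid ` fst eg" using matching_nonempty[OF m] eg(1) Sy by blast
    have "v \<in> all_nodes n" using Sm[OF eg(1) v] by (auto simp: all_nodes_def)
    moreover have "C \<inter> V0 = {}" using Sm[OF eg(1)] unfolding eg(2) outer_nodes_def by fastforce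
    ultimately show "C \<in> {C \<in> comps (joint y ?w) (all_nodes n). C \<inter> V0 = {}}"
      using comp[OF eg(1) v] eg(2) unfolding comps_def by blast
  qed
  then have "loop_factor G k act n \<delta> y ?w
      = (\<Otimes>\<^bsub>k\<^esub>C\<in>(\<lambda>eg. mid ` fst eg) ` S. act (label G (first_half y) C \<otimes> label G (second_half ?w) C) \<delta>)"
    unfolding loop_factor_alt loop_part_def by (simp only:)
  also have "\<dots> = (\<Otimes>\<^bsub>k\<^esub>C\<in>(\<lambda>eg. mid ` fst eg) ` S. \<delta>)"
    by (rule k.finprod_cong') (use lab \<delta> in auto)
  also have "\<dots> = \<delta> [^]\<^bsub>k\<^esub> card ((\<lambda>eg. mid ` fst eg) ` S)" by (rule k.finprod_const[OF \<delta>(1)])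
  finally show ?thesis .
qed

end

context diagrams
begin

text \<open>The identity diagram is \<open>cap_unit {}\<close>, so the right unit law is a special
  case of \<open>cap_unit_right\<close>; the left one follows by reflection.\<close>

lemma id_comp:
  assumes y: "y \<in> BD"
  shows "diagram_comp G n y (id_diagram G n) = y" "diagram_comp G n (id_diagram G n) y = y"
proof -
  have r: "diagram_comp G n z (id_diagram G n) = z" if "z \<in> BD" for z
    using cap_unit_right[OF that, of "{}"] unfolding cap_unit_empty by simp
  have f: "flip (id_diagram G n) = id_diagram G n"
    unfolding flip_def place_def id_diagram_def image_image
    by (rule image_cong[OF refl]) (auto simp: transpose_def)
  show "diagram_comp G n y (id_diagram G n) = y" by (rule r[OF y])
  have "flip (diagram_comp G n (id_diagram G n) y) = flip y"
    unfolding flip_comp[OF id_closed y] f by (rule r[OF flip_closed[OF y]])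
  then show "diagram_comp G n (id_diagram G n) y = y" using flip_flip by metis
qed

lemma links_comp:
  assumes s: "s permutes {1..n}" and t: "t permutes {1..n}"
    and l: "\<And>j. j \<in> {1..n} \<Longrightarrow> l j \<in> carrier G" and m: "\<And>j. j \<in> {1..n} \<Longrightarrow> m j \<in> carrier G"
  shows "diagram_comp G n (links s l {1..n}) (links t m {1..n}) = links (s \<circ> t) (\<lambda>j. l (t j) \<otimes> m j) {1..n}"
proof -
  let ?D = "links s l {1..n}" and ?E = "links t m {1..n}" and ?F = "links (s \<circ> t) (\<lambda>j. l (t j) \<otimes> m j) {1..n}"
  have tN: "t j \<in> {1..n}" if "j \<in> {1..n}" for j using permutes_in_image[OF t] that by blast
  have D: "?D \<in> BD" and E: "?E \<in> BD" by (rule links_closed[OF s l] links_closed[OF t m], assumption)+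
  have F: "?F \<in> BD" by (rule links_closed[OF permutes_compose[OF t s]]) (use l m tN in simp)
  have "?F \<subseteq> diagram_comp G n ?D ?E"
  proof
    fix eg assume "eg \<in> ?F"
    then obtain j where j: "j \<in> {1..n}" "eg = ({(Lft, s (t j)), (Rgt, j)}, l (t j) \<otimes> m j)" by (auto simp: links_def)
    \<comment> \<open>The path through the middle node \<open>t j\<close>, which the second diagram
      joins to \<open>j\<close> on the right and the first to \<open>s (t j)\<close> on the
      left.\<close>
    let ?C = "{(Lft, s (t j)), (Mid, t j), (Rgt, j)}"
    let ?a = "({(Lft, s (t j)), (Mid, t j)}, l (t j))" and ?b = "({(Mid, t j), (Rgt, j)}, m j)"
    have a: "?a \<in> first_half ?D" unfolding first_half_links using tN[OF j(1)] by blast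
    have b: "?b \<in> second_half ?E" unfolding second_half_links using j(1) by blast
    have A: "x = ?a" if x: "x \<in> first_half ?D" "fst x \<inter> ?C \<noteq> {}" for x
    proof -
      obtain i where i: "i \<in> {1..n}" "x = ({(Lft, s i), (Mid, i)}, l i)" using x(1) unfolding first_half_links by blast
      then have "s i = s (t j) \<or> i = t j" using x(2) by auto
      then have "i = t j" using injD[OF permutes_inj[OF s]] by blast
      then show ?thesis using i(2) by simp
    qed
    have B: "x = ?b" if x: "x \<in> second_half ?E" "fst x \<inter> ?C \<noteq> {}" for x
    proof -
      obtain i where i: "i \<in> {1..n}" "x = ({(Mid, t i), (Rgt, i)}, m i)" using x(1) unfolding second_half_links by blast
      then have "t i = t j \<or> i = j" using x(2) by auto
      then have "i = j" using injD[OF permutes_inj[OF t]] by blast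
      then show ?thesis using i(2) by simp
    qed
    have "({(Lft, s (t j)), (Rgt, j)}, l (t j) \<otimes> m j) \<in> diagram_comp G n ?D ?E"
    proof (rule comp_edgeI[of "(Mid, t j)" ?C])
      show "(Mid, t j) \<in> all_nodes n" using tN[OF j(1)] by (simp add: all_nodes_def)
      show "fst x \<subseteq> ?C" if "x \<in> joint ?D ?E" "fst x \<inter> ?C \<noteq> {}" for x
      proof -
        have "x = ?a \<or> x = ?b" using that A[of x] B[of x] by blast
        then show ?thesis by (elim disjE) simp_all
      qed
      have "fst ?a \<subseteq> component (joint ?D ?E) (Mid, t j)" "fst ?b \<subseteq> component (joint ?D ?E) (Mid, t j)"
        by (rule edge_component[OF _ _ component_self], use a b in simp, simp)+
      then show "?C \<subseteq> component (joint ?D ?E) (Mid, t j)" by simp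
      have "s (t j) \<in> {1..n}" using permutes_in_image[OF s] tN[OF j(1)] by blast
      then show "?C \<inter> V0 = {(Lft, s (t j)), (Rgt, j)}" using j(1) by (auto simp: outer_nodes_def)
      have "label G (first_half ?D) ?C = snd ?a"
      proof (rule label_single[OF a])
        show "x = ?a" if "x \<in> first_half ?D" "fst x \<subseteq> ?C" for x
          using A[OF that(1)] that(2) matching_nonempty[OF first_matching[OF D] that(1)] by blast
      qed (use l[OF tN[OF j(1)]] in simp_all)
      moreover have "label G (second_half ?E) ?C = snd ?b"
      proof (rule label_single[OF b])
        show "x = ?b" if "x \<in> second_half ?E" "fst x \<subseteq> ?C" for x
          using B[OF that(1)] that(2) matching_nonempty[OF second_matching[OF E] that(1)] by blast
      qed (use m[OF j(1)] in simp_all)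
      ultimately show "label G (first_half ?D) ?C \<otimes> label G (second_half ?E) ?C = l (t j) \<otimes> m j" by simp
    qed simp_all
    then show "eg \<in> diagram_comp G n ?D ?E" using j(2) by simp
  qed
  then show ?thesis using matching_subset_eq[OF brauer_matching[OF F] brauer_matching[OF comp_closed[OF D E]]] by simp
qed

section \<open>The group as the diagrams without turns\<close>

text \<open>In the group the labels are indexed by left-hand nodes, matching the action
  \<open>permute_factors\<close>. The edge ending at the right-hand node \<open>j\<close> starts at
  \<open>s j\<close> and therefore carries \<open>a (s j)\<close>.\<close>

definition wires :: "(nat \<Rightarrow> 'g) \<times> (nat \<Rightarrow> nat) \<Rightarrow> 'g diagram" where
  "wires = (\<lambda>(a, s). links s (\<lambda>j. a (s j)) {1..n})"

abbreviation "PS \<equiv> power_sym_group G n"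

lemma PS_simps:
  "h \<in> carrier PS \<longleftrightarrow> fst h \<in> {1..n} \<rightarrow>\<^sub>E carrier G \<and> snd h permutes {1..n}"
  "(a, s) \<otimes>\<^bsub>PS\<^esub> (b, t) = ((\<lambda>i\<in>{1..n}. a i \<otimes> b (inv_into UNIV s i)), s \<circ> t)"
  "\<one>\<^bsub>PS\<^esub> = ((\<lambda>i\<in>{1..n}. \<one>), id)"
  by (auto simp: power_sym_group_def semidirect_def sym_group_def permute_factors_def mem_Times_iff)

lemma wires_closed:
  assumes "h \<in> carrier PS" shows "wires h \<in> BD" "no_turns (wires h)"
proof -
  obtain a s where h: "h = (a, s)" by (cases h)
  have a: "a \<in> {1..n} \<rightarrow>\<^sub>E carrier G" and s: "s permutes {1..n}" using assms unfolding PS_simps h by simp_all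
  show "wires h \<in> BD" unfolding wires_def h split
    by (rule links_closed[OF s]) (use a permutes_in_image[OF s] in blast)
  show "no_turns (wires h)" unfolding wires_def h split no_turns_iff links_no_turns by simp
qed

lemma wires_one: "wires \<one>\<^bsub>PS\<^esub> = id_diagram G n"
  unfolding PS_simps wires_def id_diagram_links links_def split by (rule image_cong) simp_all

lemma PS_closed:
  assumes "h \<in> carrier PS" "h' \<in> carrier PS" shows "h \<otimes>\<^bsub>PS\<^esub> h' \<in> carrier PS"
proof -
  obtain a s b t where h: "h = (a, s)" "h' = (b, t)" by (cases h, cases h')
  have a: "a \<in> {1..n} \<rightarrow>\<^sub>E carrier G" and s: "s permutes {1..n}" and b: "b \<in> {1..n} \<rightarrow>\<^sub>E carrier G" and t: "t permutes {1..n}"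
    using assms unfolding PS_simps h by simp_all
  have "a i \<otimes> b (inv_into UNIV s i) \<in> carrier G" if i: "i \<in> {1..n}" for i
  proof (rule m_closed)
    show "a i \<in> carrier G" by (rule PiE_mem[OF a i])
    have "inv_into UNIV s i \<in> {1..n}" using permutes_in_image[OF permutes_inv[OF s]] i by blast
    then show "b (inv_into UNIV s i) \<in> carrier G" by (rule PiE_mem[OF b])
  qed
  then have "(\<lambda>i\<in>{1..n}. a i \<otimes> b (inv_into UNIV s i)) \<in> {1..n} \<rightarrow>\<^sub>E carrier G" by simp
  then show ?thesis unfolding h PS_simps using permutes_compose[OF t s] by simp
qed

lemma wires_mult:
  assumes "h \<in> carrier PS" "h' \<in> carrier PS"
  shows "wires (h \<otimes>\<^bsub>PS\<^esub> h') = diagram_comp G n (wires h) (wires h')"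
proof -
  obtain a s b t where h: "h = (a, s)" "h' = (b, t)" by (cases h, cases h')
  have a: "a \<in> {1..n} \<rightarrow>\<^sub>E carrier G" and s: "s permutes {1..n}" and b: "b \<in> {1..n} \<rightarrow>\<^sub>E carrier G" and t: "t permutes {1..n}"
    using assms unfolding PS_simps h by simp_all
  have sN: "s i \<in> {1..n}" and tN: "t i \<in> {1..n}" if "i \<in> {1..n}" for i
    using permutes_in_image[OF s] permutes_in_image[OF t] that by blast+
  have "diagram_comp G n (wires h) (wires h') = links (s \<circ> t) (\<lambda>j. a (s (t j)) \<otimes> b (t j)) {1..n}"
    unfolding h wires_def split by (rule links_comp[OF s t]) (use a b sN tN in blast)+
  \<comment> \<open>At \<open>i = s (t j)\<close> the inverse of \<open>s\<close> in the group law
    leads back to \<open>t j\<close>.\<close>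
  also have "\<dots> = wires (h \<otimes>\<^bsub>PS\<^esub> h')"
    unfolding h PS_simps wires_def split links_def
    by (rule image_cong) (use sN tN permutes_inverses(2)[OF s] in simp_all)
  finally show ?thesis ..
qed

lemma wires_inj: "inj_on wires (carrier PS)"
proof (rule inj_onI)
  fix h h' assume hh: "h \<in> carrier PS" "h' \<in> carrier PS" "wires h = wires h'"
  obtain a s b t where h: "h = (a, s)" "h' = (b, t)" by (cases h, cases h')
  have a: "a \<in> {1..n} \<rightarrow>\<^sub>E carrier G" and s: "s permutes {1..n}" and b: "b \<in> {1..n} \<rightarrow>\<^sub>E carrier G" and t: "t permutes {1..n}"
    using hh(1,2) unfolding PS_simps h by simp_all
  have e: "s j = t j \<and> a (s j) = b (t j)" if j: "j \<in> {1..n}" for j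
  proof -
    have "({(Lft, s j), (Rgt, j)}, a (s j)) \<in> wires h'"
      unfolding hh(3)[symmetric] unfolding h wires_def links_def split using j by blast
    then obtain i where "{(Lft, s j), (Rgt, j)} = {(Lft, t i), (Rgt, i)}" "a (s j) = b (t i)"
      unfolding h wires_def links_def split by blast
    then show ?thesis by (auto simp: doubleton_eq_iff)
  qed
  have "s j = t j" for j using e[of j] permutes_not_in[OF s] permutes_not_in[OF t] by (cases "j \<in> {1..n}") auto
  then have st: "s = t" by blast
  have "a i = b i" for i
  proof (cases "i \<in> {1..n}")
    case True
    have "inv_into UNIV s i \<in> {1..n}" using permutes_in_image[OF permutes_inv[OF s]] True by blast
    then show ?thesis using e[of "inv_into UNIV s i"] st permutes_inverses(1)[OF s] by simp
  next
    case False
    then show ?thesis using PiE_arb[OF a] PiE_arb[OF b] by simp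
  qed
  then show "h = h'" using st h by blast
qed

lemma wires_surj:
  assumes D: "D \<in> BD" and t: "no_turns D" shows "\<exists>h\<in>carrier PS. wires h = D"
proof -
  note m = brauer_matching[OF D]
  have "\<exists>p. ({(Lft, fst p), (Rgt, j)}, snd p) \<in> D \<and> fst p \<in> {1..n}" if j: "j \<in> {1..n}" for j
  proof -
    have "(Rgt, j) \<in> V0" using j by (simp add: outer_nodes_def)
    then obtain eg where eg: "eg \<in> D" "(Rgt, j) \<in> fst eg" by (rule matching_edge[OF m])
    have "\<not> fst ` fst eg \<subseteq> {Rgt}" using t eg(1) unfolding no_turns_def by (metis (mono_tags, lifting) case_prod_beta)
    then obtain u where u: "u \<in> fst eg" "fst u \<noteq> Rgt" by blast
    then have "u \<in> V0" using matching_sub[OF m eg(1)] by blast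
    then obtain i where i: "u = (Lft, i)" "i \<in> {1..n}" using u(2) by (auto simp: outer_nodes_def)
    have "{u, (Rgt, j)} = fst eg"
    proof (rule card_subset_eq)
      show "finite (fst eg)" by (rule matching_edge_finite[OF m eg(1)])
      show "{u, (Rgt, j)} \<subseteq> fst eg" using u(1) eg(2) by simp
      show "card {u, (Rgt, j)} = card (fst eg)" using matching_card[OF m eg(1)] i(1) by simp
    qed
    then have "eg = ({(Lft, i), (Rgt, j)}, snd eg)" unfolding i(1) by (metis prod.collapse)
    then show ?thesis using eg(1) i(2) by (intro exI[of _ "(i, snd eg)"]) simp
  qed
  then obtain p where p: "\<And>j. j \<in> {1..n} \<Longrightarrow> ({(Lft, fst (p j)), (Rgt, j)}, snd (p j)) \<in> D"
      "\<And>j. j \<in> {1..n} \<Longrightarrow> fst (p j) \<in> {1..n}" by metis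
  \<comment> \<open>Outside the range of nodes \<open>s\<close> is the identity, as
    \<open>permutes\<close> demands.\<close>
  define s where "s j = (if j \<in> {1..n} then fst (p j) else j)" for j
  have inj: "inj_on s {1..n}"
  proof (rule inj_onI)
    fix i j assume ij: "i \<in> {1..n}" "j \<in> {1..n}" "s i = s j"
    have "({(Lft, fst (p i)), (Rgt, i)}, snd (p i)) = ({(Lft, fst (p j)), (Rgt, j)}, snd (p j))"
      by (rule matching_unique[OF m p(1)[OF ij(1)] p(1)[OF ij(2)], of "(Lft, fst (p i))"])
        (use ij in \<open>simp_all add: s_def\<close>)
    then show "i = j" by (simp add: doubleton_eq_iff)
  qed
  have sN: "s ` {1..n} = {1..n}"
    by (rule endo_inj_surj[OF _ _ inj]) (use p(2) in \<open>auto simp: s_def\<close>)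
  have s: "s permutes {1..n}"
    by (rule bij_imp_permutes) (use inj sN in \<open>auto simp: bij_betw_def s_def\<close>)
  define a where "a = (\<lambda>i\<in>{1..n}. snd (p (inv_into UNIV s i)))"
  have aG: "a \<in> {1..n} \<rightarrow>\<^sub>E carrier G"
  proof -
    have "snd (p (inv_into UNIV s i)) \<in> carrier G" if "i \<in> {1..n}" for i
    proof -
      have "inv_into UNIV s i \<in> {1..n}" using permutes_in_image[OF permutes_inv[OF s]] that by blast
      from brauer_label[OF D p(1)[OF this]] show ?thesis by simp
    qed
    then show ?thesis unfolding a_def by auto
  qed
  have h: "(a, s) \<in> carrier PS" using aG s by (simp add: PS_simps)
  have "wires (a, s) \<subseteq> D"
  proof
    fix eg assume "eg \<in> wires (a, s)"
    then obtain j where j: "j \<in> {1..n}" "eg = ({(Lft, s j), (Rgt, j)}, a (s j))" by (auto simp: wires_def links_def)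
    have "s j \<in> {1..n}" using sN j(1) by blast
    then have "a (s j) = snd (p j)" unfolding a_def using permutes_inverses(2)[OF s] by simp
    then show "eg \<in> D" using p(1)[OF j(1)] j by (simp add: s_def)
  qed
  then have "wires (a, s) = D" by (rule matching_subset_eq[OF brauer_matching[OF wires_closed(1)[OF h]] m])
  then show ?thesis using h by blast
qed

lemma wires_bij: "bij_betw wires (carrier PS) {D \<in> BD. no_turns D}"
  unfolding bij_betw_def using wires_inj wires_closed wires_surj by blast

text \<open>Associativity and the unit law are pulled back from diagrams along the injective map
  \<open>wires\<close>; only inverses are computed by hand.\<close>

lemma PS_group: "group PS"
proof (rule groupI)
  show one: "\<one>\<^bsub>PS\<^esub> \<in> carrier PS" by (auto simp: PS_simps)
  have v: "valid (wires h)" if "h \<in> carrier PS" for h using brauer_valid wires_closed(1)[OF that] .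
  show "x \<otimes>\<^bsub>PS\<^esub> y \<otimes>\<^bsub>PS\<^esub> z = x \<otimes>\<^bsub>PS\<^esub> (y \<otimes>\<^bsub>PS\<^esub> z)"
    if h: "x \<in> carrier PS" "y \<in> carrier PS" "z \<in> carrier PS" for x y z
    by (rule inj_onD[OF wires_inj])
      (simp_all only: h PS_closed wires_mult associative(1)[OF v[OF h(1)] v[OF h(2)] v[OF h(3)]])
  show "\<one>\<^bsub>PS\<^esub> \<otimes>\<^bsub>PS\<^esub> x = x" if h: "x \<in> carrier PS" for x
    by (rule inj_onD[OF wires_inj])
      (simp_all only: h one PS_closed wires_mult wires_one id_comp(2)[OF wires_closed(1)[OF h]])
  show "\<exists>y\<in>carrier PS. y \<otimes>\<^bsub>PS\<^esub> x = \<one>\<^bsub>PS\<^esub>" if x: "x \<in> carrier PS" for x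
  proof -
    obtain a s where h: "x = (a, s)" by (cases x)
    have a: "a \<in> {1..n} \<rightarrow>\<^sub>E carrier G" and s: "s permutes {1..n}" using x unfolding PS_simps h by simp_all
    have sN: "s i \<in> {1..n}" if "i \<in> {1..n}" for i using permutes_in_image[OF s] that by blast
    have ac: "a i \<in> carrier G" if "i \<in> {1..n}" for i using a that by blast
    let ?y = "((\<lambda>i\<in>{1..n}. inv a (s i)), inv_into UNIV s)"
    have "?y \<in> carrier PS" unfolding PS_simps using permutes_inv[OF s] ac sN by auto
    moreover have "?y \<otimes>\<^bsub>PS\<^esub> x = \<one>\<^bsub>PS\<^esub>"
      unfolding h PS_simps using ac sN permutes_inv_o(2)[OF s] permutes_bij[OF s]
      by (auto simp: inv_inv_eq intro!: restrict_ext)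
    ultimately show ?thesis by blast
  qed
qed (rule PS_closed)

end

section \<open>The Brauer algebra as an instance of the abstract setting\<close>

context diagrams
begin

text \<open>Here the graph theory meets the algebra: \<open>rt\<close> is the set of right-hand
  turns, the submonoid is the set of diagrams without turns, and the unit above a diagram is the
  \<open>cap_unit\<close> of its right-hand turns.\<close>

lemma brauer_quotient:
  assumes k: "cring k" and act: "\<And>g. g \<in> carrier G \<Longrightarrow> act g \<delta> \<in> carrier k" "act \<one> \<delta> = \<delta>"
    and \<delta>: "\<delta> \<in> carrier k" "\<delta> \<in> Units k"
  shows "graded_twisted_quotient k BD (diagram_comp G n) (loop_factor G k act n \<delta>) (id_diagram G n) no_turns
    (\<lambda>D E. loop_factor G k act n \<delta> D E \<odot>\<^bsub>free_module k BD\<^esub> basis_vec k (diagram_comp G n D E))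
    (carrier PS) (monoid.mult PS) (\<lambda>_ _. \<one>\<^bsub>k\<^esub>) \<one>\<^bsub>PS\<^esub> (\<lambda>x y. basis_vec k (x \<otimes>\<^bsub>PS\<^esub> y))
    wires (turns Rgt) n"
proof -
  interpret k: cring k by (rule k)
  interpret B: group_bar k PS by (rule group_bar.intro[OF k PS_group])
  have nt: "turns c (id_diagram G n) = {}" for c unfolding id_diagram_links by (rule links_no_turns)
  have T: "twisted_monoid_algebra k BD (diagram_comp G n) (loop_factor G k act n \<delta>) (id_diagram G n) no_turns
    (\<lambda>D E. loop_factor G k act n \<delta> D E \<odot>\<^bsub>free_module k BD\<^esub> basis_vec k (diagram_comp G n D E))"
  proof (rule twisted_monoid_algebra.intro)
    show "cring k" by (rule k)
    show "id_diagram G n \<in> BD" by (rule id_closed)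
    show "no_turns (id_diagram G n)" unfolding no_turns_iff by (simp add: nt)
    fix x y assume x: "x \<in> BD" and y: "y \<in> BD"
    show "diagram_comp G n x y \<in> BD" by (rule comp_closed[OF x y])
    show "loop_factor G k act n \<delta> x y \<in> carrier k"
      unfolding loop_factor_alt loop_part_def
    proof (rule k.finprod_closed, rule Pi_I)
      fix C
      show "act (label G (first_half x) C \<otimes> label G (second_half y) C) \<delta> \<in> carrier k"
        by (intro act m_closed label_closed half_labels brauer_valid x y)
    qed
    show "no_turns (diagram_comp G n x y) \<longleftrightarrow> no_turns x \<and> no_turns y"
    proof
      assume t: "no_turns (diagram_comp G n x y)"
      have "turns Rgt y = {}" using turn_persists_right[OF x y] t unfolding no_turns_iff by blast
      then have "no_turns y" using no_turns_right[OF y] by simp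
      \<comment> \<open>For \<open>x\<close> only the absence of left-hand turns is known.
        Reflection turns this into absence of right-hand turns for \<open>flip x\<close>, hence of
        all turns.\<close>
      moreover have "turns Lft x = {}" using turn_persists_left[OF x y] t unfolding no_turns_iff by blast
      then have "turns Rgt (flip x) = {}" unfolding flip_turns by (simp add: flip_def place_def)
      then have "no_turns (flip x)" using no_turns_right[OF flip_closed[OF x]] by simp
      then have "turns Rgt (flip (flip x)) = {}" unfolding flip_turns no_turns_iff by (simp add: flip_def place_def)
      then have "no_turns x" unfolding flip_flip using no_turns_right[OF x] by simp
      ultimately show "no_turns x \<and> no_turns y" by simp
    next
      \<comment> \<open>Diagrams without turns come from group elements, and so does their
        composite.\<close>
      assume "no_turns x \<and> no_turns y"
      then obtain h h' where h: "h \<in> carrier PS" "wires h = x" "h' \<in> carrier PS" "wires h' = y"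
        using wires_surj[OF x] wires_surj[OF y] by blast
      show "no_turns (diagram_comp G n x y)"
        using wires_closed(2)[OF PS_closed[OF h(1,3)]] unfolding wires_mult[OF h(1,3)] h(2,4) .
    qed
    show "loop_factor G k act n \<delta> x y = \<one>\<^bsub>k\<^esub>" if "no_turns x" "no_turns y"
      by (rule loop_free[OF x y _ k]) (use that no_turns_iff in blast)
  next
    fix x assume x: "x \<in> BD"
    show "diagram_comp G n (id_diagram G n) x = x" "diagram_comp G n x (id_diagram G n) = x" by (rule id_comp[OF x])+
    show "loop_factor G k act n \<delta> (id_diagram G n) x = \<one>\<^bsub>k\<^esub>"
      by (rule loop_free[OF id_closed x _ k]) (simp add: nt)
    show "loop_factor G k act n \<delta> x (id_diagram G n) = \<one>\<^bsub>k\<^esub>"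
      by (rule loop_free[OF x id_closed _ k]) (simp add: nt)
  next
    fix x y z assume "x \<in> BD" "y \<in> BD" "z \<in> BD"
    note v = this[THEN brauer_valid]
    show "diagram_comp G n (diagram_comp G n x y) z = diagram_comp G n x (diagram_comp G n y z)"
      by (rule associative(1)[OF v])
    show "loop_factor G k act n \<delta> x y \<otimes>\<^bsub>k\<^esub> loop_factor G k act n \<delta> (diagram_comp G n x y) z
        = loop_factor G k act n \<delta> y z \<otimes>\<^bsub>k\<^esub> loop_factor G k act n \<delta> x (diagram_comp G n y z)"
      by (rule associative(2)[where act = act and \<delta> = \<delta>, OF v k act(1)])
  qed (rule refl)
  have unit: "\<exists>w\<in>BD. \<exists>c\<in>carrier k. turns Rgt x \<subseteq> turns Rgt w \<and> (\<forall>y\<in>BD. turns Rgt x \<subseteq> turns Rgt y \<longrightarrow>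
      diagram_comp G n y w = y \<and> c \<otimes>\<^bsub>k\<^esub> loop_factor G k act n \<delta> y w = \<one>\<^bsub>k\<^esub>)" if x: "x \<in> BD" for x
  proof -
    let ?S = "turns Rgt x"
    \<comment> \<open>The number of loops depends on \<open>?S\<close> alone, so one inverse power
      of \<open>\<delta>\<close> serves every \<open>y\<close>. This is where
      \<open>\<delta>\<close> has to be invertible.\<close>
    let ?d = "\<delta> [^]\<^bsub>k\<^esub> card ((\<lambda>eg. mid ` fst eg) ` ?S)"
    have d: "?d \<in> Units k" by (rule k.Units_pow_closed[OF \<delta>(2)])
    show ?thesis
    proof (intro bexI[of _ "cap_unit ?S"] bexI[of _ "inv\<^bsub>k\<^esub> ?d"] conjI ballI impI)
      show "?S \<subseteq> turns Rgt (cap_unit ?S)" by (rule cap_unit_turns[OF order_refl])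
      show "cap_unit ?S \<in> BD" by (rule cap_unit_closed[OF x order_refl])
      show "inv\<^bsub>k\<^esub> ?d \<in> carrier k" by (rule k.Units_inv_closed[OF d])
      fix y assume y: "y \<in> BD" "?S \<subseteq> turns Rgt y"
      show "diagram_comp G n y (cap_unit ?S) = y" by (rule cap_unit_right[OF y])
      show "inv\<^bsub>k\<^esub> ?d \<otimes>\<^bsub>k\<^esub> loop_factor G k act n \<delta> y (cap_unit ?S) = \<one>\<^bsub>k\<^esub>"
        unfolding cap_unit_loops[where act = act and \<delta> = \<delta>, OF y k \<delta>(1) act(2)] by (rule k.Units_l_inv[OF d])
    qed
  qed
  show ?thesis
  proof (intro graded_twisted_quotient.intro twisted_quotient.intro T B.twisted
      twisted_quotient_axioms.intro graded_twisted_quotient_axioms.intro)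
    show "bij_betw wires (carrier PS) {x \<in> BD. no_turns x}" by (rule wires_bij)
    show "wires \<one>\<^bsub>PS\<^esub> = id_diagram G n" by (rule wires_one)
    show "wires (x \<otimes>\<^bsub>PS\<^esub> y) = diagram_comp G n (wires x) (wires y)" if "x \<in> carrier PS" "y \<in> carrier PS" for x y
      by (rule wires_mult[OF that])
    fix x assume x: "x \<in> BD"
    show "finite (turns Rgt x)" by (rule finite_subset[OF turns_sub brauer_finite[OF x]])
    show "card (turns Rgt x) \<le> n" by (rule turns_card[OF x])
    show "no_turns x \<longleftrightarrow> turns Rgt x = {}" by (rule no_turns_right[OF x])
    show "turns Rgt y \<subseteq> turns Rgt (diagram_comp G n x y)" if "y \<in> BD" for y
      by (rule turn_persists_right[OF x that])
    show "\<exists>w\<in>BD. \<exists>c\<in>carrier k. turns Rgt x \<subseteq> turns Rgt w \<and> (\<forall>y\<in>BD. turns Rgt x \<subseteq> turns Rgt y \<longrightarrow>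
      diagram_comp G n y w = y \<and> c \<otimes>\<^bsub>k\<^esub> loop_factor G k act n \<delta> y w = \<one>\<^bsub>k\<^esub>)" by (rule unit[OF x])
  qed
qed

end

text \<open>That the neutral element acts trivially is not among the conditions in
  \<open>commutative_G_ring\<close>; it follows because its action is injective and
  idempotent.\<close>

lemma G_ring_one:
  assumes "group G" "commutative_G_ring G k act" "r \<in> carrier k"
  shows "act \<one>\<^bsub>G\<^esub> r = r"
proof -
  interpret G: group G by (rule assms(1))
  have i: "act \<one>\<^bsub>G\<^esub> \<in> ring_iso k k" using assms(2) unfolding commutative_G_ring_def by blast
  then have c: "act \<one>\<^bsub>G\<^esub> r \<in> carrier k" by (simp add: ring_iso_memE(1) assms(3))
  have "act (\<one>\<^bsub>G\<^esub> \<otimes>\<^bsub>G\<^esub> \<one>\<^bsub>G\<^esub>) r = act \<one>\<^bsub>G\<^esub> (act \<one>\<^bsub>G\<^esub> r)"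
    using assms(2,3) unfolding commutative_G_ring_def by blast
  then have "act \<one>\<^bsub>G\<^esub> r = act \<one>\<^bsub>G\<^esub> (act \<one>\<^bsub>G\<^esub> r)" by simp
  then show ?thesis using ring_iso_memE(5)[OF i] inj_onD[of "act \<one>\<^bsub>G\<^esub>" "carrier k" r "act \<one>\<^bsub>G\<^esub> r"] assms(3) c
    by (simp add: bij_betw_def)
qed

theorem theorem8p1:
  fixes G :: "('g, 'e) monoid_scheme" and k :: "('k, 'f) ring_scheme"
    and act :: "'g \<Rightarrow> 'k \<Rightarrow> 'k" and n :: nat and \<delta> :: 'k
  assumes "comm_group G" and "commutative_G_ring G k act" and "\<delta> \<in> carrier k"
    and "\<delta> \<in> Units k"
  shows "\<forall>p.
    module_iso k
      (Tor k (brauer_algebra G k act n \<delta>)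
         (brauer_trivial_module k) (brauer_trivial_module k) p)
      (Tor k (group_algebra k (power_sym_group G n))
         (group_trivial_module k) (group_trivial_module k) p) \<and>
    module_iso k
      (Tor k (group_algebra k (power_sym_group G n))
         (group_trivial_module k) (group_trivial_module k) p)
      (group_homology k (power_sym_group G n) p)"
proof (intro allI conjI)
  fix p
  interpret G: comm_group G by fact
  interpret diagrams G n by unfold_locales
  have k: "cring k" using assms(2) by (simp add: commutative_G_ring_def)
  have act: "act g \<delta> \<in> carrier k" if "g \<in> carrier G" for g
    using assms(2,3) ring_iso_memE(1)[of "act g" k k \<delta>] that by (simp add: commutative_G_ring_def)
  interpret Q: graded_twisted_quotient k "brauer_diagrams G n" "diagram_comp G n" "loop_factor G k act n \<delta>"
    "id_diagram G n" no_turns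
    "\<lambda>D E. loop_factor G k act n \<delta> D E \<odot>\<^bsub>free_module k (brauer_diagrams G n)\<^esub> basis_vec k (diagram_comp G n D E)"
    "carrier (power_sym_group G n)" "monoid.mult (power_sym_group G n)" "\<lambda>_ _. \<one>\<^bsub>k\<^esub>" "\<one>\<^bsub>power_sym_group G n\<^esub>"
    "\<lambda>x y. basis_vec k (x \<otimes>\<^bsub>power_sym_group G n\<^esub> y)" wires "turns Rgt" n
    by (rule brauer_quotient[where act = act and \<delta> = \<delta>, OF k act G_ring_one[OF G.group_axioms assms(2,3)] assms(3,4)])
  \<comment> \<open>Unfolding brings both algebras to \<open>based_algebra\<close> and both trivial
    modules to \<open>scalar_module\<close>, the form of the abstract statement.\<close>
  show "module_iso k (Tor k (brauer_algebra G k act n \<delta>) (brauer_trivial_module k) (brauer_trivial_module k) p)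
      (Tor k (group_algebra k (power_sym_group G n)) (group_trivial_module k) (group_trivial_module k) p)"
    unfolding brauer_algebra_def brauer_trivial_module_def group_algebra_def group_trivial_module_def
    by (rule Q.Tor_quotient_iso)
  interpret B: group_bar k "power_sym_group G n" by (rule group_bar.intro[OF k PS_group])
  show "module_iso k (Tor k (group_algebra k (power_sym_group G n)) (group_trivial_module k) (group_trivial_module k) p)
      (group_homology k (power_sym_group G n) p)"
    unfolding group_algebra_def group_trivial_module_def by (rule B.Tor_group_homology)
qed

end
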